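(* Let $(R,\mu)$ be a Hopf-Galois algebra over a field $k$, and assume that the ambiskew polynomial algebra $A_R=A(R,X,Y,\tau,c,\xi)$ is a Hopf-Galois algebra, with structure extending $\mu$ and satisfying, for some $g,h\in G_0(R)$, $$\mu(X)=X\otimes 1\otimes 1-g\otimes g^{-1}X\otimes 1+g\otimes g^{-1}\otimes X,\qquad \mu(Y)=Y\otimes 1\otimes 1-h\otimes h^{-1}Y\otimes 1+h\otimes h^{-1}\otimes Y.$$ Then the corresponding Hopf algebra $\underline{H}(A_R)$ is a generalized ambiskew polynomial algebra $A(\underline{H}(R),E,F,\tau',\omega',c',\xi')$, where $\tau',\omega'$ are the commuting algebra automorphisms of $\underline{H}(R)$ given by $\tau'(r\otimes s)=grg^{-1}\otimes\tau(s)$ and $\omega'(r\otimes s)=hrh^{-1}\otimes\tau^{-1}(s)$ for $r\otimes s\in\underline{H}(R)$. These automorphisms are not necessarily inverse to each other, i.e. there exist a field $k$, a Hopf-Galois algebra $(R,\mu)$ over $k$, an algebra automorphism $\tau$ of $R$, a central element $c\in R$, a scalar $\xi\in k^*$ and elements $g,h\in G_0(R)$ such that $A(R,X,Y,\tau,c,\xi)$ is a Hopf-Galois algebra with structure extending $\mu$ and satisfying $\mu(X)=X\otimes 1\otimes 1-g\otimes g^{-1}X\otimes 1+g\otimes g^{-1}\otimes X$ and $\mu(Y)=Y\otimes 1\otimes 1-h\otimes h^{-1}Y\otimes 1+h\otimes h^{-1}\otimes Y$, and for which the automorphisms $\tau',\omega'$ of $\underline{H}(R)$ given by $\tau'(r\otimes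 s)=grg^{-1}\otimes\tau(s)$ and $\omega'(r\otimes s)=hrh^{-1}\otimes\tau^{-1}(s)$ satisfy $\tau'\omega'\neq{\rm id}$.
   Context: All algebras and tensor products are over a field $k$. A Hopf-Galois algebra is a non-zero algebra $R$ with an algebra map $\mu:R\to R\otimes R^{\rm op}\otimes R$, written $\mu(r)=r_{(1)}\otimes r_{(2)}\otimes r_{(3)}$, such that $(\mu\otimes{\rm id}\otimes{\rm id})\circ\mu=({\rm id}\otimes{\rm id}\otimes\mu)\circ\mu$, $r_{(1)}r_{(2)}\otimes r_{(3)}=1\otimes r$ and $r_{(1)}\otimes r_{(2)}r_{(3)}=r\otimes 1$ for all $r\in R$. $G_0(R)$ is the group of invertible $g\in R$ with $\mu(g)=g\otimes g^{-1}\otimes g$. Products inside a middle tensor factor are written using the product of $R$ (not of $R^{\rm op}$). Writing a general element $\sum_i x_i\otimes y_i$ of $R^{\rm op}\otimes R$ simply as $x\otimes y$, $\underline{H}(R)$ is the subalgebra $\{x\otimes y: xy_{(1)}\otimes y_{(2)}\otimes y_{(3)}=1\otimes x\otimes y\}$ of $R^{\rm op}\otimes R$; it is a Hopf algebra (Grunspan, Schauenburg) with $\Delta(x\otimes y)=(x\otimes y_{(1)})\otimes(y_{(2)}\otimes y_{(3)})$ and $\varepsilon(x\otimes y)=xy$. For commuting algebra automorphisms $\tau,\omega$ of an algebra $R$, $\sigma=\tau\omega$, an element $c\in R$ with $cr=\sigma(r)c$ for all $r\in R$, and $\xi\in k^*$, the generalized ambiskew polynomial algebra $A(R,X,Y,\tau,\omega,c,\xi)$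 is the quotient of the free product $R*k\langle X,Y\rangle$ by the relations $Xr=\tau(r)X$, $Yr=\omega(r)Y$ ($r\in R$), $XY-\xi YX=c$. When $\omega=\tau^{-1}$ (so $c$ is central) it is called an ambiskew polynomial algebra and denoted $A(R,X,Y,\tau,c,\xi)$. *)

theory Defs
  imports Complex_Main "HOL-Algebra.Module" "HOL-Algebra.QuotRing"
begin

section \<open>Associative unital algebras over a field\<close>

text \<open>The locale \<open>algebra\<close> of HOL-Algebra requires commutativity, so it cannot be used here.\<close>

definition k_algebra :: "'k ring \<Rightarrow> ('k, 'r) module \<Rightarrow> bool" where
  "k_algebra K R \<longleftrightarrow> field K \<and> module K R \<and> ring R \<and>
     (\<forall>a\<in>carrier K. \<forall>x\<in>carrier R. \<forall>y\<in>carrier R.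
        (a \<odot>\<^bsub>R\<^esub> x) \<otimes>\<^bsub>R\<^esub> y = a \<odot>\<^bsub>R\<^esub> (x \<otimes>\<^bsub>R\<^esub> y) \<and>
        x \<otimes>\<^bsub>R\<^esub> (a \<odot>\<^bsub>R\<^esub> y) = a \<odot>\<^bsub>R\<^esub> (x \<otimes>\<^bsub>R\<^esub> y))"

definition opp :: "('k, 'r) module \<Rightarrow> ('k, 'r) module" where
  "opp R = R\<lparr>mult := \<lambda>x y. y \<otimes>\<^bsub>R\<^esub> x\<rparr>"

definition alg_hom :: "'k ring \<Rightarrow> ('k, 'r) module \<Rightarrow> ('k, 's) module \<Rightarrow> ('r \<Rightarrow> 's) set" where
  "alg_hom K R S = {f \<in> ring_hom R S.
     \<forall>a\<in>carrier K. \<forall>x\<in>carrier R. f (a \<odot>\<^bsub>R\<^esub> x) = a \<odot>\<^bsub>S\<^esub> f x}"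

definition alg_iso :: "'k ring \<Rightarrow> ('k, 'r) module \<Rightarrow> ('k, 's) module \<Rightarrow> ('r \<Rightarrow> 's) set" where
  "alg_iso K R S = {f \<in> alg_hom K R S. bij_betw f (carrier R) (carrier S)}"

abbreviation alg_auto :: "'k ring \<Rightarrow> ('k, 'r) module \<Rightarrow> ('r \<Rightarrow> 'r) set" where
  "alg_auto K R \<equiv> alg_iso K R R"


section \<open>Monoid algebras and quotients\<close>

text \<open>Finitely supported functions \<open>M \<rightarrow> K\<close> (extended by zero outside the carrier of \<open>M\<close>)
  with the convolution product.\<close>

definition monoid_alg :: "'k ring \<Rightarrow> 'x monoid \<Rightarrow> ('k, 'x \<Rightarrow> 'k) module" where
  "monoid_alg K M =
    \<lparr>carrier = {f. (\<forall>x. f x \<in> carrier K) \<and> (\<forall>x. x \<notin> carrier M \<longrightarrow> f x = \<zero>\<^bsub>K\<^esub>) \<and>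
                   finite {x. f x \<noteq> \<zero>\<^bsub>K\<^esub>}},
     mult = (\<lambda>f g z. \<Oplus>\<^bsub>K\<^esub>p\<in>{(x, y). f x \<noteq> \<zero>\<^bsub>K\<^esub> \<and> g y \<noteq> \<zero>\<^bsub>K\<^esub> \<and> x \<otimes>\<^bsub>M\<^esub> y = z}.
               f (fst p) \<otimes>\<^bsub>K\<^esub> g (snd p)),
     one = (\<lambda>x. if x = \<one>\<^bsub>M\<^esub> then \<one>\<^bsub>K\<^esub> else \<zero>\<^bsub>K\<^esub>),
     zero = (\<lambda>x. \<zero>\<^bsub>K\<^esub>),
     add = (\<lambda>f g x. f x \<oplus>\<^bsub>K\<^esub> g x),
     smult = (\<lambda>a f x. a \<otimes>\<^bsub>K\<^esub> f x)\<rparr>"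

definition single :: "'k ring \<Rightarrow> 'x \<Rightarrow> 'x \<Rightarrow> 'k" where
  "single K x = (\<lambda>y. if y = x then \<one>\<^bsub>K\<^esub> else \<zero>\<^bsub>K\<^esub>)"

text \<open>The ring \<open>A Quot I\<close> together with the induced scalar multiplication.\<close>

definition quot_alg :: "('k, 'a) module \<Rightarrow> 'a set \<Rightarrow> ('k, 'a set) module" where
  "quot_alg A I = ring.extend (A Quot I)
     \<lparr>smult = (\<lambda>a U. \<Union>u\<in>U. I +>\<^bsub>A\<^esub> (a \<odot>\<^bsub>A\<^esub> u))\<rparr>"

definition lin_span :: "'k ring \<Rightarrow> ('k, 'a) module \<Rightarrow> 'a set \<Rightarrow> 'a set" where
  "lin_span K A S = \<Inter>{N. submodule N K A \<and> S \<subseteq> N}"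


section \<open>Tensor products of finitely many algebras\<close>

text \<open>Tensor products are unbracketed: \<open>tensor K [R\<^sub>1, \<dots>, R\<^sub>n]\<close> is the free module on the set of
  tuples \<open>[x\<^sub>1, \<dots>, x\<^sub>n]\<close>, \<open>x\<^sub>i \<in> R\<^sub>i\<close>, modulo the submodule spanned by the multilinearity relations.
  The free module is taken with the monoid algebra structure for the componentwise product of
  tuples, so the quotient carries the usual multiplication of a tensor product of algebras
  (the submodule of relations is a two-sided ideal).\<close>

definition tuple_monoid :: "('k, 'r) module list \<Rightarrow> 'r list monoid" where
  "tuple_monoid Rs =
    \<lparr>carrier = {xs. length xs = length Rs \<and> (\<forall>i<length Rs. xs ! i \<in> carrier (Rs ! i))},
     mult = (\<lambda>xs ys. map (\<lambda>i. xs ! i \<otimes>\<^bsub>Rs ! i\<^esub> ys ! i) [0..<length Rs]),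
     one = map (\<lambda>R. \<one>\<^bsub>R\<^esub>) Rs\<rparr>"

definition tensor_rels :: "'k ring \<Rightarrow> ('k, 'r) module list \<Rightarrow> ('r list \<Rightarrow> 'k) set" where
  "tensor_rels K Rs = (let F = monoid_alg K (tuple_monoid Rs) in
     {single K (xs[i := a \<oplus>\<^bsub>Rs ! i\<^esub> b]) \<ominus>\<^bsub>F\<^esub> (single K (xs[i := a]) \<oplus>\<^bsub>F\<^esub> single K (xs[i := b])) | xs i a b.
        xs \<in> carrier (tuple_monoid Rs) \<and> i < length Rs \<and>
        a \<in> carrier (Rs ! i) \<and> b \<in> carrier (Rs ! i)} \<union>
     {single K (xs[i := \<alpha> \<odot>\<^bsub>Rs ! i\<^esub> a]) \<ominus>\<^bsub>F\<^esub> (\<alpha> \<odot>\<^bsub>F\<^esub> single K (xs[i := a])) | xs i \<alpha> a.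
        xs \<in> carrier (tuple_monoid Rs) \<and> i < length Rs \<and>
        \<alpha> \<in> carrier K \<and> a \<in> carrier (Rs ! i)})"

definition tensor_null :: "'k ring \<Rightarrow> ('k, 'r) module list \<Rightarrow> ('r list \<Rightarrow> 'k) set" where
  "tensor_null K Rs = lin_span K (monoid_alg K (tuple_monoid Rs)) (tensor_rels K Rs)"

definition tensor :: "'k ring \<Rightarrow> ('k, 'r) module list \<Rightarrow> ('k, ('r list \<Rightarrow> 'k) set) module" where
  "tensor K Rs = quot_alg (monoid_alg K (tuple_monoid Rs)) (tensor_null K Rs)"

definition pure :: "'k ring \<Rightarrow> ('k, 'r) module list \<Rightarrow> 'r list \<Rightarrow> ('r list \<Rightarrow> 'k) set" where
  "pure K Rs xs = tensor_null K Rs +>\<^bsub>monoid_alg K (tuple_monoid Rs)\<^esub> single K xs"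

text \<open>The linear map into \<open>N\<close> induced on a tensor product by a multilinear map \<open>F\<close>: it sends
  \<open>x\<^sub>1 \<otimes> \<dots> \<otimes> x\<^sub>n\<close> to \<open>F [x\<^sub>1, \<dots>, x\<^sub>n]\<close>. A tensor is a coset; its value is computed from a
  representative \<open>f\<close>, the choice of which is immaterial because \<open>F\<close> is multilinear.\<close>

definition tlift :: "'k ring \<Rightarrow> ('k, 'n) module \<Rightarrow> ('r list \<Rightarrow> 'n) \<Rightarrow> ('r list \<Rightarrow> 'k) set \<Rightarrow> 'n" where
  "tlift K N F u = (let f = (SOME f. f \<in> u) in
     \<Oplus>\<^bsub>N\<^esub>xs\<in>{xs. f xs \<noteq> \<zero>\<^bsub>K\<^esub>}. f xs \<odot>\<^bsub>N\<^esub> F xs)"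


section \<open>Hopf-Galois algebras\<close>

abbreviation T3 :: "'k ring \<Rightarrow> ('k, 'r) module \<Rightarrow> ('k, ('r list \<Rightarrow> 'k) set) module" where
  "T3 K R \<equiv> tensor K [R, opp R, R]"

abbreviation pure3 :: "'k ring \<Rightarrow> ('k, 'r) module \<Rightarrow> 'r list \<Rightarrow> ('r list \<Rightarrow> 'k) set" where
  "pure3 K R \<equiv> pure K [R, opp R, R]"

text \<open>In the coassociativity axiom, \<open>x = [r\<^sub>1, r\<^sub>2, r\<^sub>3]\<close> runs through the summands of \<open>\<mu> r\<close> and \<open>y\<close>
  through those of \<open>\<mu> r\<^sub>1\<close>, respectively \<open>\<mu> r\<^sub>3\<close>; both sides lie in
  \<open>R \<otimes> R\<^sup>o\<^sup>p \<otimes> R \<otimes> R\<^sup>o\<^sup>p \<otimes> R\<close>.\<close>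

definition hopf_galois ::
  "'k ring \<Rightarrow> ('k, 'r) module \<Rightarrow> ('r \<Rightarrow> ('r list \<Rightarrow> 'k) set) \<Rightarrow> bool" where
  "hopf_galois K R \<mu> \<longleftrightarrow>
     k_algebra K R \<and> \<one>\<^bsub>R\<^esub> \<noteq> \<zero>\<^bsub>R\<^esub> \<and> \<mu> \<in> alg_hom K R (T3 K R) \<and>
     (let Rs5 = [R, opp R, R, opp R, R] in
      \<forall>r\<in>carrier R.
        tlift K (tensor K Rs5)
          (\<lambda>x. tlift K (tensor K Rs5) (\<lambda>y. pure K Rs5 (y @ [x!1, x!2])) (\<mu> (x!0))) (\<mu> r) =
        tlift K (tensor K Rs5)
          (\<lambda>x. tlift K (tensor K Rs5) (\<lambda>y. pure K Rs5 ([x!0, x!1] @ y)) (\<mu> (x!2))) (\<mu> r)) \<and>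
     (\<forall>r\<in>carrier R.
        tlift K (tensor K [R, R]) (\<lambda>x. pure K [R, R] [x!0 \<otimes>\<^bsub>R\<^esub> x!1, x!2]) (\<mu> r) =
          pure K [R, R] [\<one>\<^bsub>R\<^esub>, r] \<and>
        tlift K (tensor K [R, R]) (\<lambda>x. pure K [R, R] [x!0, x!1 \<otimes>\<^bsub>R\<^esub> x!2]) (\<mu> r) =
          pure K [R, R] [r, \<one>\<^bsub>R\<^esub>])"

definition G0 :: "'k ring \<Rightarrow> ('k, 'r) module \<Rightarrow> ('r \<Rightarrow> ('r list \<Rightarrow> 'k) set) \<Rightarrow> 'r set" where
  "G0 K R \<mu> = {g \<in> Units R. \<mu> g = pure3 K R [g, inv\<^bsub>R\<^esub> g, g]}"

text \<open>The underlying algebra of the Hopf algebra \<open>H(R)\<close>; here \<open>u = \<Sum> x\<^sub>0 \<otimes> x\<^sub>1\<close> and \<open>y\<close> runs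
  through the summands of \<open>\<mu> x\<^sub>1\<close>.\<close>

definition HG_alg :: "'k ring \<Rightarrow> ('k, 'r) module \<Rightarrow> ('r \<Rightarrow> ('r list \<Rightarrow> 'k) set)
    \<Rightarrow> ('k, ('r list \<Rightarrow> 'k) set) module" where
  "HG_alg K R \<mu> = (tensor K [opp R, R])\<lparr>carrier :=
     {u \<in> carrier (tensor K [opp R, R]).
        tlift K (T3 K R)
          (\<lambda>x. tlift K (T3 K R) (\<lambda>y. pure3 K R [x!0 \<otimes>\<^bsub>R\<^esub> y!0, y!1, y!2]) (\<mu> (x!1))) u =
        tlift K (T3 K R) (\<lambda>x. pure3 K R [\<one>\<^bsub>R\<^esub>, x!0, x!1]) u}\<rparr>"


section \<open>Generalized ambiskew polynomial algebras\<close>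

datatype 'r gen = Coeff 'r | GenX | GenY

definition word_monoid :: "('k, 'r) module \<Rightarrow> 'r gen list monoid" where
  "word_monoid R =
    \<lparr>carrier = {w. \<forall>r. Coeff r \<in> set w \<longrightarrow> r \<in> carrier R}, mult = (@), one = []\<rparr>"

definition free_prod_rels :: "'k ring \<Rightarrow> ('k, 'r) module \<Rightarrow> ('r gen list \<Rightarrow> 'k) set" where
  "free_prod_rels K R =
    (let F = monoid_alg K (word_monoid R); e = (\<lambda>r. single K [Coeff r]) in
     {e (a \<oplus>\<^bsub>R\<^esub> b) \<ominus>\<^bsub>F\<^esub> (e a \<oplus>\<^bsub>F\<^esub> e b) | a b. a \<in> carrier R \<and> b \<in> carrier R} \<union>
     {e (\<alpha> \<odot>\<^bsub>R\<^esub> a) \<ominus>\<^bsub>F\<^esub> (\<alpha> \<odot>\<^bsub>F\<^esub> e a) | \<alpha> a. \<alpha> \<in> carrier K \<and> a \<in> carrier R} \<union>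
     {e (a \<otimes>\<^bsub>R\<^esub> b) \<ominus>\<^bsub>F\<^esub> (e a \<otimes>\<^bsub>F\<^esub> e b) | a b. a \<in> carrier R \<and> b \<in> carrier R} \<union>
     {e \<one>\<^bsub>R\<^esub> \<ominus>\<^bsub>F\<^esub> \<one>\<^bsub>F\<^esub>})"

text \<open>The free product \<open>R * k\<langle>X, Y\<rangle>\<close>, and the class of a word in it.\<close>

definition free_prod :: "'k ring \<Rightarrow> ('k, 'r) module \<Rightarrow> ('k, ('r gen list \<Rightarrow> 'k) set) module" where
  "free_prod K R = (let F = monoid_alg K (word_monoid R) in
     quot_alg F (Idl\<^bsub>F\<^esub> (free_prod_rels K R)))"

definition fp_word :: "'k ring \<Rightarrow> ('k, 'r) module \<Rightarrow> 'r gen list \<Rightarrow> ('r gen list \<Rightarrow> 'k) set" where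
  "fp_word K R w = (let F = monoid_alg K (word_monoid R) in
     (Idl\<^bsub>F\<^esub> (free_prod_rels K R)) +>\<^bsub>F\<^esub> single K w)"

definition gas_ideal :: "'k ring \<Rightarrow> ('k, 'r) module \<Rightarrow> ('r \<Rightarrow> 'r) \<Rightarrow> ('r \<Rightarrow> 'r) \<Rightarrow> 'r \<Rightarrow> 'k
    \<Rightarrow> ('r gen list \<Rightarrow> 'k) set set" where
  "gas_ideal K R \<tau> \<omega> c \<xi> =
    (let P = free_prod K R; e = (\<lambda>r. fp_word K R [Coeff r]);
         X = fp_word K R [GenX]; Y = fp_word K R [GenY] in
     Idl\<^bsub>P\<^esub> ({X \<otimes>\<^bsub>P\<^esub> e r \<ominus>\<^bsub>P\<^esub> (e (\<tau> r) \<otimes>\<^bsub>P\<^esub> X) | r. r \<in> carrier R} \<union>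
           {Y \<otimes>\<^bsub>P\<^esub> e r \<ominus>\<^bsub>P\<^esub> (e (\<omega> r) \<otimes>\<^bsub>P\<^esub> Y) | r. r \<in> carrier R} \<union>
           {(X \<otimes>\<^bsub>P\<^esub> Y \<ominus>\<^bsub>P\<^esub> (\<xi> \<odot>\<^bsub>P\<^esub> (Y \<otimes>\<^bsub>P\<^esub> X))) \<ominus>\<^bsub>P\<^esub> e c}))"

definition gas :: "'k ring \<Rightarrow> ('k, 'r) module \<Rightarrow> ('r \<Rightarrow> 'r) \<Rightarrow> ('r \<Rightarrow> 'r) \<Rightarrow> 'r \<Rightarrow> 'k
    \<Rightarrow> ('k, ('r gen list \<Rightarrow> 'k) set set) module" where
  "gas K R \<tau> \<omega> c \<xi> = quot_alg (free_prod K R) (gas_ideal K R \<tau> \<omega> c \<xi>)"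

text \<open>The image in \<open>gas K R \<tau> \<omega> c \<xi>\<close> of a generator: \<open>X\<close>, \<open>Y\<close>, or an element of \<open>R\<close>.\<close>

definition gas_gen :: "'k ring \<Rightarrow> ('k, 'r) module \<Rightarrow> ('r \<Rightarrow> 'r) \<Rightarrow> ('r \<Rightarrow> 'r) \<Rightarrow> 'r \<Rightarrow> 'k
    \<Rightarrow> 'r gen \<Rightarrow> ('r gen list \<Rightarrow> 'k) set set" where
  "gas_gen K R \<tau> \<omega> c \<xi> x = gas_ideal K R \<tau> \<omega> c \<xi> +>\<^bsub>free_prod K R\<^esub> fp_word K R [x]"

definition gas_data :: "'k ring \<Rightarrow> ('k, 'r) module \<Rightarrow> ('r \<Rightarrow> 'r) \<Rightarrow> ('r \<Rightarrow> 'r) \<Rightarrow> 'r \<Rightarrow> 'k \<Rightarrow> bool" where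
  "gas_data K R \<tau> \<omega> c \<xi> \<longleftrightarrow>
     k_algebra K R \<and> \<tau> \<in> alg_auto K R \<and> \<omega> \<in> alg_auto K R \<and>
     (\<forall>r\<in>carrier R. \<tau> (\<omega> r) = \<omega> (\<tau> r)) \<and>
     c \<in> carrier R \<and> (\<forall>r\<in>carrier R. c \<otimes>\<^bsub>R\<^esub> r = \<tau> (\<omega> r) \<otimes>\<^bsub>R\<^esub> c) \<and>
     \<xi> \<in> carrier K - {\<zero>\<^bsub>K\<^esub>}"

text \<open>The inverse of an automorphism of \<open>R\<close>.\<close>

abbreviation inv_auto :: "('k, 'r) module \<Rightarrow> ('r \<Rightarrow> 'r) \<Rightarrow> 'r \<Rightarrow> 'r" where
  "inv_auto R \<tau> \<equiv> inv_into (carrier R) \<tau>"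

abbreviation ambiskew :: "'k ring \<Rightarrow> ('k, 'r) module \<Rightarrow> ('r \<Rightarrow> 'r) \<Rightarrow> 'r \<Rightarrow> 'k
    \<Rightarrow> ('k, ('r gen list \<Rightarrow> 'k) set set) module" where
  "ambiskew K R \<tau> c \<xi> \<equiv> gas K R \<tau> (inv_auto R \<tau>) c \<xi>"

abbreviation ambiskew_gen :: "'k ring \<Rightarrow> ('k, 'r) module \<Rightarrow> ('r \<Rightarrow> 'r) \<Rightarrow> 'r \<Rightarrow> 'k
    \<Rightarrow> 'r gen \<Rightarrow> ('r gen list \<Rightarrow> 'k) set set" where
  "ambiskew_gen K R \<tau> c \<xi> \<equiv> gas_gen K R \<tau> (inv_auto R \<tau>) c \<xi>"


section \<open>Hopf-Galois structures on ambiskew polynomial algebras\<close>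

text \<open>\<open>x \<otimes> 1 \<otimes> 1 - g \<otimes> g\<^sup>-\<^sup>1x \<otimes> 1 + g \<otimes> g\<^sup>-\<^sup>1 \<otimes> x\<close>\<close>

definition skew_prim :: "'k ring \<Rightarrow> ('k, 'r) module \<Rightarrow> 'r \<Rightarrow> 'r \<Rightarrow> ('r list \<Rightarrow> 'k) set" where
  "skew_prim K A g x =
     (pure3 K A [x, \<one>\<^bsub>A\<^esub>, \<one>\<^bsub>A\<^esub>] \<ominus>\<^bsub>T3 K A\<^esub> pure3 K A [g, inv\<^bsub>A\<^esub> g \<otimes>\<^bsub>A\<^esub> x, \<one>\<^bsub>A\<^esub>])
       \<oplus>\<^bsub>T3 K A\<^esub> pure3 K A [g, inv\<^bsub>A\<^esub> g, x]"

definition ambiskew_hopf_galois ::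
  "'k ring \<Rightarrow> ('k, 'r) module \<Rightarrow> ('r \<Rightarrow> ('r list \<Rightarrow> 'k) set) \<Rightarrow> ('r \<Rightarrow> 'r) \<Rightarrow> 'r \<Rightarrow> 'k \<Rightarrow> 'r \<Rightarrow> 'r
    \<Rightarrow> (('r gen list \<Rightarrow> 'k) set set \<Rightarrow> (('r gen list \<Rightarrow> 'k) set set list \<Rightarrow> 'k) set) \<Rightarrow> bool" where
  "ambiskew_hopf_galois K R \<mu> \<tau> c \<xi> g h \<mu>' \<longleftrightarrow>
    (let A = ambiskew K R \<tau> c \<xi>; \<iota> = ambiskew_gen K R \<tau> c \<xi> in
     hopf_galois K R \<mu> \<and>
     \<tau> \<in> alg_auto K R \<and>
     c \<in> carrier R \<and> (\<forall>r\<in>carrier R. c \<otimes>\<^bsub>R\<^esub> r = r \<otimes>\<^bsub>R\<^esub> c) \<and>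
     \<xi> \<in> carrier K - {\<zero>\<^bsub>K\<^esub>} \<and>
     g \<in> G0 K R \<mu> \<and> h \<in> G0 K R \<mu> \<and>
     hopf_galois K A \<mu>' \<and>
     (\<forall>r\<in>carrier R. \<mu>' (\<iota> (Coeff r)) =
        tlift K (T3 K A) (\<lambda>x. pure3 K A (map (\<lambda>s. \<iota> (Coeff s)) x)) (\<mu> r)) \<and>
     \<mu>' (\<iota> GenX) = skew_prim K A (\<iota> (Coeff g)) (\<iota> GenX) \<and>
     \<mu>' (\<iota> GenY) = skew_prim K A (\<iota> (Coeff h)) (\<iota> GenY))"

text \<open>The map \<open>r \<otimes> s \<mapsto> grg\<^sup>-\<^sup>1 \<otimes> \<sigma>(s)\<close> on \<open>R\<^sup>o\<^sup>p \<otimes> R\<close>, the products being those of \<open>R\<close>.\<close>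

definition conj_tensor :: "'k ring \<Rightarrow> ('k, 'r) module \<Rightarrow> 'r \<Rightarrow> ('r \<Rightarrow> 'r)
    \<Rightarrow> ('r list \<Rightarrow> 'k) set \<Rightarrow> ('r list \<Rightarrow> 'k) set" where
  "conj_tensor K R g \<sigma> = tlift K (tensor K [opp R, R])
     (\<lambda>x. pure K [opp R, R] [g \<otimes>\<^bsub>R\<^esub> x!0 \<otimes>\<^bsub>R\<^esub> inv\<^bsub>R\<^esub> g, \<sigma> (x!1)])"

text \<open>The map \<open>H(R) \<rightarrow> H(A)\<close> induced by the canonical map \<open>R \<rightarrow> A\<close> to the ambiskew polynomial algebra.\<close>

definition HG_incl :: "'k ring \<Rightarrow> ('k, 'r) module \<Rightarrow> ('r \<Rightarrow> 'r) \<Rightarrow> 'r \<Rightarrow> 'k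
    \<Rightarrow> ('r list \<Rightarrow> 'k) set \<Rightarrow> (('r gen list \<Rightarrow> 'k) set set list \<Rightarrow> 'k) set" where
  "HG_incl K R \<tau> c \<xi> = (let A = ambiskew K R \<tau> c \<xi> in
     tlift K (tensor K [opp A, A])
       (\<lambda>x. pure K [opp A, A] (map (\<lambda>s. ambiskew_gen K R \<tau> c \<xi> (Coeff s)) x)))"

end

theory Submission
  imports Defs
begin

text \<open>With \<open>E = g\<^sup>-\<^sup>1 \<otimes> X - g\<^sup>-\<^sup>1X \<otimes> 1\<close> and \<open>F = h\<^sup>-\<^sup>1 \<otimes> Y - h\<^sup>-\<^sup>1Y \<otimes> 1\<close> in \<open>H(A)\<close>, one has
  \<open>\<mu>(X) = X \<otimes> 1 \<otimes> 1 + g \<otimes> E\<close> and \<open>\<mu>(Y) = Y \<otimes> 1 \<otimes> 1 + h \<otimes> F\<close>. Comparing coefficients in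
  \<open>\<mu>(X)\<mu>(r) = \<mu>(\<tau>(r))\<mu>(X)\<close> and in \<open>\<mu>(XY - \<xi>YX) = \<mu>(c)\<close> gives \<open>Eu = \<tau>'(u)E\<close> and \<open>Fu = \<omega>'(u)F\<close> on \<open>H(R)\<close>,
  the relations \<open>\<tau>(h) = \<xi>h\<close> and \<open>\<omega>(g) = \<xi>\<^sup>-\<^sup>1g\<close>, and a scalar \<open>\<lambda>\<close> with \<open>hg = \<lambda>gh\<close>. Then \<open>EF - \<xi>'FE = c'\<close>
  for \<open>\<xi>' = \<xi>\<lambda>\<close>, \<open>q = h\<^sup>-\<^sup>1g\<^sup>-\<^sup>1\<close> and \<open>c' = q \<otimes> c - qc \<otimes> 1\<close>, which yields an algebra map
  \<open>\<psi>\<close> from the generalized ambiskew algebra over \<open>H(R)\<close> to \<open>H(A)\<close>.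

  It is injective because \<open>A\<close> is free over \<open>R\<close> on the monomials \<open>X\<^sup>jY\<^sup>i\<close>. It is surjective because, for every
  functional \<open>\<phi>\<close>, the map \<open>\<phi> \<otimes> id \<otimes> id\<close> sends \<open>\<mu>(A)\<close> into the image of \<open>\<psi>\<close>: an element \<open>x \<otimes> y\<close> of \<open>H(A)\<close>
  satisfies \<open>1 \<otimes> x \<otimes> y = xy\<^sub>1 \<otimes> y\<^sub>2 \<otimes> y\<^sub>3\<close>, and a functional with \<open>\<phi>(1) = 1\<close> recovers it.

  For the example take \<open>\<complex>[X, Y] \<otimes> M\<close> over a twisted group algebra \<open>M\<close> of \<open>\<int>/2 \<times> \<int>/2\<close>, with \<open>h = 1\<close> and
  \<open>g\<close> a non-central basis element: there \<open>\<tau>'\<omega>'\<close> is conjugation by \<open>g\<close> on the first factor.\<close>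

section \<open>Algebras and linear maps\<close>

text \<open>No basis of R is chosen. Identities in tensor powers of A are compared by applying left
  R-linear coefficient maps from A to R in each slot, and functionals are used to remove a slot. The
  obstacle is Eu = \<tau>'(u)E. Its part with X in the second slot is formal. The part with X in the
  first slot asks for xg^-1 \<otimes> y = g^-1 \<tau>(gxg^-1) \<otimes> \<tau>(y) on H(R); this
  comes from the coefficient of X in the middle slot of \<mu>(X)\<mu>(r) = \<mu>(\<tau>(r))\<mu>(X),
  together with the equation that defines H(R). The third slot of the same identity shows that
  \<tau>' preserves H(R). In \<xi>' = \<xi>\<lambda> the factor \<xi> compensates \<tau>(h^-1) =
  \<xi>^-1 h^-1, and \<lambda> turns g^-1 h^-1 into h^-1 g^-1. That c' lies in H(R) and intertwines
  u with \<tau>'\<omega>'(u) is not computed but inherited from EF - \<xi>'FE, since H(R) is the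
  preimage of H(A) under an injective map. In the example conjugation by g changes the sign of a
  basis element. The sign occurs in two slots of \<mu>, where it cancels, but only once in
  \<tau>'.\<close>

locale kalg =
  fixes K :: "'k ring" and R :: "('k, 'r) module"
  assumes alg: "k_algebra K R"
begin

lemma fieldK: "field K" and moduleR: "module K R" and ringR: "ring R"
  using alg by (auto simp: k_algebra_def)

end

sublocale kalg \<subseteq> K: field K by (rule fieldK)
sublocale kalg \<subseteq> ring R by (rule ringR)
sublocale kalg \<subseteq> Mod: module K R by (rule moduleR)

lemma (in kalg) smult_mult_l:
    "\<lbrakk>a \<in> carrier K; x \<in> carrier R; y \<in> carrier R\<rbrakk> \<Longrightarrow> (a \<odot>\<^bsub>R\<^esub> x) \<otimes>\<^bsub>R\<^esub> y = a \<odot>\<^bsub>R\<^esub> (x \<otimes>\<^bsub>R\<^esub> y)"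
  and smult_mult_r:
    "\<lbrakk>a \<in> carrier K; x \<in> carrier R; y \<in> carrier R\<rbrakk> \<Longrightarrow> x \<otimes>\<^bsub>R\<^esub> (a \<odot>\<^bsub>R\<^esub> y) = a \<odot>\<^bsub>R\<^esub> (x \<otimes>\<^bsub>R\<^esub> y)"
  using alg by (auto simp: k_algebra_def)

lemma (in abelian_group) diff_eq_zero_iff:
  "\<lbrakk>x \<in> carrier G; y \<in> carrier G\<rbrakk> \<Longrightarrow> x \<ominus> y = \<zero> \<longleftrightarrow> x = y"
  by (metis a_minus_def add.inv_solve_right' add.inv_closed l_zero minus_equality minus_minus r_neg)

lemma kalgI: "k_algebra K R \<Longrightarrow> kalg K R"
  by (rule kalg.intro)

text \<open>A predicate on bare functions with no condition off the carrier, so that lambda terms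
  compose without being restricted.\<close>

definition linmap :: "'k ring \<Rightarrow> ('k, 'm) module \<Rightarrow> ('k, 'n) module \<Rightarrow> ('m \<Rightarrow> 'n) \<Rightarrow> bool" where
  "linmap K M N f \<longleftrightarrow> (\<forall>x\<in>carrier M. f x \<in> carrier N) \<and>
     (\<forall>x\<in>carrier M. \<forall>y\<in>carrier M. f (x \<oplus>\<^bsub>M\<^esub> y) = f x \<oplus>\<^bsub>N\<^esub> f y) \<and>
     (\<forall>a\<in>carrier K. \<forall>x\<in>carrier M. f (a \<odot>\<^bsub>M\<^esub> x) = a \<odot>\<^bsub>N\<^esub> f x)"

lemma linmapI:
  assumes "\<And>x. x \<in> carrier M \<Longrightarrow> f x \<in> carrier N"
    and "\<And>x y. \<lbrakk>x \<in> carrier M; y \<in> carrier M\<rbrakk> \<Longrightarrow> f (x \<oplus>\<^bsub>M\<^esub> y) = f x \<oplus>\<^bsub>N\<^esub> f y"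
    and "\<And>a x. \<lbrakk>a \<in> carrier K; x \<in> carrier M\<rbrakk> \<Longrightarrow> f (a \<odot>\<^bsub>M\<^esub> x) = a \<odot>\<^bsub>N\<^esub> f x"
  shows "linmap K M N f"
  using assms by (simp add: linmap_def)

lemma linmapD:
  assumes "linmap K M N f"
  shows "x \<in> carrier M \<Longrightarrow> f x \<in> carrier N"
    and "\<lbrakk>x \<in> carrier M; y \<in> carrier M\<rbrakk> \<Longrightarrow> f (x \<oplus>\<^bsub>M\<^esub> y) = f x \<oplus>\<^bsub>N\<^esub> f y"
    and "\<lbrakk>a \<in> carrier K; x \<in> carrier M\<rbrakk> \<Longrightarrow> f (a \<odot>\<^bsub>M\<^esub> x) = a \<odot>\<^bsub>N\<^esub> f x"
  using assms by (auto simp: linmap_def)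

lemma linmap_zero:
  assumes "linmap K M N f" "module K M" "module K N"
  shows "f \<zero>\<^bsub>M\<^esub> = \<zero>\<^bsub>N\<^esub>"
proof -
  interpret M: module K M by fact
  interpret N: module K N by fact
  have "f (\<zero>\<^bsub>K\<^esub> \<odot>\<^bsub>M\<^esub> \<zero>\<^bsub>M\<^esub>) = \<zero>\<^bsub>K\<^esub> \<odot>\<^bsub>N\<^esub> f \<zero>\<^bsub>M\<^esub>"
    by (rule linmapD(3)[OF assms(1)]) auto
  then show ?thesis using linmapD(1)[OF assms(1), of "\<zero>\<^bsub>M\<^esub>"] by simp
qed

lemma linmap_uminus:
  assumes f: "linmap K M N f" "module K M" "module K N" and x: "x \<in> carrier M"
  shows "f (\<ominus>\<^bsub>M\<^esub> x) = \<ominus>\<^bsub>N\<^esub> f x"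
proof -
  interpret M: module K M by fact
  interpret N: module K N by fact
  have "f (\<ominus>\<^bsub>M\<^esub> x) \<oplus>\<^bsub>N\<^esub> f x = \<zero>\<^bsub>N\<^esub>"
    using linmapD(2)[OF f(1), of "\<ominus>\<^bsub>M\<^esub> x" x] linmap_zero[OF f] x by (simp add: M.l_neg)
  then show ?thesis using linmapD(1)[OF f(1)] x
    by (simp add: N.minus_equality)
qed

lemma linmap_minus:
  assumes f: "linmap K M N f" "module K M" "module K N" and x: "x \<in> carrier M" "y \<in> carrier M"
  shows "f (x \<ominus>\<^bsub>M\<^esub> y) = f x \<ominus>\<^bsub>N\<^esub> f y"
proof -
  interpret M: module K M by fact
  show ?thesis
    using linmapD(2)[OF f(1)] linmap_uminus[OF f] x by (simp add: a_minus_def)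
qed

lemma linmap_finsum:
  assumes f: "linmap K M N f" "module K M" "module K N"
    and h: "finite S" "\<And>s. s \<in> S \<Longrightarrow> h s \<in> carrier M"
  shows "f (finsum M h S) = finsum N (\<lambda>s. f (h s)) S"
proof -
  interpret M: module K M by fact
  interpret N: module K N by fact
  show ?thesis using h
  proof (induction S)
    case empty then show ?case by (simp add: linmap_zero[OF f])
  next
    case (insert x S)
    then show ?case
      by (simp add: Pi_def linmapD[OF f(1)])
  qed
qed

lemma linmap_id: "linmap K M M (\<lambda>x. x)"
  by (simp add: linmap_def)

lemma linmap_comp: "\<lbrakk>linmap K N P f; linmap K M N g\<rbrakk> \<Longrightarrow> linmap K M P (\<lambda>x. f (g x))"
  by (simp add: linmap_def)

lemma linmap_cong:
  assumes "linmap K M N f" "\<And>x. x \<in> carrier M \<Longrightarrow> g x = f x" "module K M"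
  shows "linmap K M N g"
proof -
  interpret M: module K M by fact
  show ?thesis using assms(1,2) by (simp add: linmap_def)
qed

lemma linmap_const0: "module K N \<Longrightarrow> linmap K M N (\<lambda>x. \<zero>\<^bsub>N\<^esub>)"
proof -
  assume "module K N"
  then interpret N: module K N .
  show ?thesis by (simp add: linmap_def)
qed

lemma linmap_add:
  assumes "linmap K M N f" "linmap K M N g" "module K N"
  shows "linmap K M N (\<lambda>x. f x \<oplus>\<^bsub>N\<^esub> g x)"
proof -
  interpret N: module K N by fact
  show ?thesis using assms(1,2)
    by (auto simp: linmap_def N.smult_r_distr N.a_ac)
qed

lemma linmap_smult:
  assumes "linmap K M N f" "a \<in> carrier K" "module K N"
  shows "linmap K M N (\<lambda>x. a \<odot>\<^bsub>N\<^esub> f x)"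
proof -
  interpret N: module K N by fact
  show ?thesis using assms(1,2)
    by (auto simp: linmap_def N.smult_r_distr N.smult_assoc1[symmetric] N.R.m_comm)
qed

lemma linmap_neg:
  assumes "linmap K M N f" "module K N"
  shows "linmap K M N (\<lambda>x. \<ominus>\<^bsub>N\<^esub> f x)"
proof -
  interpret N: module K N by fact
  show ?thesis using assms(1)
    by (auto simp: linmap_def N.minus_add N.smult_r_minus)
qed

lemma linmap_diff:
  assumes "linmap K M N f" "linmap K M N g" "module K N"
  shows "linmap K M N (\<lambda>x. f x \<ominus>\<^bsub>N\<^esub> g x)"
  unfolding a_minus_def by (intro linmap_add linmap_neg assms)

lemma linmap_mult_l:
  assumes "k_algebra K N" "linmap K M N f" "c \<in> carrier N"
  shows "linmap K M N (\<lambda>x. c \<otimes>\<^bsub>N\<^esub> f x)"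
proof -
  interpret N: kalg K N by (rule kalgI) fact
  show ?thesis using assms(2,3)
    by (auto simp: linmap_def N.r_distr N.smult_mult_r)
qed

lemma linmap_mult_r:
  assumes "k_algebra K N" "linmap K M N f" "c \<in> carrier N"
  shows "linmap K M N (\<lambda>x. f x \<otimes>\<^bsub>N\<^esub> c)"
proof -
  interpret N: kalg K N by (rule kalgI) fact
  show ?thesis using assms(2,3)
    by (auto simp: linmap_def N.l_distr N.smult_mult_l)
qed

lemma linmap_kernel:
  assumes f: "linmap K M N f" "module K M" "module K N"
  shows "submodule {x \<in> carrier M. f x = \<zero>\<^bsub>N\<^esub>} K M"
proof -
  interpret M: module K M by fact
  interpret N: module K N by fact
  show ?thesis
    by (rule M.submoduleI) (auto simp: linmap_zero[OF f] linmap_uminus[OF f] linmapD[OF f(1)])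
qed

text \<open>Nearly every identity below is proved through this: two linear maps agree on a
  submodule, so it is enough to compare them on a spanning set.\<close>

lemma linmap_equalizer:
  assumes f: "linmap K M N f" and g: "linmap K M N g" and M: "module K M" "module K N"
  shows "submodule {x \<in> carrier M. f x = g x} K M"
proof -
  interpret M: module K M by fact
  interpret N: module K N by fact
  show ?thesis
    by (rule M.submoduleI) (auto simp: linmap_zero[OF f M] linmap_uminus[OF f M] linmapD[OF f]
        linmap_zero[OF g M] linmap_uminus[OF g M] linmapD[OF g])
qed

lemma linmap_vimage:
  assumes f: "linmap K M N f" and M: "module K M" "module K N" and S: "submodule S K N"
  shows "submodule {x \<in> carrier M. f x \<in> S} K M"
proof -
  interpret M: module K M by fact
  interpret N: module K N by fact
  show ?thesis
    by (rule M.submoduleI)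
      (auto simp: linmap_zero[OF f M] linmap_uminus[OF f M] linmapD[OF f]
        intro: N.submoduleE[OF S] subgroup.one_closed[OF submodule.axioms(1)[OF S], simplified])
qed

lemma alg_hom_linmap: "f \<in> alg_hom K M N \<Longrightarrow> linmap K M N f"
  by (auto simp: alg_hom_def linmap_def ring_hom_def)

lemma alg_homD:
  assumes "f \<in> alg_hom K M N"
  shows "x \<in> carrier M \<Longrightarrow> f x \<in> carrier N"
    and "\<lbrakk>x \<in> carrier M; y \<in> carrier M\<rbrakk> \<Longrightarrow> f (x \<oplus>\<^bsub>M\<^esub> y) = f x \<oplus>\<^bsub>N\<^esub> f y"
    and "\<lbrakk>x \<in> carrier M; y \<in> carrier M\<rbrakk> \<Longrightarrow> f (x \<otimes>\<^bsub>M\<^esub> y) = f x \<otimes>\<^bsub>N\<^esub> f y"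
    and "f \<one>\<^bsub>M\<^esub> = \<one>\<^bsub>N\<^esub>"
    and "\<lbrakk>a \<in> carrier K; x \<in> carrier M\<rbrakk> \<Longrightarrow> f (a \<odot>\<^bsub>M\<^esub> x) = a \<odot>\<^bsub>N\<^esub> f x"
  using assms by (auto simp: alg_hom_def ring_hom_def)

lemma alg_homI:
  assumes "linmap K M N f"
    and "\<And>x y. \<lbrakk>x \<in> carrier M; y \<in> carrier M\<rbrakk> \<Longrightarrow> f (x \<otimes>\<^bsub>M\<^esub> y) = f x \<otimes>\<^bsub>N\<^esub> f y"
    and "f \<one>\<^bsub>M\<^esub> = \<one>\<^bsub>N\<^esub>"
  shows "f \<in> alg_hom K M N"
  using assms by (auto simp: alg_hom_def ring_hom_def linmap_def)

lemma alg_hom_comp: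
  assumes "f \<in> alg_hom K N P" "g \<in> alg_hom K M N"
  shows "(\<lambda>x. f (g x)) \<in> alg_hom K M P"
  using assms by (auto simp: alg_hom_def ring_hom_def Pi_def)

lemma lin_span_mono: "x \<in> S \<Longrightarrow> x \<in> lin_span K A S"
  by (auto simp: lin_span_def)

lemma lin_span_least: "\<lbrakk>submodule N K A; S \<subseteq> N\<rbrakk> \<Longrightarrow> lin_span K A S \<subseteq> N"
  by (auto simp: lin_span_def)

lemma submodule_zero: "submodule N K A \<Longrightarrow> \<zero>\<^bsub>A\<^esub> \<in> N"
  using subgroup.one_closed[OF submodule.axioms(1), of N K A] by simp

lemma lin_span_submodule:
  assumes "module K A" "S \<subseteq> carrier A"
  shows "submodule (lin_span K A S) K A"
proof -
  interpret A: module K A by fact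
  have c: "submodule (carrier A) K A" by (rule A.carrier_is_submodule)
  show ?thesis unfolding lin_span_def
    by (rule A.submoduleI) (use c assms(2) in \<open>auto intro: A.submoduleE submodule_zero\<close>)
qed

lemma finsum_in_submodule:
  assumes N: "submodule N K M" and M: "module K M" and "finite S" "\<And>s. s \<in> S \<Longrightarrow> f s \<in> N"
  shows "finsum M f S \<in> N"
proof -
  interpret M: module K M by fact
  have "N \<subseteq> carrier M" using M.submoduleE(1)[OF N] .
  with assms(3,4) show ?thesis
  proof (induction S)
    case empty then show ?case by (simp add: submodule_zero[OF N])
  next
    case (insert x S)
    then have "f \<in> S \<rightarrow> carrier M" "f x \<in> carrier M" by (auto simp: Pi_def)
    then show ?case using insert by (simp add: M.submoduleE[OF N])
  qed
qed

lemma finsum_Sigma_conv: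
  assumes "abelian_monoid G" "finite S" "finite T" "\<And>x y. \<lbrakk>x \<in> S; y \<in> T\<rbrakk> \<Longrightarrow> f x y \<in> carrier G"
  shows "finsum G (\<lambda>p. f (fst p) (snd p)) (S \<times> T) = finsum G (\<lambda>x. finsum G (f x) T) S"
proof -
  interpret abelian_monoid G by fact
  show ?thesis using assms(2,4)
  proof (induction S)
    case empty then show ?case by simp
  next
    case (insert x S)
    have "finsum G (\<lambda>p. f (fst p) (snd p)) (insert x S \<times> T)
       = finsum G (\<lambda>p. f (fst p) (snd p)) ((Pair x ` T) \<union> (S \<times> T))"
      by (rule arg_cong[where f = "finsum G _"]) auto
    also have "\<dots> = finsum G (\<lambda>p. f (fst p) (snd p)) (Pair x ` T) \<oplus>\<^bsub>G\<^esub> finsum G (\<lambda>p. f (fst p) (snd p)) (S \<times> T)"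
      by (rule finsum_Un_disjoint) (use insert assms(3) in auto)
    also have "finsum G (\<lambda>p. f (fst p) (snd p)) (Pair x ` T) = finsum G (f x) T"
      by (subst finsum_reindex) (use insert in \<open>auto simp: inj_on_def\<close>)
    finally show ?case using insert
      by (subst finsum_insert) (auto simp: Pi_def intro!: finsum_closed)
  qed
qed

section \<open>Monoid algebras\<close>

text \<open>Linear extension of \<open>F\<close> from the basis of functions
  \<open>single K x\<close>. The map \<open>tlift\<close> is this sum evaluated at a chosen
  representative of a coset.\<close>

definition lext :: "'k ring \<Rightarrow> ('k, 'n) module \<Rightarrow> ('x \<Rightarrow> 'n) \<Rightarrow> ('x \<Rightarrow> 'k) \<Rightarrow> 'n" where
  "lext K N F f = (\<Oplus>\<^bsub>N\<^esub>x\<in>{x. f x \<noteq> \<zero>\<^bsub>K\<^esub>}. f x \<odot>\<^bsub>N\<^esub> F x)"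

locale monalg =
  fixes K :: "'k ring" and M :: "'x monoid"
  assumes field: "field K" and mon: "monoid M"
begin

sublocale K: field K by (rule field)
sublocale M: monoid M by (rule mon)

abbreviation "F \<equiv> monoid_alg K M"

lemma carrier_F: "f \<in> carrier F \<longleftrightarrow> (\<forall>x. f x \<in> carrier K) \<and> (\<forall>x. x \<notin> carrier M \<longrightarrow> f x = \<zero>\<^bsub>K\<^esub>) \<and>
     finite {x. f x \<noteq> \<zero>\<^bsub>K\<^esub>}"
  and add_F: "f \<oplus>\<^bsub>F\<^esub> g = (\<lambda>x. f x \<oplus>\<^bsub>K\<^esub> g x)"
  and smult_F: "a \<odot>\<^bsub>F\<^esub> f = (\<lambda>x. a \<otimes>\<^bsub>K\<^esub> f x)"
  and zero_F: "\<zero>\<^bsub>F\<^esub> = (\<lambda>x. \<zero>\<^bsub>K\<^esub>)"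
  and one_F: "\<one>\<^bsub>F\<^esub> = single K \<one>\<^bsub>M\<^esub>"
  by (auto simp: monoid_alg_def single_def)

lemma support_subset: "f \<in> carrier F \<Longrightarrow> {x. f x \<noteq> \<zero>\<^bsub>K\<^esub>} \<subseteq> carrier M"
  by (auto simp: carrier_F)

lemma single_closed [simp]: "x \<in> carrier M \<Longrightarrow> single K x \<in> carrier F"
  by (auto simp: carrier_F single_def)

lemma add_closed_F: "\<lbrakk>f \<in> carrier F; g \<in> carrier F\<rbrakk> \<Longrightarrow> f \<oplus>\<^bsub>F\<^esub> g \<in> carrier F"
  by (auto simp: carrier_F add_F intro!: finite_subset[of "{x. f x \<oplus>\<^bsub>K\<^esub> g x \<noteq> \<zero>\<^bsub>K\<^esub>}" "{x. f x \<noteq> \<zero>\<^bsub>K\<^esub>} \<union> {x. g x \<noteq> \<zero>\<^bsub>K\<^esub>}"])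

lemma smult_closed_F: "\<lbrakk>a \<in> carrier K; f \<in> carrier F\<rbrakk> \<Longrightarrow> a \<odot>\<^bsub>F\<^esub> f \<in> carrier F"
  by (auto simp: carrier_F smult_F intro!: finite_subset[of "{x. a \<otimes>\<^bsub>K\<^esub> f x \<noteq> \<zero>\<^bsub>K\<^esub>}" "{x. f x \<noteq> \<zero>\<^bsub>K\<^esub>}"])

lemma module_F: "module K F"
proof (rule moduleI)
  show "abelian_group F"
  proof (rule abelian_groupI)
    fix f assume f: "f \<in> carrier F"
    have "(\<lambda>x. \<ominus>\<^bsub>K\<^esub> f x) \<in> carrier F"
      using f by (auto simp: carrier_F elim!: rev_finite_subset)
    moreover have "(\<lambda>x. \<ominus>\<^bsub>K\<^esub> f x) \<oplus>\<^bsub>F\<^esub> f = \<zero>\<^bsub>F\<^esub>"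
      using f by (auto simp: carrier_F add_F zero_F K.l_neg)
    ultimately show "\<exists>y\<in>carrier F. y \<oplus>\<^bsub>F\<^esub> f = \<zero>\<^bsub>F\<^esub>" by blast
  qed (simp_all add: add_closed_F, auto simp: carrier_F add_F zero_F K.a_ac)
qed (auto simp: smult_closed_F K.is_cring, auto simp: smult_F add_F carrier_F K.l_distr K.r_distr K.m_assoc)

sublocale FM: module K F by (rule module_F)

lemma finsum_F:
  assumes "finite S" "\<And>s. s \<in> S \<Longrightarrow> h s \<in> carrier F"
  shows "finsum F h S z = finsum K (\<lambda>s. h s z) S"
  using assms
proof (induction S)
  case empty then show ?case by (simp add: zero_F)
next
  case (insert x S)
  then have "h x z \<in> carrier K" "(\<lambda>s. h s z) \<in> S \<rightarrow> carrier K" "h \<in> S \<rightarrow> carrier F"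
    by (auto simp: carrier_F)
  then show ?case using insert by (simp add: add_F)
qed

text \<open>The support depends on \<open>f\<close>. Summing over a larger common finite set allows
  two extensions to be added term by term.\<close>

lemma lext_superset:
  assumes N: "module K N" and f: "f \<in> carrier F" and H: "\<And>x. x \<in> carrier M \<Longrightarrow> H x \<in> carrier N"
    and S: "finite S" "{x. f x \<noteq> \<zero>\<^bsub>K\<^esub>} \<subseteq> S" "S \<subseteq> carrier M"
  shows "lext K N H f = (\<Oplus>\<^bsub>N\<^esub>x\<in>S. f x \<odot>\<^bsub>N\<^esub> H x)"
proof -
  interpret N: module K N by fact
  show ?thesis unfolding lext_def
    by (rule N.add.finprod_mono_neutral_cong_left) (use f H S in \<open>auto simp: carrier_F\<close>)
qed

lemma linmap_lext:
  assumes N: "module K N" and H: "\<And>x. x \<in> carrier M \<Longrightarrow> H x \<in> carrier N"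
  shows "linmap K F N (lext K N H)"
proof -
  interpret N: module K N by fact
  have [simp]: "f x \<in> carrier K" if "f \<in> carrier F" for f x using that by (auto simp: carrier_F)
  show ?thesis
  proof (rule linmapI)
    fix f assume f: "f \<in> carrier F"
    show "lext K N H f \<in> carrier N" unfolding lext_def
      by (rule N.finsum_closed) (use support_subset[OF f] f H in auto)
  next
    fix f g assume f: "f \<in> carrier F" and g: "g \<in> carrier F"
    let ?S = "{x. f x \<noteq> \<zero>\<^bsub>K\<^esub>} \<union> {x. g x \<noteq> \<zero>\<^bsub>K\<^esub>}"
    have S: "finite ?S" "?S \<subseteq> carrier M" using f g by (auto simp: carrier_F)
    have "lext K N H (f \<oplus>\<^bsub>F\<^esub> g) = (\<Oplus>\<^bsub>N\<^esub>x\<in>?S. (f \<oplus>\<^bsub>F\<^esub> g) x \<odot>\<^bsub>N\<^esub> H x)"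
      by (rule lext_superset) (use N f g H S in \<open>auto simp: add_closed_F[unfolded add_F] add_F\<close>)
    also have "\<dots> = (\<Oplus>\<^bsub>N\<^esub>x\<in>?S. f x \<odot>\<^bsub>N\<^esub> H x \<oplus>\<^bsub>N\<^esub> g x \<odot>\<^bsub>N\<^esub> H x)"
      by (rule N.finsum_cong') (use S H f g in \<open>auto simp: add_F N.smult_l_distr\<close>)
    also have "\<dots> = (\<Oplus>\<^bsub>N\<^esub>x\<in>?S. f x \<odot>\<^bsub>N\<^esub> H x) \<oplus>\<^bsub>N\<^esub> (\<Oplus>\<^bsub>N\<^esub>x\<in>?S. g x \<odot>\<^bsub>N\<^esub> H x)"
      by (rule N.finsum_addf) (use S H f g in auto)
    also have "(\<Oplus>\<^bsub>N\<^esub>x\<in>?S. f x \<odot>\<^bsub>N\<^esub> H x) = lext K N H f"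
      by (rule lext_superset[symmetric]) (use N f g H S in auto)
    also have "(\<Oplus>\<^bsub>N\<^esub>x\<in>?S. g x \<odot>\<^bsub>N\<^esub> H x) = lext K N H g"
      by (rule lext_superset[symmetric]) (use N f g H S in auto)
    finally show "lext K N H (f \<oplus>\<^bsub>F\<^esub> g) = lext K N H f \<oplus>\<^bsub>N\<^esub> lext K N H g" .
  next
    fix a f assume a: "a \<in> carrier K" and f: "f \<in> carrier F"
    let ?S = "{x. f x \<noteq> \<zero>\<^bsub>K\<^esub>}"
    have S: "finite ?S" "?S \<subseteq> carrier M" using f by (auto simp: carrier_F)
    have "lext K N H (a \<odot>\<^bsub>F\<^esub> f) = (\<Oplus>\<^bsub>N\<^esub>x\<in>?S. (a \<odot>\<^bsub>F\<^esub> f) x \<odot>\<^bsub>N\<^esub> H x)"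
      by (rule lext_superset) (use N f a H S in \<open>auto simp: smult_closed_F[unfolded smult_F] smult_F\<close>)
    also have "\<dots> = (\<Oplus>\<^bsub>N\<^esub>x\<in>?S. a \<odot>\<^bsub>N\<^esub> (f x \<odot>\<^bsub>N\<^esub> H x))"
      by (rule N.finsum_cong') (use S H f a in \<open>auto simp: smult_F N.smult_assoc1\<close>)
    also have "\<dots> = a \<odot>\<^bsub>N\<^esub> lext K N H f" unfolding lext_def
      by (rule N.finsum_smult_ldistr[symmetric]) (use S H f a in auto)
    finally show "lext K N H (a \<odot>\<^bsub>F\<^esub> f) = a \<odot>\<^bsub>N\<^esub> lext K N H f" .
  qed
qed

lemma lext_single:
  assumes N: "module K N" and H: "\<And>x. x \<in> carrier M \<Longrightarrow> H x \<in> carrier N" and x: "x \<in> carrier M"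
  shows "lext K N H (single K x) = H x"
proof -
  interpret N: module K N by fact
  have "lext K N H (single K x) = (\<Oplus>\<^bsub>N\<^esub>y\<in>{x}. single K x y \<odot>\<^bsub>N\<^esub> H y)"
    by (rule lext_superset) (use N H x single_closed[OF x] in \<open>auto simp: single_def split: if_splits\<close>)
  then show ?thesis using H[OF x] by (simp add: single_def)
qed

lemma expand_F: "f \<in> carrier F \<Longrightarrow> f = lext K F (single K) f"
proof
  fix z assume f: "f \<in> carrier F"
  let ?S = "{x. f x \<noteq> \<zero>\<^bsub>K\<^esub>}"
  have S: "finite ?S" "?S \<subseteq> carrier M" "\<And>x. f x \<in> carrier K" using f by (auto simp: carrier_F)
  have "lext K F (single K) f z = (\<Oplus>\<^bsub>K\<^esub>x\<in>?S. f x \<otimes>\<^bsub>K\<^esub> single K x z)"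
    unfolding lext_def by (subst finsum_F) (use S in \<open>auto simp: smult_closed_F[unfolded smult_F] smult_F subset_eq\<close>)
  also have "\<dots> = (\<Oplus>\<^bsub>K\<^esub>x\<in>?S. if z = x then f x else \<zero>\<^bsub>K\<^esub>)"
    by (rule K.finsum_cong') (use S in \<open>auto simp: single_def\<close>)
  also have "\<dots> = f z"
  proof (cases "z \<in> ?S")
    case True then show ?thesis using S by (subst K.finsum_singleton) auto
  next
    case False
    then have "(\<Oplus>\<^bsub>K\<^esub>x\<in>?S. if z = x then f x else \<zero>\<^bsub>K\<^esub>) = (\<Oplus>\<^bsub>K\<^esub>x\<in>?S. \<zero>\<^bsub>K\<^esub>)"
      by (intro K.finsum_cong') auto
    then show ?thesis using False by simp
  qed
  finally show "f z = lext K F (single K) f z" by simp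
qed

lemma submodule_F_eq:
  assumes N: "submodule N K F" and s: "\<And>x. x \<in> carrier M \<Longrightarrow> single K x \<in> N" and f: "f \<in> carrier F"
  shows "f \<in> N"
proof -
  have "lext K F (single K) f \<in> N" unfolding lext_def
    by (rule finsum_in_submodule[OF N module_F])
      (use f s in \<open>auto simp: carrier_F intro!: submodule.smult_closed[OF N]\<close>)
  then show ?thesis using expand_F[OF f] by simp
qed

lemma linmap_F_eqI:
  assumes f: "linmap K F N f" and g: "linmap K F N g" and N: "module K N"
    and e: "\<And>x. x \<in> carrier M \<Longrightarrow> f (single K x) = g (single K x)" and u: "u \<in> carrier F"
  shows "f u = g u"
  using submodule_F_eq[OF linmap_equalizer[OF f g module_F N], of u] e u by auto

text \<open>Writing the convolution as an iterated linear extension makes its bilinearity visible,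
  so that associativity and the unit laws reduce to the monoid.\<close>

lemma mult_F_eq:
  assumes f: "f \<in> carrier F" and g: "g \<in> carrier F"
  shows "f \<otimes>\<^bsub>F\<^esub> g = lext K F (\<lambda>x. lext K F (\<lambda>y. single K (x \<otimes>\<^bsub>M\<^esub> y)) g) f"
proof
  fix z
  let ?S = "{x. f x \<noteq> \<zero>\<^bsub>K\<^esub>}" and ?T = "{x. g x \<noteq> \<zero>\<^bsub>K\<^esub>}"
  have S: "finite ?S" "?S \<subseteq> carrier M" "\<And>x. f x \<in> carrier K" using f by (auto simp: carrier_F)
  have T: "finite ?T" "?T \<subseteq> carrier M" "\<And>x. g x \<in> carrier K" using g by (auto simp: carrier_F)
  have l: "lext K F (\<lambda>y. single K (x \<otimes>\<^bsub>M\<^esub> y)) g \<in> carrier F" if "x \<in> carrier M" for x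
    by (rule linmapD(1)[OF linmap_lext[OF module_F] g]) (use that in auto)
  have l2: "lext K F (\<lambda>y. single K (x \<otimes>\<^bsub>M\<^esub> y)) g z = (\<Oplus>\<^bsub>K\<^esub>y\<in>?T. g y \<otimes>\<^bsub>K\<^esub> single K (x \<otimes>\<^bsub>M\<^esub> y) z)"
    if "x \<in> carrier M" for x unfolding lext_def
    by (subst finsum_F) (use T that in \<open>auto simp: smult_closed_F[unfolded smult_F] smult_F subset_eq\<close>)
  let ?h = "\<lambda>x y. f x \<otimes>\<^bsub>K\<^esub> (g y \<otimes>\<^bsub>K\<^esub> single K (x \<otimes>\<^bsub>M\<^esub> y) z)"
  have sc: "single K w z \<in> carrier K" for w by (simp add: single_def)
  have "lext K F (\<lambda>x. lext K F (\<lambda>y. single K (x \<otimes>\<^bsub>M\<^esub> y)) g) f z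
     = (\<Oplus>\<^bsub>K\<^esub>x\<in>?S. f x \<otimes>\<^bsub>K\<^esub> lext K F (\<lambda>y. single K (x \<otimes>\<^bsub>M\<^esub> y)) g z)"
    unfolding lext_def[of K F _ f] by (subst finsum_F) (use S l in \<open>auto simp: smult_closed_F[unfolded smult_F] smult_F subset_eq\<close>)
  also have "\<dots> = (\<Oplus>\<^bsub>K\<^esub>x\<in>?S. \<Oplus>\<^bsub>K\<^esub>y\<in>?T. ?h x y)"
    by (rule K.finsum_cong')
      (use S T sc in \<open>auto simp: l2 subset_eq intro!: K.finsum_rdistr K.finsum_closed\<close>)
  also have "\<dots> = (\<Oplus>\<^bsub>K\<^esub>p\<in>?S \<times> ?T. ?h (fst p) (snd p))"
    by (rule finsum_Sigma_conv[symmetric]) (use S T sc K.abelian_monoid_axioms in auto)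
  also have "\<dots> = (\<Oplus>\<^bsub>K\<^esub>p\<in>{(x, y). f x \<noteq> \<zero>\<^bsub>K\<^esub> \<and> g y \<noteq> \<zero>\<^bsub>K\<^esub> \<and> x \<otimes>\<^bsub>M\<^esub> y = z}. f (fst p) \<otimes>\<^bsub>K\<^esub> g (snd p))"
    by (rule K.add.finprod_mono_neutral_cong_right)
      (use S T in \<open>auto simp: single_def\<close>)
  finally show "(f \<otimes>\<^bsub>F\<^esub> g) z = lext K F (\<lambda>x. lext K F (\<lambda>y. single K (x \<otimes>\<^bsub>M\<^esub> y)) g) f z"
    by (simp add: monoid_alg_def)
qed

lemma linmap_mult_F_r: "f \<in> carrier F \<Longrightarrow> linmap K F F (\<lambda>g. f \<otimes>\<^bsub>F\<^esub> g)"
proof -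
  assume f: "f \<in> carrier F"
  let ?S = "{x. f x \<noteq> \<zero>\<^bsub>K\<^esub>}"
  have S: "finite ?S" "?S \<subseteq> carrier M" "\<And>x. f x \<in> carrier K" using f by (auto simp: carrier_F)
  have L: "linmap K F F (lext K F (\<lambda>y. single K (x \<otimes>\<^bsub>M\<^esub> y)))" if "x \<in> carrier M" for x
    by (rule linmap_lext[OF module_F]) (use that in simp)
  let ?G = "\<lambda>g. finsum F (\<lambda>x. f x \<odot>\<^bsub>F\<^esub> lext K F (\<lambda>y. single K (x \<otimes>\<^bsub>M\<^esub> y)) g) ?S"
  \<comment> \<open>The outer index set depends only on the fixed factor \<open>f\<close>, so
    linearity in \<open>g\<close> follows by induction over finite sets of summands.\<close>
  have "linmap K F F (\<lambda>g. finsum F (\<lambda>x. f x \<odot>\<^bsub>F\<^esub> lext K F (\<lambda>y. single K (x \<otimes>\<^bsub>M\<^esub> y)) g) U)" if "finite U" "U \<subseteq> carrier M" for U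
    using that
  proof (induction U)
    case empty then show ?case by (simp add: linmap_const0[OF module_F])
  next
    case (insert x U)
    have *: "linmap K F F (\<lambda>g. f x \<odot>\<^bsub>F\<^esub> lext K F (\<lambda>y. single K (x \<otimes>\<^bsub>M\<^esub> y)) g \<oplus>\<^bsub>F\<^esub>
       finsum F (\<lambda>x. f x \<odot>\<^bsub>F\<^esub> lext K F (\<lambda>y. single K (x \<otimes>\<^bsub>M\<^esub> y)) g) U)"
      by (intro linmap_add linmap_smult L module_F) (use insert S in auto)
    show ?case
      by (rule linmap_cong[OF * _ module_F], rule FM.finsum_insert)
        (use insert S linmapD(1)[OF L] in \<open>auto simp: smult_closed_F subset_eq\<close>)
  qed
  from this[OF S(1,2)] show ?thesis
    by (rule linmap_cong[OF _ _ module_F]) (simp add: mult_F_eq[OF f] lext_def)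
qed

lemma linmap_mult_F_l: "g \<in> carrier F \<Longrightarrow> linmap K F F (\<lambda>f. f \<otimes>\<^bsub>F\<^esub> g)"
proof -
  assume g: "g \<in> carrier F"
  have "linmap K F F (lext K F (\<lambda>x. lext K F (\<lambda>y. single K (x \<otimes>\<^bsub>M\<^esub> y)) g))"
    by (intro linmap_lext module_F linmapD(1)[OF linmap_lext g]) auto
  then show ?thesis by (rule linmap_cong[OF _ _ module_F]) (simp add: mult_F_eq g)
qed

lemma mult_single: "\<lbrakk>x \<in> carrier M; y \<in> carrier M\<rbrakk> \<Longrightarrow> single K x \<otimes>\<^bsub>F\<^esub> single K y = single K (x \<otimes>\<^bsub>M\<^esub> y)"
  by (simp add: mult_F_eq lext_single module_F)

lemma mult_closed_F: "\<lbrakk>f \<in> carrier F; g \<in> carrier F\<rbrakk> \<Longrightarrow> f \<otimes>\<^bsub>F\<^esub> g \<in> carrier F"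
  using linmapD(1)[OF linmap_mult_F_r] .

lemma k_algebra_F: "k_algebra K F"
proof -
  have assoc: "(f \<otimes>\<^bsub>F\<^esub> g) \<otimes>\<^bsub>F\<^esub> h = f \<otimes>\<^bsub>F\<^esub> (g \<otimes>\<^bsub>F\<^esub> h)"
    if f: "f \<in> carrier F" and g: "g \<in> carrier F" and h: "h \<in> carrier F" for f g h
  proof (rule linmap_F_eqI[OF _ _ module_F _ f])
    show "linmap K F F (\<lambda>f. f \<otimes>\<^bsub>F\<^esub> g \<otimes>\<^bsub>F\<^esub> h)"
      by (rule linmap_comp[OF linmap_mult_F_l[OF h] linmap_mult_F_l[OF g]])
    show "linmap K F F (\<lambda>f. f \<otimes>\<^bsub>F\<^esub> (g \<otimes>\<^bsub>F\<^esub> h))"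
      by (rule linmap_mult_F_l) (simp add: g h mult_closed_F)
    fix x assume x: "x \<in> carrier M"
    show "single K x \<otimes>\<^bsub>F\<^esub> g \<otimes>\<^bsub>F\<^esub> h = single K x \<otimes>\<^bsub>F\<^esub> (g \<otimes>\<^bsub>F\<^esub> h)"
    proof (rule linmap_F_eqI[OF _ _ module_F _ g])
      show "linmap K F F (\<lambda>g. single K x \<otimes>\<^bsub>F\<^esub> g \<otimes>\<^bsub>F\<^esub> h)"
        by (rule linmap_comp[OF linmap_mult_F_l[OF h] linmap_mult_F_r]) (simp add: x)
      show "linmap K F F (\<lambda>g. single K x \<otimes>\<^bsub>F\<^esub> (g \<otimes>\<^bsub>F\<^esub> h))"
        by (rule linmap_comp[OF linmap_mult_F_r linmap_mult_F_l[OF h]]) (simp add: x)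
      fix y assume y: "y \<in> carrier M"
      show "single K x \<otimes>\<^bsub>F\<^esub> single K y \<otimes>\<^bsub>F\<^esub> h = single K x \<otimes>\<^bsub>F\<^esub> (single K y \<otimes>\<^bsub>F\<^esub> h)"
        by (rule linmap_F_eqI[OF linmap_mult_F_r linmap_comp[OF linmap_mult_F_r linmap_mult_F_r] module_F _ h])
          (simp_all add: x y mult_closed_F mult_single M.m_assoc)
    qed
  qed
  have one: "\<one>\<^bsub>F\<^esub> \<otimes>\<^bsub>F\<^esub> f = f" "f \<otimes>\<^bsub>F\<^esub> \<one>\<^bsub>F\<^esub> = f" if f: "f \<in> carrier F" for f
    by (rule linmap_F_eqI[OF linmap_mult_F_r linmap_id module_F _ f]; simp add: one_F mult_single)
      (rule linmap_F_eqI[OF linmap_mult_F_l linmap_id module_F _ f]; simp add: one_F mult_single)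
  have "ring F"
    by (rule ringI)
      (auto intro!: monoidI FM.abelian_group_axioms simp: mult_closed_F one_F one[unfolded one_F] assoc
        linmapD(2)[OF linmap_mult_F_l] linmapD(2)[OF linmap_mult_F_r])
  then show ?thesis
    by (auto simp: k_algebra_def field module_F linmapD(3)[OF linmap_mult_F_l] linmapD(3)[OF linmap_mult_F_r])
qed

end

section \<open>Quotient algebras\<close>

text \<open>Evaluation at an arbitrary representative, in the same form as \<open>tlift\<close>; it
  is meaningful when \<psi> vanishes on the ideal.\<close>

definition qlift :: "('a \<Rightarrow> 'n) \<Rightarrow> 'a set \<Rightarrow> 'n" where
  "qlift \<psi> U = \<psi> (SOME f. f \<in> U)"

locale kquot = kalg K A for K :: "'k ring" and A :: "('k, 'a) module" +
  fixes I :: "'a set"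
  assumes ideal_I: "ideal I A"
begin

sublocale I: ideal I A by (rule ideal_I)

abbreviation "Q \<equiv> quot_alg A I"

text \<open>A scalar acts as multiplication by the ring element a1, hence a ring ideal is
  automatically a subspace.\<close>

lemma I_smult: "\<lbrakk>a \<in> carrier K; x \<in> I\<rbrakk> \<Longrightarrow> a \<odot>\<^bsub>A\<^esub> x \<in> I"
proof -
  assume a: "a \<in> carrier K" and x: "x \<in> I"
  have "(a \<odot>\<^bsub>A\<^esub> \<one>\<^bsub>A\<^esub>) \<otimes>\<^bsub>A\<^esub> x \<in> I" using a x by (intro I.I_l_closed) auto
  then show ?thesis using a x I.Icarr by (simp add: smult_mult_l)
qed

lemma carrier_Q: "carrier Q = (\<lambda>x. I +>\<^bsub>A\<^esub> x) ` carrier A"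
  by (auto simp: quot_alg_def ring.extend_def FactRing_def A_RCOSETS_def RCOSETS_def a_r_coset_def)

lemma Q_closed: "x \<in> carrier A \<Longrightarrow> I +>\<^bsub>A\<^esub> x \<in> carrier Q"
  by (simp add: carrier_Q)

lemma Q_cases: "U \<in> carrier Q \<Longrightarrow> (\<And>x. \<lbrakk>U = I +>\<^bsub>A\<^esub> x; x \<in> carrier A\<rbrakk> \<Longrightarrow> P) \<Longrightarrow> P"
  by (auto simp: carrier_Q)

lemma Q_zero: "\<zero>\<^bsub>Q\<^esub> = I +>\<^bsub>A\<^esub> \<zero>\<^bsub>A\<^esub>"
  using a_coset_add_zero I.a_subset by (simp add: quot_alg_def ring.extend_def FactRing_def)

lemma Q_one: "\<one>\<^bsub>Q\<^esub> = I +>\<^bsub>A\<^esub> \<one>\<^bsub>A\<^esub>"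
  by (simp add: quot_alg_def ring.extend_def FactRing_def)

lemma Q_add: "\<lbrakk>x \<in> carrier A; y \<in> carrier A\<rbrakk> \<Longrightarrow> (I +>\<^bsub>A\<^esub> x) \<oplus>\<^bsub>Q\<^esub> (I +>\<^bsub>A\<^esub> y) = I +>\<^bsub>A\<^esub> (x \<oplus>\<^bsub>A\<^esub> y)"
  by (simp add: quot_alg_def ring.extend_def FactRing_def I.a_rcos_sum)

lemma Q_mult: "\<lbrakk>x \<in> carrier A; y \<in> carrier A\<rbrakk> \<Longrightarrow> (I +>\<^bsub>A\<^esub> x) \<otimes>\<^bsub>Q\<^esub> (I +>\<^bsub>A\<^esub> y) = I +>\<^bsub>A\<^esub> (x \<otimes>\<^bsub>A\<^esub> y)"
  by (simp add: quot_alg_def ring.extend_def FactRing_def I.rcoset_mult_add)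

lemma mem_coset: "x \<in> carrier A \<Longrightarrow> u \<in> I +>\<^bsub>A\<^esub> x \<Longrightarrow> u \<in> carrier A \<and> u \<ominus>\<^bsub>A\<^esub> x \<in> I"
proof -
  assume x: "x \<in> carrier A" and "u \<in> I +>\<^bsub>A\<^esub> x"
  then obtain i where i: "i \<in> I" "u = i \<oplus>\<^bsub>A\<^esub> x" by (auto simp: a_r_coset_def r_coset_def)
  have ic: "i \<in> carrier A" using i I.Icarr by simp
  have "u \<ominus>\<^bsub>A\<^esub> x = i" using i ic x by (simp add: a_minus_def a_assoc r_neg)
  then show ?thesis using i ic x by simp
qed

lemma coset_eqI: "\<lbrakk>x \<in> carrier A; y \<in> carrier A; x \<ominus>\<^bsub>A\<^esub> y \<in> I\<rbrakk> \<Longrightarrow> I +>\<^bsub>A\<^esub> x = I +>\<^bsub>A\<^esub> y"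
proof -
  assume xy: "x \<in> carrier A" "y \<in> carrier A" "x \<ominus>\<^bsub>A\<^esub> y \<in> I"
  have "x \<in> I +>\<^bsub>A\<^esub> y" unfolding a_r_coset_def r_coset_def
    using xy by (auto intro!: bexI[of _ "x \<ominus>\<^bsub>A\<^esub> y"] simp: a_minus_def a_assoc l_neg)
  then show ?thesis using xy a_repr_independence[of x I y] I.a_subgroup by metis
qed

lemma coset_self: "x \<in> carrier A \<Longrightarrow> x \<in> I +>\<^bsub>A\<^esub> x"
  by (rule I.a_rcos_self)

text \<open>The scalar multiplication of \<open>quot_alg\<close> is a union over all
  representatives; scaling any of them gives the same coset, so the union collapses.\<close>

lemma Q_smult: "\<lbrakk>a \<in> carrier K; x \<in> carrier A\<rbrakk> \<Longrightarrow> a \<odot>\<^bsub>Q\<^esub> (I +>\<^bsub>A\<^esub> x) = I +>\<^bsub>A\<^esub> (a \<odot>\<^bsub>A\<^esub> x)"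
proof -
  assume a: "a \<in> carrier K" and x: "x \<in> carrier A"
  have "I +>\<^bsub>A\<^esub> (a \<odot>\<^bsub>A\<^esub> u) = I +>\<^bsub>A\<^esub> (a \<odot>\<^bsub>A\<^esub> x)" if u: "u \<in> I +>\<^bsub>A\<^esub> x" for u
  proof -
    have u': "u \<in> carrier A" "u \<ominus>\<^bsub>A\<^esub> x \<in> I" using mem_coset[OF x u] by auto
    have e: "a \<odot>\<^bsub>A\<^esub> (u \<ominus>\<^bsub>A\<^esub> x) = a \<odot>\<^bsub>A\<^esub> u \<ominus>\<^bsub>A\<^esub> a \<odot>\<^bsub>A\<^esub> x"
      using a x u' by (simp add: a_minus_def Mod.smult_r_distr Mod.smult_r_minus)
    show ?thesis
      by (rule coset_eqI) (use a x u'(1) I_smult[OF a u'(2), unfolded e] in simp_all)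
  qed
  then have "(\<Union>u\<in>I +>\<^bsub>A\<^esub> x. I +>\<^bsub>A\<^esub> (a \<odot>\<^bsub>A\<^esub> u)) = I +>\<^bsub>A\<^esub> (a \<odot>\<^bsub>A\<^esub> x)"
    using coset_self[OF x] by blast
  then show ?thesis by (simp add: quot_alg_def ring.extend_def FactRing_def)
qed

lemma module_Q: "module K Q"
proof (rule moduleI)
  show "abelian_group Q"
  proof (rule abelian_groupI)
    fix x assume "x \<in> carrier Q"
    then obtain z where "x = I +>\<^bsub>A\<^esub> z" "z \<in> carrier A" by (auto simp: carrier_Q)
    then show "\<exists>y\<in>carrier Q. y \<oplus>\<^bsub>Q\<^esub> x = \<zero>\<^bsub>Q\<^esub>"
      by (intro bexI[of _ "I +>\<^bsub>A\<^esub> (\<ominus>\<^bsub>A\<^esub> z)"]) (simp_all add: Q_add Q_zero Q_closed l_neg)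
  qed (auto simp: carrier_Q Q_add Q_zero a_ac)
qed (rule K.is_cring, auto simp: carrier_Q Q_add Q_smult Mod.smult_l_distr Mod.smult_r_distr Mod.smult_assoc1)

lemma ring_Q: "ring Q"
proof (rule ringI)
  show "abelian_group Q" using module_Q by (simp add: module_def)
  show "monoid Q"
    by (rule monoidI) (auto simp: carrier_Q Q_mult Q_one m_assoc)
qed (auto simp: carrier_Q Q_add Q_mult l_distr r_distr)

lemma k_algebra_Q: "k_algebra K Q"
  unfolding k_algebra_def
proof (intro conjI ballI)
  fix a x y assume a: "a \<in> carrier K" and "x \<in> carrier Q" "y \<in> carrier Q"
  then obtain u v where "x = I +>\<^bsub>A\<^esub> u" "u \<in> carrier A" "y = I +>\<^bsub>A\<^esub> v" "v \<in> carrier A"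
    by (auto simp: carrier_Q)
  with a show "a \<odot>\<^bsub>Q\<^esub> x \<otimes>\<^bsub>Q\<^esub> y = a \<odot>\<^bsub>Q\<^esub> (x \<otimes>\<^bsub>Q\<^esub> y)" "x \<otimes>\<^bsub>Q\<^esub> (a \<odot>\<^bsub>Q\<^esub> y) = a \<odot>\<^bsub>Q\<^esub> (x \<otimes>\<^bsub>Q\<^esub> y)"
    by (simp_all add: Q_mult Q_smult smult_mult_l smult_mult_r)
qed (rule fieldK module_Q ring_Q)+

lemma proj_hom: "(\<lambda>x. I +>\<^bsub>A\<^esub> x) \<in> alg_hom K A Q"
  by (intro alg_homI linmapI) (simp_all add: Q_closed Q_add Q_mult Q_smult Q_one)

lemma qlift_coset:
  assumes \<psi>: "linmap K A N \<psi>" and N: "module K N" and z: "\<And>x. x \<in> I \<Longrightarrow> \<psi> x = \<zero>\<^bsub>N\<^esub>" and x: "x \<in> carrier A"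
  shows "qlift \<psi> (I +>\<^bsub>A\<^esub> x) = \<psi> x"
proof -
  interpret N: module K N by fact
  let ?f = "SOME f. f \<in> I +>\<^bsub>A\<^esub> x"
  have "?f \<in> I +>\<^bsub>A\<^esub> x" using coset_self[OF x] by (rule someI)
  then have f: "?f \<in> carrier A" "?f \<ominus>\<^bsub>A\<^esub> x \<in> I" using mem_coset[OF x] by auto
  have "\<psi> ?f \<ominus>\<^bsub>N\<^esub> \<psi> x = \<zero>\<^bsub>N\<^esub>"
    using linmap_minus[OF \<psi> moduleR N f(1) x] z[OF f(2)] by simp
  then show ?thesis using linmapD(1)[OF \<psi> f(1)] linmapD(1)[OF \<psi> x]
    by (simp add: qlift_def N.diff_eq_zero_iff)
qed

lemma linmap_qlift:
  assumes \<psi>: "linmap K A N \<psi>" and N: "module K N" and z: "\<And>x. x \<in> I \<Longrightarrow> \<psi> x = \<zero>\<^bsub>N\<^esub>"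
  shows "linmap K Q N (qlift \<psi>)"
  by (rule linmapI) (auto simp: carrier_Q Q_add Q_smult qlift_coset[OF \<psi> N z] linmapD[OF \<psi>])

lemma alg_hom_qlift:
  assumes \<psi>: "\<psi> \<in> alg_hom K A N" and N: "k_algebra K N" and z: "\<And>x. x \<in> I \<Longrightarrow> \<psi> x = \<zero>\<^bsub>N\<^esub>"
  shows "qlift \<psi> \<in> alg_hom K Q N"
proof -
  interpret N: kalg K N by (rule kalgI) fact
  note q = qlift_coset[OF alg_hom_linmap[OF \<psi>] N.moduleR z]
  show ?thesis
  proof (rule alg_homI)
    show "linmap K Q N (qlift \<psi>)" by (rule linmap_qlift[OF alg_hom_linmap[OF \<psi>] N.moduleR z])
    show "qlift \<psi> \<one>\<^bsub>Q\<^esub> = \<one>\<^bsub>N\<^esub>" by (simp add: Q_one q alg_homD[OF \<psi>])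
    fix x y assume "x \<in> carrier Q" "y \<in> carrier Q"
    then show "qlift \<psi> (x \<otimes>\<^bsub>Q\<^esub> y) = qlift \<psi> x \<otimes>\<^bsub>N\<^esub> qlift \<psi> y"
      by (auto simp: carrier_Q Q_mult q alg_homD[OF \<psi>])
  qed
qed

end

section \<open>Tensor products\<close>

text \<open>Linearity in each slot is phrased with list update because \<open>tensor_rels\<close>
  is.\<close>

definition multilin :: "'k ring \<Rightarrow> ('k, 'r) module list \<Rightarrow> ('k, 'n) module \<Rightarrow> ('r list \<Rightarrow> 'n) \<Rightarrow> bool" where
  "multilin K Rs N F \<longleftrightarrow> (\<forall>xs\<in>carrier (tuple_monoid Rs). F xs \<in> carrier N \<and>
     (\<forall>i<length Rs. linmap K (Rs ! i) N (\<lambda>a. F (xs[i := a]))))"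

locale tens =
  fixes K :: "'k ring" and Rs :: "('k, 'r) module list"
  assumes fieldK: "field K" and algs: "\<And>i. i < length Rs \<Longrightarrow> k_algebra K (Rs ! i)"
begin

abbreviation "TM \<equiv> tuple_monoid Rs"

lemma carrier_TM: "xs \<in> carrier TM \<longleftrightarrow> length xs = length Rs \<and> (\<forall>i<length Rs. xs ! i \<in> carrier (Rs ! i))"
  by (simp add: tuple_monoid_def)

lemma mult_TM: "xs \<otimes>\<^bsub>TM\<^esub> ys = map (\<lambda>i. xs ! i \<otimes>\<^bsub>Rs ! i\<^esub> ys ! i) [0..<length Rs]"
  and one_TM: "\<one>\<^bsub>TM\<^esub> = map (\<lambda>R. \<one>\<^bsub>R\<^esub>) Rs"
  by (simp_all add: tuple_monoid_def)

lemma ringRs: "i < length Rs \<Longrightarrow> ring (Rs ! i)"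
  using algs by (auto simp: k_algebra_def)

lemma monoid_TM: "monoid TM"
  by (rule monoidI) (auto simp: carrier_TM mult_TM one_TM ring.ring_simprules[OF ringRs]
      monoid.r_one[OF ring.is_monoid[OF ringRs]] intro!: nth_equalityI)

sublocale MA: monalg K TM by (rule monalg.intro[OF fieldK monoid_TM])

abbreviation "Nul \<equiv> tensor_null K Rs"

lemma update_TM: "\<lbrakk>xs \<in> carrier TM; i < length Rs; a \<in> carrier (Rs ! i)\<rbrakk> \<Longrightarrow> xs[i := a] \<in> carrier TM"
  by (auto simp: carrier_TM nth_list_update)

lemma rels_subset: "tensor_rels K Rs \<subseteq> carrier MA.F"
proof -
  interpret F: kalg K MA.F by (rule kalgI, rule MA.k_algebra_F)
  show ?thesis
    by (auto simp: tensor_rels_def Let_def intro!: MA.FM.minus_closed MA.FM.a_closed MA.FM.smult_closed MA.single_closed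
       update_TM ring.ring_simprules[OF ringRs] module.smult_closed algs[unfolded k_algebra_def, THEN conjunct2, THEN conjunct1])
qed

lemma submodule_Nul: "submodule Nul K MA.F"
  unfolding tensor_null_def by (rule lin_span_submodule[OF MA.module_F rels_subset])

lemma mult_update_r:
  assumes "xs \<in> carrier TM" "ys \<in> carrier TM" "i < length Rs" "a \<in> carrier (Rs ! i)"
  shows "xs[i := a] \<otimes>\<^bsub>TM\<^esub> ys = (xs \<otimes>\<^bsub>TM\<^esub> ys)[i := a \<otimes>\<^bsub>Rs ! i\<^esub> ys ! i]"
  using assms by (auto simp: mult_TM carrier_TM nth_list_update intro!: nth_equalityI)

lemma mult_update_l:
  assumes "xs \<in> carrier TM" "ys \<in> carrier TM" "i < length Rs" "a \<in> carrier (Rs ! i)"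
  shows "ys \<otimes>\<^bsub>TM\<^esub> xs[i := a] = (ys \<otimes>\<^bsub>TM\<^esub> xs)[i := ys ! i \<otimes>\<^bsub>Rs ! i\<^esub> a]"
  using assms by (auto simp: mult_TM carrier_TM nth_list_update intro!: nth_equalityI)

lemma relsI1: "\<lbrakk>xs \<in> carrier TM; i < length Rs; a \<in> carrier (Rs ! i); b \<in> carrier (Rs ! i)\<rbrakk> \<Longrightarrow>
   single K (xs[i := a \<oplus>\<^bsub>Rs ! i\<^esub> b]) \<ominus>\<^bsub>MA.F\<^esub> (single K (xs[i := a]) \<oplus>\<^bsub>MA.F\<^esub> single K (xs[i := b])) \<in> Nul"
  unfolding tensor_null_def by (rule lin_span_mono) (auto simp: tensor_rels_def Let_def)

lemma relsI2: "\<lbrakk>xs \<in> carrier TM; i < length Rs; a \<in> carrier (Rs ! i); \<alpha> \<in> carrier K\<rbrakk> \<Longrightarrow>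
   single K (xs[i := \<alpha> \<odot>\<^bsub>Rs ! i\<^esub> a]) \<ominus>\<^bsub>MA.F\<^esub> (\<alpha> \<odot>\<^bsub>MA.F\<^esub> single K (xs[i := a])) \<in> Nul"
  unfolding tensor_null_def by (rule lin_span_mono) (auto simp: tensor_rels_def Let_def)

text \<open>An endomorphism that acts on a family \<open>xs[i := a]\<close> through a linear map of
  the i-th factor sends relations to relations. Left and right multiplication by a tuple are of this
  kind, which is why the relations form a two-sided ideal.\<close>

lemma Nul_invariant:
  assumes L: "linmap K MA.F MA.F L" and s: "\<And>xs i. \<lbrakk>xs \<in> carrier TM; i < length Rs\<rbrakk> \<Longrightarrow>
     \<exists>zs l. zs \<in> carrier TM \<and> linmap K (Rs ! i) (Rs ! i) l \<and>
       (\<forall>a\<in>carrier (Rs ! i). L (single K (xs[i := a])) = single K (zs[i := l a]))"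
    and u: "u \<in> Nul"
  shows "L u \<in> Nul"
proof -
  have "Nul \<subseteq> {x \<in> carrier MA.F. L x \<in> Nul}"
    unfolding tensor_null_def[of K Rs]
  proof (rule lin_span_least[OF linmap_vimage[OF L MA.module_F MA.module_F submodule_Nul, unfolded tensor_null_def]], rule subsetI)
    interpret F: kalg K MA.F by (rule kalgI, rule MA.k_algebra_F)
    fix u assume u: "u \<in> tensor_rels K Rs"
    then have uc: "u \<in> carrier MA.F" using rels_subset by auto
    have "L u \<in> Nul"
    proof -
      consider xs i a b where "xs \<in> carrier TM" "i < length Rs" "a \<in> carrier (Rs ! i)" "b \<in> carrier (Rs ! i)"
          "u = single K (xs[i := a \<oplus>\<^bsub>Rs ! i\<^esub> b]) \<ominus>\<^bsub>MA.F\<^esub> (single K (xs[i := a]) \<oplus>\<^bsub>MA.F\<^esub> single K (xs[i := b]))"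
        | xs i \<alpha> a where "xs \<in> carrier TM" "i < length Rs" "\<alpha> \<in> carrier K" "a \<in> carrier (Rs ! i)"
          "u = single K (xs[i := \<alpha> \<odot>\<^bsub>Rs ! i\<^esub> a]) \<ominus>\<^bsub>MA.F\<^esub> (\<alpha> \<odot>\<^bsub>MA.F\<^esub> single K (xs[i := a]))"
        using u by (auto simp: tensor_rels_def Let_def)
      then show ?thesis
      proof cases
        case 1
        obtain zs l where z: "zs \<in> carrier TM" "linmap K (Rs ! i) (Rs ! i) l"
          "\<And>a. a \<in> carrier (Rs ! i) \<Longrightarrow> L (single K (xs[i := a])) = single K (zs[i := l a])"
          using s[OF 1(1,2)] by blast
        have ab: "a \<oplus>\<^bsub>Rs ! i\<^esub> b \<in> carrier (Rs ! i)" using 1 by (simp add: ring.ring_simprules[OF ringRs])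
        have c: "single K (xs[i := a]) \<in> carrier MA.F" "single K (xs[i := b]) \<in> carrier MA.F"
          "single K (xs[i := a \<oplus>\<^bsub>Rs ! i\<^esub> b]) \<in> carrier MA.F"
          using 1 ab by (auto intro!: MA.single_closed update_TM)
        have "L u = single K (zs[i := l a \<oplus>\<^bsub>Rs ! i\<^esub> l b]) \<ominus>\<^bsub>MA.F\<^esub> (single K (zs[i := l a]) \<oplus>\<^bsub>MA.F\<^esub> single K (zs[i := l b]))"
          unfolding 1(5) using 1 c z(3) ab
          by (subst linmap_minus[OF L MA.module_F MA.module_F]) (simp_all add: linmapD[OF L] linmapD[OF z(2)])
        then show ?thesis using relsI1[OF z(1) 1(2)] linmapD(1)[OF z(2)] 1 by simp
      next
        case 2
        obtain zs l where z: "zs \<in> carrier TM" "linmap K (Rs ! i) (Rs ! i) l"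
          "\<And>a. a \<in> carrier (Rs ! i) \<Longrightarrow> L (single K (xs[i := a])) = single K (zs[i := l a])"
          using s[OF 2(1,2)] by blast
        have ab: "\<alpha> \<odot>\<^bsub>Rs ! i\<^esub> a \<in> carrier (Rs ! i)"
          using 2 algs[OF 2(2)] by (auto simp: k_algebra_def intro: module.smult_closed)
        have c: "single K (xs[i := a]) \<in> carrier MA.F" 
          "single K (xs[i := \<alpha> \<odot>\<^bsub>Rs ! i\<^esub> a]) \<in> carrier MA.F"
          using 2 ab by (auto intro!: MA.single_closed update_TM)
        have "L u = single K (zs[i := \<alpha> \<odot>\<^bsub>Rs ! i\<^esub> l a]) \<ominus>\<^bsub>MA.F\<^esub> (\<alpha> \<odot>\<^bsub>MA.F\<^esub> single K (zs[i := l a]))"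
          unfolding 2(5) using 2 c z(3) ab
          by (subst linmap_minus[OF L MA.module_F MA.module_F]) (simp_all add: linmapD[OF L] linmapD[OF z(2)])
        then show ?thesis using relsI2[OF z(1) 2(2)] linmapD(1)[OF z(2)] 2 by simp
      qed
    qed
    then show "u \<in> {x \<in> carrier (monoid_alg K TM). L x \<in> lin_span K (monoid_alg K TM) (tensor_rels K Rs)}"
      using uc by (simp add: tensor_null_def)
  qed
  then show ?thesis using u by auto
qed

lemma ideal_Nul: "ideal Nul MA.F"
proof -
  interpret F: kalg K MA.F by (rule kalgI, rule MA.k_algebra_F)
  have sub: "Nul \<subseteq> carrier MA.F" by (rule MA.FM.submoduleE(1)[OF submodule_Nul])
  have l: "single K ys \<otimes>\<^bsub>MA.F\<^esub> u \<in> Nul" if u: "u \<in> Nul" and ys: "ys \<in> carrier TM" for u ys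
  proof (rule Nul_invariant[OF MA.linmap_mult_F_r _ u])
    show "single K ys \<in> carrier MA.F" using ys by simp
    fix xs i assume x: "xs \<in> carrier TM" "i < length Rs"
    show "\<exists>zs l. zs \<in> carrier TM \<and> linmap K (Rs ! i) (Rs ! i) l \<and>
       (\<forall>a\<in>carrier (Rs ! i). single K ys \<otimes>\<^bsub>MA.F\<^esub> single K (xs[i := a]) = single K (zs[i := l a]))"
      using x ys monoid.m_closed[OF monoid_TM]
      by (intro exI[of _ "ys \<otimes>\<^bsub>TM\<^esub> xs"] exI[of _ "\<lambda>a. ys ! i \<otimes>\<^bsub>Rs ! i\<^esub> a"])
        (auto simp: MA.mult_single update_TM mult_update_l intro!: linmap_mult_l linmap_id algs, auto simp: carrier_TM)
  qed
  have r: "u \<otimes>\<^bsub>MA.F\<^esub> single K ys \<in> Nul" if u: "u \<in> Nul" and ys: "ys \<in> carrier TM" for u ys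
  proof (rule Nul_invariant[OF MA.linmap_mult_F_l _ u])
    show "single K ys \<in> carrier MA.F" using ys by simp
    fix xs i assume x: "xs \<in> carrier TM" "i < length Rs"
    show "\<exists>zs l. zs \<in> carrier TM \<and> linmap K (Rs ! i) (Rs ! i) l \<and>
       (\<forall>a\<in>carrier (Rs ! i). single K (xs[i := a]) \<otimes>\<^bsub>MA.F\<^esub> single K ys = single K (zs[i := l a]))"
      using x ys monoid.m_closed[OF monoid_TM]
      by (intro exI[of _ "xs \<otimes>\<^bsub>TM\<^esub> ys"] exI[of _ "\<lambda>a. a \<otimes>\<^bsub>Rs ! i\<^esub> ys ! i"])
        (auto simp: MA.mult_single update_TM mult_update_r intro!: linmap_mult_r linmap_id algs, auto simp: carrier_TM)
  qed
  show ?thesis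
  proof (rule idealI)
    show "ring MA.F" by (rule F.ringR)
    show "subgroup Nul (add_monoid MA.F)" by (rule submodule.axioms(1)[OF submodule_Nul])
    \<comment> \<open>The cases \<open>l\<close> and \<open>r\<close> treat multiplication by single
      tuples; for a general multiplier, the elements that carry \<open>a\<close> into
      \<open>Nul\<close> form a submodule.\<close>
    fix a x assume a: "a \<in> Nul" and x: "x \<in> carrier MA.F"
    have ac: "a \<in> carrier MA.F" using a sub by auto
    show "x \<otimes>\<^bsub>MA.F\<^esub> a \<in> Nul"
      using MA.submodule_F_eq[OF linmap_vimage[OF MA.linmap_mult_F_l[OF ac] MA.module_F MA.module_F submodule_Nul] _ x] l[OF a]
      by auto
    show "a \<otimes>\<^bsub>MA.F\<^esub> x \<in> Nul"
      using MA.submodule_F_eq[OF linmap_vimage[OF MA.linmap_mult_F_r[OF ac] MA.module_F MA.module_F submodule_Nul] _ x] r[OF a]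
      by auto
  qed
qed

sublocale TQ: kquot K MA.F Nul
  by (rule kquot.intro, rule kalgI, rule MA.k_algebra_F, rule kquot_axioms.intro, rule ideal_Nul)

abbreviation "T \<equiv> tensor K Rs"

lemma k_algebra_T: "k_algebra K T"
  unfolding tensor_def by (rule TQ.k_algebra_Q)

lemma module_T: "module K T"
  using k_algebra_T by (simp add: k_algebra_def)

lemma pure_closed: "xs \<in> carrier TM \<Longrightarrow> pure K Rs xs \<in> carrier T"
  unfolding tensor_def pure_def by (simp add: TQ.Q_closed)

lemma pure_mult: "\<lbrakk>xs \<in> carrier TM; ys \<in> carrier TM\<rbrakk> \<Longrightarrow> pure K Rs xs \<otimes>\<^bsub>T\<^esub> pure K Rs ys = pure K Rs (xs \<otimes>\<^bsub>TM\<^esub> ys)"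
  unfolding tensor_def pure_def by (simp add: TQ.Q_mult MA.mult_single)

lemma one_T: "\<one>\<^bsub>T\<^esub> = pure K Rs (map (\<lambda>R. \<one>\<^bsub>R\<^esub>) Rs)"
  unfolding tensor_def pure_def by (simp add: TQ.Q_one MA.one_F one_TM)

lemma linmap_T_eqI:
  assumes f: "linmap K T N f" and g: "linmap K T N g" and N: "module K N"
    and e: "\<And>xs. xs \<in> carrier TM \<Longrightarrow> f (pure K Rs xs) = g (pure K Rs xs)" and u: "u \<in> carrier T"
  shows "f u = g u"
proof -
  obtain x where x: "u = Nul +>\<^bsub>MA.F\<^esub> x" "x \<in> carrier MA.F"
    using u unfolding tensor_def by (elim TQ.Q_cases)
  have p: "linmap K MA.F T (\<lambda>x. Nul +>\<^bsub>MA.F\<^esub> x)"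
    unfolding tensor_def by (rule alg_hom_linmap[OF TQ.proj_hom])
  show ?thesis unfolding x(1)
    by (rule MA.linmap_F_eqI[OF linmap_comp[OF f p] linmap_comp[OF g p] N _ x(2)])
      (use e in \<open>simp add: pure_def\<close>)
qed

lemma linmap_pure:
  assumes xs: "xs \<in> carrier TM" and i: "i < length Rs"
  shows "linmap K (Rs ! i) T (\<lambda>a. pure K Rs (xs[i := a]))"
proof (rule linmapI)
  fix a assume a: "a \<in> carrier (Rs ! i)"
  show "pure K Rs (xs[i := a]) \<in> carrier T" using a xs i by (intro pure_closed update_TM)
next
  fix a b assume a: "a \<in> carrier (Rs ! i)" "b \<in> carrier (Rs ! i)"
  then have "a \<oplus>\<^bsub>Rs ! i\<^esub> b \<in> carrier (Rs ! i)" using i by (simp add: ring.ring_simprules[OF ringRs])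
  then show "pure K Rs (xs[i := a \<oplus>\<^bsub>Rs ! i\<^esub> b]) = pure K Rs (xs[i := a]) \<oplus>\<^bsub>T\<^esub> pure K Rs (xs[i := b])"
    unfolding pure_def tensor_def using relsI1[OF xs i a] a xs i
    by (simp add: TQ.Q_add update_TM) (rule TQ.coset_eqI, auto simp: update_TM MA.add_closed_F)
next
  fix \<alpha> a assume a: "\<alpha> \<in> carrier K" "a \<in> carrier (Rs ! i)"
  then have "\<alpha> \<odot>\<^bsub>Rs ! i\<^esub> a \<in> carrier (Rs ! i)" using i algs[OF i] by (auto simp: k_algebra_def intro: module.smult_closed)
  then show "pure K Rs (xs[i := \<alpha> \<odot>\<^bsub>Rs ! i\<^esub> a]) = \<alpha> \<odot>\<^bsub>T\<^esub> pure K Rs (xs[i := a])"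
    unfolding pure_def tensor_def using relsI2[OF xs i a(2,1)] a xs i
    by (simp add: TQ.Q_smult update_TM) (rule TQ.coset_eqI, auto simp: update_TM MA.smult_closed_F)
qed

section \<open>Linear maps induced by multilinear maps\<close>

lemma tlift_eq_qlift: "tlift K N H = qlift (lext K N H)"
  by (rule ext) (simp add: tlift_def qlift_def lext_def Let_def)

lemma multilinD:
  assumes "multilin K Rs N H"
  shows "xs \<in> carrier TM \<Longrightarrow> H xs \<in> carrier N"
    "\<lbrakk>xs \<in> carrier TM; i < length Rs\<rbrakk> \<Longrightarrow> linmap K (Rs ! i) N (\<lambda>a. H (xs[i := a]))"
  using assms by (auto simp: multilin_def)

text \<open>This makes the choice of representative in \<open>tlift\<close> immaterial:
  multilinearity says exactly that the extension kills the spanning relations.\<close>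

lemma lext_Nul:
  assumes H: "multilin K Rs N H" and N: "module K N" and u: "u \<in> Nul"
  shows "lext K N H u = \<zero>\<^bsub>N\<^esub>"
proof -
  interpret N: module K N by fact
  have L: "linmap K MA.F N (lext K N H)" by (rule MA.linmap_lext[OF N multilinD(1)[OF H]])
  note ls = MA.lext_single[OF N multilinD(1)[OF H]]
  have "Nul \<subseteq> {x \<in> carrier MA.F. lext K N H x = \<zero>\<^bsub>N\<^esub>}"
    unfolding tensor_null_def
  proof (rule lin_span_least[OF linmap_kernel[OF L MA.module_F N]], rule subsetI)
    interpret F: kalg K MA.F by (rule kalgI, rule MA.k_algebra_F)
    fix u assume u: "u \<in> tensor_rels K Rs"
    have uc: "u \<in> carrier MA.F" using u rels_subset by auto
    consider xs i a b where "xs \<in> carrier TM" "i < length Rs" "a \<in> carrier (Rs ! i)" "b \<in> carrier (Rs ! i)"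
        "u = single K (xs[i := a \<oplus>\<^bsub>Rs ! i\<^esub> b]) \<ominus>\<^bsub>MA.F\<^esub> (single K (xs[i := a]) \<oplus>\<^bsub>MA.F\<^esub> single K (xs[i := b]))"
      | xs i \<alpha> a where "xs \<in> carrier TM" "i < length Rs" "\<alpha> \<in> carrier K" "a \<in> carrier (Rs ! i)"
        "u = single K (xs[i := \<alpha> \<odot>\<^bsub>Rs ! i\<^esub> a]) \<ominus>\<^bsub>MA.F\<^esub> (\<alpha> \<odot>\<^bsub>MA.F\<^esub> single K (xs[i := a]))"
      using u by (auto simp: tensor_rels_def Let_def)
    then have "lext K N H u = \<zero>\<^bsub>N\<^esub>"
    proof cases
      case 1
      note h = linmapD[OF multilinD(2)[OF H 1(1,2)]]
      have ab: "a \<oplus>\<^bsub>Rs ! i\<^esub> b \<in> carrier (Rs ! i)" using 1 by (simp add: ring.ring_simprules[OF ringRs])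
      show ?thesis unfolding 1(5) using 1(1-4) ab
        by (subst linmap_minus[OF L MA.module_F N]) (simp_all add: update_TM linmapD[OF L] ls h MA.add_closed_F N.diff_eq_zero_iff)
    next
      case 2
      note h = linmapD[OF multilinD(2)[OF H 2(1,2)]]
      have ab: "\<alpha> \<odot>\<^bsub>Rs ! i\<^esub> a \<in> carrier (Rs ! i)"
        using 2 algs[OF 2(2)] by (auto simp: k_algebra_def intro: module.smult_closed)
      show ?thesis unfolding 2(5) using 2(1-4) ab
        by (subst linmap_minus[OF L MA.module_F N]) (simp_all add: update_TM linmapD[OF L] ls h MA.smult_closed_F N.diff_eq_zero_iff)
    qed
    then show "u \<in> {x \<in> carrier (monoid_alg K TM). lext K N H x = \<zero>\<^bsub>N\<^esub>}" using uc by simp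
  qed
  then show ?thesis using u by auto
qed

lemma linmap_tlift:
  assumes H: "multilin K Rs N H" and N: "module K N"
  shows "linmap K T N (tlift K N H)"
  unfolding tlift_eq_qlift tensor_def
  by (rule TQ.linmap_qlift[OF MA.linmap_lext[OF N multilinD(1)[OF H]] N lext_Nul[OF H N]])

lemma tlift_pure:
  assumes H: "multilin K Rs N H" and N: "module K N" and xs: "xs \<in> carrier TM"
  shows "tlift K N H (pure K Rs xs) = H xs"
  unfolding tlift_eq_qlift pure_def using xs
  by (simp add: TQ.qlift_coset[OF MA.linmap_lext[OF N multilinD(1)[OF H]] N lext_Nul[OF H N]]
      MA.lext_single[OF N multilinD(1)[OF H]])

text \<open>Any representative is supported on genuine tuples, so agreement there suffices. It
  converts the list-indexed expressions of the definitions into the curried \<open>lift2\<close> and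
  \<open>lift3\<close>.\<close>

lemma tlift_cong:
  assumes H: "multilin K Rs N H" and N: "module K N" and u: "u \<in> carrier T"
    and e: "\<And>xs. xs \<in> carrier TM \<Longrightarrow> G xs = H xs"
  shows "tlift K N G u = tlift K N H u"
proof -
  interpret N: module K N by fact
  obtain x where x: "u = Nul +>\<^bsub>MA.F\<^esub> x" "x \<in> carrier MA.F"
    using u unfolding tensor_def by (elim TQ.Q_cases)
  let ?f = "SOME f. f \<in> Nul +>\<^bsub>MA.F\<^esub> x"
  have "?f \<in> Nul +>\<^bsub>MA.F\<^esub> x" by (rule someI[of "\<lambda>f. f \<in> Nul +>\<^bsub>MA.F\<^esub> x", OF TQ.coset_self[OF x(2)]])
  then have f: "?f \<in> carrier MA.F" using TQ.mem_coset[OF x(2)] by auto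
  have "lext K N G ?f = lext K N H ?f" unfolding lext_def
    by (rule N.finsum_cong') (use f MA.support_subset[OF f] e multilinD(1)[OF H] in \<open>auto simp: MA.carrier_F subset_eq\<close>)
  then show ?thesis unfolding x(1) tlift_eq_qlift qlift_def .
qed

end

section \<open>Tensor squares and cubes\<close>

lemma opp_simps [simp]: "carrier (opp R) = carrier R" "add (opp R) = add R" "zero (opp R) = zero R" "one (opp R) = one R"
  "smult (opp R) = smult R" "x \<otimes>\<^bsub>opp R\<^esub> y = y \<otimes>\<^bsub>R\<^esub> x"
  by (simp_all add: opp_def)

lemma linmap_opp [simp]: "linmap K (opp R) N f = linmap K R N f"
  by (simp add: linmap_def)

lemma k_algebra_opp:
  assumes "k_algebra K R" shows "k_algebra K (opp R)"
proof -
  interpret kalg K R by (rule kalgI) fact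
  have ag: "abelian_group (opp R)"
    by (rule abelian_groupI) (auto simp: a_ac intro!: bexI[of _ "\<ominus>\<^bsub>R\<^esub> _"] l_neg)
  have "ring (opp R)"
    by (rule ringI[OF ag monoidI]) (auto simp: m_assoc l_distr r_distr)
  moreover have "module K (opp R)"
    by (rule moduleI[OF K.is_cring ag]) (auto simp: Mod.smult_l_distr Mod.smult_r_distr Mod.smult_assoc1)
  ultimately show ?thesis
    by (auto simp: k_algebra_def fieldK smult_mult_l smult_mult_r)
qed

definition bilin where
  "bilin K M1 M2 N G \<longleftrightarrow> (\<forall>y\<in>carrier M2. linmap K M1 N (\<lambda>x. G x y)) \<and> (\<forall>x\<in>carrier M1. linmap K M2 N (\<lambda>y. G x y))"

definition trilin where
  "trilin K M1 M2 M3 N G \<longleftrightarrow>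
     (\<forall>y\<in>carrier M2. \<forall>z\<in>carrier M3. linmap K M1 N (\<lambda>x. G x y z)) \<and>
     (\<forall>x\<in>carrier M1. \<forall>z\<in>carrier M3. linmap K M2 N (\<lambda>y. G x y z)) \<and>
     (\<forall>x\<in>carrier M1. \<forall>y\<in>carrier M2. linmap K M3 N (\<lambda>z. G x y z))"

lemma bilinI:
  assumes "\<And>y. y \<in> carrier M2 \<Longrightarrow> linmap K M1 N (\<lambda>x. G x y)"
    and "\<And>x. x \<in> carrier M1 \<Longrightarrow> linmap K M2 N (\<lambda>y. G x y)"
  shows "bilin K M1 M2 N G"
  using assms by (simp add: bilin_def)

lemma trilinI:
  assumes "\<And>y z. \<lbrakk>y \<in> carrier M2; z \<in> carrier M3\<rbrakk> \<Longrightarrow> linmap K M1 N (\<lambda>x. G x y z)"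
    and "\<And>x z. \<lbrakk>x \<in> carrier M1; z \<in> carrier M3\<rbrakk> \<Longrightarrow> linmap K M2 N (\<lambda>y. G x y z)"
    and "\<And>x y. \<lbrakk>x \<in> carrier M1; y \<in> carrier M2\<rbrakk> \<Longrightarrow> linmap K M3 N (\<lambda>z. G x y z)"
  shows "trilin K M1 M2 M3 N G"
  using assms by (simp add: trilin_def)

definition lift2 :: "'k ring \<Rightarrow> ('k, 'n) module \<Rightarrow> ('r \<Rightarrow> 'r \<Rightarrow> 'n) \<Rightarrow> ('r list \<Rightarrow> 'k) set \<Rightarrow> 'n" where
  "lift2 K N G = tlift K N (\<lambda>x. G (x ! 0) (x ! 1))"

definition lift3 :: "'k ring \<Rightarrow> ('k, 'n) module \<Rightarrow> ('r \<Rightarrow> 'r \<Rightarrow> 'r \<Rightarrow> 'n) \<Rightarrow> ('r list \<Rightarrow> 'k) set \<Rightarrow> 'n" where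
  "lift3 K N G = tlift K N (\<lambda>x. G (x ! 0) (x ! 1) (x ! 2))"

abbreviation "T2 K R \<equiv> tensor K [opp R, R]"
abbreviation "pure2 K R \<equiv> pure K [opp R, R]"
abbreviation "fac5 R \<equiv> [R, opp R, R, opp R, R]"

lemma all_less_two: "(\<forall>i<Suc (Suc 0). P i) \<longleftrightarrow> P 0 \<and> P 1"
  and all_less_three: "(\<forall>i<Suc (Suc (Suc 0)). P i) \<longleftrightarrow> P 0 \<and> P 1 \<and> P 2"
  by (auto simp: less_Suc_eq numeral_2_eq_2)

lemma multilin2:
  assumes "bilin K R1 R2 N G"
  shows "multilin K [R1, R2] N (\<lambda>x. G (x ! 0) (x ! 1))"
  using assms
  by (auto simp: multilin_def bilin_def tuple_monoid_def less_Suc_eq linmap_def)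

lemma multilin3:
  assumes "trilin K R1 R2 R3 N G"
  shows "multilin K [R1, R2, R3] N (\<lambda>x. G (x ! 0) (x ! 1) (x ! 2))"
  unfolding multilin_def
proof (intro ballI conjI allI impI)
  fix xs assume "xs \<in> carrier (tuple_monoid [R1, R2, R3])"
  then have xs: "xs ! 0 \<in> carrier R1" "xs ! 1 \<in> carrier R2" "xs ! 2 \<in> carrier R3" "length xs = 3"
    by (simp_all add: tuple_monoid_def all_less_three numeral_2_eq_2)
  then show "G (xs ! 0) (xs ! 1) (xs ! 2) \<in> carrier N" using assms by (auto simp: trilin_def linmap_def)
  fix i assume "i < length [R1, R2, R3]"
  then consider "i = 0" | "i = 1" | "i = 2" by (auto simp: less_Suc_eq)
  then show "linmap K ([R1, R2, R3] ! i) N (\<lambda>a. G (xs[i := a] ! 0) (xs[i := a] ! 1) (xs[i := a] ! 2))"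
    using xs assms by cases (auto simp: trilin_def)
qed

lemma tens2:
  assumes "k_algebra K R1" "k_algebra K R2" shows "tens K [R1, R2]"
  using assms by (intro tens.intro) (auto simp: less_Suc_eq k_algebra_def)

lemma tens3:
  assumes "k_algebra K R1" "k_algebra K R2" "k_algebra K R3" shows "tens K [R1, R2, R3]"
  using assms by (intro tens.intro) (auto simp: less_Suc_eq k_algebra_def)

lemma tuple2_cases:
  assumes "xs \<in> carrier (tuple_monoid [R1, R2])"
  obtains a b where "xs = [a, b]" "a \<in> carrier R1" "b \<in> carrier R2"
proof -
  have "length xs = Suc (Suc 0)" using assms by (simp add: tuple_monoid_def)
  then obtain a b where xs: "xs = [a, b]" by (auto simp: length_Suc_conv)
  then show ?thesis using that assms by (simp add: tuple_monoid_def all_less_two)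
qed

lemma tuple3_cases:
  assumes "xs \<in> carrier (tuple_monoid [R1, R2, R3])"
  obtains a b c where "xs = [a, b, c]" "a \<in> carrier R1" "b \<in> carrier R2" "c \<in> carrier R3"
proof -
  have "length xs = Suc (Suc (Suc 0))" using assms by (simp add: tuple_monoid_def)
  then obtain a b c where xs: "xs = [a, b, c]" by (auto simp: length_Suc_conv)
  then show ?thesis using that assms by (simp add: tuple_monoid_def all_less_three)
qed

lemma tuple2I: "\<lbrakk>a \<in> carrier R1; b \<in> carrier R2\<rbrakk> \<Longrightarrow> [a, b] \<in> carrier (tuple_monoid [R1, R2])"
  by (auto simp: tuple_monoid_def less_Suc_eq)

lemma tuple3I: "\<lbrakk>a \<in> carrier R1; b \<in> carrier R2; c \<in> carrier R3\<rbrakk> \<Longrightarrow> [a, b, c] \<in> carrier (tuple_monoid [R1, R2, R3])"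
  by (auto simp: tuple_monoid_def less_Suc_eq)

lemma tuple5I: "\<lbrakk>a \<in> carrier R1; b \<in> carrier R2; c \<in> carrier R3; d \<in> carrier R4; e \<in> carrier R5\<rbrakk> \<Longrightarrow>
    [a, b, c, d, e] \<in> carrier (tuple_monoid [R1, R2, R3, R4, R5])"
  by (auto simp: tuple_monoid_def less_Suc_eq)

text \<open>Arbitrary factors are allowed because both \<open>[opp R, R]\<close>, which carries
  H(R), and \<open>[R, R]\<close>, where the counit axioms live, are needed.\<close>

lemma pair_tensor:
  assumes R: "k_algebra K R1" "k_algebra K R2"
  shows pair_alg: "k_algebra K (tensor K [R1, R2])"
    and pair_closed: "\<lbrakk>a \<in> carrier R1; b \<in> carrier R2\<rbrakk> \<Longrightarrow> pure K [R1, R2] [a, b] \<in> carrier (tensor K [R1, R2])"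
    and pair_mult: "\<lbrakk>a \<in> carrier R1; b \<in> carrier R2; c \<in> carrier R1; d \<in> carrier R2\<rbrakk> \<Longrightarrow>
      pure K [R1, R2] [a, b] \<otimes>\<^bsub>tensor K [R1, R2]\<^esub> pure K [R1, R2] [c, d] = pure K [R1, R2] [a \<otimes>\<^bsub>R1\<^esub> c, b \<otimes>\<^bsub>R2\<^esub> d]"
    and pair_one: "\<one>\<^bsub>tensor K [R1, R2]\<^esub> = pure K [R1, R2] [\<one>\<^bsub>R1\<^esub>, \<one>\<^bsub>R2\<^esub>]"
    and pair_lin1: "b \<in> carrier R2 \<Longrightarrow> linmap K R1 (tensor K [R1, R2]) (\<lambda>a. pure K [R1, R2] [a, b])"
    and pair_lin2: "a \<in> carrier R1 \<Longrightarrow> linmap K R2 (tensor K [R1, R2]) (\<lambda>b. pure K [R1, R2] [a, b])"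
    and pair_lift: "\<lbrakk>bilin K R1 R2 N G; module K N\<rbrakk> \<Longrightarrow> linmap K (tensor K [R1, R2]) N (lift2 K N G)"
    and pair_lift_pure: "\<lbrakk>bilin K R1 R2 N G; module K N; a \<in> carrier R1; b \<in> carrier R2\<rbrakk> \<Longrightarrow>
      lift2 K N G (pure K [R1, R2] [a, b]) = G a b"
    and pair_eqI: "\<lbrakk>linmap K (tensor K [R1, R2]) N f; linmap K (tensor K [R1, R2]) N g; module K N;
      \<And>a b. \<lbrakk>a \<in> carrier R1; b \<in> carrier R2\<rbrakk> \<Longrightarrow> f (pure K [R1, R2] [a, b]) = g (pure K [R1, R2] [a, b]);
      u \<in> carrier (tensor K [R1, R2])\<rbrakk> \<Longrightarrow> f u = g u"
proof -
  interpret T: tens K "[R1, R2]" by (rule tens2[OF R])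
  show "k_algebra K (tensor K [R1, R2])" by (rule T.k_algebra_T)
  show "\<lbrakk>a \<in> carrier R1; b \<in> carrier R2\<rbrakk> \<Longrightarrow> pure K [R1, R2] [a, b] \<in> carrier (tensor K [R1, R2])"
    by (rule T.pure_closed) (rule tuple2I)
  show "\<lbrakk>a \<in> carrier R1; b \<in> carrier R2; c \<in> carrier R1; d \<in> carrier R2\<rbrakk> \<Longrightarrow>
      pure K [R1, R2] [a, b] \<otimes>\<^bsub>tensor K [R1, R2]\<^esub> pure K [R1, R2] [c, d] = pure K [R1, R2] [a \<otimes>\<^bsub>R1\<^esub> c, b \<otimes>\<^bsub>R2\<^esub> d]"
    by (simp add: T.pure_mult tuple2I T.mult_TM upt_conv_Cons)
  show "\<one>\<^bsub>tensor K [R1, R2]\<^esub> = pure K [R1, R2] [\<one>\<^bsub>R1\<^esub>, \<one>\<^bsub>R2\<^esub>]" by (simp add: T.one_T)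
  have [simp]: "\<one>\<^bsub>R1\<^esub> \<in> carrier R1" "\<one>\<^bsub>R2\<^esub> \<in> carrier R2"
    using R by (auto simp: k_algebra_def ring.ring_simprules)
  show "b \<in> carrier R2 \<Longrightarrow> linmap K R1 (tensor K [R1, R2]) (\<lambda>a. pure K [R1, R2] [a, b])"
    using T.linmap_pure[of "[\<one>\<^bsub>R1\<^esub>, b]" 0] by (simp add: tuple2I)
  show "a \<in> carrier R1 \<Longrightarrow> linmap K R2 (tensor K [R1, R2]) (\<lambda>b. pure K [R1, R2] [a, b])"
    using T.linmap_pure[of "[a, \<one>\<^bsub>R2\<^esub>]" 1] by (simp add: tuple2I)
  show "\<lbrakk>bilin K R1 R2 N G; module K N\<rbrakk> \<Longrightarrow> linmap K (tensor K [R1, R2]) N (lift2 K N G)"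
    unfolding lift2_def by (rule T.linmap_tlift[OF multilin2])
  show "\<lbrakk>bilin K R1 R2 N G; module K N; a \<in> carrier R1; b \<in> carrier R2\<rbrakk> \<Longrightarrow>
      lift2 K N G (pure K [R1, R2] [a, b]) = G a b"
    unfolding lift2_def by (subst T.tlift_pure[OF multilin2]) (auto intro: tuple2I)
  show "\<lbrakk>linmap K (tensor K [R1, R2]) N f; linmap K (tensor K [R1, R2]) N g; module K N;
      \<And>a b. \<lbrakk>a \<in> carrier R1; b \<in> carrier R2\<rbrakk> \<Longrightarrow> f (pure K [R1, R2] [a, b]) = g (pure K [R1, R2] [a, b]);
      u \<in> carrier (tensor K [R1, R2])\<rbrakk> \<Longrightarrow> f u = g u"
    by (rule T.linmap_T_eqI[of N f g]) (auto elim!: tuple2_cases)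
qed

lemma lift2_cong:
  assumes R: "k_algebra K R1" "k_algebra K R2" and G: "bilin K R1 R2 N G" and N: "module K N"
    and u: "u \<in> carrier (tensor K [R1, R2])"
    and e: "\<And>a b. \<lbrakk>a \<in> carrier R1; b \<in> carrier R2\<rbrakk> \<Longrightarrow> H [a, b] = G a b"
  shows "tlift K N H u = lift2 K N G u"
proof -
  interpret T: tens K "[R1, R2]" by (rule tens2[OF R])
  show ?thesis unfolding lift2_def
    by (rule T.tlift_cong[OF multilin2[OF G] N u]) (auto elim!: tuple2_cases simp: e)
qed

lemma lift3_cong:
  assumes R: "k_algebra K R1" "k_algebra K R2" "k_algebra K R3" and G: "trilin K R1 R2 R3 N G" and N: "module K N"
    and u: "u \<in> carrier (tensor K [R1, R2, R3])"
    and e: "\<And>a b c. \<lbrakk>a \<in> carrier R1; b \<in> carrier R2; c \<in> carrier R3\<rbrakk> \<Longrightarrow> H [a, b, c] = G a b c"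
  shows "tlift K N H u = lift3 K N G u"
proof -
  interpret T: tens K "[R1, R2, R3]" by (rule tens3[OF R])
  show ?thesis unfolding lift3_def
    by (rule T.tlift_cong[OF multilin3[OF G] N u]) (auto elim!: tuple3_cases simp: e)
qed

context kalg
begin

lemma alg_opp: "k_algebra K (opp R)" by (rule k_algebra_opp[OF alg])

lemma tens_T3: "tens K [R, opp R, R]" by (rule tens3[OF alg alg_opp alg])

lemma T2_alg: "k_algebra K (T2 K R)" and T2_module: "module K (T2 K R)"
  using pair_alg[OF alg_opp alg] by (auto simp: k_algebra_def)

lemma T3_alg: "k_algebra K (T3 K R)" and T3_module: "module K (T3 K R)"
  using tens.k_algebra_T[OF tens_T3] by (auto simp: k_algebra_def)

lemma tens_T5: "tens K (fac5 R)"
  by (rule tens.intro) (auto simp: fieldK less_Suc_eq alg alg_opp)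

lemma T5_alg: "k_algebra K (tensor K (fac5 R))" and T5_module: "module K (tensor K (fac5 R))"
  using tens.k_algebra_T[OF tens_T5] by (auto simp: k_algebra_def)

lemma pure2_closed [simp]: "\<lbrakk>a \<in> carrier R; b \<in> carrier R\<rbrakk> \<Longrightarrow> pure2 K R [a, b] \<in> carrier (T2 K R)"
  using pair_closed[OF alg_opp alg] by simp

lemma pure2_mult [simp]: "\<lbrakk>a \<in> carrier R; b \<in> carrier R; c \<in> carrier R; d \<in> carrier R\<rbrakk> \<Longrightarrow>
    pure2 K R [a, b] \<otimes>\<^bsub>T2 K R\<^esub> pure2 K R [c, d] = pure2 K R [c \<otimes>\<^bsub>R\<^esub> a, b \<otimes>\<^bsub>R\<^esub> d]"
  using pair_mult[OF alg_opp alg] by simp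

lemma T2_one: "\<one>\<^bsub>T2 K R\<^esub> = pure2 K R [\<one>\<^bsub>R\<^esub>, \<one>\<^bsub>R\<^esub>]"
  using pair_one[OF alg_opp alg] by simp

lemma linmap_pure2_1: "\<lbrakk>linmap K M R f; b \<in> carrier R\<rbrakk> \<Longrightarrow> linmap K M (T2 K R) (\<lambda>t. pure2 K R [f t, b])"
  using linmap_comp[OF pair_lin1[OF alg_opp alg, unfolded linmap_opp]] .

lemma linmap_pure2_2: "\<lbrakk>linmap K M R f; a \<in> carrier R\<rbrakk> \<Longrightarrow> linmap K M (T2 K R) (\<lambda>t. pure2 K R [a, f t])"
  using linmap_comp[OF pair_lin2[OF alg_opp alg]] by simp

lemma linmap_lift2: "\<lbrakk>bilin K R R N G; module K N\<rbrakk> \<Longrightarrow> linmap K (T2 K R) N (lift2 K N G)"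
  by (rule pair_lift[OF alg_opp alg]) (simp add: bilin_def)

lemma lift2_pure: "\<lbrakk>bilin K R R N G; module K N; a \<in> carrier R; b \<in> carrier R\<rbrakk> \<Longrightarrow>
    lift2 K N G (pure2 K R [a, b]) = G a b"
  by (rule pair_lift_pure[OF alg_opp alg]) (simp_all add: bilin_def)

lemma T2_eqI: "\<lbrakk>linmap K (T2 K R) N f; linmap K (T2 K R) N g; module K N;
    \<And>a b. \<lbrakk>a \<in> carrier R; b \<in> carrier R\<rbrakk> \<Longrightarrow> f (pure2 K R [a, b]) = g (pure2 K R [a, b]);
    u \<in> carrier (T2 K R)\<rbrakk> \<Longrightarrow> f u = g u"
  by (rule pair_eqI[OF alg_opp alg]) simp_all

lemma pure3_closed [simp]: "\<lbrakk>a \<in> carrier R; b \<in> carrier R; c \<in> carrier R\<rbrakk> \<Longrightarrow> pure3 K R [a, b, c] \<in> carrier (T3 K R)"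
  by (rule tens.pure_closed[OF tens_T3]) (auto intro: tuple3I)

lemma pure3_mult [simp]: "\<lbrakk>a \<in> carrier R; b \<in> carrier R; c \<in> carrier R; a' \<in> carrier R; b' \<in> carrier R; c' \<in> carrier R\<rbrakk> \<Longrightarrow>
    pure3 K R [a, b, c] \<otimes>\<^bsub>T3 K R\<^esub> pure3 K R [a', b', c'] = pure3 K R [a \<otimes>\<^bsub>R\<^esub> a', b' \<otimes>\<^bsub>R\<^esub> b, c \<otimes>\<^bsub>R\<^esub> c']"
  by (simp add: tens.pure_mult[OF tens_T3] tuple3I tens.mult_TM[OF tens_T3] upt_conv_Cons numeral_2_eq_2)

lemma T3_one: "\<one>\<^bsub>T3 K R\<^esub> = pure3 K R [\<one>\<^bsub>R\<^esub>, \<one>\<^bsub>R\<^esub>, \<one>\<^bsub>R\<^esub>]"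
  by (simp add: tens.one_T[OF tens_T3])

lemma linmap_pure3_1: "\<lbrakk>linmap K M R f; b \<in> carrier R; c \<in> carrier R\<rbrakk> \<Longrightarrow> linmap K M (T3 K R) (\<lambda>t. pure3 K R [f t, b, c])"
  using linmap_comp[OF tens.linmap_pure[OF tens_T3, of "[\<one>\<^bsub>R\<^esub>, b, c]" 0], of M f] by (simp add: tuple3I)

lemma linmap_pure3_2: "\<lbrakk>linmap K M R f; a \<in> carrier R; c \<in> carrier R\<rbrakk> \<Longrightarrow> linmap K M (T3 K R) (\<lambda>t. pure3 K R [a, f t, c])"
  using linmap_comp[OF tens.linmap_pure[OF tens_T3, of "[a, \<one>\<^bsub>R\<^esub>, c]" 1], of M f]
  by (simp add: tuple3I) (simp add: linmap_def)

lemma linmap_pure3_3: "\<lbrakk>linmap K M R f; a \<in> carrier R; b \<in> carrier R\<rbrakk> \<Longrightarrow> linmap K M (T3 K R) (\<lambda>t. pure3 K R [a, b, f t])"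
  using linmap_comp[OF tens.linmap_pure[OF tens_T3, of "[a, b, \<one>\<^bsub>R\<^esub>]" 2], of M f] by (simp add: tuple3I)

lemma linmap_lift3: "\<lbrakk>trilin K R R R N G; module K N\<rbrakk> \<Longrightarrow> linmap K (T3 K R) N (lift3 K N G)"
  unfolding lift3_def by (rule tens.linmap_tlift[OF tens_T3 multilin3]) (simp_all add: trilin_def)

lemma lift3_pure: "\<lbrakk>trilin K R R R N G; module K N; a \<in> carrier R; b \<in> carrier R; c \<in> carrier R\<rbrakk> \<Longrightarrow>
    lift3 K N G (pure3 K R [a, b, c]) = G a b c"
  unfolding lift3_def
  by (subst tens.tlift_pure[OF tens_T3 multilin3]) (auto intro: tuple3I simp: trilin_def)

lemma T3_eqI: "\<lbrakk>linmap K (T3 K R) N f; linmap K (T3 K R) N g; module K N;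
    \<And>a b c. \<lbrakk>a \<in> carrier R; b \<in> carrier R; c \<in> carrier R\<rbrakk> \<Longrightarrow> f (pure3 K R [a, b, c]) = g (pure3 K R [a, b, c]);
    u \<in> carrier (T3 K R)\<rbrakk> \<Longrightarrow> f u = g u"
  by (rule tens.linmap_T_eqI[OF tens_T3, of N f g]) (auto elim!: tuple3_cases)

text \<open>Both sides are linear in \<open>u\<close> and in \<open>v\<close>, so multiplicativity
  is first extended in the second argument and then in the first.\<close>

lemma T2_mult_eqI:
  assumes "\<And>a b c d. \<lbrakk>a \<in> carrier R; b \<in> carrier R; c \<in> carrier R; d \<in> carrier R\<rbrakk> \<Longrightarrow>
      f (pure2 K R [a, b] \<otimes>\<^bsub>T2 K R\<^esub> pure2 K R [c, d]) = f (pure2 K R [a, b]) \<otimes>\<^bsub>N\<^esub> f (pure2 K R [c, d])"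
    and f: "linmap K (T2 K R) N f" and N: "k_algebra K N"
    and u: "u \<in> carrier (T2 K R)" and v: "v \<in> carrier (T2 K R)"
  shows "f (u \<otimes>\<^bsub>T2 K R\<^esub> v) = f u \<otimes>\<^bsub>N\<^esub> f v"
proof -
  interpret N: kalg K N by (rule kalgI) fact
  have "f (pure2 K R [a, b] \<otimes>\<^bsub>T2 K R\<^esub> v) = f (pure2 K R [a, b]) \<otimes>\<^bsub>N\<^esub> f v"
    if "a \<in> carrier R" "b \<in> carrier R" for a b
    by (rule T2_eqI[OF linmap_comp[OF f linmap_mult_l[OF T2_alg linmap_id]] linmap_mult_l[OF N f] N.moduleR _ v])
      (use that assms(1) linmapD[OF f] in auto)
  then show ?thesis
    by (intro T2_eqI[OF linmap_comp[OF f linmap_mult_r[OF T2_alg linmap_id v]] linmap_mult_r[OF N f] N.moduleR _ u])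
      (use linmapD[OF f] v in auto)
qed

lemma T3_mult_eqI:
  assumes "\<And>a b c a' b' c'. \<lbrakk>a \<in> carrier R; b \<in> carrier R; c \<in> carrier R; a' \<in> carrier R; b' \<in> carrier R; c' \<in> carrier R\<rbrakk> \<Longrightarrow>
      f (pure3 K R [a, b, c] \<otimes>\<^bsub>T3 K R\<^esub> pure3 K R [a', b', c']) = f (pure3 K R [a, b, c]) \<otimes>\<^bsub>N\<^esub> f (pure3 K R [a', b', c'])"
    and f: "linmap K (T3 K R) N f" and N: "k_algebra K N"
    and u: "u \<in> carrier (T3 K R)" and v: "v \<in> carrier (T3 K R)"
  shows "f (u \<otimes>\<^bsub>T3 K R\<^esub> v) = f u \<otimes>\<^bsub>N\<^esub> f v"
proof -
  interpret N: kalg K N by (rule kalgI) fact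
  have "f (pure3 K R [a, b, c] \<otimes>\<^bsub>T3 K R\<^esub> v) = f (pure3 K R [a, b, c]) \<otimes>\<^bsub>N\<^esub> f v"
    if "a \<in> carrier R" "b \<in> carrier R" "c \<in> carrier R" for a b c
    by (rule T3_eqI[OF linmap_comp[OF f linmap_mult_l[OF T3_alg linmap_id]] linmap_mult_l[OF N f] N.moduleR _ v])
      (use that assms(1) linmapD[OF f] in auto)
  then show ?thesis
    by (intro T3_eqI[OF linmap_comp[OF f linmap_mult_r[OF T3_alg linmap_id v]] linmap_mult_r[OF N f] N.moduleR _ u])
      (use linmapD[OF f] v in auto)
qed

section \<open>Subalgebras and linear functionals\<close>

lemma subalgebra:
  assumes S: "submodule S K R" and one: "\<one>\<^bsub>R\<^esub> \<in> S" and m: "\<And>x y. \<lbrakk>x \<in> S; y \<in> S\<rbrakk> \<Longrightarrow> x \<otimes>\<^bsub>R\<^esub> y \<in> S"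
  shows "k_algebra K (R\<lparr>carrier := S\<rparr>)"
proof -
  have M: "module K (R\<lparr>carrier := S\<rparr>)" by (rule submodule.submodule_is_module[OF S moduleR])
  have sub: "x \<in> S \<Longrightarrow> x \<in> carrier R" for x using Mod.submoduleE(1)[OF S] by auto
  have "ring (R\<lparr>carrier := S\<rparr>)"
    by (rule ringI) (use M one m sub in \<open>auto simp: module_def m_assoc l_distr r_distr intro!: monoidI\<close>)
  then show ?thesis using M sub by (auto simp: k_algebra_def fieldK smult_mult_l smult_mult_r)
qed

text \<open>Linear maps into the field itself. They are spelled out separately because
  \<open>K\<close> is a ring record without scalar multiplication, so that \<open>linmap\<close>
  cannot have it as a target.\<close>

definition "functional \<phi> \<longleftrightarrow> (\<forall>x\<in>carrier R. \<phi> x \<in> carrier K) \<and>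
  (\<forall>x\<in>carrier R. \<forall>y\<in>carrier R. \<phi> (x \<oplus>\<^bsub>R\<^esub> y) = \<phi> x \<oplus>\<^bsub>K\<^esub> \<phi> y) \<and>
  (\<forall>a\<in>carrier K. \<forall>x\<in>carrier R. \<phi> (a \<odot>\<^bsub>R\<^esub> x) = a \<otimes>\<^bsub>K\<^esub> \<phi> x)"

lemma functionalD:
  assumes "functional \<phi>"
  shows "x \<in> carrier R \<Longrightarrow> \<phi> x \<in> carrier K"
    "\<lbrakk>x \<in> carrier R; y \<in> carrier R\<rbrakk> \<Longrightarrow> \<phi> (x \<oplus>\<^bsub>R\<^esub> y) = \<phi> x \<oplus>\<^bsub>K\<^esub> \<phi> y"
    "\<lbrakk>a \<in> carrier K; x \<in> carrier R\<rbrakk> \<Longrightarrow> \<phi> (a \<odot>\<^bsub>R\<^esub> x) = a \<otimes>\<^bsub>K\<^esub> \<phi> x"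
  using assms by (auto simp: functional_def)

lemma functional_linmap:
  assumes "functional \<phi>" "linmap K R R f"
  shows "functional (\<lambda>x. \<phi> (f x))"
  using assms by (auto simp: functional_def linmap_def)

lemma linmap_functional_smult:
  assumes \<phi>: "functional \<phi>" and f: "linmap K M R f" and N: "module K N" and v: "v \<in> carrier N"
  shows "linmap K M N (\<lambda>x. \<phi> (f x) \<odot>\<^bsub>N\<^esub> v)"
proof -
  interpret N: module K N by fact
  show ?thesis using \<phi> f v by (auto simp: linmap_def functional_def N.smult_l_distr N.smult_assoc1)
qed

lemma smult_one_cancel:
  assumes N: "submodule N K R" "\<one>\<^bsub>R\<^esub> \<notin> N" and a: "a \<in> carrier K" "a \<odot>\<^bsub>R\<^esub> \<one>\<^bsub>R\<^esub> \<in> N"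
  shows "a = \<zero>\<^bsub>K\<^esub>"
proof (rule ccontr)
  assume "a \<noteq> \<zero>\<^bsub>K\<^esub>"
  then have u: "inv\<^bsub>K\<^esub> a \<in> carrier K" "inv\<^bsub>K\<^esub> a \<otimes>\<^bsub>K\<^esub> a = \<one>\<^bsub>K\<^esub>"
    using a K.field_Units by (auto intro: K.Units_l_inv K.Units_inv_closed)
  have "inv\<^bsub>K\<^esub> a \<odot>\<^bsub>R\<^esub> (a \<odot>\<^bsub>R\<^esub> \<one>\<^bsub>R\<^esub>) \<in> N" using u a by (simp add: submodule.smult_closed[OF N(1)])
  moreover have "inv\<^bsub>K\<^esub> a \<odot>\<^bsub>R\<^esub> (a \<odot>\<^bsub>R\<^esub> \<one>\<^bsub>R\<^esub>) = \<one>\<^bsub>R\<^esub>"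
    using u a by (simp add: Mod.smult_assoc1[symmetric])
  ultimately show False using N(2) by simp
qed

text \<open>A maximal subspace avoiding \<open>1\<close> is a complement of \<open>K\<close>.\<close>

lemma ex_functional:
  assumes nz: "\<one>\<^bsub>R\<^esub> \<noteq> \<zero>\<^bsub>R\<^esub>"
  shows "\<exists>\<phi>. functional \<phi> \<and> \<phi> \<one>\<^bsub>R\<^esub> = \<one>\<^bsub>K\<^esub>"
proof -
  let ?S = "{N. submodule N K R \<and> \<one>\<^bsub>R\<^esub> \<notin> N}"
  have z: "{\<zero>\<^bsub>R\<^esub>} \<in> ?S" using nz by (auto intro!: Mod.submoduleI)
  have "\<exists>N\<in>?S. \<forall>X\<in>?S. N \<subseteq> X \<longrightarrow> X = N"
  proof (rule subset_Zorn_nonempty)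
    show "?S \<noteq> {}" using z by blast
    fix C assume C: "C \<noteq> {}" "subset.chain ?S C"
    then have CS: "\<And>N. N \<in> C \<Longrightarrow> submodule N K R \<and> \<one>\<^bsub>R\<^esub> \<notin> N"
      and ch: "\<And>X Y. \<lbrakk>X \<in> C; Y \<in> C\<rbrakk> \<Longrightarrow> X \<subseteq> Y \<or> Y \<subseteq> X"
      by (auto simp: subset.chain_def subset_eq)
    note E = Mod.submoduleE[OF conjunct1[OF CS]]
    have "submodule (\<Union> C) K R"
    proof (rule Mod.submoduleI)
      fix a b assume "a \<in> \<Union> C" "b \<in> \<Union> C"
      then obtain X Y where "X \<in> C" "a \<in> X" "Y \<in> C" "b \<in> Y" by blast
      then show "a \<oplus>\<^bsub>R\<^esub> b \<in> \<Union> C" using ch[of X Y] E(5) by blast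
    next
      show "\<Union> C \<subseteq> carrier R" using E(1) by blast
      show "\<zero>\<^bsub>R\<^esub> \<in> \<Union> C" using C(1) submodule_zero[OF conjunct1[OF CS]] by auto
    next
      fix a assume "a \<in> \<Union> C"
      then obtain X where X: "X \<in> C" "a \<in> X" by blast
      then show "\<ominus>\<^bsub>R\<^esub> a \<in> \<Union> C" using E(3)[of X a] by blast
      fix k assume "k \<in> carrier K"
      then show "k \<odot>\<^bsub>R\<^esub> a \<in> \<Union> C" using X E(4)[of X k a] by blast
    qed
    then show "\<Union> C \<in> ?S" using CS by blast
  qed
  then obtain N where N: "submodule N K R" "\<one>\<^bsub>R\<^esub> \<notin> N"
    and mx: "\<And>X. \<lbrakk>submodule X K R; \<one>\<^bsub>R\<^esub> \<notin> X; N \<subseteq> X\<rbrakk> \<Longrightarrow> X = N" by auto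
  note E = Mod.submoduleE[OF N(1)]
  have Nc: "n \<in> N \<Longrightarrow> n \<in> carrier R" for n using E(1) by auto
  have ex: "\<exists>a\<in>carrier K. x \<ominus>\<^bsub>R\<^esub> a \<odot>\<^bsub>R\<^esub> \<one>\<^bsub>R\<^esub> \<in> N" if x: "x \<in> carrier R" for x
  proof (cases "x \<in> N")
    case True
    then show ?thesis using x by (intro bexI[of _ "\<zero>\<^bsub>K\<^esub>"]) (auto simp: a_minus_def)
  next
    case False
    \<comment> \<open>Adjoining \<open>x\<close> gives a strictly larger subspace, which by
      maximality contains 1. From 1 = n + bx with b nonzero, the difference of \<open>x\<close> and
      b^-1 1 is -b^-1 n, an element of \<open>N\<close>.\<close>
    let ?X = "{n \<oplus>\<^bsub>R\<^esub> b \<odot>\<^bsub>R\<^esub> x |n b. n \<in> N \<and> b \<in> carrier K}"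
    have sX: "submodule ?X K R"
    proof (rule Mod.submoduleI)
      show "?X \<subseteq> carrier R" using x Nc by auto
      show "\<zero>\<^bsub>R\<^esub> \<in> ?X" using x submodule_zero[OF N(1)] by (intro CollectI exI[of _ "\<zero>\<^bsub>R\<^esub>"] exI[of _ "\<zero>\<^bsub>K\<^esub>"]) auto
    next
      fix a assume "a \<in> ?X"
      then obtain n b where a: "a = n \<oplus>\<^bsub>R\<^esub> b \<odot>\<^bsub>R\<^esub> x" "n \<in> N" "b \<in> carrier K" by blast
      then show "\<ominus>\<^bsub>R\<^esub> a \<in> ?X" using x Nc E(3)
        by (intro CollectI exI[of _ "\<ominus>\<^bsub>R\<^esub> n"] exI[of _ "\<ominus>\<^bsub>K\<^esub> b"]) (auto simp: minus_add Mod.smult_l_minus)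
      fix k assume k: "k \<in> carrier K"
      then show "k \<odot>\<^bsub>R\<^esub> a \<in> ?X" using x Nc E(4) a
        by (intro CollectI exI[of _ "k \<odot>\<^bsub>R\<^esub> n"] exI[of _ "k \<otimes>\<^bsub>K\<^esub> b"]) (auto simp: Mod.smult_r_distr Mod.smult_assoc1)
    next
      fix a a' assume "a \<in> ?X" "a' \<in> ?X"
      then obtain n b n' b' where a: "a = n \<oplus>\<^bsub>R\<^esub> b \<odot>\<^bsub>R\<^esub> x" "n \<in> N" "b \<in> carrier K"
        "a' = n' \<oplus>\<^bsub>R\<^esub> b' \<odot>\<^bsub>R\<^esub> x" "n' \<in> N" "b' \<in> carrier K" by blast
      then show "a \<oplus>\<^bsub>R\<^esub> a' \<in> ?X" using x Nc E(5)
        by (intro CollectI exI[of _ "n \<oplus>\<^bsub>R\<^esub> n'"] exI[of _ "b \<oplus>\<^bsub>K\<^esub> b'"]) (auto simp: Mod.smult_l_distr a_ac)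
    qed
    have "x \<in> ?X" using x submodule_zero[OF N(1)] by (intro CollectI exI[of _ "\<zero>\<^bsub>R\<^esub>"] exI[of _ "\<one>\<^bsub>K\<^esub>"]) auto
    moreover have "N \<subseteq> ?X"
    proof
      fix n assume "n \<in> N"
      then show "n \<in> ?X" using x Nc by (intro CollectI exI[of _ n] exI[of _ "\<zero>\<^bsub>K\<^esub>"]) auto
    qed
    ultimately have "\<one>\<^bsub>R\<^esub> \<in> ?X" using mx[OF sX] False by blast
    then obtain n b where n: "\<one>\<^bsub>R\<^esub> = n \<oplus>\<^bsub>R\<^esub> b \<odot>\<^bsub>R\<^esub> x" "n \<in> N" "b \<in> carrier K" by blast
    have "b \<noteq> \<zero>\<^bsub>K\<^esub>" using n N(2) x Nc by auto
    then have u: "inv\<^bsub>K\<^esub> b \<in> carrier K" "inv\<^bsub>K\<^esub> b \<otimes>\<^bsub>K\<^esub> b = \<one>\<^bsub>K\<^esub>"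
      using n K.field_Units by (auto intro: K.Units_l_inv K.Units_inv_closed)
    let ?m = "inv\<^bsub>K\<^esub> b \<odot>\<^bsub>R\<^esub> n"
    have "inv\<^bsub>K\<^esub> b \<odot>\<^bsub>R\<^esub> \<one>\<^bsub>R\<^esub> = ?m \<oplus>\<^bsub>R\<^esub> x"
      using n x Nc u by (simp add: Mod.smult_r_distr Mod.smult_assoc1[symmetric])
    moreover have "x \<ominus>\<^bsub>R\<^esub> (?m \<oplus>\<^bsub>R\<^esub> x) = \<ominus>\<^bsub>R\<^esub> ?m"
      using x Nc[OF n(2)] u by (simp add: a_minus_def minus_add r_neg2 a_ac(2) a_ac(3) r_neg l_neg a_lcomm)
    moreover have "\<ominus>\<^bsub>R\<^esub> ?m \<in> N" using E(3,4) n u by blast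
    ultimately show ?thesis using u by (intro bexI[of _ "inv\<^bsub>K\<^esub> b"]) auto
  qed
  have un: "a = b" if a: "a \<in> carrier K" "b \<in> carrier K" and x: "x \<in> carrier R"
     "x \<ominus>\<^bsub>R\<^esub> a \<odot>\<^bsub>R\<^esub> \<one>\<^bsub>R\<^esub> \<in> N" "x \<ominus>\<^bsub>R\<^esub> b \<odot>\<^bsub>R\<^esub> \<one>\<^bsub>R\<^esub> \<in> N" for a b x
  proof -
    have e: "(x \<ominus>\<^bsub>R\<^esub> b \<odot>\<^bsub>R\<^esub> \<one>\<^bsub>R\<^esub>) \<oplus>\<^bsub>R\<^esub> \<ominus>\<^bsub>R\<^esub> (x \<ominus>\<^bsub>R\<^esub> a \<odot>\<^bsub>R\<^esub> \<one>\<^bsub>R\<^esub>) = (a \<ominus>\<^bsub>K\<^esub> b) \<odot>\<^bsub>R\<^esub> \<one>\<^bsub>R\<^esub>"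
      using a x(1) by (simp add: a_minus_def Mod.smult_l_distr Mod.smult_l_minus minus_add a_ac r_neg1 r_neg2 r_neg)
    have "(a \<ominus>\<^bsub>K\<^esub> b) \<odot>\<^bsub>R\<^esub> \<one>\<^bsub>R\<^esub> \<in> N" unfolding e[symmetric] using E(3,5) x by blast
    then have "a \<ominus>\<^bsub>K\<^esub> b = \<zero>\<^bsub>K\<^esub>" using smult_one_cancel[OF N] a by simp
    then show ?thesis using a by (simp add: K.diff_eq_zero_iff)
  qed
  define \<phi> where "\<phi> x = (SOME a. a \<in> carrier K \<and> x \<ominus>\<^bsub>R\<^esub> a \<odot>\<^bsub>R\<^esub> \<one>\<^bsub>R\<^esub> \<in> N)" for x
  have \<phi>: "\<phi> x \<in> carrier K \<and> x \<ominus>\<^bsub>R\<^esub> \<phi> x \<odot>\<^bsub>R\<^esub> \<one>\<^bsub>R\<^esub> \<in> N" if "x \<in> carrier R" for x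
    unfolding \<phi>_def by (rule someI_ex) (use ex[OF that] in blast)
  have \<phi>I: "\<phi> x = a" if "x \<in> carrier R" "a \<in> carrier K" "x \<ominus>\<^bsub>R\<^esub> a \<odot>\<^bsub>R\<^esub> \<one>\<^bsub>R\<^esub> \<in> N" for x a
    using un[of "\<phi> x" a x] \<phi> that by blast
  have "functional \<phi>"
    unfolding functional_def
  proof (intro conjI ballI)
    fix x assume x: "x \<in> carrier R"
    show "\<phi> x \<in> carrier K" using \<phi> x by blast
    fix y assume y: "y \<in> carrier R"
    have "(x \<ominus>\<^bsub>R\<^esub> \<phi> x \<odot>\<^bsub>R\<^esub> \<one>\<^bsub>R\<^esub>) \<oplus>\<^bsub>R\<^esub> (y \<ominus>\<^bsub>R\<^esub> \<phi> y \<odot>\<^bsub>R\<^esub> \<one>\<^bsub>R\<^esub>) \<in> N" using \<phi> x y E(5) by blast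
    moreover have "(x \<ominus>\<^bsub>R\<^esub> \<phi> x \<odot>\<^bsub>R\<^esub> \<one>\<^bsub>R\<^esub>) \<oplus>\<^bsub>R\<^esub> (y \<ominus>\<^bsub>R\<^esub> \<phi> y \<odot>\<^bsub>R\<^esub> \<one>\<^bsub>R\<^esub>)
      = (x \<oplus>\<^bsub>R\<^esub> y) \<ominus>\<^bsub>R\<^esub> (\<phi> x \<oplus>\<^bsub>K\<^esub> \<phi> y) \<odot>\<^bsub>R\<^esub> \<one>\<^bsub>R\<^esub>"
      using \<phi> x y by (simp add: a_minus_def Mod.smult_l_distr minus_add a_ac)
    ultimately show "\<phi> (x \<oplus>\<^bsub>R\<^esub> y) = \<phi> x \<oplus>\<^bsub>K\<^esub> \<phi> y" using \<phi> x y by (intro \<phi>I) auto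
  next
    fix a x assume a: "a \<in> carrier K" and x: "x \<in> carrier R"
    have "a \<odot>\<^bsub>R\<^esub> (x \<ominus>\<^bsub>R\<^esub> \<phi> x \<odot>\<^bsub>R\<^esub> \<one>\<^bsub>R\<^esub>) \<in> N" using \<phi> x a E(4) by blast
    moreover have "a \<odot>\<^bsub>R\<^esub> (x \<ominus>\<^bsub>R\<^esub> \<phi> x \<odot>\<^bsub>R\<^esub> \<one>\<^bsub>R\<^esub>) = (a \<odot>\<^bsub>R\<^esub> x) \<ominus>\<^bsub>R\<^esub> (a \<otimes>\<^bsub>K\<^esub> \<phi> x) \<odot>\<^bsub>R\<^esub> \<one>\<^bsub>R\<^esub>"
      using \<phi> x a by (simp add: a_minus_def Mod.smult_r_distr Mod.smult_r_minus Mod.smult_assoc1)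
    ultimately show "\<phi> (a \<odot>\<^bsub>R\<^esub> x) = a \<otimes>\<^bsub>K\<^esub> \<phi> x" using \<phi> x a by (intro \<phi>I) auto
  qed
  moreover have "\<phi> \<one>\<^bsub>R\<^esub> = \<one>\<^bsub>K\<^esub>"
    using submodule_zero[OF N(1)] by (intro \<phi>I) (auto simp: a_minus_def r_neg)
  ultimately show ?thesis by blast
qed

end

section \<open>Endomorphism algebras and homomorphisms\<close>

lemma (in monalg) alg_hom_lext:
  assumes N: "k_algebra K N" and H: "\<And>x. x \<in> carrier M \<Longrightarrow> H x \<in> carrier N"
    and one: "H \<one>\<^bsub>M\<^esub> = \<one>\<^bsub>N\<^esub>"
    and mult: "\<And>x y. \<lbrakk>x \<in> carrier M; y \<in> carrier M\<rbrakk> \<Longrightarrow> H (x \<otimes>\<^bsub>M\<^esub> y) = H x \<otimes>\<^bsub>N\<^esub> H y"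
  shows "lext K N H \<in> alg_hom K F N"
proof -
  interpret N: kalg K N by (rule kalgI) fact
  have L: "linmap K F N (lext K N H)" by (rule linmap_lext[OF N.moduleR H])
  note ls = lext_single[OF N.moduleR H]
  show ?thesis
  proof (rule alg_homI[OF L])
    show "lext K N H \<one>\<^bsub>F\<^esub> = \<one>\<^bsub>N\<^esub>" by (simp add: one_F ls one)
    fix f g assume f: "f \<in> carrier F" and g: "g \<in> carrier F"
    have 1: "lext K N H (single K x \<otimes>\<^bsub>F\<^esub> g) = H x \<otimes>\<^bsub>N\<^esub> lext K N H g" if x: "x \<in> carrier M" for x
      by (rule linmap_F_eqI[OF linmap_comp[OF L linmap_mult_F_r] linmap_mult_l[OF N L] N.moduleR _ g])
        (use x H in \<open>simp_all add: mult_single ls mult\<close>)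
    show "lext K N H (f \<otimes>\<^bsub>F\<^esub> g) = lext K N H f \<otimes>\<^bsub>N\<^esub> lext K N H g"
      by (rule linmap_F_eqI[OF linmap_comp[OF L linmap_mult_F_l] linmap_mult_r[OF N L] N.moduleR _ f])
        (use g linmapD(1)[OF L g] in \<open>simp_all add: 1 ls\<close>)
  qed
qed

lemma alg_hom_kernel_ideal:
  assumes f: "f \<in> alg_hom K A B" and A: "k_algebra K A" and B: "k_algebra K B"
  shows "ideal {x \<in> carrier A. f x = \<zero>\<^bsub>B\<^esub>} A"
proof -
  interpret A: kalg K A by (rule kalgI) fact
  interpret B: kalg K B by (rule kalgI) fact
  show ?thesis
    by (rule idealI[OF A.ringR submodule.axioms(1)[OF linmap_kernel[OF alg_hom_linmap[OF f] A.moduleR B.moduleR]]])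
      (auto simp: alg_homD[OF f])
qed

text \<open>Endomorphisms are made extensional so that equality of functions is equality of
  operators. This algebra is the target of the representation of A on arrays of
  coefficients.\<close>

definition End_alg :: "'k ring \<Rightarrow> ('k, 'n) module \<Rightarrow> ('k, 'n \<Rightarrow> 'n) module" where
  "End_alg K N = \<lparr>carrier = {f. linmap K N N f \<and> f \<in> extensional (carrier N)},
     mult = (\<lambda>f g. restrict (\<lambda>x. f (g x)) (carrier N)), one = restrict (\<lambda>x. x) (carrier N),
     zero = restrict (\<lambda>x. \<zero>\<^bsub>N\<^esub>) (carrier N), add = (\<lambda>f g. restrict (\<lambda>x. f x \<oplus>\<^bsub>N\<^esub> g x) (carrier N)),
     smult = (\<lambda>a f. restrict (\<lambda>x. a \<odot>\<^bsub>N\<^esub> f x) (carrier N))\<rparr>"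

lemma linmap_restrict: "module K M \<Longrightarrow> linmap K M N (restrict f (carrier M)) \<longleftrightarrow> linmap K M N f"
proof -
  assume "module K M"
  then interpret module K M .
  show ?thesis by (simp add: linmap_def)
qed

lemma k_algebra_End:
  assumes K: "field K" and N: "module K N"
  shows "k_algebra K (End_alg K N)"
proof -
  interpret N: module K N by fact
  interpret K: field K by fact
  let ?E = "End_alg K N"
  note r = linmap_restrict[OF N]
  have c: "carrier ?E = {f. linmap K N N f \<and> f \<in> extensional (carrier N)}"
    by (simp add: End_alg_def)
  have eqI: "f = g" if "f \<in> carrier ?E" "g \<in> carrier ?E" "\<And>x. x \<in> carrier N \<Longrightarrow> f x = g x" for f g
    using that by (auto simp: c intro: extensionalityI)
  have cl: "f x \<in> carrier N" if "f \<in> carrier ?E" "x \<in> carrier N" for f x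
    using that linmapD(1) by (auto simp: c)
  have m: "f \<otimes>\<^bsub>?E\<^esub> g \<in> carrier ?E" "f \<oplus>\<^bsub>?E\<^esub> g \<in> carrier ?E" if "f \<in> carrier ?E" "g \<in> carrier ?E" for f g
    using that unfolding c by (auto simp: End_alg_def r intro: linmap_comp linmap_add N)
  have s: "a \<odot>\<^bsub>?E\<^esub> f \<in> carrier ?E" if "f \<in> carrier ?E" "a \<in> carrier K" for f a
    using that unfolding c by (auto simp: End_alg_def r intro: linmap_smult N)
  have o: "\<one>\<^bsub>?E\<^esub> \<in> carrier ?E" "\<zero>\<^bsub>?E\<^esub> \<in> carrier ?E"
    unfolding c by (auto simp: End_alg_def r intro: linmap_id linmap_const0 N)
  have ap: "(f \<otimes>\<^bsub>?E\<^esub> g) x = f (g x)" "(f \<oplus>\<^bsub>?E\<^esub> g) x = f x \<oplus>\<^bsub>N\<^esub> g x" "(a \<odot>\<^bsub>?E\<^esub> f) x = a \<odot>\<^bsub>N\<^esub> f x"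
    "\<one>\<^bsub>?E\<^esub> x = x" "\<zero>\<^bsub>?E\<^esub> x = \<zero>\<^bsub>N\<^esub>" if "x \<in> carrier N" for f g a x
    using that by (auto simp: End_alg_def)
  have lin: "f (x \<oplus>\<^bsub>N\<^esub> y) = f x \<oplus>\<^bsub>N\<^esub> f y" "f (a \<odot>\<^bsub>N\<^esub> x) = a \<odot>\<^bsub>N\<^esub> f x"
    if "f \<in> carrier ?E" "x \<in> carrier N" "y \<in> carrier N" "a \<in> carrier K" for f x y a
    using that by (auto simp: c linmapD)
  have lina: "f (x \<oplus>\<^bsub>N\<^esub> y) = f x \<oplus>\<^bsub>N\<^esub> f y" if "f \<in> carrier ?E" "x \<in> carrier N" "y \<in> carrier N" for f x y
    using that by (auto simp: c linmapD)
  have linz: "f \<zero>\<^bsub>N\<^esub> = \<zero>\<^bsub>N\<^esub>" if "f \<in> carrier ?E" for f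
    using that linmap_zero[OF _ N N] by (auto simp: c)
  have ag: "abelian_group ?E"
  proof (rule abelian_groupI)
    fix f assume f: "f \<in> carrier ?E"
    have *: "restrict (\<lambda>x. \<ominus>\<^bsub>N\<^esub> f x) (carrier N) \<in> carrier ?E"
      using f unfolding c by (auto simp: r intro: linmap_neg N)
    show "\<exists>g\<in>carrier ?E. g \<oplus>\<^bsub>?E\<^esub> f = \<zero>\<^bsub>?E\<^esub>"
      by (rule bexI[OF eqI *]) (use f * in \<open>auto simp: m o ap cl N.l_neg\<close>)
  qed (auto simp: m o, auto intro!: eqI simp: m o ap cl N.a_ac)
  have mo: "monoid ?E"
    by (rule monoidI) (auto simp: m o, auto intro!: eqI simp: m o ap cl)
  have "ring ?E"
    by (rule ringI[OF ag mo]) (auto intro!: eqI simp: m ap cl lina)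
  moreover have "module K ?E"
    by (rule moduleI[OF N.R.is_cring ag]) (auto simp: s, auto intro!: eqI simp: m s ap cl N.smult_l_distr N.smult_r_distr N.smult_assoc1)
  ultimately show ?thesis
    unfolding k_algebra_def using K by (auto intro!: eqI simp: m s ap cl lin)
qed

lemma End_memI: "\<lbrakk>module K N; linmap K N N f\<rbrakk> \<Longrightarrow> restrict f (carrier N) \<in> carrier (End_alg K N)"
  by (simp add: End_alg_def linmap_restrict)

definition fun_mod :: "('k, 'r) module \<Rightarrow> ('k, 'i \<Rightarrow> 'r) module" where
  "fun_mod R = \<lparr>carrier = {f. \<forall>p. f p \<in> carrier R}, mult = (\<lambda>f g p. f p \<otimes>\<^bsub>R\<^esub> g p), one = (\<lambda>p. \<one>\<^bsub>R\<^esub>),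
     zero = (\<lambda>p. \<zero>\<^bsub>R\<^esub>), add = (\<lambda>f g p. f p \<oplus>\<^bsub>R\<^esub> g p), smult = (\<lambda>a f p. a \<odot>\<^bsub>R\<^esub> f p)\<rparr>"

lemma fun_mod_simps [simp]: "f \<in> carrier (fun_mod R) \<longleftrightarrow> (\<forall>p. f p \<in> carrier R)"
  "\<zero>\<^bsub>fun_mod R\<^esub> = (\<lambda>p. \<zero>\<^bsub>R\<^esub>)" "f \<oplus>\<^bsub>fun_mod R\<^esub> g = (\<lambda>p. f p \<oplus>\<^bsub>R\<^esub> g p)" "a \<odot>\<^bsub>fun_mod R\<^esub> f = (\<lambda>p. a \<odot>\<^bsub>R\<^esub> f p)"
  by (simp_all add: fun_mod_def)

lemma (in kalg) module_fun_mod: "module K (fun_mod R :: ('k, 'i \<Rightarrow> 'r) module)"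
proof (rule moduleI)
  show "abelian_group (fun_mod R :: ('k, 'i \<Rightarrow> 'r) module)"
  proof (rule abelian_groupI)
    fix f assume "f \<in> carrier (fun_mod R :: ('k, 'i \<Rightarrow> 'r) module)"
    then show "\<exists>g\<in>carrier (fun_mod R). g \<oplus>\<^bsub>fun_mod R\<^esub> f = \<zero>\<^bsub>fun_mod R\<^esub>"
      by (intro bexI[of _ "\<lambda>p. \<ominus>\<^bsub>R\<^esub> f p"]) (auto simp: l_neg)
  qed (auto simp: a_ac)
qed (auto simp: K.is_cring Mod.smult_l_distr Mod.smult_r_distr Mod.smult_assoc1)

section \<open>Generalized ambiskew polynomial algebras\<close>

text \<open>The recursion comes from X Y^(i+1) = (\<xi> Y X + c) Y^i: passing Y over the coefficient
  already found for Y^i applies \<omega> to it and multiplies it by \<xi>.\<close>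

primrec qcoef :: "('k, 'r) module \<Rightarrow> ('r \<Rightarrow> 'r) \<Rightarrow> 'r \<Rightarrow> 'k \<Rightarrow> nat \<Rightarrow> 'r" where
  "qcoef R \<omega> c \<xi> 0 = \<zero>\<^bsub>R\<^esub>"
| "qcoef R \<omega> c \<xi> (Suc i) = c \<oplus>\<^bsub>R\<^esub> \<xi> \<odot>\<^bsub>R\<^esub> \<omega> (qcoef R \<omega> c \<xi> i)"

locale gasl =
  fixes K :: "'k ring" and R :: "('k, 'r) module" and \<tau> \<omega> c \<xi>
  assumes data: "gas_data K R \<tau> \<omega> c \<xi>"
begin

lemma algR: "k_algebra K R" and tau_hom: "\<tau> \<in> alg_hom K R R" and omega_hom: "\<omega> \<in> alg_hom K R R"
  and tau_bij: "bij_betw \<tau> (carrier R) (carrier R)" and omega_bij: "bij_betw \<omega> (carrier R) (carrier R)"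
  and tau_omega: "r \<in> carrier R \<Longrightarrow> \<tau> (\<omega> r) = \<omega> (\<tau> r)"
  and c_closed [simp]: "c \<in> carrier R" and c_comm: "r \<in> carrier R \<Longrightarrow> c \<otimes>\<^bsub>R\<^esub> r = \<tau> (\<omega> r) \<otimes>\<^bsub>R\<^esub> c"
  and xi_closed [simp]: "\<xi> \<in> carrier K" and xi_nz: "\<xi> \<noteq> \<zero>\<^bsub>K\<^esub>"
  using data by (auto simp: gas_data_def alg_iso_def)

sublocale R: kalg K R by (rule kalgI, rule algR)

lemma tau_closed [simp]: "r \<in> carrier R \<Longrightarrow> \<tau> r \<in> carrier R" and omega_closed [simp]: "r \<in> carrier R \<Longrightarrow> \<omega> r \<in> carrier R"
  by (rule alg_homD(1)[OF tau_hom] alg_homD(1)[OF omega_hom], assumption)+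

lemma xi_inv [simp]: "inv\<^bsub>K\<^esub> \<xi> \<in> carrier K" "inv\<^bsub>K\<^esub> \<xi> \<otimes>\<^bsub>K\<^esub> \<xi> = \<one>\<^bsub>K\<^esub>" "\<xi> \<otimes>\<^bsub>K\<^esub> inv\<^bsub>K\<^esub> \<xi> = \<one>\<^bsub>K\<^esub>" "inv\<^bsub>K\<^esub> \<xi> \<noteq> \<zero>\<^bsub>K\<^esub>"
proof -
  have u: "\<xi> \<in> Units K" using xi_nz by (simp add: R.K.field_Units)
  then show "inv\<^bsub>K\<^esub> \<xi> \<in> carrier K" and i: "inv\<^bsub>K\<^esub> \<xi> \<otimes>\<^bsub>K\<^esub> \<xi> = \<one>\<^bsub>K\<^esub>" "\<xi> \<otimes>\<^bsub>K\<^esub> inv\<^bsub>K\<^esub> \<xi> = \<one>\<^bsub>K\<^esub>"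
    by (auto intro: R.K.Units_l_inv R.K.Units_r_inv)
  show "inv\<^bsub>K\<^esub> \<xi> \<noteq> \<zero>\<^bsub>K\<^esub>" using i(1) xi_closed R.K.one_not_zero by auto
qed

abbreviation "A \<equiv> gas K R \<tau> \<omega> c \<xi>"
abbreviation "\<iota> r \<equiv> gas_gen K R \<tau> \<omega> c \<xi> (Coeff r)"
abbreviation "X \<equiv> gas_gen K R \<tau> \<omega> c \<xi> GenX"
abbreviation "Y \<equiv> gas_gen K R \<tau> \<omega> c \<xi> GenY"
abbreviation "WM \<equiv> word_monoid R"
abbreviation "FP \<equiv> free_prod K R"
abbreviation "e r \<equiv> fp_word K R [Coeff r]"
abbreviation "rels1 \<equiv> free_prod_rels K R"
abbreviation "rels2 \<equiv> {fp_word K R [GenX] \<otimes>\<^bsub>FP\<^esub> e r \<ominus>\<^bsub>FP\<^esub> (e (\<tau> r) \<otimes>\<^bsub>FP\<^esub> fp_word K R [GenX]) | r. r \<in> carrier R} \<union>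
           {fp_word K R [GenY] \<otimes>\<^bsub>FP\<^esub> e r \<ominus>\<^bsub>FP\<^esub> (e (\<omega> r) \<otimes>\<^bsub>FP\<^esub> fp_word K R [GenY]) | r. r \<in> carrier R} \<union>
           {(fp_word K R [GenX] \<otimes>\<^bsub>FP\<^esub> fp_word K R [GenY] \<ominus>\<^bsub>FP\<^esub> (\<xi> \<odot>\<^bsub>FP\<^esub> (fp_word K R [GenY] \<otimes>\<^bsub>FP\<^esub> fp_word K R [GenX]))) \<ominus>\<^bsub>FP\<^esub> e c}"

lemma carrier_WM: "w \<in> carrier WM \<longleftrightarrow> (\<forall>r. Coeff r \<in> set w \<longrightarrow> r \<in> carrier R)"
  and mult_WM: "v \<otimes>\<^bsub>WM\<^esub> w = v @ w" and one_WM: "\<one>\<^bsub>WM\<^esub> = []"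
  by (simp_all add: word_monoid_def)

sublocale W: monalg K WM
  by (rule monalg.intro[OF R.fieldK]) (rule monoidI; auto simp: carrier_WM mult_WM one_WM)

lemma rels1_subset: "rels1 \<subseteq> carrier W.F"
proof -
  interpret F: kalg K W.F by (rule kalgI, rule W.k_algebra_F)
  have s: "\<And>r. r \<in> carrier R \<Longrightarrow> single K [Coeff r] \<in> carrier W.F"
    by (rule W.single_closed) (simp add: carrier_WM)
  show ?thesis
    by (auto simp: free_prod_rels_def Let_def W.smult_closed_F W.mult_closed_F W.add_closed_F s
        intro!: W.FM.minus_closed)
qed

sublocale P: kquot K W.F "Idl\<^bsub>W.F\<^esub> rels1"
proof -
  interpret F: kalg K W.F by (rule kalgI, rule W.k_algebra_F)
  show "kquot K W.F (Idl\<^bsub>W.F\<^esub> rels1)"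
    by (rule kquot.intro, rule F.kalg_axioms, rule kquot_axioms.intro, rule F.genideal_ideal[OF rels1_subset])
qed

lemma FP_alg: "k_algebra K FP"
  using P.k_algebra_Q by (simp add: free_prod_def Let_def)

lemma fp_word_closed: "w \<in> carrier WM \<Longrightarrow> fp_word K R w \<in> carrier FP"
  by (simp add: fp_word_def free_prod_def Let_def P.Q_closed)

lemma rels2_subset: "rels2 \<subseteq> carrier FP"
proof -
  interpret FP: kalg K FP by (rule kalgI, rule FP_alg)
  have "e r \<in> carrier FP" if "r \<in> carrier R" for r using that by (intro fp_word_closed) (simp add: carrier_WM)
  moreover have "fp_word K R [GenX] \<in> carrier FP" "fp_word K R [GenY] \<in> carrier FP"
    by (intro fp_word_closed; simp add: carrier_WM)+
  ultimately show ?thesis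
    by (auto intro!: FP.minus_closed)
qed

lemma gas_ideal_eq: "gas_ideal K R \<tau> \<omega> c \<xi> = Idl\<^bsub>FP\<^esub> rels2"
  by (simp add: gas_ideal_def Let_def)

sublocale G: kquot K FP "gas_ideal K R \<tau> \<omega> c \<xi>"
proof -
  interpret FP: kalg K FP by (rule kalgI, rule FP_alg)
  show "kquot K FP (gas_ideal K R \<tau> \<omega> c \<xi>)"
    by (rule kquot.intro, rule FP.kalg_axioms, rule kquot_axioms.intro)
      (unfold gas_ideal_eq, rule FP.genideal_ideal[OF rels2_subset])
qed

lemma algA: "k_algebra K A"
  using G.k_algebra_Q by (simp add: gas_def)

sublocale A: kalg K A by (rule kalgI, rule algA)

text \<open>The composite of the two quotient maps, from the algebra of words down to A; the
  generators of A are classes of words of length one.\<close>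

definition can where "can f = gas_ideal K R \<tau> \<omega> c \<xi> +>\<^bsub>FP\<^esub> (Idl\<^bsub>W.F\<^esub> rels1 +>\<^bsub>W.F\<^esub> f)"

lemma can_hom: "can \<in> alg_hom K W.F A"
proof -
  have 1: "(\<lambda>f. Idl\<^bsub>W.F\<^esub> rels1 +>\<^bsub>W.F\<^esub> f) \<in> alg_hom K W.F FP"
    using P.proj_hom by (simp add: free_prod_def Let_def)
  have 2: "(\<lambda>f. gas_ideal K R \<tau> \<omega> c \<xi> +>\<^bsub>FP\<^esub> f) \<in> alg_hom K FP A"
    using G.proj_hom by (simp add: gas_def)
  show ?thesis using alg_hom_comp[OF 2 1] by (simp add: can_def[abs_def])
qed

lemma can_surj: "a \<in> carrier A \<Longrightarrow> \<exists>f\<in>carrier W.F. a = can f"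
proof -
  assume "a \<in> carrier A"
  then obtain x where x: "a = gas_ideal K R \<tau> \<omega> c \<xi> +>\<^bsub>FP\<^esub> x" "x \<in> carrier FP"
    using G.carrier_Q by (auto simp: gas_def)
  from x(2) obtain f where "x = Idl\<^bsub>W.F\<^esub> rels1 +>\<^bsub>W.F\<^esub> f" "f \<in> carrier W.F"
    using P.carrier_Q by (auto simp: free_prod_def Let_def)
  then show ?thesis using x by (auto simp: can_def)
qed

lemma gen_eq: "gas_gen K R \<tau> \<omega> c \<xi> x = can (single K [x])"
  by (simp add: gas_gen_def can_def fp_word_def Let_def)

lemma e_closed: "r \<in> carrier R \<Longrightarrow> single K [Coeff r] \<in> carrier W.F" "single K [GenX] \<in> carrier W.F" "single K [GenY] \<in> carrier W.F"
  by (auto intro!: W.single_closed simp: carrier_WM)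

lemma iota_closed [simp]: "r \<in> carrier R \<Longrightarrow> \<iota> r \<in> carrier A" and X_closed [simp]: "X \<in> carrier A" and Y_closed [simp]: "Y \<in> carrier A"
  unfolding gen_eq by (rule alg_homD(1)[OF can_hom], erule e_closed, rule alg_homD(1)[OF can_hom], rule e_closed,
    rule alg_homD(1)[OF can_hom], rule e_closed)

lemma rels1I:
  "\<lbrakk>r \<in> carrier R; s \<in> carrier R\<rbrakk> \<Longrightarrow>
    single K [Coeff (r \<oplus>\<^bsub>R\<^esub> s)] \<ominus>\<^bsub>W.F\<^esub> (single K [Coeff r] \<oplus>\<^bsub>W.F\<^esub> single K [Coeff s]) \<in> rels1"
  "\<lbrakk>a \<in> carrier K; r \<in> carrier R\<rbrakk> \<Longrightarrow>
    single K [Coeff (a \<odot>\<^bsub>R\<^esub> r)] \<ominus>\<^bsub>W.F\<^esub> (a \<odot>\<^bsub>W.F\<^esub> single K [Coeff r]) \<in> rels1"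
  "\<lbrakk>r \<in> carrier R; s \<in> carrier R\<rbrakk> \<Longrightarrow>
    single K [Coeff (r \<otimes>\<^bsub>R\<^esub> s)] \<ominus>\<^bsub>W.F\<^esub> (single K [Coeff r] \<otimes>\<^bsub>W.F\<^esub> single K [Coeff s]) \<in> rels1"
  "single K [Coeff \<one>\<^bsub>R\<^esub>] \<ominus>\<^bsub>W.F\<^esub> \<one>\<^bsub>W.F\<^esub> \<in> rels1"
  unfolding free_prod_rels_def Let_def by blast+

lemma can_eq1:
  assumes "f \<ominus>\<^bsub>W.F\<^esub> g \<in> rels1" "f \<in> carrier W.F" "g \<in> carrier W.F"
  shows "can f = can g"
proof -
  have "f \<ominus>\<^bsub>W.F\<^esub> g \<in> Idl\<^bsub>W.F\<^esub> rels1" using P.genideal_self[OF rels1_subset] assms(1) by blast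
  then show ?thesis unfolding can_def using P.coset_eqI[OF assms(2,3)] by simp
qed

lemma iota_hom: "(\<lambda>r. \<iota> r) \<in> alg_hom K R A"
proof (rule alg_homI[OF linmapI])
  fix r s a assume r: "r \<in> carrier R"
  show "\<iota> r \<in> carrier A" using r by simp
  { assume s: "s \<in> carrier R"
    have "can (single K [Coeff (r \<oplus>\<^bsub>R\<^esub> s)]) = can (single K [Coeff r] \<oplus>\<^bsub>W.F\<^esub> single K [Coeff s])"
      by (rule can_eq1) (use r s in \<open>auto simp: rels1I e_closed W.add_closed_F\<close>)
    then show "\<iota> (r \<oplus>\<^bsub>R\<^esub> s) = \<iota> r \<oplus>\<^bsub>A\<^esub> \<iota> s" using r s by (simp add: gen_eq alg_homD[OF can_hom] e_closed)
    have "can (single K [Coeff (r \<otimes>\<^bsub>R\<^esub> s)]) = can (single K [Coeff r] \<otimes>\<^bsub>W.F\<^esub> single K [Coeff s])"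
      by (rule can_eq1) (use r s in \<open>auto simp: rels1I e_closed W.mult_closed_F\<close>)
    then show "\<iota> (r \<otimes>\<^bsub>R\<^esub> s) = \<iota> r \<otimes>\<^bsub>A\<^esub> \<iota> s" using r s by (simp add: gen_eq alg_homD[OF can_hom] e_closed) }
  assume a: "a \<in> carrier K"
  have "can (single K [Coeff (a \<odot>\<^bsub>R\<^esub> r)]) = can (a \<odot>\<^bsub>W.F\<^esub> single K [Coeff r])"
    by (rule can_eq1) (use r a in \<open>auto simp: rels1I e_closed W.smult_closed_F\<close>)
  then show "\<iota> (a \<odot>\<^bsub>R\<^esub> r) = a \<odot>\<^bsub>A\<^esub> \<iota> r" using r a by (simp add: gen_eq alg_homD[OF can_hom] e_closed)
next
  have "can (single K [Coeff \<one>\<^bsub>R\<^esub>]) = can \<one>\<^bsub>W.F\<^esub>"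
    by (rule can_eq1[OF rels1I(4)]) (auto simp: e_closed W.one_F one_WM carrier_WM intro!: W.single_closed)
  then show "\<iota> \<one>\<^bsub>R\<^esub> = \<one>\<^bsub>A\<^esub>" by (simp add: gen_eq alg_homD[OF can_hom])
qed

lemma iota_simps: "\<lbrakk>r \<in> carrier R; s \<in> carrier R\<rbrakk> \<Longrightarrow> \<iota> (r \<oplus>\<^bsub>R\<^esub> s) = \<iota> r \<oplus>\<^bsub>A\<^esub> \<iota> s"
  "\<lbrakk>r \<in> carrier R; s \<in> carrier R\<rbrakk> \<Longrightarrow> \<iota> (r \<otimes>\<^bsub>R\<^esub> s) = \<iota> r \<otimes>\<^bsub>A\<^esub> \<iota> s" "\<iota> \<one>\<^bsub>R\<^esub> = \<one>\<^bsub>A\<^esub>"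
  "\<lbrakk>a \<in> carrier K; r \<in> carrier R\<rbrakk> \<Longrightarrow> \<iota> (a \<odot>\<^bsub>R\<^esub> r) = a \<odot>\<^bsub>A\<^esub> \<iota> r"
  by (rule alg_homD[OF iota_hom]; assumption)+

lemma fp_closed: "r \<in> carrier R \<Longrightarrow> e r \<in> carrier FP" "fp_word K R [GenX] \<in> carrier FP" "fp_word K R [GenY] \<in> carrier FP"
  by (auto intro!: fp_word_closed simp: carrier_WM)

lemma G_eq:
  assumes "f \<ominus>\<^bsub>FP\<^esub> g \<in> rels2" "f \<in> carrier FP" "g \<in> carrier FP"
  shows "gas_ideal K R \<tau> \<omega> c \<xi> +>\<^bsub>FP\<^esub> f = gas_ideal K R \<tau> \<omega> c \<xi> +>\<^bsub>FP\<^esub> g"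
proof -
  have "f \<ominus>\<^bsub>FP\<^esub> g \<in> gas_ideal K R \<tau> \<omega> c \<xi>" unfolding gas_ideal_eq
    using G.genideal_self[OF rels2_subset] assms(1) by blast
  then show ?thesis by (rule G.coset_eqI[OF assms(2,3)])
qed

lemma X_iota: "r \<in> carrier R \<Longrightarrow> X \<otimes>\<^bsub>A\<^esub> \<iota> r = \<iota> (\<tau> r) \<otimes>\<^bsub>A\<^esub> X"
  and Y_iota: "r \<in> carrier R \<Longrightarrow> Y \<otimes>\<^bsub>A\<^esub> \<iota> r = \<iota> (\<omega> r) \<otimes>\<^bsub>A\<^esub> Y"
  and XY_eq: "X \<otimes>\<^bsub>A\<^esub> Y = \<xi> \<odot>\<^bsub>A\<^esub> (Y \<otimes>\<^bsub>A\<^esub> X) \<oplus>\<^bsub>A\<^esub> \<iota> c"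
proof -
  let ?g = "\<lambda>f. gas_ideal K R \<tau> \<omega> c \<xi> +>\<^bsub>FP\<^esub> f"
  have h: "?g \<in> alg_hom K FP A" using G.proj_hom by (simp add: gas_def)
  have g: "gas_gen K R \<tau> \<omega> c \<xi> x = ?g (fp_word K R [x])" for x by (simp add: gas_gen_def)
  { fix r assume r: "r \<in> carrier R"
    have "?g (fp_word K R [GenX] \<otimes>\<^bsub>FP\<^esub> e r) = ?g (e (\<tau> r) \<otimes>\<^bsub>FP\<^esub> fp_word K R [GenX])"
      by (rule G_eq) (use r in \<open>auto simp: fp_closed\<close>)
    then show "X \<otimes>\<^bsub>A\<^esub> \<iota> r = \<iota> (\<tau> r) \<otimes>\<^bsub>A\<^esub> X" using r by (simp add: g alg_homD[OF h] fp_closed)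
    have "?g (fp_word K R [GenY] \<otimes>\<^bsub>FP\<^esub> e r) = ?g (e (\<omega> r) \<otimes>\<^bsub>FP\<^esub> fp_word K R [GenY])"
      by (rule G_eq) (use r in \<open>auto simp: fp_closed\<close>)
    then show "Y \<otimes>\<^bsub>A\<^esub> \<iota> r = \<iota> (\<omega> r) \<otimes>\<^bsub>A\<^esub> Y" using r by (simp add: g alg_homD[OF h] fp_closed) }
  have "?g (fp_word K R [GenX] \<otimes>\<^bsub>FP\<^esub> fp_word K R [GenY] \<ominus>\<^bsub>FP\<^esub> (\<xi> \<odot>\<^bsub>FP\<^esub> (fp_word K R [GenY] \<otimes>\<^bsub>FP\<^esub> fp_word K R [GenX]))) = ?g (e c)"
    by (rule G_eq) (auto simp: fp_closed)
  then have "X \<otimes>\<^bsub>A\<^esub> Y \<ominus>\<^bsub>A\<^esub> \<xi> \<odot>\<^bsub>A\<^esub> (Y \<otimes>\<^bsub>A\<^esub> X) = \<iota> c"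
    by (simp add: g alg_homD[OF h] fp_closed linmap_minus[OF alg_hom_linmap[OF h] G.moduleR A.moduleR])
  moreover have "\<iota> c \<in> carrier A" "\<xi> \<odot>\<^bsub>A\<^esub> (Y \<otimes>\<^bsub>A\<^esub> X) \<in> carrier A" "X \<otimes>\<^bsub>A\<^esub> Y \<in> carrier A" by simp_all
  ultimately show "X \<otimes>\<^bsub>A\<^esub> Y = \<xi> \<odot>\<^bsub>A\<^esub> (Y \<otimes>\<^bsub>A\<^esub> X) \<oplus>\<^bsub>A\<^esub> \<iota> c"
    by (metis A.a_assoc A.a_comm A.a_inv_closed a_minus_def A.l_neg A.l_zero A.a_closed)
qed

lemma can_word: "w \<in> carrier WM \<Longrightarrow> can (single K w) = foldr (\<lambda>x a. gas_gen K R \<tau> \<omega> c \<xi> x \<otimes>\<^bsub>A\<^esub> a) w \<one>\<^bsub>A\<^esub>"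
proof (induction w)
  case Nil
  then show ?case using alg_homD(4)[OF can_hom] by (simp add: W.one_F one_WM)
next
  case (Cons x w)
  then have "[x] \<in> carrier WM" "w \<in> carrier WM" by (auto simp: carrier_WM)
  moreover from this have "single K (x # w) = single K [x] \<otimes>\<^bsub>W.F\<^esub> single K w"
    by (simp add: W.mult_single mult_WM)
  ultimately show ?case using Cons.IH by (simp add: gen_eq alg_homD[OF can_hom])
qed

text \<open>Words are built by prepending letters and their classes span A, so stability under left
  multiplication by generators is enough.\<close>

lemma gas_induct:
  assumes S: "submodule S K A" and one: "\<one>\<^bsub>A\<^esub> \<in> S"
    and i: "\<And>r a. \<lbrakk>r \<in> carrier R; a \<in> S\<rbrakk> \<Longrightarrow> \<iota> r \<otimes>\<^bsub>A\<^esub> a \<in> S"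
    and x: "\<And>a. a \<in> S \<Longrightarrow> X \<otimes>\<^bsub>A\<^esub> a \<in> S" and y: "\<And>a. a \<in> S \<Longrightarrow> Y \<otimes>\<^bsub>A\<^esub> a \<in> S"
    and a: "a \<in> carrier A"
  shows "a \<in> S"
proof -
  obtain f where f: "f \<in> carrier W.F" "a = can f" using can_surj[OF a] by blast
  have w: "can (single K w) \<in> S" if "w \<in> carrier WM" for w
    unfolding can_word[OF that] using that
  proof (induction w)
    case (Cons g w)
    then have "w \<in> carrier WM" by (auto simp: carrier_WM)
    then show ?case using Cons by (cases g) (auto simp: carrier_WM intro: i x y)
  qed (simp add: one)
  show ?thesis
    using W.submodule_F_eq[OF linmap_vimage[OF alg_hom_linmap[OF can_hom] W.module_F A.moduleR S] _ f(1)] w f by simp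
qed

text \<open>Words are evaluated multiplicatively in \<open>B\<close>. Since kernels are ideals, it
  is enough that the defining relations go to zero, once for the free product and once for the
  ambiskew relations.\<close>

lemma gas_univ:
  assumes B: "k_algebra K B" and f: "f \<in> alg_hom K R B" and x: "x \<in> carrier B" and y: "y \<in> carrier B"
    and xr: "\<And>r. r \<in> carrier R \<Longrightarrow> x \<otimes>\<^bsub>B\<^esub> f r = f (\<tau> r) \<otimes>\<^bsub>B\<^esub> x"
    and yr: "\<And>r. r \<in> carrier R \<Longrightarrow> y \<otimes>\<^bsub>B\<^esub> f r = f (\<omega> r) \<otimes>\<^bsub>B\<^esub> y"
    and xy: "x \<otimes>\<^bsub>B\<^esub> y = \<xi> \<odot>\<^bsub>B\<^esub> (y \<otimes>\<^bsub>B\<^esub> x) \<oplus>\<^bsub>B\<^esub> f c"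
  obtains \<psi> where "\<psi> \<in> alg_hom K A B" "\<And>r. r \<in> carrier R \<Longrightarrow> \<psi> (\<iota> r) = f r" "\<psi> X = x" "\<psi> Y = y"
proof -
  interpret B: kalg K B by (rule kalgI) fact
  define v where "v = case_gen f x y"
  have v: "v (Coeff r) = f r" "v GenX = x" "v GenY = y" for r by (simp_all add: v_def)
  note fD = alg_homD[OF f]
  define wd where "wd w = foldr (\<lambda>g a. v g \<otimes>\<^bsub>B\<^esub> a) w \<one>\<^bsub>B\<^esub>" for w
  have wd_closed: "wd w \<in> carrier B" if "w \<in> carrier WM" for w
    using that
  proof (induction w)
    case (Cons g w)
    then have "w \<in> carrier WM" by (auto simp: carrier_WM)
    then show ?case using Cons x y by (cases g) (auto simp: wd_def v carrier_WM fD)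
  qed (simp add: wd_def)
  have wd_mult: "wd (u @ w) = wd u \<otimes>\<^bsub>B\<^esub> wd w" if "u \<in> carrier WM" "w \<in> carrier WM" for u w
    using that(1)
  proof (induction u)
    case Nil then show ?case using wd_closed[OF that(2)] by (simp add: wd_def)
  next
    case (Cons g u)
    then have u: "u \<in> carrier WM" by (auto simp: carrier_WM)
    have "v g \<in> carrier B" using Cons x y by (cases g) (auto simp: v carrier_WM fD)
    moreover have "foldr (\<lambda>g. (\<otimes>\<^bsub>B\<^esub>) (v g)) u \<one>\<^bsub>B\<^esub> \<in> carrier B" "foldr (\<lambda>g. (\<otimes>\<^bsub>B\<^esub>) (v g)) w \<one>\<^bsub>B\<^esub> \<in> carrier B"
      using wd_closed u that(2) by (auto simp: wd_def)
    ultimately show ?case using Cons.IH u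
      by (simp add: wd_def B.m_assoc)
  qed
  let ?l = "lext K B wd"
  have l: "?l \<in> alg_hom K W.F B"
    by (rule W.alg_hom_lext[OF B]) (auto simp: wd_closed wd_mult mult_WM one_WM, simp add: wd_def)
  have ls: "?l (single K [g]) = v g" if "[g] \<in> carrier WM" for g
    using W.lext_single[of B wd "[g]", OF B.moduleR wd_closed that] that x y by (cases g) (auto simp: wd_def v carrier_WM fD)
  note lm = linmap_minus[OF alg_hom_linmap[OF l] W.module_F B.moduleR]
  have wc: "[Coeff r] \<in> carrier WM \<longleftrightarrow> r \<in> carrier R" "[GenX] \<in> carrier WM" "[GenY] \<in> carrier WM" for r
    by (auto simp: carrier_WM)
  have "rels1 \<subseteq> {z \<in> carrier W.F. ?l z = \<zero>\<^bsub>B\<^esub>}"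
  proof
    fix z assume z: "z \<in> rels1"
    have "?l z = \<zero>\<^bsub>B\<^esub>"
      using z unfolding free_prod_rels_def Let_def
      by (auto simp: lm e_closed W.add_closed_F W.smult_closed_F W.mult_closed_F alg_homD[OF l] ls wc v fD B.diff_eq_zero_iff
          W.one_F[symmetric])
    then show "z \<in> {z \<in> carrier W.F. ?l z = \<zero>\<^bsub>B\<^esub>}" using z rels1_subset by blast
  qed
  then have I1: "z \<in> Idl\<^bsub>W.F\<^esub> rels1 \<Longrightarrow> ?l z = \<zero>\<^bsub>B\<^esub>" for z
    using P.genideal_minimal[OF alg_hom_kernel_ideal[OF l W.k_algebra_F B]] by blast
  let ?m = "qlift ?l"
  have m: "?m \<in> alg_hom K FP B"
    using P.alg_hom_qlift[OF l B I1] by (simp add: free_prod_def Let_def)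
  have ms: "?m (fp_word K R [g]) = v g" if "[g] \<in> carrier WM" for g
    using P.qlift_coset[OF alg_hom_linmap[OF l] B.moduleR I1, of "single K [g]"] that
    by (simp add: fp_word_def Let_def ls)
  note mm = linmap_minus[OF alg_hom_linmap[OF m] G.moduleR B.moduleR]
  have "rels2 \<subseteq> {z \<in> carrier FP. ?m z = \<zero>\<^bsub>B\<^esub>}"
  proof
    fix z assume z: "z \<in> rels2"
    have q: "(\<xi> \<odot>\<^bsub>B\<^esub> (y \<otimes>\<^bsub>B\<^esub> x) \<oplus>\<^bsub>B\<^esub> f c) \<ominus>\<^bsub>B\<^esub> \<xi> \<odot>\<^bsub>B\<^esub> (y \<otimes>\<^bsub>B\<^esub> x) = f c"
      using x y by (simp add: fD a_minus_def B.a_ac B.r_neg B.r_neg1 B.r_neg2)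
    have "?m z = \<zero>\<^bsub>B\<^esub>"
      using z by (auto simp: mm fp_closed alg_homD[OF m] ms wc v fD x y xr yr B.diff_eq_zero_iff)
         (simp add: xy q)
    then show "z \<in> {z \<in> carrier FP. ?m z = \<zero>\<^bsub>B\<^esub>}" using z rels2_subset by blast
  qed
  then have I2: "z \<in> gas_ideal K R \<tau> \<omega> c \<xi> \<Longrightarrow> ?m z = \<zero>\<^bsub>B\<^esub>" for z
    unfolding gas_ideal_eq
    using G.genideal_minimal[OF alg_hom_kernel_ideal[OF m FP_alg B]] by blast
  have n: "qlift ?m \<in> alg_hom K A B"
    using G.alg_hom_qlift[OF m B I2] by (simp add: gas_def)
  have ns: "qlift ?m (gas_gen K R \<tau> \<omega> c \<xi> g) = v g" if "[g] \<in> carrier WM" for g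
    using G.qlift_coset[OF alg_hom_linmap[OF m] B.moduleR I2, of "fp_word K R [g]"] that
    by (simp add: gas_gen_def ms fp_word_closed)
  show ?thesis
    by (rule that[OF n]) (simp_all add: ns wc v)
qed

lemma gas_hom_eqI:
  assumes f: "f \<in> alg_hom K A B" and g: "g \<in> alg_hom K A B" and B: "k_algebra K B"
    and "\<And>r. r \<in> carrier R \<Longrightarrow> f (\<iota> r) = g (\<iota> r)" "f X = g X" "f Y = g Y" and a: "a \<in> carrier A"
  shows "f a = g a"
proof -
  interpret B: kalg K B by (rule kalgI) fact
  have "a \<in> {a \<in> carrier A. f a = g a}"
    by (rule gas_induct[OF linmap_equalizer[OF alg_hom_linmap[OF f] alg_hom_linmap[OF g] A.moduleR B.moduleR]])
      (use assms(4-) in \<open>auto simp: alg_homD[OF f] alg_homD[OF g]\<close>)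
  then show ?thesis by simp
qed

end

lemma End_restrict:
  assumes N: "module K N"
  shows End_mult_restrict: "linmap K N N g \<Longrightarrow>
      restrict f (carrier N) \<otimes>\<^bsub>End_alg K N\<^esub> restrict g (carrier N) = restrict (\<lambda>x. f (g x)) (carrier N)"
    and End_add_restrict: "restrict f (carrier N) \<oplus>\<^bsub>End_alg K N\<^esub> restrict g (carrier N) = restrict (\<lambda>x. f x \<oplus>\<^bsub>N\<^esub> g x) (carrier N)"
    and End_smult_restrict: "a \<odot>\<^bsub>End_alg K N\<^esub> restrict f (carrier N) = restrict (\<lambda>x. a \<odot>\<^bsub>N\<^esub> f x) (carrier N)"
    and End_one_restrict: "\<one>\<^bsub>End_alg K N\<^esub> = restrict (\<lambda>x. x) (carrier N)"
  by (auto simp: End_alg_def linmap_def fun_eq_iff)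

context gasl
begin

section \<open>The representation on arrays of coefficients\<close>

lemma tau_simps: "\<lbrakk>r \<in> carrier R; s \<in> carrier R\<rbrakk> \<Longrightarrow> \<tau> (r \<oplus>\<^bsub>R\<^esub> s) = \<tau> r \<oplus>\<^bsub>R\<^esub> \<tau> s"
  "\<lbrakk>r \<in> carrier R; s \<in> carrier R\<rbrakk> \<Longrightarrow> \<tau> (r \<otimes>\<^bsub>R\<^esub> s) = \<tau> r \<otimes>\<^bsub>R\<^esub> \<tau> s" "\<tau> \<one>\<^bsub>R\<^esub> = \<one>\<^bsub>R\<^esub>"
  "\<lbrakk>a \<in> carrier K; r \<in> carrier R\<rbrakk> \<Longrightarrow> \<tau> (a \<odot>\<^bsub>R\<^esub> r) = a \<odot>\<^bsub>R\<^esub> \<tau> r"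
  by (rule alg_homD[OF tau_hom]; assumption)+

lemma omega_simps: "\<lbrakk>r \<in> carrier R; s \<in> carrier R\<rbrakk> \<Longrightarrow> \<omega> (r \<oplus>\<^bsub>R\<^esub> s) = \<omega> r \<oplus>\<^bsub>R\<^esub> \<omega> s"
  "\<lbrakk>r \<in> carrier R; s \<in> carrier R\<rbrakk> \<Longrightarrow> \<omega> (r \<otimes>\<^bsub>R\<^esub> s) = \<omega> r \<otimes>\<^bsub>R\<^esub> \<omega> s" "\<omega> \<one>\<^bsub>R\<^esub> = \<one>\<^bsub>R\<^esub>"
  "\<lbrakk>a \<in> carrier K; r \<in> carrier R\<rbrakk> \<Longrightarrow> \<omega> (a \<odot>\<^bsub>R\<^esub> r) = a \<odot>\<^bsub>R\<^esub> \<omega> r"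
  by (rule alg_homD[OF omega_hom]; assumption)+

lemma tau_zero [simp]: "\<tau> \<zero>\<^bsub>R\<^esub> = \<zero>\<^bsub>R\<^esub>" and omega_zero [simp]: "\<omega> \<zero>\<^bsub>R\<^esub> = \<zero>\<^bsub>R\<^esub>"
  using linmap_zero[OF alg_hom_linmap[OF tau_hom]] linmap_zero[OF alg_hom_linmap[OF omega_hom]] R.moduleR by auto

abbreviation "qc i \<equiv> qcoef R \<omega> c \<xi> i"

lemma qc_closed [simp]: "qc i \<in> carrier R"
  by (induction i) auto

lemma xi_pow [simp]: "\<xi> [^]\<^bsub>K\<^esub> (n::nat) \<in> carrier K"
  by simp

text \<open>The action of \<open>X\<close> and \<open>Y\<close> by left multiplication on \<open>\<Sum> f(i,j) Y\<^sup>iX\<^sup>j\<close>; here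
  \<open>X Y\<^sup>i = \<xi>\<^sup>i Y\<^sup>i X + qc i Y\<^sup>i\<^sup>-\<^sup>1\<close>.\<close>

definition opX :: "(nat \<times> nat \<Rightarrow> 'r) \<Rightarrow> nat \<times> nat \<Rightarrow> 'r" where
  "opX f = (\<lambda>(i, j). (case j of 0 \<Rightarrow> \<zero>\<^bsub>R\<^esub> | Suc j' \<Rightarrow> (\<xi> [^]\<^bsub>K\<^esub> i) \<odot>\<^bsub>R\<^esub> \<tau> (f (i, j'))) \<oplus>\<^bsub>R\<^esub> \<tau> (f (Suc i, j)) \<otimes>\<^bsub>R\<^esub> qc (Suc i))"

definition opY :: "(nat \<times> nat \<Rightarrow> 'r) \<Rightarrow> nat \<times> nat \<Rightarrow> 'r" where
  "opY f = (\<lambda>(i, j). case i of 0 \<Rightarrow> \<zero>\<^bsub>R\<^esub> | Suc i' \<Rightarrow> \<omega> (f (i', j)))"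

lemma linmap_opX: "linmap K (fun_mod R) (fun_mod R) opX"
  by (rule linmapI)
    (auto simp: opX_def fun_eq_iff tau_simps R.l_distr R.Mod.smult_r_distr R.a_ac R.Mod.smult_assoc1[symmetric] R.K.m_comm
       R.smult_mult_l split: nat.splits simp del: qcoef.simps)

lemma linmap_opY: "linmap K (fun_mod R) (fun_mod R) opY"
  by (rule linmapI) (auto simp: opY_def fun_eq_iff omega_simps split: nat.splits)

lemma linmap_opR: "r \<in> carrier R \<Longrightarrow> linmap K (fun_mod R) (fun_mod R) (\<lambda>f p. r \<otimes>\<^bsub>R\<^esub> f p)"
  by (rule linmapI) (auto simp: fun_eq_iff R.r_distr R.smult_mult_r)

text \<open>This is the one relation of A whose validity for the operators is not formal. The
  operator for X leaves \<tau>(\<omega>(r)) to the left of \<open>c\<close>, and the commutation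
  rule of \<open>c\<close> turns this into cr.\<close>

lemma opX_opY:
  assumes f: "\<And>p. f p \<in> carrier R"
  shows "opX (opY f) p = \<xi> \<odot>\<^bsub>R\<^esub> opY (opX f) p \<oplus>\<^bsub>R\<^esub> c \<otimes>\<^bsub>R\<^esub> f p"
proof (cases p)
  case (Pair i j)
  have 1: "c \<otimes>\<^bsub>R\<^esub> f (i, j) = \<tau> (\<omega> (f (i, j))) \<otimes>\<^bsub>R\<^esub> c" using f c_comm by simp
  show ?thesis
  proof (cases i)
    \<comment> \<open>Only the second term of \<open>opX\<close> survives, and
      \<open>qc (Suc 0)\<close> equals \<open>c\<close> because the recursion starts at
      zero.\<close>
    case 0
    then show ?thesis using f 1 by (auto simp: Pair opX_def opY_def split: nat.splits)
  next
    case (Suc k)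
    let ?u = "case j of 0 \<Rightarrow> \<zero>\<^bsub>R\<^esub> | Suc j' \<Rightarrow> (\<xi> [^]\<^bsub>K\<^esub> k) \<odot>\<^bsub>R\<^esub> \<omega> (\<tau> (f (k, j')))"
    have u: "?u \<in> carrier R" using f by (auto split: nat.splits)
    have L: "opX (opY f) p = \<xi> \<odot>\<^bsub>R\<^esub> ?u \<oplus>\<^bsub>R\<^esub> \<tau> (\<omega> (f (i, j))) \<otimes>\<^bsub>R\<^esub> (c \<oplus>\<^bsub>R\<^esub> \<xi> \<odot>\<^bsub>R\<^esub> \<omega> (qc i))"
      using f by (auto simp: Pair Suc opX_def opY_def tau_omega R.Mod.smult_assoc1[symmetric] R.K.m_comm split: nat.splits)
    have "opY (opX f) p = ?u \<oplus>\<^bsub>R\<^esub> \<omega> (\<tau> (f (i, j))) \<otimes>\<^bsub>R\<^esub> \<omega> (qc i)"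
      using f by (auto simp: Pair Suc opX_def opY_def omega_simps simp del: qcoef.simps split: nat.splits)
    then show ?thesis unfolding L using f u
      by (simp add: Pair 1 R.r_distr R.smult_mult_r R.Mod.smult_r_distr tau_omega R.a_ac del: qcoef.simps)
  qed
qed

text \<open>Independence of the monomials without a confluence argument: A acts on arrays, and the
  coefficients of \<open>a\<close> are the entries of \<open>a\<close> applied to the array of 1,
  which has its only nonzero entry at (0, 0).\<close>

lemma ex_coefficients:
  obtains p :: "('r gen list \<Rightarrow> 'k) set set \<Rightarrow> nat \<Rightarrow> nat \<Rightarrow> 'r" where
    "\<And>i j. linmap K A R (\<lambda>a. p a i j)"
    "\<And>r a i j. \<lbrakk>r \<in> carrier R; a \<in> carrier A\<rbrakk> \<Longrightarrow> p (\<iota> r \<otimes>\<^bsub>A\<^esub> a) i j = r \<otimes>\<^bsub>R\<^esub> p a i j"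
    "\<And>a i j. a \<in> carrier A \<Longrightarrow> p (Y \<otimes>\<^bsub>A\<^esub> a) i j = (case i of 0 \<Rightarrow> \<zero>\<^bsub>R\<^esub> | Suc i' \<Rightarrow> \<omega> (p a i' j))"
    "\<And>a i j. a \<in> carrier A \<Longrightarrow> p (X \<otimes>\<^bsub>A\<^esub> a) i j =
       (case j of 0 \<Rightarrow> \<zero>\<^bsub>R\<^esub> | Suc j' \<Rightarrow> (\<xi> [^]\<^bsub>K\<^esub> i) \<odot>\<^bsub>R\<^esub> \<tau> (p a i j')) \<oplus>\<^bsub>R\<^esub> \<tau> (p a (Suc i) j) \<otimes>\<^bsub>R\<^esub> qc (Suc i)"
    "\<And>i j. p \<one>\<^bsub>A\<^esub> i j = (if i = 0 \<and> j = 0 then \<one>\<^bsub>R\<^esub> else \<zero>\<^bsub>R\<^esub>)"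
proof -
  let ?N = "fun_mod R :: ('k, nat \<times> nat \<Rightarrow> 'r) module"
  let ?B = "End_alg K ?N"
  have N: "module K ?N" by (rule R.module_fun_mod)
  have B: "k_algebra K ?B" by (rule k_algebra_End[OF R.fieldK N])
  interpret N: module K ?N by (rule N)
  let ?r = "\<lambda>f. restrict f (carrier ?N)"
  let ?f = "\<lambda>r. ?r (\<lambda>g p. r \<otimes>\<^bsub>R\<^esub> g p)"
  note E = End_mult_restrict[OF N] End_add_restrict[OF N] End_smult_restrict[OF N] End_one_restrict[OF N]
  have f: "?f \<in> alg_hom K R ?B"
  proof (rule alg_homI[OF linmapI])
    fix r assume r: "r \<in> carrier R"
    show "?f r \<in> carrier ?B" by (rule End_memI[OF N linmap_opR[OF r]])
  qed (auto simp: E linmap_opR intro!: restrict_ext, auto simp: R.l_distr R.smult_mult_l R.m_assoc)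
  obtain \<rho> where \<rho>: "\<rho> \<in> alg_hom K A ?B" and \<rho>g: "\<And>r. r \<in> carrier R \<Longrightarrow> \<rho> (\<iota> r) = ?f r" "\<rho> X = ?r opX" "\<rho> Y = ?r opY"
  proof (rule gas_univ[OF B f End_memI[OF N linmap_opX] End_memI[OF N linmap_opY]])
    fix r assume r: "r \<in> carrier R"
    show "?r opX \<otimes>\<^bsub>?B\<^esub> ?f r = ?f (\<tau> r) \<otimes>\<^bsub>?B\<^esub> ?r opX"
      using r by (auto simp: E linmap_opR linmap_opX intro!: restrict_ext)
        (auto simp: opX_def fun_eq_iff tau_simps R.r_distr R.m_assoc R.smult_mult_r simp del: qcoef.simps split: nat.splits)
    show "?r opY \<otimes>\<^bsub>?B\<^esub> ?f r = ?f (\<omega> r) \<otimes>\<^bsub>?B\<^esub> ?r opY"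
      using r by (auto simp: E linmap_opR linmap_opY intro!: restrict_ext)
        (auto simp: opY_def fun_eq_iff omega_simps split: nat.splits)
  next
    show "?r opX \<otimes>\<^bsub>?B\<^esub> ?r opY = \<xi> \<odot>\<^bsub>?B\<^esub> (?r opY \<otimes>\<^bsub>?B\<^esub> ?r opX) \<oplus>\<^bsub>?B\<^esub> ?f c"
    proof -
      have "opX (opY g) = (\<lambda>p. \<xi> \<odot>\<^bsub>R\<^esub> opY (opX g) p \<oplus>\<^bsub>R\<^esub> c \<otimes>\<^bsub>R\<^esub> g p)" if "g \<in> carrier ?N" for g
        by (rule ext, rule opX_opY) (use that in \<open>metis fun_mod_simps(1)\<close>)
      then show ?thesis by (simp add: E linmap_opX linmap_opY cong: restrict_cong)
    qed
  qed blast
  note \<rho>D = alg_homD[OF \<rho>]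
  have ap: "\<rho> a g \<in> carrier ?N" if "a \<in> carrier A" "g \<in> carrier ?N" for a g
    using \<rho>D(1)[OF that(1)] that(2) by (auto simp: End_alg_def linmap_def)
  define d :: "nat \<times> nat \<Rightarrow> 'r" where "d = (\<lambda>q. if q = (0, 0) then \<one>\<^bsub>R\<^esub> else \<zero>\<^bsub>R\<^esub>)"
  have d: "d \<in> carrier ?N" by (simp add: d_def)
  define p where "p a i j = \<rho> a d (i, j)" for a i j
  have m: "\<rho> (b \<otimes>\<^bsub>A\<^esub> a) d = \<rho> b (\<rho> a d)" if "b \<in> carrier A" "a \<in> carrier A" for a b
    using that d by (simp add: \<rho>D) (simp add: End_alg_def)
  show ?thesis
  proof (rule that[of p])
    fix i j
    show "linmap K A R (\<lambda>a. p a i j)"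
      unfolding p_def
    proof (rule linmapI)
      fix a assume a: "a \<in> carrier A"
      show "\<rho> a d (i, j) \<in> carrier R" using ap[OF a d] by simp
    qed (use d in \<open>simp_all add: \<rho>D\<close>, simp_all add: End_alg_def)
    show "p \<one>\<^bsub>A\<^esub> i j = (if i = 0 \<and> j = 0 then \<one>\<^bsub>R\<^esub> else \<zero>\<^bsub>R\<^esub>)"
      using d by (simp add: p_def \<rho>D) (simp add: End_alg_def d_def)
    fix a assume a: "a \<in> carrier A"
    note am = ap[OF a d]
    show "p (Y \<otimes>\<^bsub>A\<^esub> a) i j = (case i of 0 \<Rightarrow> \<zero>\<^bsub>R\<^esub> | Suc i' \<Rightarrow> \<omega> (p a i' j))"
      using am a by (simp add: p_def m \<rho>g opY_def split: nat.split)
    show "p (X \<otimes>\<^bsub>A\<^esub> a) i j =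
       (case j of 0 \<Rightarrow> \<zero>\<^bsub>R\<^esub> | Suc j' \<Rightarrow> (\<xi> [^]\<^bsub>K\<^esub> i) \<odot>\<^bsub>R\<^esub> \<tau> (p a i j')) \<oplus>\<^bsub>R\<^esub> \<tau> (p a (Suc i) j) \<otimes>\<^bsub>R\<^esub> qc (Suc i)"
      using am a by (simp add: p_def m \<rho>g opX_def del: qcoef.simps split: nat.split)
    fix r assume r: "r \<in> carrier R"
    show "p (\<iota> r \<otimes>\<^bsub>A\<^esub> a) i j = r \<otimes>\<^bsub>R\<^esub> p a i j"
      using am a r by (simp add: p_def m \<rho>g)
  qed
qed

text \<open>Solving XY - \<xi>YX = c for the other order gives YX - \<xi>^-1 XY = -\<xi>^-1 c, whose
  right-hand side is this element.\<close>

definition swapc where "swapc = (\<ominus>\<^bsub>K\<^esub> (inv\<^bsub>K\<^esub> \<xi>)) \<odot>\<^bsub>R\<^esub> c"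

lemma swap_data: "gas_data K R \<omega> \<tau> swapc (inv\<^bsub>K\<^esub> \<xi>)"
  using data by (auto simp: gas_data_def swapc_def R.smult_mult_l R.smult_mult_r tau_omega)

text \<open>Coefficients with respect to the monomials \<open>X\<^sup>jY\<^sup>i\<close>, obtained by exchanging the roles of
  \<open>X\<close> and \<open>Y\<close>.\<close>

lemma ex_coefficients':
  obtains q :: "('r gen list \<Rightarrow> 'k) set set \<Rightarrow> nat \<Rightarrow> nat \<Rightarrow> 'r" where
    "\<And>i j. linmap K A R (\<lambda>a. q a i j)"
    "\<And>r i j k l. r \<in> carrier R \<Longrightarrow> q ((X [^]\<^bsub>A\<^esub> (l::nat)) \<otimes>\<^bsub>A\<^esub> (\<iota> r \<otimes>\<^bsub>A\<^esub> (Y [^]\<^bsub>A\<^esub> (k::nat)))) i j =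
       (if i = k \<and> j = l then (\<tau> ^^ l) r else \<zero>\<^bsub>R\<^esub>)"
proof -
  interpret S: gasl K R \<omega> \<tau> swapc "inv\<^bsub>K\<^esub> \<xi>" by (rule gasl.intro, rule swap_data)
  have yx: "S.Y \<otimes>\<^bsub>S.A\<^esub> S.X = \<xi> \<odot>\<^bsub>S.A\<^esub> (S.X \<otimes>\<^bsub>S.A\<^esub> S.Y) \<oplus>\<^bsub>S.A\<^esub> S.\<iota> c"
  proof -
    have c: "\<xi> \<odot>\<^bsub>S.A\<^esub> S.\<iota> swapc = \<ominus>\<^bsub>S.A\<^esub> S.\<iota> c"
    proof -
      have "\<xi> \<odot>\<^bsub>R\<^esub> swapc = \<ominus>\<^bsub>R\<^esub> c"
        by (simp add: swapc_def R.Mod.smult_assoc1[symmetric] R.Mod.smult_l_minus R.Mod.smult_r_minus)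
      then have "\<xi> \<odot>\<^bsub>S.A\<^esub> S.\<iota> swapc = S.\<iota> (\<ominus>\<^bsub>R\<^esub> c)" by (simp add: S.iota_simps(4)[symmetric])
      then show ?thesis using linmap_uminus[OF alg_hom_linmap[OF S.iota_hom] R.moduleR S.A.moduleR c_closed] by simp
    qed
    show ?thesis
      by (simp add: S.XY_eq S.A.Mod.smult_r_distr S.A.Mod.smult_assoc1[symmetric] c S.A.a_assoc S.A.l_neg S.c_closed)
  qed
  \<comment> \<open>X goes to the second generator of the exchanged algebra and Y to the first;
    \<open>yx\<close> is the defining relation that has to be respected. Coefficients are then
    pulled back along \<theta>.\<close>
  obtain \<theta> where \<theta>: "\<theta> \<in> alg_hom K A S.A" and \<theta>g: "\<And>r. r \<in> carrier R \<Longrightarrow> \<theta> (\<iota> r) = S.\<iota> r" "\<theta> X = S.Y" "\<theta> Y = S.X"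
    by (rule gas_univ[OF S.algA S.iota_hom S.Y_closed S.X_closed]) (auto simp: S.X_iota S.Y_iota yx)
  note \<theta>D = alg_homD[OF \<theta>]
  obtain p where pl: "\<And>i j. linmap K S.A R (\<lambda>a. p a i j)" and
    pr: "\<And>r a i j. \<lbrakk>r \<in> carrier R; a \<in> carrier S.A\<rbrakk> \<Longrightarrow> p (S.\<iota> r \<otimes>\<^bsub>S.A\<^esub> a) i j = r \<otimes>\<^bsub>R\<^esub> p a i j" and
    pY: "\<And>a i j. a \<in> carrier S.A \<Longrightarrow> p (S.Y \<otimes>\<^bsub>S.A\<^esub> a) i j = (case i of 0 \<Rightarrow> \<zero>\<^bsub>R\<^esub> | Suc i' \<Rightarrow> \<tau> (p a i' j))" and
    pX: "\<And>a i j. a \<in> carrier S.A \<Longrightarrow> p (S.X \<otimes>\<^bsub>S.A\<^esub> a) i j =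
       (case j of 0 \<Rightarrow> \<zero>\<^bsub>R\<^esub> | Suc j' \<Rightarrow> (inv\<^bsub>K\<^esub> \<xi> [^]\<^bsub>K\<^esub> i) \<odot>\<^bsub>R\<^esub> \<omega> (p a i j')) \<oplus>\<^bsub>R\<^esub> \<omega> (p a (Suc i) j) \<otimes>\<^bsub>R\<^esub> S.qc (Suc i)" and
    p1: "\<And>i j. p \<one>\<^bsub>S.A\<^esub> i j = (if i = 0 \<and> j = 0 then \<one>\<^bsub>R\<^esub> else \<zero>\<^bsub>R\<^esub>)"
    by (rule S.ex_coefficients) blast
  have pXk: "p (S.X [^]\<^bsub>S.A\<^esub> (k::nat)) j i = (if j = 0 \<and> i = k then \<one>\<^bsub>R\<^esub> else \<zero>\<^bsub>R\<^esub>)" for i j k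
  proof (induction k arbitrary: i j)
    case 0 then show ?case by (auto simp: p1)
  next
    case (Suc k)
    show ?case
      unfolding S.A.nat_pow_Suc2[OF S.X_closed]
      by (auto simp: pX Suc.IH omega_simps split: nat.splits simp del: qcoef.simps)
  qed
  have pY': "p ((S.Y [^]\<^bsub>S.A\<^esub> (l::nat)) \<otimes>\<^bsub>S.A\<^esub> a) j i = (if l \<le> j then (\<tau> ^^ l) (p a (j - l) i) else \<zero>\<^bsub>R\<^esub>)" 
    if a: "a \<in> carrier S.A" for l i j a
    using a
  proof (induction l arbitrary: j)
    case 0 then show ?case by (auto simp: p1)
  next
    case (Suc l)
    then show ?case
      unfolding S.A.nat_pow_Suc2[OF S.Y_closed]
      by (auto simp: S.A.m_assoc pY split: nat.splits)
  qed
  have \<theta>p: "\<theta> (x [^]\<^bsub>A\<^esub> (n::nat)) = \<theta> x [^]\<^bsub>S.A\<^esub> n" if "x \<in> carrier A" for x n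
    by (induction n) (simp_all add: \<theta>D that)
  have tp: "(\<tau> ^^ l) \<zero>\<^bsub>R\<^esub> = \<zero>\<^bsub>R\<^esub>" for l by (induction l) auto
  show ?thesis
  \<comment> \<open>The indices are exchanged because X becomes the generator \<open>S.Y\<close>,
    whose exponent is the first index of \<open>p\<close>.\<close>
  proof (rule that[of "\<lambda>a i j. p (\<theta> a) j i"])
    show "linmap K A R (\<lambda>a. p (\<theta> a) j i)" for i j by (rule linmap_comp[OF pl alg_hom_linmap[OF \<theta>]])
    fix r i j k l assume r: "r \<in> carrier R"
    show "p (\<theta> ((X [^]\<^bsub>A\<^esub> (l::nat)) \<otimes>\<^bsub>A\<^esub> (\<iota> r \<otimes>\<^bsub>A\<^esub> (Y [^]\<^bsub>A\<^esub> (k::nat))))) j i =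
       (if i = k \<and> j = l then (\<tau> ^^ l) r else \<zero>\<^bsub>R\<^esub>)"
      using r by (auto simp: \<theta>D \<theta>p \<theta>g pY' pr pXk tp)
  qed
qed

section \<open>Spanning monomials\<close>

text \<open>The coefficient stands in the middle because E^j u F^i will be analysed by stripping
  powers of E from the left and powers of F from the right.\<close>

definition "mnm i j r = (X [^]\<^bsub>A\<^esub> (j::nat)) \<otimes>\<^bsub>A\<^esub> (\<iota> r \<otimes>\<^bsub>A\<^esub> (Y [^]\<^bsub>A\<^esub> (i::nat)))"

lemma mnm_closed [simp]: "r \<in> carrier R \<Longrightarrow> mnm i j r \<in> carrier A"
  by (simp add: mnm_def)

text \<open>Moving a coefficient to the right of X needs a preimage under \<tau>; this is where
  bijectivity of \<tau> enters.\<close>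

lemma iota_Xpow:
  assumes "r \<in> carrier R"
  shows "\<exists>r'\<in>carrier R. \<iota> r \<otimes>\<^bsub>A\<^esub> (X [^]\<^bsub>A\<^esub> (j::nat)) = (X [^]\<^bsub>A\<^esub> j) \<otimes>\<^bsub>A\<^esub> \<iota> r'"
  using assms
proof (induction j arbitrary: r)
  case 0 then show ?case by (auto intro!: bexI[of _ r])
next
  case (Suc j)
  then obtain r1 where r1: "r1 \<in> carrier R" "\<iota> r \<otimes>\<^bsub>A\<^esub> (X [^]\<^bsub>A\<^esub> j) = (X [^]\<^bsub>A\<^esub> j) \<otimes>\<^bsub>A\<^esub> \<iota> r1" by blast
  obtain r' where r': "r' \<in> carrier R" "r1 = \<tau> r'" using r1(1) tau_bij by (auto simp: bij_betw_def)
  have "\<iota> r \<otimes>\<^bsub>A\<^esub> (X [^]\<^bsub>A\<^esub> Suc j) = (\<iota> r \<otimes>\<^bsub>A\<^esub> (X [^]\<^bsub>A\<^esub> j)) \<otimes>\<^bsub>A\<^esub> X" using Suc by (simp add: A.m_assoc)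
  also have "\<dots> = (X [^]\<^bsub>A\<^esub> j) \<otimes>\<^bsub>A\<^esub> (\<iota> r1 \<otimes>\<^bsub>A\<^esub> X)" using r1 by (simp add: A.m_assoc)
  also have "\<dots> = (X [^]\<^bsub>A\<^esub> Suc j) \<otimes>\<^bsub>A\<^esub> \<iota> r'" using r' by (simp add: A.m_assoc X_iota[symmetric])
  finally show ?case using r' by blast
qed

lemma Ypow_iota:
  assumes "r \<in> carrier R"
  shows "\<exists>r'\<in>carrier R. \<iota> r \<otimes>\<^bsub>A\<^esub> (Y [^]\<^bsub>A\<^esub> (j::nat)) = (Y [^]\<^bsub>A\<^esub> j) \<otimes>\<^bsub>A\<^esub> \<iota> r'"
  using assms
proof (induction j arbitrary: r)
  case 0 then show ?case by (auto intro!: bexI[of _ r])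
next
  case (Suc j)
  then obtain r1 where r1: "r1 \<in> carrier R" "\<iota> r \<otimes>\<^bsub>A\<^esub> (Y [^]\<^bsub>A\<^esub> j) = (Y [^]\<^bsub>A\<^esub> j) \<otimes>\<^bsub>A\<^esub> \<iota> r1" by blast
  obtain r' where r': "r' \<in> carrier R" "r1 = \<omega> r'" using r1(1) omega_bij by (auto simp: bij_betw_def)
  have "\<iota> r \<otimes>\<^bsub>A\<^esub> (Y [^]\<^bsub>A\<^esub> Suc j) = (\<iota> r \<otimes>\<^bsub>A\<^esub> (Y [^]\<^bsub>A\<^esub> j)) \<otimes>\<^bsub>A\<^esub> Y" using Suc by (simp add: A.m_assoc)
  also have "\<dots> = (Y [^]\<^bsub>A\<^esub> j) \<otimes>\<^bsub>A\<^esub> (\<iota> r1 \<otimes>\<^bsub>A\<^esub> Y)" using r1 by (simp add: A.m_assoc)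
  also have "\<dots> = (Y [^]\<^bsub>A\<^esub> Suc j) \<otimes>\<^bsub>A\<^esub> \<iota> r'" using r' by (simp add: A.m_assoc Y_iota[symmetric])
  finally show ?case using r' by blast
qed

lemma YX_eq: "Y \<otimes>\<^bsub>A\<^esub> X = inv\<^bsub>K\<^esub> \<xi> \<odot>\<^bsub>A\<^esub> (X \<otimes>\<^bsub>A\<^esub> Y \<ominus>\<^bsub>A\<^esub> \<iota> c)"
proof -
  have "X \<otimes>\<^bsub>A\<^esub> Y \<ominus>\<^bsub>A\<^esub> \<iota> c = \<xi> \<odot>\<^bsub>A\<^esub> (Y \<otimes>\<^bsub>A\<^esub> X)"
    by (simp add: XY_eq a_minus_def A.a_assoc A.r_neg)
  then show ?thesis by (simp add: A.Mod.smult_assoc1[symmetric])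
qed

text \<open>The span is stable under left multiplication by each generator. Only Y is delicate: it
  is passed through X^j by induction on j, using YX = \<xi>^-1 (XY - c) and the stability under X
  and R already shown.\<close>

lemma mnm_span:
  assumes S: "submodule S K A" and m: "\<And>i j r. r \<in> carrier R \<Longrightarrow> mnm i j r \<in> S" and a: "a \<in> carrier A"
  shows "a \<in> S"
proof -
  let ?G = "{mnm i j r |i j r. r \<in> carrier R}"
  let ?L = "lin_span K A ?G"
  have Gc: "?G \<subseteq> carrier A" by auto
  have L: "submodule ?L K A" by (rule lin_span_submodule[OF A.moduleR Gc])
  note LE = A.Mod.submoduleE[OF L]
  have mL: "mnm i j r \<in> ?L" if "r \<in> carrier R" for i j r using that by (intro lin_span_mono) blast
  have ext: "b \<otimes>\<^bsub>A\<^esub> z \<in> ?L" if b: "b \<in> carrier A" and h: "\<And>i j r. r \<in> carrier R \<Longrightarrow> b \<otimes>\<^bsub>A\<^esub> mnm i j r \<in> ?L" and z: "z \<in> ?L" for b z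
  proof -
    have "?L \<subseteq> {z \<in> carrier A. b \<otimes>\<^bsub>A\<^esub> z \<in> ?L}"
      by (rule lin_span_least[OF linmap_vimage[OF linmap_mult_l[OF algA linmap_id b] A.moduleR A.moduleR L]])
        (use h in auto)
    then show ?thesis using z by auto
  qed
  have x: "X \<otimes>\<^bsub>A\<^esub> z \<in> ?L" if "z \<in> ?L" for z
  proof (rule ext[OF X_closed _ that])
    fix i j r assume r: "r \<in> carrier R"
    have "X \<otimes>\<^bsub>A\<^esub> mnm i j r = mnm i (Suc j) r"
      unfolding mnm_def A.nat_pow_Suc2[OF X_closed] using r by (simp add: A.m_assoc)
    then show "X \<otimes>\<^bsub>A\<^esub> mnm i j r \<in> ?L" using mL[OF r] by simp
  qed
  have io: "\<iota> s \<otimes>\<^bsub>A\<^esub> z \<in> ?L" if s: "s \<in> carrier R" and z: "z \<in> ?L" for s z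
  proof (rule ext[OF iota_closed[OF s] _ z])
    fix i j :: nat and r assume r: "r \<in> carrier R"
    obtain s' where s': "s' \<in> carrier R" "\<iota> s \<otimes>\<^bsub>A\<^esub> (X [^]\<^bsub>A\<^esub> (j::nat)) = (X [^]\<^bsub>A\<^esub> (j::nat)) \<otimes>\<^bsub>A\<^esub> \<iota> s'"
      by (rule bexE[OF iota_Xpow[OF s, of j]])
    have "\<iota> s \<otimes>\<^bsub>A\<^esub> mnm i j r = (\<iota> s \<otimes>\<^bsub>A\<^esub> (X [^]\<^bsub>A\<^esub> j)) \<otimes>\<^bsub>A\<^esub> (\<iota> r \<otimes>\<^bsub>A\<^esub> (Y [^]\<^bsub>A\<^esub> i))"
      using r s by (simp add: mnm_def A.m_assoc)
    also have "\<dots> = mnm i j (s' \<otimes>\<^bsub>R\<^esub> r)" using r s'(1) unfolding s'(2) by (simp add: mnm_def A.m_assoc iota_simps)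
    finally show "\<iota> s \<otimes>\<^bsub>A\<^esub> mnm i j r \<in> ?L" using mL r s' by simp
  qed
  have y: "Y \<otimes>\<^bsub>A\<^esub> z \<in> ?L" if "z \<in> ?L" for z
  proof (rule ext[OF Y_closed _ that])
    fix i j r assume r: "r \<in> carrier R"
    show "Y \<otimes>\<^bsub>A\<^esub> mnm i j r \<in> ?L"
    proof (induction j)
      case 0
      have "Y \<otimes>\<^bsub>A\<^esub> mnm i 0 r = (Y \<otimes>\<^bsub>A\<^esub> \<iota> r) \<otimes>\<^bsub>A\<^esub> (Y [^]\<^bsub>A\<^esub> i)"
        using r by (simp add: mnm_def A.m_assoc)
      also have "\<dots> = mnm (Suc i) 0 (\<omega> r)"
        unfolding mnm_def A.nat_pow_Suc2[OF Y_closed] using r by (simp add: Y_iota A.m_assoc)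
      finally show ?case using mL r by simp
    next
      case (Suc j)
      have "Y \<otimes>\<^bsub>A\<^esub> mnm i (Suc j) r = (Y \<otimes>\<^bsub>A\<^esub> X) \<otimes>\<^bsub>A\<^esub> mnm i j r"
        unfolding mnm_def A.nat_pow_Suc2[OF X_closed] using r by (simp add: A.m_assoc)
      also have "\<dots> = inv\<^bsub>K\<^esub> \<xi> \<odot>\<^bsub>A\<^esub> (X \<otimes>\<^bsub>A\<^esub> (Y \<otimes>\<^bsub>A\<^esub> mnm i j r) \<oplus>\<^bsub>A\<^esub> \<ominus>\<^bsub>A\<^esub> (\<iota> c \<otimes>\<^bsub>A\<^esub> mnm i j r))"
        using r by (simp add: YX_eq A.smult_mult_l a_minus_def A.l_distr A.m_assoc A.l_minus)
      finally show ?case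
        using LE(3,4,5) x[OF Suc.IH] io[OF c_closed mL[OF r]] by simp
    qed
  qed
  have "a \<in> ?L"
  proof (rule gas_induct[OF L _ io x y a])
    show "\<one>\<^bsub>A\<^esub> \<in> ?L" using mL[OF R.one_closed, of 0 0] by (simp add: mnm_def iota_simps)
  qed auto
  then show ?thesis using lin_span_least[OF S, of ?G] m by blast
qed

lemma normal_form:
  assumes a: "a \<in> carrier A"
  shows "\<exists>S u. finite S \<and> (\<forall>p. u p \<in> carrier R) \<and> a = finsum A (\<lambda>p. mnm (fst p) (snd p) (u p)) S"
proof -
  \<comment> \<open>The coefficients are required to vanish outside \<open>S\<close>, so that the
    expansions of two elements can be moved to a common index set and added.\<close>
  let ?P = "\<lambda>S u a. finite S \<and> (\<forall>p. u p \<in> carrier R) \<and> (\<forall>p. p \<notin> S \<longrightarrow> u p = \<zero>\<^bsub>R\<^esub>) \<and> a = finsum A (\<lambda>p. mnm (fst p) (snd p) (u p)) S"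
  have lin: "linmap K R A (mnm i j)" for i j
    unfolding mnm_def by (intro linmap_mult_l linmap_mult_r algA alg_hom_linmap[OF iota_hom]) auto
  have m0: "mnm i j \<zero>\<^bsub>R\<^esub> = \<zero>\<^bsub>A\<^esub>" for i j by (rule linmap_zero[OF lin R.moduleR A.moduleR])
  have sup: "?P T u a" if "?P S u a" "finite T" "S \<subseteq> T" for S T u a
  proof -
    have "finsum A (\<lambda>p. mnm (fst p) (snd p) (u p)) S = finsum A (\<lambda>p. mnm (fst p) (snd p) (u p)) T"
      by (rule A.add.finprod_mono_neutral_cong_left) (use that in \<open>auto simp: m0\<close>)
    then show ?thesis using that by blast
  qed
  have sm: "submodule {a \<in> carrier A. \<exists>S u. ?P S u a} K A"
  proof (rule A.Mod.submoduleI)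
    show "\<zero>\<^bsub>A\<^esub> \<in> {a \<in> carrier A. \<exists>S u. ?P S u a}"
      by (auto intro!: exI[of _ "{}"] exI[of _ "\<lambda>_. \<zero>\<^bsub>R\<^esub>"])
    have sc: "k \<odot>\<^bsub>A\<^esub> a \<in> {a \<in> carrier A. \<exists>S u. ?P S u a}" if k: "k \<in> carrier K" and ka: "a \<in> {a \<in> carrier A. \<exists>S u. ?P S u a}" for k a
    proof -
      have a: "a \<in> carrier A" and aex: "\<exists>S u. ?P S u a" using CollectD[OF ka] by (rule conjunct1, rule conjunct2)
      obtain S u where P: "?P S u a" using aex by (elim exE)
      have "k \<odot>\<^bsub>A\<^esub> a = finsum A (\<lambda>p. k \<odot>\<^bsub>A\<^esub> mnm (fst p) (snd p) (u p)) S"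
      proof -
        have h: "finite S" "(\<lambda>p. mnm (fst p) (snd p) (u p)) \<in> S \<rightarrow> carrier A"
          "a = finsum A (\<lambda>p. mnm (fst p) (snd p) (u p)) S" using P by auto
        show ?thesis unfolding h(3) by (rule A.Mod.finsum_smult_ldistr[OF h(1) k h(2)])
      qed
      also have "\<dots> = finsum A (\<lambda>p. mnm (fst p) (snd p) (k \<odot>\<^bsub>R\<^esub> u p)) S"
      proof (rule A.finsum_cong')
        have "u p \<in> carrier R" for p using P by blast
        then show "(\<lambda>p. mnm (fst p) (snd p) (k \<odot>\<^bsub>R\<^esub> u p)) \<in> S \<rightarrow> carrier A"
          "\<And>p. p \<in> S \<Longrightarrow> k \<odot>\<^bsub>A\<^esub> mnm (fst p) (snd p) (u p) = mnm (fst p) (snd p) (k \<odot>\<^bsub>R\<^esub> u p)"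
          using k linmapD(3)[OF lin] by simp_all
      qed simp
      finally have e: "k \<odot>\<^bsub>A\<^esub> a = finsum A (\<lambda>p. mnm (fst p) (snd p) (k \<odot>\<^bsub>R\<^esub> u p)) S" .
      have f: "finite S" "\<forall>p. u p \<in> carrier R" "\<forall>p. p \<notin> S \<longrightarrow> u p = \<zero>\<^bsub>R\<^esub>" using P by blast+
      have "\<forall>p. k \<odot>\<^bsub>R\<^esub> u p \<in> carrier R" "\<forall>p. p \<notin> S \<longrightarrow> k \<odot>\<^bsub>R\<^esub> u p = \<zero>\<^bsub>R\<^esub>"
        using f(2,3) k by simp_all
      then have "?P S (\<lambda>p. k \<odot>\<^bsub>R\<^esub> u p) (k \<odot>\<^bsub>A\<^esub> a)" using f(1) e by blast
      then have ex: "\<exists>S u. ?P S u (k \<odot>\<^bsub>A\<^esub> a)" by (intro exI)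
      show ?thesis by (rule CollectI, rule conjI[OF _ ex]) (simp add: a k)
    qed
    fix a assume a: "a \<in> {a \<in> carrier A. \<exists>S u. ?P S u a}"
    have ac: "a \<in> carrier A" and aex: "\<exists>S u. ?P S u a" using CollectD[OF a] by (rule conjunct1, rule conjunct2)
    have mi: "\<ominus>\<^bsub>A\<^esub> a = (\<ominus>\<^bsub>K\<^esub> \<one>\<^bsub>K\<^esub>) \<odot>\<^bsub>A\<^esub> a" using ac by (simp add: A.Mod.smult_l_minus)
    show "\<ominus>\<^bsub>A\<^esub> a \<in> {a \<in> carrier A. \<exists>S u. ?P S u a}" unfolding mi by (rule sc[OF _ a]) simp
    { fix k assume "k \<in> carrier K"
      then show "k \<odot>\<^bsub>A\<^esub> a \<in> {a \<in> carrier A. \<exists>S u. ?P S u a}" by (rule sc[OF _ a]) }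
    fix b assume b: "b \<in> {a \<in> carrier A. \<exists>S u. ?P S u a}"
    have bc: "b \<in> carrier A" and bex: "\<exists>S u. ?P S u b" using CollectD[OF b] by (rule conjunct1, rule conjunct2)
    note ab = ac bc
    obtain S u where Pa: "?P S u a" using aex by (elim exE)
    obtain T v where Pb: "?P T v b" using bex by (elim exE)
    note P = Pa Pb
    have P': "?P (S \<union> T) u a" "?P (S \<union> T) v b"
      using sup[OF P(1), of "S \<union> T"] sup[OF P(2), of "S \<union> T"] P by blast+
    have "a \<oplus>\<^bsub>A\<^esub> b = finsum A (\<lambda>p. mnm (fst p) (snd p) (u p) \<oplus>\<^bsub>A\<^esub> mnm (fst p) (snd p) (v p)) (S \<union> T)"
    proof -
      have h: "a = finsum A (\<lambda>p. mnm (fst p) (snd p) (u p)) (S \<union> T)" "b = finsum A (\<lambda>p. mnm (fst p) (snd p) (v p)) (S \<union> T)"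
        "(\<lambda>p. mnm (fst p) (snd p) (u p)) \<in> S \<union> T \<rightarrow> carrier A" "(\<lambda>p. mnm (fst p) (snd p) (v p)) \<in> S \<union> T \<rightarrow> carrier A"
        using P' by auto
      show ?thesis unfolding h(1,2) by (rule A.finsum_addf[OF h(3,4), symmetric])
    qed
    also have "\<dots> = finsum A (\<lambda>p. mnm (fst p) (snd p) (u p \<oplus>\<^bsub>R\<^esub> v p)) (S \<union> T)"
    proof (rule A.finsum_cong')
      have "u p \<in> carrier R" "v p \<in> carrier R" for p using P' by blast+
      then show "(\<lambda>p. mnm (fst p) (snd p) (u p \<oplus>\<^bsub>R\<^esub> v p)) \<in> S \<union> T \<rightarrow> carrier A"
        "\<And>p. p \<in> S \<union> T \<Longrightarrow> mnm (fst p) (snd p) (u p) \<oplus>\<^bsub>A\<^esub> mnm (fst p) (snd p) (v p) = mnm (fst p) (snd p) (u p \<oplus>\<^bsub>R\<^esub> v p)"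
        using linmapD(2)[OF lin] by simp_all
    qed simp
    finally have e: "a \<oplus>\<^bsub>A\<^esub> b = finsum A (\<lambda>p. mnm (fst p) (snd p) (u p \<oplus>\<^bsub>R\<^esub> v p)) (S \<union> T)" .
    have f: "finite (S \<union> T)" "\<forall>p. u p \<in> carrier R" "\<forall>p. v p \<in> carrier R"
      "\<forall>p. p \<notin> S \<union> T \<longrightarrow> u p = \<zero>\<^bsub>R\<^esub>" "\<forall>p. p \<notin> S \<union> T \<longrightarrow> v p = \<zero>\<^bsub>R\<^esub>" using P' by blast+
    have "\<forall>p. u p \<oplus>\<^bsub>R\<^esub> v p \<in> carrier R" "\<forall>p. p \<notin> S \<union> T \<longrightarrow> u p \<oplus>\<^bsub>R\<^esub> v p = \<zero>\<^bsub>R\<^esub>"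
      using f(2-5) by simp_all
    then have "?P (S \<union> T) (\<lambda>p. u p \<oplus>\<^bsub>R\<^esub> v p) (a \<oplus>\<^bsub>A\<^esub> b)" using f(1) e by blast
    then have ex: "\<exists>S u. ?P S u (a \<oplus>\<^bsub>A\<^esub> b)" by (intro exI)
    show "a \<oplus>\<^bsub>A\<^esub> b \<in> {a \<in> carrier A. \<exists>S u. ?P S u a}" by (rule CollectI, rule conjI[OF _ ex]) (simp add: ab)
  qed auto
  have "a \<in> {a \<in> carrier A. \<exists>S u. ?P S u a}"
  proof (rule mnm_span[OF sm _ a])
    fix i j r assume r: "r \<in> carrier R"
    then have "?P {(i, j)} (\<lambda>p. if p = (i, j) then r else \<zero>\<^bsub>R\<^esub>) (mnm i j r)" by simp
    then have ex: "\<exists>S u. ?P S u (mnm i j r)" by (intro exI)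
    show "mnm i j r \<in> {a \<in> carrier A. \<exists>S u. ?P S u a}" by (rule CollectI, rule conjI[OF _ ex]) (simp add: r)
  qed
  from conjunct2[OF CollectD[OF this]] show ?thesis by (elim exE) (intro exI conjI; elim conjE; assumption)
qed

end

section \<open>Hopf-Galois algebras\<close>

context kalg
begin

abbreviation "T5 \<equiv> tensor K (fac5 R)"
abbreviation "pure5 \<equiv> pure K (fac5 R)"
abbreviation "TT \<equiv> tensor K [R, R]"

lemma pure5_closed: "\<lbrakk>a \<in> carrier R; b \<in> carrier R; x \<in> carrier R; y \<in> carrier R; z \<in> carrier R\<rbrakk> \<Longrightarrow>
    pure5 [a, b, x, y, z] \<in> carrier T5"
  by (rule tens.pure_closed[OF tens_T5]) (auto intro: tuple5I)

lemma pure5_mult: "\<lbrakk>a \<in> carrier R; b \<in> carrier R; x \<in> carrier R; y \<in> carrier R; z \<in> carrier R;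
    a' \<in> carrier R; b' \<in> carrier R; x' \<in> carrier R; y' \<in> carrier R; z' \<in> carrier R\<rbrakk> \<Longrightarrow>
    pure5 [a, b, x, y, z] \<otimes>\<^bsub>T5\<^esub> pure5 [a', b', x', y', z'] =
    pure5 [a \<otimes>\<^bsub>R\<^esub> a', b' \<otimes>\<^bsub>R\<^esub> b, x \<otimes>\<^bsub>R\<^esub> x', y' \<otimes>\<^bsub>R\<^esub> y, z \<otimes>\<^bsub>R\<^esub> z']"
  by (simp add: tens.pure_mult[OF tens_T5] tuple5I tens.mult_TM[OF tens_T5] upt_conv_Cons numeral_2_eq_2 numeral_3_eq_3)

lemma T5_one: "\<one>\<^bsub>T5\<^esub> = pure5 [\<one>\<^bsub>R\<^esub>, \<one>\<^bsub>R\<^esub>, \<one>\<^bsub>R\<^esub>, \<one>\<^bsub>R\<^esub>, \<one>\<^bsub>R\<^esub>]"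
  by (simp add: tens.one_T[OF tens_T5])

lemma linmap_pure5:
  assumes [simp]: "a \<in> carrier R" "b \<in> carrier R" "x \<in> carrier R" "y \<in> carrier R" "z \<in> carrier R"
  shows "linmap K R T5 (\<lambda>t. pure5 [t, b, x, y, z])" "linmap K R T5 (\<lambda>t. pure5 [a, t, x, y, z])"
    "linmap K R T5 (\<lambda>t. pure5 [a, b, t, y, z])" "linmap K R T5 (\<lambda>t. pure5 [a, b, x, t, z])"
    "linmap K R T5 (\<lambda>t. pure5 [a, b, x, y, t])"
proof -
  have m: "[a, b, x, y, z] \<in> carrier (tuple_monoid (fac5 R))" by (rule tuple5I) auto
  note l = tens.linmap_pure[OF tens_T5 m]
  show "linmap K R T5 (\<lambda>t. pure5 [t, b, x, y, z])" "linmap K R T5 (\<lambda>t. pure5 [a, t, x, y, z])"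
    "linmap K R T5 (\<lambda>t. pure5 [a, b, t, y, z])" "linmap K R T5 (\<lambda>t. pure5 [a, b, x, t, z])"
    "linmap K R T5 (\<lambda>t. pure5 [a, b, x, y, t])"
    using l[of 0] l[of "Suc 0"] l[of "Suc (Suc 0)"] l[of "Suc (Suc (Suc 0))"] l[of "Suc (Suc (Suc (Suc 0)))"] by simp_all
qed

lemma TT_alg: "k_algebra K TT" and TT_module: "module K TT"
  using pair_alg[OF alg alg] by (auto simp: k_algebra_def)

text \<open>\<open>I123\<close> and \<open>I345\<close> embed a threefold tensor in the first and
  the last three of five slots. With them the two sides of coassociativity, \<open>L1\<close> and
  \<open>L2\<close>, become products in the fivefold tensor algebra, which later shows them to be
  multiplicative.\<close>

definition "I123 = lift3 K T5 (\<lambda>x y z. pure5 [x, y, z, \<one>\<^bsub>R\<^esub>, \<one>\<^bsub>R\<^esub>])"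
definition "I345 = lift3 K T5 (\<lambda>x y z. pure5 [\<one>\<^bsub>R\<^esub>, \<one>\<^bsub>R\<^esub>, x, y, z])"
definition "L1 \<mu> = lift3 K T5 (\<lambda>a b c. I123 (\<mu> a) \<otimes>\<^bsub>T5\<^esub> pure5 [\<one>\<^bsub>R\<^esub>, \<one>\<^bsub>R\<^esub>, \<one>\<^bsub>R\<^esub>, b, c])"
definition "L2 \<mu> = lift3 K T5 (\<lambda>a b c. pure5 [a, b, \<one>\<^bsub>R\<^esub>, \<one>\<^bsub>R\<^esub>, \<one>\<^bsub>R\<^esub>] \<otimes>\<^bsub>T5\<^esub> I345 (\<mu> c))"
definition "N1 = lift3 K TT (\<lambda>x y z. pure K [R, R] [x \<otimes>\<^bsub>R\<^esub> y, z])"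
definition "N2 = lift3 K TT (\<lambda>x y z. pure K [R, R] [x, y \<otimes>\<^bsub>R\<^esub> z])"

lemma tri_I123: "trilin K R R R T5 (\<lambda>x y z. pure5 [x, y, z, \<one>\<^bsub>R\<^esub>, \<one>\<^bsub>R\<^esub>])"
  and tri_I345: "trilin K R R R T5 (\<lambda>x y z. pure5 [\<one>\<^bsub>R\<^esub>, \<one>\<^bsub>R\<^esub>, x, y, z])"
  by (auto intro!: trilinI linmap_pure5)

lemma I123_pure: "\<lbrakk>a \<in> carrier R; b \<in> carrier R; x \<in> carrier R\<rbrakk> \<Longrightarrow> I123 (pure3 K R [a, b, x]) = pure5 [a, b, x, \<one>\<^bsub>R\<^esub>, \<one>\<^bsub>R\<^esub>]"
  and I345_pure: "\<lbrakk>a \<in> carrier R; b \<in> carrier R; x \<in> carrier R\<rbrakk> \<Longrightarrow> I345 (pure3 K R [a, b, x]) = pure5 [\<one>\<^bsub>R\<^esub>, \<one>\<^bsub>R\<^esub>, a, b, x]"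
  unfolding I123_def I345_def
  by (simp_all add: lift3_pure[OF tri_I123 T5_module] lift3_pure[OF tri_I345 T5_module])

lemma linmap_I123: "linmap K (T3 K R) T5 I123" and linmap_I345: "linmap K (T3 K R) T5 I345"
  unfolding I123_def I345_def by (rule linmap_lift3[OF tri_I123 T5_module] linmap_lift3[OF tri_I345 T5_module])+

lemma I123_hom: "I123 \<in> alg_hom K (T3 K R) T5" and I345_hom: "I345 \<in> alg_hom K (T3 K R) T5"
  by (rule alg_homI; (rule linmap_I123 linmap_I345 T3_mult_eqI[OF _ _ T5_alg])?;
     simp add: I123_pure I345_pure pure5_mult T3_one T5_one linmap_I123 linmap_I345)+

lemma tri_N1: "trilin K R R R TT (\<lambda>x y z. pure K [R, R] [x \<otimes>\<^bsub>R\<^esub> y, z])"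
  and tri_N2: "trilin K R R R TT (\<lambda>x y z. pure K [R, R] [x, y \<otimes>\<^bsub>R\<^esub> z])"
  by (auto intro!: trilinI linmap_comp[OF pair_lin1[OF alg alg]] linmap_comp[OF pair_lin2[OF alg alg]]
      linmap_mult_l linmap_mult_r linmap_id alg)

lemma linmap_N1: "linmap K (T3 K R) TT N1" and linmap_N2: "linmap K (T3 K R) TT N2"
  unfolding N1_def N2_def by (rule linmap_lift3[OF tri_N1 TT_module] linmap_lift3[OF tri_N2 TT_module])+

lemma N1_pure: "\<lbrakk>a \<in> carrier R; b \<in> carrier R; x \<in> carrier R\<rbrakk> \<Longrightarrow> N1 (pure3 K R [a, b, x]) = pure K [R, R] [a \<otimes>\<^bsub>R\<^esub> b, x]"
  and N2_pure: "\<lbrakk>a \<in> carrier R; b \<in> carrier R; x \<in> carrier R\<rbrakk> \<Longrightarrow> N2 (pure3 K R [a, b, x]) = pure K [R, R] [a, b \<otimes>\<^bsub>R\<^esub> x]"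
  unfolding N1_def N2_def
  by (simp_all add: lift3_pure[OF tri_N1 TT_module] lift3_pure[OF tri_N2 TT_module])

context
  fixes \<mu> assumes mu: "linmap K R (T3 K R) \<mu>"
begin

lemma tri_L1: "trilin K R R R T5 (\<lambda>a b c. I123 (\<mu> a) \<otimes>\<^bsub>T5\<^esub> pure5 [\<one>\<^bsub>R\<^esub>, \<one>\<^bsub>R\<^esub>, \<one>\<^bsub>R\<^esub>, b, c])"
  and tri_L2: "trilin K R R R T5 (\<lambda>a b c. pure5 [a, b, \<one>\<^bsub>R\<^esub>, \<one>\<^bsub>R\<^esub>, \<one>\<^bsub>R\<^esub>] \<otimes>\<^bsub>T5\<^esub> I345 (\<mu> c))"
  by (auto intro!: trilinI linmap_mult_l linmap_mult_r T5_alg linmap_pure5 pure5_closed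
      linmap_comp[OF linmap_I123 mu] linmap_comp[OF linmap_I345 mu] linmapD(1)[OF linmap_I123] linmapD(1)[OF linmap_I345] linmapD(1)[OF mu])

lemma linmap_L1: "linmap K (T3 K R) T5 (L1 \<mu>)" and linmap_L2: "linmap K (T3 K R) T5 (L2 \<mu>)"
  unfolding L1_def L2_def by (rule linmap_lift3[OF tri_L1 T5_module] linmap_lift3[OF tri_L2 T5_module])+

lemma L1_pure: "\<lbrakk>a \<in> carrier R; b \<in> carrier R; x \<in> carrier R\<rbrakk> \<Longrightarrow>
      L1 \<mu> (pure3 K R [a, b, x]) = I123 (\<mu> a) \<otimes>\<^bsub>T5\<^esub> pure5 [\<one>\<^bsub>R\<^esub>, \<one>\<^bsub>R\<^esub>, \<one>\<^bsub>R\<^esub>, b, x]"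
  and L2_pure: "\<lbrakk>a \<in> carrier R; b \<in> carrier R; x \<in> carrier R\<rbrakk> \<Longrightarrow>
      L2 \<mu> (pure3 K R [a, b, x]) = pure5 [a, b, \<one>\<^bsub>R\<^esub>, \<one>\<^bsub>R\<^esub>, \<one>\<^bsub>R\<^esub>] \<otimes>\<^bsub>T5\<^esub> I345 (\<mu> x)"
  unfolding L1_def L2_def
  by (simp_all add: lift3_pure[OF tri_L1 T5_module] lift3_pure[OF tri_L2 T5_module])

lemma coassoc_eq:
  assumes u: "u \<in> carrier (T3 K R)"
  shows "tlift K T5 (\<lambda>x. tlift K T5 (\<lambda>y. pure5 (y @ [x!1, x!2])) (\<mu> (x!0))) u = L1 \<mu> u"
    and "tlift K T5 (\<lambda>x. tlift K T5 (\<lambda>y. pure5 ([x!0, x!1] @ y)) (\<mu> (x!2))) u = L2 \<mu> u"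
proof -
  have t1: "trilin K R R R T5 (\<lambda>x y z. pure5 [x, y, z, b, c])" and t2: "trilin K R R R T5 (\<lambda>x y z. pure5 [b, c, x, y, z])"
    if "b \<in> carrier R" "c \<in> carrier R" for b c
    using that by (auto intro!: trilinI linmap_pure5)
  have t1': "trilin K R (opp R) R T5 (\<lambda>x y z. pure5 [x, y, z, b, c])" and t2': "trilin K R (opp R) R T5 (\<lambda>x y z. pure5 [b, c, x, y, z])"
    if "b \<in> carrier R" "c \<in> carrier R" for b c
    using t1[OF that] t2[OF that] by (simp_all add: trilin_def)
  have e1: "tlift K T5 (\<lambda>y. pure5 (y @ [b, c])) t = I123 t \<otimes>\<^bsub>T5\<^esub> pure5 [\<one>\<^bsub>R\<^esub>, \<one>\<^bsub>R\<^esub>, \<one>\<^bsub>R\<^esub>, b, c]"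
    and e2: "tlift K T5 (\<lambda>y. pure5 ([b, c] @ y)) t = pure5 [b, c, \<one>\<^bsub>R\<^esub>, \<one>\<^bsub>R\<^esub>, \<one>\<^bsub>R\<^esub>] \<otimes>\<^bsub>T5\<^esub> I345 t"
    if b: "b \<in> carrier R" "c \<in> carrier R" and t: "t \<in> carrier (T3 K R)" for b c t
  proof -
    have "tlift K T5 (\<lambda>y. pure5 (y @ [b, c])) t = lift3 K T5 (\<lambda>x y z. pure5 [x, y, z, b, c]) t"
      by (rule lift3_cong[OF alg alg_opp alg t1'[OF b] T5_module t]) simp
    also have "\<dots> = I123 t \<otimes>\<^bsub>T5\<^esub> pure5 [\<one>\<^bsub>R\<^esub>, \<one>\<^bsub>R\<^esub>, \<one>\<^bsub>R\<^esub>, b, c]"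
      by (rule T3_eqI[OF linmap_lift3[OF t1[OF b] T5_module] linmap_mult_r[OF T5_alg linmap_I123 pure5_closed] T5_module _ t])
        (use b in \<open>auto simp: lift3_pure[OF t1 T5_module] I123_pure pure5_mult\<close>)
    finally show "tlift K T5 (\<lambda>y. pure5 (y @ [b, c])) t = I123 t \<otimes>\<^bsub>T5\<^esub> pure5 [\<one>\<^bsub>R\<^esub>, \<one>\<^bsub>R\<^esub>, \<one>\<^bsub>R\<^esub>, b, c]" .
    have "tlift K T5 (\<lambda>y. pure5 ([b, c] @ y)) t = lift3 K T5 (\<lambda>x y z. pure5 [b, c, x, y, z]) t"
      by (rule lift3_cong[OF alg alg_opp alg t2'[OF b] T5_module t]) simp
    also have "\<dots> = pure5 [b, c, \<one>\<^bsub>R\<^esub>, \<one>\<^bsub>R\<^esub>, \<one>\<^bsub>R\<^esub>] \<otimes>\<^bsub>T5\<^esub> I345 t"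
      by (rule T3_eqI[OF linmap_lift3[OF t2[OF b] T5_module] linmap_mult_l[OF T5_alg linmap_I345 pure5_closed] T5_module _ t])
        (use b in \<open>auto simp: lift3_pure[OF t2 T5_module] I345_pure pure5_mult\<close>)
    finally show "tlift K T5 (\<lambda>y. pure5 ([b, c] @ y)) t = pure5 [b, c, \<one>\<^bsub>R\<^esub>, \<one>\<^bsub>R\<^esub>, \<one>\<^bsub>R\<^esub>] \<otimes>\<^bsub>T5\<^esub> I345 t" .
  qed
  have tL1: "trilin K R (opp R) R T5 (\<lambda>a b c. I123 (\<mu> a) \<otimes>\<^bsub>T5\<^esub> pure5 [\<one>\<^bsub>R\<^esub>, \<one>\<^bsub>R\<^esub>, \<one>\<^bsub>R\<^esub>, b, c])"
    and tL2: "trilin K R (opp R) R T5 (\<lambda>a b c. pure5 [a, b, \<one>\<^bsub>R\<^esub>, \<one>\<^bsub>R\<^esub>, \<one>\<^bsub>R\<^esub>] \<otimes>\<^bsub>T5\<^esub> I345 (\<mu> c))"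
    using tri_L1 tri_L2 by (simp_all add: trilin_def)
  show "tlift K T5 (\<lambda>x. tlift K T5 (\<lambda>y. pure5 (y @ [x!1, x!2])) (\<mu> (x!0))) u = L1 \<mu> u"
    unfolding L1_def
    by (rule lift3_cong[OF alg alg_opp alg tL1 T5_module u]) (simp add: e1 linmapD(1)[OF mu])
  show "tlift K T5 (\<lambda>x. tlift K T5 (\<lambda>y. pure5 ([x!0, x!1] @ y)) (\<mu> (x!2))) u = L2 \<mu> u"
    unfolding L2_def
    by (rule lift3_cong[OF alg alg_opp alg tL2 T5_module u]) (use e2 in \<open>simp add: linmapD(1)[OF mu]\<close>)
qed

end

text \<open>In this form each axiom equates two maps that are linear in \<open>r\<close>, so that it
  may be checked on spanning elements.\<close>

lemma hopf_galois_iff: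
  "hopf_galois K R \<mu> \<longleftrightarrow> \<one>\<^bsub>R\<^esub> \<noteq> \<zero>\<^bsub>R\<^esub> \<and> \<mu> \<in> alg_hom K R (T3 K R) \<and>
     (\<forall>r\<in>carrier R. L1 \<mu> (\<mu> r) = L2 \<mu> (\<mu> r) \<and> N1 (\<mu> r) = pure K [R, R] [\<one>\<^bsub>R\<^esub>, r] \<and> N2 (\<mu> r) = pure K [R, R] [r, \<one>\<^bsub>R\<^esub>])"
proof (cases "\<mu> \<in> alg_hom K R (T3 K R)")
  case True
  note l = alg_hom_linmap[OF True]
  have c: "\<mu> r \<in> carrier (T3 K R)" if "r \<in> carrier R" for r using linmapD(1)[OF l that] .
  have "hopf_galois K R \<mu> \<longleftrightarrow> k_algebra K R \<and> \<one>\<^bsub>R\<^esub> \<noteq> \<zero>\<^bsub>R\<^esub> \<and> \<mu> \<in> alg_hom K R (T3 K R) \<and>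
     (\<forall>r\<in>carrier R. L1 \<mu> (\<mu> r) = L2 \<mu> (\<mu> r)) \<and>
     (\<forall>r\<in>carrier R. N1 (\<mu> r) = pure K [R, R] [\<one>\<^bsub>R\<^esub>, r] \<and> N2 (\<mu> r) = pure K [R, R] [r, \<one>\<^bsub>R\<^esub>])"
    unfolding hopf_galois_def Let_def N1_def N2_def lift3_def
    by (simp only: coassoc_eq[OF l] c cong: ball_cong)
  then show ?thesis using True alg by blast
qed (simp add: hopf_galois_def)

end

section \<open>The algebra H(R) of a Hopf-Galois algebra\<close>

locale hg = kalg K R for K :: "'k ring" and R :: "('k, 'r) module" +
  fixes \<mu> :: "'r \<Rightarrow> ('r list \<Rightarrow> 'k) set"
  assumes hopf: "hopf_galois K R \<mu>"
begin

lemma mu_hom: "\<mu> \<in> alg_hom K R (T3 K R)" and one_ne_zero: "\<one>\<^bsub>R\<^esub> \<noteq> \<zero>\<^bsub>R\<^esub>"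
  and coassoc: "r \<in> carrier R \<Longrightarrow> L1 \<mu> (\<mu> r) = L2 \<mu> (\<mu> r)"
  and counit1: "r \<in> carrier R \<Longrightarrow> N1 (\<mu> r) = pure K [R, R] [\<one>\<^bsub>R\<^esub>, r]"
  and counit2: "r \<in> carrier R \<Longrightarrow> N2 (\<mu> r) = pure K [R, R] [r, \<one>\<^bsub>R\<^esub>]"
  using hopf by (auto simp: hopf_galois_iff)

lemma mu_lin: "linmap K R (T3 K R) \<mu>" by (rule alg_hom_linmap[OF mu_hom])

lemmas muD = alg_homD[OF mu_hom]

sublocale T3: kalg K "T3 K R" by (rule kalgI, rule T3_alg)
sublocale T2: kalg K "T2 K R" by (rule kalgI, rule T2_alg)

abbreviation "HG \<equiv> HG_alg K R \<mu>"

text \<open>\<open>Phi\<close> and \<open>inj3\<close> are the two sides of the equation that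
  defines H(R), which becomes an equalizer of linear maps.\<close>

definition "Phi = lift2 K (T3 K R) (\<lambda>a b. pure3 K R [a, \<one>\<^bsub>R\<^esub>, \<one>\<^bsub>R\<^esub>] \<otimes>\<^bsub>T3 K R\<^esub> \<mu> b)"
definition "inj3 = lift2 K (T3 K R) (\<lambda>a b. pure3 K R [\<one>\<^bsub>R\<^esub>, a, b])"

lemmas lin_simps = linmap_id linmap_mult_l linmap_mult_r linmap_pure3_1 linmap_pure3_2 linmap_pure3_3 linmap_pure2_1 linmap_pure2_2
   T3_alg T2_alg alg

lemma bi_Phi: "bilin K R R (T3 K R) (\<lambda>a b. pure3 K R [a, \<one>\<^bsub>R\<^esub>, \<one>\<^bsub>R\<^esub>] \<otimes>\<^bsub>T3 K R\<^esub> \<mu> b)"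
  by (rule bilinI) (auto intro!: lin_simps mu_lin muD(1))

lemma bi_inj3: "bilin K R R (T3 K R) (\<lambda>a b. pure3 K R [\<one>\<^bsub>R\<^esub>, a, b])"
  by (rule bilinI) (auto intro!: lin_simps)

lemma linmap_Phi: "linmap K (T2 K R) (T3 K R) Phi" and linmap_inj3: "linmap K (T2 K R) (T3 K R) inj3"
  unfolding Phi_def inj3_def by (rule linmap_lift2[OF bi_Phi T3_module] linmap_lift2[OF bi_inj3 T3_module])+

lemma Phi_pure: "\<lbrakk>a \<in> carrier R; b \<in> carrier R\<rbrakk> \<Longrightarrow> Phi (pure2 K R [a, b]) = pure3 K R [a, \<one>\<^bsub>R\<^esub>, \<one>\<^bsub>R\<^esub>] \<otimes>\<^bsub>T3 K R\<^esub> \<mu> b"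
  and inj3_pure: "\<lbrakk>a \<in> carrier R; b \<in> carrier R\<rbrakk> \<Longrightarrow> inj3 (pure2 K R [a, b]) = pure3 K R [\<one>\<^bsub>R\<^esub>, a, b]"
  unfolding Phi_def inj3_def by (simp_all add: lift2_pure[OF bi_Phi T3_module] lift2_pure[OF bi_inj3 T3_module])

lemma inj3_hom: "inj3 \<in> alg_hom K (T2 K R) (T3 K R)"
proof (rule alg_homI[OF linmap_inj3])
  show "inj3 \<one>\<^bsub>T2 K R\<^esub> = \<one>\<^bsub>T3 K R\<^esub>" by (simp add: T2_one T3_one inj3_pure)
  fix u v assume "u \<in> carrier (T2 K R)" "v \<in> carrier (T2 K R)"
  then show "inj3 (u \<otimes>\<^bsub>T2 K R\<^esub> v) = inj3 u \<otimes>\<^bsub>T3 K R\<^esub> inj3 v"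
    by (rule T2_mult_eqI[OF _ linmap_inj3 T3_alg, rotated]) (simp_all add: inj3_pure)
qed

lemma HG_carrier: "carrier HG = {u \<in> carrier (T2 K R). Phi u = inj3 u}"
proof -
  have t: "trilin K R R R (T3 K R) (\<lambda>x y z. pure3 K R [a \<otimes>\<^bsub>R\<^esub> x, y, z])" if "a \<in> carrier R" for a
    using that by (auto intro!: trilinI lin_simps)
  have e: "lift3 K (T3 K R) (\<lambda>x y z. pure3 K R [a \<otimes>\<^bsub>R\<^esub> x, y, z]) t = pure3 K R [a, \<one>\<^bsub>R\<^esub>, \<one>\<^bsub>R\<^esub>] \<otimes>\<^bsub>T3 K R\<^esub> t"
    if a: "a \<in> carrier R" and "t \<in> carrier (T3 K R)" for a t
    by (rule T3_eqI[OF linmap_lift3[OF t[OF a] T3_module] linmap_mult_l[OF T3_alg linmap_id] T3_module _ that(2)])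
      (use a in \<open>simp_all add: lift3_pure[OF t T3_module]\<close>)
  have b1: "bilin K (opp R) R (T3 K R) (\<lambda>a b. pure3 K R [a, \<one>\<^bsub>R\<^esub>, \<one>\<^bsub>R\<^esub>] \<otimes>\<^bsub>T3 K R\<^esub> \<mu> b)"
    using bi_Phi by (simp add: bilin_def)
  have 1: "tlift K (T3 K R) (\<lambda>x. tlift K (T3 K R) (\<lambda>y. pure3 K R [x!0 \<otimes>\<^bsub>R\<^esub> y!0, y!1, y!2]) (\<mu> (x!1))) u = Phi u"
    if u: "u \<in> carrier (T2 K R)" for u
    unfolding Phi_def
    by (rule lift2_cong[OF alg_opp alg b1 T3_module u]) (use e muD(1) in \<open>simp add: lift3_def\<close>)
  have c: "carrier HG = {u \<in> carrier (T2 K R).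
     tlift K (T3 K R) (\<lambda>x. tlift K (T3 K R) (\<lambda>y. pure3 K R [x!0 \<otimes>\<^bsub>R\<^esub> y!0, y!1, y!2]) (\<mu> (x!1))) u
       = tlift K (T3 K R) (\<lambda>x. pure3 K R [\<one>\<^bsub>R\<^esub>, x!0, x!1]) u}"
    unfolding HG_alg_def by simp
  have 2: "tlift K (T3 K R) (\<lambda>x. pure3 K R [\<one>\<^bsub>R\<^esub>, x!0, x!1]) u = inj3 u" for u
    unfolding inj3_def lift2_def ..
  show ?thesis unfolding c 2 by (rule Collect_cong, rule conj_cong[OF refl]) (simp only: 1)
qed

lemma HG_sub: "u \<in> carrier HG \<Longrightarrow> u \<in> carrier (T2 K R)" by (simp add: HG_carrier)

lemma HG_ops [simp]: "mult HG = mult (T2 K R)" "add HG = add (T2 K R)" "one HG = one (T2 K R)" "zero HG = zero (T2 K R)"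
   "smult HG = smult (T2 K R)"
  by (simp_all add: HG_alg_def)

lemma HG_record: "HG = (T2 K R)\<lparr>carrier := carrier HG\<rparr>"
  by (simp add: HG_alg_def)

text \<open>For w = c \<otimes> d the product vw is (cx \<otimes> yd) if v = x \<otimes> y, so its
  image is c \<otimes> 1 \<otimes> 1 times \<open>Phi v\<close> times \<mu>(d). Once
  \<open>Phi v\<close> is replaced by 1 \<otimes> x \<otimes> y, the factor c \<otimes> 1 \<otimes>
  1 commutes past it. Closure of H(R) under products follows.\<close>

lemma Phi_mult:
  assumes v: "v \<in> carrier HG" and w: "w \<in> carrier (T2 K R)"
  shows "Phi (v \<otimes>\<^bsub>T2 K R\<^esub> w) = inj3 v \<otimes>\<^bsub>T3 K R\<^esub> Phi w"
proof -
  have v': "v \<in> carrier (T2 K R)" "Phi v = inj3 v" using v by (auto simp: HG_carrier)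
  have 1: "Phi (v \<otimes>\<^bsub>T2 K R\<^esub> pure2 K R [c, d]) = inj3 v \<otimes>\<^bsub>T3 K R\<^esub> Phi (pure2 K R [c, d])"
    if cd: "c \<in> carrier R" "d \<in> carrier R" for c d
  proof -
    let ?c = "pure3 K R [c, \<one>\<^bsub>R\<^esub>, \<one>\<^bsub>R\<^esub>]"
    have "Phi (v \<otimes>\<^bsub>T2 K R\<^esub> pure2 K R [c, d]) = (?c \<otimes>\<^bsub>T3 K R\<^esub> Phi v) \<otimes>\<^bsub>T3 K R\<^esub> \<mu> d"
      by (rule T2_eqI[OF linmap_comp[OF linmap_Phi linmap_mult_r[OF T2_alg linmap_id]]
            linmap_mult_r[OF T3_alg linmap_mult_l[OF T3_alg linmap_Phi]] T3_module _ v'(1)])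
        (use cd muD in \<open>simp_all add: Phi_pure T3.m_assoc[symmetric]\<close>)
    also have "?c \<otimes>\<^bsub>T3 K R\<^esub> Phi v = inj3 v \<otimes>\<^bsub>T3 K R\<^esub> ?c"
      unfolding v'(2)
      by (rule T2_eqI[OF linmap_mult_l[OF T3_alg linmap_inj3] linmap_mult_r[OF T3_alg linmap_inj3] T3_module _ v'(1)])
        (use cd in \<open>simp_all add: inj3_pure\<close>)
    finally show ?thesis using cd muD(1) linmapD(1)[OF linmap_inj3 v'(1)] by (simp add: Phi_pure T3.m_assoc)
  qed
  show ?thesis
    by (rule T2_eqI[OF linmap_comp[OF linmap_Phi linmap_mult_l[OF T2_alg linmap_id v'(1)]]
          linmap_mult_l[OF T3_alg linmap_Phi linmapD(1)[OF linmap_inj3 v'(1)]] T3_module 1 w])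
qed

lemma HG_submodule: "submodule (carrier HG) K (T2 K R)"
  unfolding HG_carrier by (rule linmap_equalizer[OF linmap_Phi linmap_inj3 T2_module T3_module])

lemma HG_mult_closed: "\<lbrakk>u \<in> carrier HG; v \<in> carrier HG\<rbrakk> \<Longrightarrow> u \<otimes>\<^bsub>T2 K R\<^esub> v \<in> carrier HG"
  using Phi_mult[of u v] by (simp add: HG_carrier alg_homD(3)[OF inj3_hom])

lemma HG_one: "\<one>\<^bsub>T2 K R\<^esub> \<in> carrier HG"
  by (simp add: HG_carrier T2_one Phi_pure inj3_pure muD T3_one)

lemma HG_algebra: "k_algebra K HG"
  by (subst HG_record, rule T2.subalgebra[OF HG_submodule HG_one HG_mult_closed])

sublocale HG: kalg K HG by (rule kalgI, rule HG_algebra)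

definition "contr \<phi> = lift3 K (T2 K R) (\<lambda>x y z. \<phi> x \<odot>\<^bsub>T2 K R\<^esub> pure2 K R [y, z])"

lemma tri_contr: "functional \<phi> \<Longrightarrow> trilin K R R R (T2 K R) (\<lambda>x y z. \<phi> x \<odot>\<^bsub>T2 K R\<^esub> pure2 K R [y, z])"
  by (rule trilinI) (auto intro!: linmap_functional_smult linmap_smult T2_module lin_simps functionalD)

lemma linmap_contr: "functional \<phi> \<Longrightarrow> linmap K (T3 K R) (T2 K R) (contr \<phi>)"
  unfolding contr_def by (rule linmap_lift3[OF tri_contr T2_module])

lemma contr_pure: "\<lbrakk>functional \<phi>; a \<in> carrier R; b \<in> carrier R; x \<in> carrier R\<rbrakk> \<Longrightarrow>
    contr \<phi> (pure3 K R [a, b, x]) = \<phi> a \<odot>\<^bsub>T2 K R\<^esub> pure2 K R [b, x]"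
  unfolding contr_def by (simp add: lift3_pure[OF tri_contr T2_module])

lemma contr_inj3:
  assumes "functional \<phi>" "\<phi> \<one>\<^bsub>R\<^esub> = \<one>\<^bsub>K\<^esub>" "u \<in> carrier (T2 K R)"
  shows "contr \<phi> (inj3 u) = u"
  by (rule T2_eqI[OF linmap_comp[OF linmap_contr linmap_inj3] linmap_id T2_module _ assms(3)])
    (use assms in \<open>simp_all add: inj3_pure contr_pure\<close>)

text \<open>Apply \<phi> to the first slot of the coassociativity law and multiply the second and
  third slots. One side collapses to \<phi>(r_1) 1 \<otimes> r_2 \<otimes> r_3, the other is
  \<phi>(r_1) times \<open>Phi\<close> of r_2 \<otimes> r_3; this is the defining equation of
  H(R).\<close>

lemma contr_mu_HG:
  assumes \<phi>: "functional \<phi>" and r: "r \<in> carrier R"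
  shows "contr \<phi> (\<mu> r) \<in> carrier HG"
proof -
  let ?G = "\<lambda>x. \<phi> (x ! 0) \<odot>\<^bsub>T3 K R\<^esub> pure3 K R [x ! 1 \<otimes>\<^bsub>R\<^esub> x ! 2, x ! 3, x ! 4]"
  have ml: "multilin K (fac5 R) (T3 K R) ?G"
    unfolding multilin_def
  proof (intro ballI conjI allI impI)
    fix xs assume "xs \<in> carrier (tuple_monoid (fac5 R))"
    then have l: "length xs = 5" and c: "\<forall>i<5. xs ! i \<in> carrier R"
      using tens.carrier_TM[OF tens_T5] by (auto simp: less_Suc_eq nth_Cons' eval_nat_numeral)
    have xs: "xs ! 0 \<in> carrier R" "xs ! 1 \<in> carrier R" "xs ! 2 \<in> carrier R" "xs ! 3 \<in> carrier R" "xs ! 4 \<in> carrier R"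
      using c by auto
    then show "?G xs \<in> carrier (T3 K R)" using functionalD(1)[OF \<phi>] by simp
    fix i assume "i < length (fac5 R)"
    then consider "i = 0" | "i = 1" | "i = 2" | "i = 3" | "i = 4" by fastforce
    then show "linmap K (fac5 R ! i) (T3 K R) (\<lambda>a. ?G (xs[i := a]))"
      by cases (use xs l in \<open>auto simp: numeral_2_eq_2 numeral_3_eq_3 intro!: linmap_functional_smult[OF \<phi>] linmap_smult T3_module lin_simps functionalD(1)[OF \<phi>]\<close>)
  qed
  define M where "M = tlift K (T3 K R) ?G"
  have M: "linmap K T5 (T3 K R) M" unfolding M_def by (rule tens.linmap_tlift[OF tens_T5 ml T3_module])
  have Mp: "M (pure5 [a, b, x, y, z]) = \<phi> a \<odot>\<^bsub>T3 K R\<^esub> pure3 K R [b \<otimes>\<^bsub>R\<^esub> x, y, z]"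
    if "a \<in> carrier R" "b \<in> carrier R" "x \<in> carrier R" "y \<in> carrier R" "z \<in> carrier R" for a b x y z
    using that unfolding M_def by (subst tens.tlift_pure[OF tens_T5 ml T3_module]) (auto intro: tuple5I simp: numeral_2_eq_2 numeral_3_eq_3)
  have m: "\<mu> r \<in> carrier (T3 K R)" using r muD by blast
  have c: "contr \<phi> (\<mu> r) \<in> carrier (T2 K R)" by (rule linmapD(1)[OF linmap_contr[OF \<phi>] m])
  \<comment> \<open>The counit axiom with r_1 \<otimes> r_2 r_3 = r \<otimes> 1, applied to the
    first leg, removes the two multiplied slots.\<close>
  have lhs: "M (L1 \<mu> (\<mu> r)) = inj3 (contr \<phi> (\<mu> r))"
  proof (rule T3_eqI[OF linmap_comp[OF M linmap_L1[OF mu_lin]] linmap_comp[OF linmap_inj3 linmap_contr[OF \<phi>]] T3_module _ m])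
    fix x y z assume c: "x \<in> carrier R" "y \<in> carrier R" "z \<in> carrier R"
    let ?B = "\<lambda>a b. \<phi> a \<odot>\<^bsub>T3 K R\<^esub> pure3 K R [b, y, z]"
    have b: "bilin K R R (T3 K R) ?B"
      by (rule bilinI) (use c in \<open>auto intro!: linmap_functional_smult[OF \<phi>] linmap_smult T3_module lin_simps functionalD(1)[OF \<phi>]\<close>)
    have "M (I123 t \<otimes>\<^bsub>T5\<^esub> pure5 [\<one>\<^bsub>R\<^esub>, \<one>\<^bsub>R\<^esub>, \<one>\<^bsub>R\<^esub>, y, z]) = lift2 K (T3 K R) ?B (N2 t)" if "t \<in> carrier (T3 K R)" for t
      by (rule T3_eqI[OF linmap_comp[OF M linmap_mult_r[OF T5_alg linmap_I123]] linmap_comp[OF pair_lift[OF alg alg b T3_module] linmap_N2] T3_module _ that])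
        (use c in \<open>simp_all add: pure5_closed I123_pure pure5_mult Mp N2_pure pair_lift_pure[OF alg alg b T3_module]\<close>)
    then show "M (L1 \<mu> (pure3 K R [x, y, z])) = inj3 (contr \<phi> (pure3 K R [x, y, z]))"
      using c muD(1) functionalD(1)[OF \<phi>]
      by (simp add: L1_pure[OF mu_lin] counit2 pair_lift_pure[OF alg alg b T3_module] contr_pure[OF \<phi>] inj3_pure linmapD(3)[OF linmap_inj3])
  qed
  \<comment> \<open>Here the second leg of \<mu>(r) is multiplied into the first leg of \<mu>(r_3),
    as in \<open>Phi\<close>.\<close>
  have rhs: "M (L2 \<mu> (\<mu> r)) = Phi (contr \<phi> (\<mu> r))"
  proof (rule T3_eqI[OF linmap_comp[OF M linmap_L2[OF mu_lin]] linmap_comp[OF linmap_Phi linmap_contr[OF \<phi>]] T3_module _ m])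
    fix x y z assume c: "x \<in> carrier R" "y \<in> carrier R" "z \<in> carrier R"
    have "M (pure5 [x, y, \<one>\<^bsub>R\<^esub>, \<one>\<^bsub>R\<^esub>, \<one>\<^bsub>R\<^esub>] \<otimes>\<^bsub>T5\<^esub> I345 t) = \<phi> x \<odot>\<^bsub>T3 K R\<^esub> (pure3 K R [y, \<one>\<^bsub>R\<^esub>, \<one>\<^bsub>R\<^esub>] \<otimes>\<^bsub>T3 K R\<^esub> t)" if "t \<in> carrier (T3 K R)" for t
      by (rule T3_eqI[OF linmap_comp[OF M linmap_mult_l[OF T5_alg linmap_I345]] linmap_smult[OF linmap_mult_l[OF T3_alg linmap_id]] T3_module _ that])
        (use c in \<open>simp_all add: pure5_closed I345_pure pure5_mult Mp functionalD(1)[OF \<phi>] T3_module\<close>)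
    then show "M (L2 \<mu> (pure3 K R [x, y, z])) = Phi (contr \<phi> (pure3 K R [x, y, z]))"
      using c muD(1) functionalD(1)[OF \<phi>]
      by (simp add: L2_pure[OF mu_lin] contr_pure[OF \<phi>] Phi_pure linmapD(3)[OF linmap_Phi])
  qed
  show ?thesis using lhs rhs coassoc[OF r] c by (simp add: HG_carrier)
qed

section \<open>Conjugation on the Hopf algebra\<close>

lemma Units_simps: "g \<in> Units R \<Longrightarrow> g \<in> carrier R" "g \<in> Units R \<Longrightarrow> inv\<^bsub>R\<^esub> g \<in> carrier R"
  "g \<in> Units R \<Longrightarrow> g \<otimes>\<^bsub>R\<^esub> inv\<^bsub>R\<^esub> g = \<one>\<^bsub>R\<^esub>" "g \<in> Units R \<Longrightarrow> inv\<^bsub>R\<^esub> g \<otimes>\<^bsub>R\<^esub> g = \<one>\<^bsub>R\<^esub>"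
  by auto

lemma Units_cancel:
  assumes "g \<in> Units R" "x \<in> carrier R"
  shows "g \<otimes>\<^bsub>R\<^esub> (inv\<^bsub>R\<^esub> g \<otimes>\<^bsub>R\<^esub> x) = x" "inv\<^bsub>R\<^esub> g \<otimes>\<^bsub>R\<^esub> (g \<otimes>\<^bsub>R\<^esub> x) = x"
    "x \<otimes>\<^bsub>R\<^esub> g \<otimes>\<^bsub>R\<^esub> inv\<^bsub>R\<^esub> g = x" "x \<otimes>\<^bsub>R\<^esub> inv\<^bsub>R\<^esub> g \<otimes>\<^bsub>R\<^esub> g = x"
  using Units_simps[OF assms(1)] assms(2) by (simp_all add: m_assoc) (simp_all add: m_assoc[symmetric])

definition "S3 \<sigma> = lift3 K (T3 K R) (\<lambda>x y z. pure3 K R [x, y, \<sigma> z])"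

lemma tri_S3: "linmap K R R \<sigma> \<Longrightarrow> trilin K R R R (T3 K R) (\<lambda>x y z. pure3 K R [x, y, \<sigma> z])"
  by (rule trilinI) (auto intro!: lin_simps linmapD(1)[of K R R \<sigma>])

lemma linmap_S3: "linmap K R R \<sigma> \<Longrightarrow> linmap K (T3 K R) (T3 K R) (S3 \<sigma>)"
  unfolding S3_def by (rule linmap_lift3[OF tri_S3 T3_module])

lemma S3_pure: "\<lbrakk>linmap K R R \<sigma>; a \<in> carrier R; b \<in> carrier R; x \<in> carrier R\<rbrakk> \<Longrightarrow> S3 \<sigma> (pure3 K R [a, b, x]) = pure3 K R [a, b, \<sigma> x]"
  unfolding S3_def by (simp add: lift3_pure[OF tri_S3 T3_module])

abbreviation "cj g \<sigma> \<equiv> conj_tensor K R g \<sigma>"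

lemma cj_eq: "cj g \<sigma> = lift2 K (T2 K R) (\<lambda>a b. pure2 K R [g \<otimes>\<^bsub>R\<^esub> a \<otimes>\<^bsub>R\<^esub> inv\<^bsub>R\<^esub> g, \<sigma> b])"
  by (simp add: conj_tensor_def lift2_def)

lemma bi_cj: "\<lbrakk>g \<in> Units R; linmap K R R \<sigma>\<rbrakk> \<Longrightarrow> bilin K R R (T2 K R) (\<lambda>a b. pure2 K R [g \<otimes>\<^bsub>R\<^esub> a \<otimes>\<^bsub>R\<^esub> inv\<^bsub>R\<^esub> g, \<sigma> b])"
  by (rule bilinI) (auto intro!: lin_simps linmapD(1)[of K R R \<sigma>])

lemma linmap_cj: "\<lbrakk>g \<in> Units R; linmap K R R \<sigma>\<rbrakk> \<Longrightarrow> linmap K (T2 K R) (T2 K R) (cj g \<sigma>)"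
  unfolding cj_eq by (rule linmap_lift2[OF bi_cj T2_module])

lemma cj_pure: "\<lbrakk>g \<in> Units R; linmap K R R \<sigma>; a \<in> carrier R; b \<in> carrier R\<rbrakk> \<Longrightarrow>
   cj g \<sigma> (pure2 K R [a, b]) = pure2 K R [g \<otimes>\<^bsub>R\<^esub> a \<otimes>\<^bsub>R\<^esub> inv\<^bsub>R\<^esub> g, \<sigma> b]"
  unfolding cj_eq by (simp add: lift2_pure[OF bi_cj T2_module])

lemma cj_hom:
  assumes g: "g \<in> Units R" and s: "\<sigma> \<in> alg_hom K R R"
  shows "cj g \<sigma> \<in> alg_hom K (T2 K R) (T2 K R)"
proof (rule alg_homI)
  note l = alg_hom_linmap[OF s]
  show L: "linmap K (T2 K R) (T2 K R) (cj g \<sigma>)" by (rule linmap_cj[OF g l])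
  show "cj g \<sigma> \<one>\<^bsub>T2 K R\<^esub> = \<one>\<^bsub>T2 K R\<^esub>"
    using Units_simps[OF g] by (simp add: T2_one cj_pure[OF g l] alg_homD[OF s])
  fix u v assume "u \<in> carrier (T2 K R)" "v \<in> carrier (T2 K R)"
  then show "cj g \<sigma> (u \<otimes>\<^bsub>T2 K R\<^esub> v) = cj g \<sigma> u \<otimes>\<^bsub>T2 K R\<^esub> cj g \<sigma> v"
    by (rule T2_mult_eqI[OF _ L T2_alg, rotated])
      (use Units_simps[OF g] in \<open>simp_all add: cj_pure[OF g l] alg_homD[OF s] m_assoc Units_cancel[OF g]\<close>)
qed

text \<open>\<open>adG g = g \<otimes> g\<^sup>-\<^sup>1 \<otimes> 1\<close>. The identity \<open>\<mu>(\<sigma>(r)) = grg\<^sup>-\<^sup>1 \<otimes> grg\<^sup>-\<^sup>1 \<otimes> \<sigma>(r)\<close>, read with Sweedler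
  indices, becomes an intertwining relation for this element.\<close>

abbreviation "adG g \<equiv> pure3 K R [g, inv\<^bsub>R\<^esub> g, \<one>\<^bsub>R\<^esub>]"

definition "twist g \<sigma> \<longleftrightarrow> (\<forall>r\<in>carrier R. adG g \<otimes>\<^bsub>T3 K R\<^esub> S3 \<sigma> (\<mu> r) = \<mu> (\<sigma> r) \<otimes>\<^bsub>T3 K R\<^esub> adG g)"

lemma adG_inv:
  assumes "g \<in> Units R"
  shows "adG g \<otimes>\<^bsub>T3 K R\<^esub> adG (inv\<^bsub>R\<^esub> g) = \<one>\<^bsub>T3 K R\<^esub>" "adG (inv\<^bsub>R\<^esub> g) \<otimes>\<^bsub>T3 K R\<^esub> adG g = \<one>\<^bsub>T3 K R\<^esub>"
    "adG g \<in> carrier (T3 K R)" "adG (inv\<^bsub>R\<^esub> g) \<in> carrier (T3 K R)"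
  using assms Units_simps[OF assms] by (simp_all add: T3_one)

lemma twist_eq:
  assumes tw: "twist g \<sigma>" and g: "g \<in> Units R" and s: "linmap K R R \<sigma>" and r: "r \<in> carrier R"
  shows "\<mu> (\<sigma> r) = adG g \<otimes>\<^bsub>T3 K R\<^esub> S3 \<sigma> (\<mu> r) \<otimes>\<^bsub>T3 K R\<^esub> adG (inv\<^bsub>R\<^esub> g)"
  using tw r muD(1)[OF linmapD(1)[OF s r]] adG_inv[OF g]
  by (simp add: twist_def T3.m_assoc del: pure3_mult)

text \<open>The map \<open>?W\<close>, which applies \<sigma> to the third slot and conjugates by
  \<open>adG g\<close>, is carried along by both \<open>Phi\<close> and \<open>inj3\<close>: each of
  them intertwines the conjugation on the twofold tensors with \<open>?W\<close>. So the equalizer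
  is preserved.\<close>

lemma cj_HG:
  assumes tw: "twist g \<sigma>" and g: "g \<in> Units R" and s: "linmap K R R \<sigma>" and u: "u \<in> carrier HG"
  shows "cj g \<sigma> u \<in> carrier HG"
proof -
  have u': "u \<in> carrier (T2 K R)" "Phi u = inj3 u" using u by (auto simp: HG_carrier)
  note a = adG_inv[OF g]
  let ?W = "\<lambda>t. adG g \<otimes>\<^bsub>T3 K R\<^esub> S3 \<sigma> t \<otimes>\<^bsub>T3 K R\<^esub> adG (inv\<^bsub>R\<^esub> g)"
  have W: "linmap K (T3 K R) (T3 K R) ?W"
    by (intro linmap_mult_l linmap_mult_r linmap_S3 s T3_alg a)
  have "Phi (cj g \<sigma> u) = ?W (Phi u)"
  proof (rule T2_eqI[OF linmap_comp[OF linmap_Phi linmap_cj[OF g s]] linmap_comp[OF W linmap_Phi] T3_module _ u'(1)])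
    fix b d assume c: "b \<in> carrier R" "d \<in> carrier R"
    have l: "S3 \<sigma> (pure3 K R [b, \<one>\<^bsub>R\<^esub>, \<one>\<^bsub>R\<^esub>] \<otimes>\<^bsub>T3 K R\<^esub> t) = pure3 K R [b, \<one>\<^bsub>R\<^esub>, \<one>\<^bsub>R\<^esub>] \<otimes>\<^bsub>T3 K R\<^esub> S3 \<sigma> t" if "t \<in> carrier (T3 K R)" for t
      by (rule T3_eqI[OF linmap_comp[OF linmap_S3[OF s] linmap_mult_l[OF T3_alg linmap_id]] linmap_mult_l[OF T3_alg linmap_S3[OF s]] T3_module _ that])
        (use c linmapD(1)[OF s] in \<open>simp_all add: S3_pure[OF s]\<close>)
    have cc: "S3 \<sigma> (\<mu> d) \<in> carrier (T3 K R)" using c muD(1) linmapD(1)[OF linmap_S3[OF s]] by blast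
    have e: "pure3 K R [g \<otimes>\<^bsub>R\<^esub> b \<otimes>\<^bsub>R\<^esub> inv\<^bsub>R\<^esub> g, \<one>\<^bsub>R\<^esub>, \<one>\<^bsub>R\<^esub>] \<otimes>\<^bsub>T3 K R\<^esub> adG g = adG g \<otimes>\<^bsub>T3 K R\<^esub> pure3 K R [b, \<one>\<^bsub>R\<^esub>, \<one>\<^bsub>R\<^esub>]"
      using c Units_simps[OF g] by (simp add: m_assoc)
    have k: "pure3 K R [g \<otimes>\<^bsub>R\<^esub> b \<otimes>\<^bsub>R\<^esub> inv\<^bsub>R\<^esub> g, \<one>\<^bsub>R\<^esub>, \<one>\<^bsub>R\<^esub>] \<in> carrier (T3 K R)" "pure3 K R [b, \<one>\<^bsub>R\<^esub>, \<one>\<^bsub>R\<^esub>] \<in> carrier (T3 K R)"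
      using c Units_simps[OF g] by simp_all
    have "Phi (cj g \<sigma> (pure2 K R [b, d])) = pure3 K R [g \<otimes>\<^bsub>R\<^esub> b \<otimes>\<^bsub>R\<^esub> inv\<^bsub>R\<^esub> g, \<one>\<^bsub>R\<^esub>, \<one>\<^bsub>R\<^esub>] \<otimes>\<^bsub>T3 K R\<^esub> ?W (\<mu> d)"
      using c Units_simps[OF g] linmapD(1)[OF s] by (simp add: cj_pure[OF g s] Phi_pure twist_eq[OF tw g s])
    also have "\<dots> = (pure3 K R [g \<otimes>\<^bsub>R\<^esub> b \<otimes>\<^bsub>R\<^esub> inv\<^bsub>R\<^esub> g, \<one>\<^bsub>R\<^esub>, \<one>\<^bsub>R\<^esub>] \<otimes>\<^bsub>T3 K R\<^esub> adG g) \<otimes>\<^bsub>T3 K R\<^esub> S3 \<sigma> (\<mu> d) \<otimes>\<^bsub>T3 K R\<^esub> adG (inv\<^bsub>R\<^esub> g)"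
      using k a cc by (simp add: T3.m_assoc del: pure3_mult pure3_closed)
    also have "\<dots> = ?W (Phi (pure2 K R [b, d]))"
      unfolding e using k a cc c muD(1) by (simp add: T3.m_assoc Phi_pure l del: pure3_mult pure3_closed)
    finally show "Phi (cj g \<sigma> (pure2 K R [b, d])) = ?W (Phi (pure2 K R [b, d]))" .
  qed
  also have "\<dots> = ?W (inj3 u)" by (simp only: u')
  also have "\<dots> = inj3 (cj g \<sigma> u)"
    by (rule T2_eqI[OF linmap_comp[OF W linmap_inj3] linmap_comp[OF linmap_inj3 linmap_cj[OF g s]] T3_module _ u'(1)])
      (use Units_inv_inv[OF g] Units_simps[OF g] linmapD(1)[OF s] in \<open>simp_all add: inj3_pure S3_pure[OF s] cj_pure[OF g s] m_assoc\<close>)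
  finally show ?thesis using linmapD(1)[OF linmap_cj[OF g s] u'(1)] by (simp add: HG_carrier)
qed

text \<open>Applying \<sigma>^-1 to the third slot undoes \<open>S3 \<sigma>\<close>, so the
  intertwining relation can be inverted. It provides the inverse of the conjugation map on
  H(R).\<close>

lemma twist_inv:
  assumes tw: "twist g \<sigma>" and g: "g \<in> Units R" and s: "linmap K R R \<sigma>" and s': "linmap K R R \<sigma>'"
    and i: "\<And>x. x \<in> carrier R \<Longrightarrow> \<sigma> (\<sigma>' x) = x" "\<And>x. x \<in> carrier R \<Longrightarrow> \<sigma>' (\<sigma> x) = x"
  shows "twist (inv\<^bsub>R\<^esub> g) \<sigma>'"
  unfolding twist_def
proof
  fix r assume r: "r \<in> carrier R"
  note a = adG_inv[OF g]
  have r': "\<sigma>' r \<in> carrier R" using linmapD(1)[OF s' r] .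
  have m: "\<mu> (\<sigma>' r) \<in> carrier (T3 K R)" using muD(1)[OF r'] .
  have S: "S3 \<sigma> t \<in> carrier (T3 K R)" "S3 \<sigma>' t \<in> carrier (T3 K R)" if "t \<in> carrier (T3 K R)" for t
    using that linmapD(1)[OF linmap_S3[OF s]] linmapD(1)[OF linmap_S3[OF s']] by auto
  have h: "S3 \<sigma>' (adG g \<otimes>\<^bsub>T3 K R\<^esub> S3 \<sigma> t \<otimes>\<^bsub>T3 K R\<^esub> adG (inv\<^bsub>R\<^esub> g)) = adG g \<otimes>\<^bsub>T3 K R\<^esub> t \<otimes>\<^bsub>T3 K R\<^esub> adG (inv\<^bsub>R\<^esub> g)" if "t \<in> carrier (T3 K R)" for t
    by (rule T3_eqI[OF linmap_comp[OF linmap_S3[OF s'] linmap_mult_r[OF T3_alg linmap_mult_l[OF T3_alg linmap_S3[OF s]]]]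
        linmap_mult_r[OF T3_alg linmap_mult_l[OF T3_alg linmap_id]] T3_module _ that])
      (use Units_inv_inv[OF g] Units_simps[OF g] linmapD(1)[OF s] in \<open>simp_all add: S3_pure[OF s] S3_pure[OF s'] i\<close>)
  have "S3 \<sigma>' (\<mu> r) = adG g \<otimes>\<^bsub>T3 K R\<^esub> \<mu> (\<sigma>' r) \<otimes>\<^bsub>T3 K R\<^esub> adG (inv\<^bsub>R\<^esub> g)"
    using twist_eq[OF tw g s r'] h[OF m] i(1)[OF r] by simp
  then show "adG (inv\<^bsub>R\<^esub> g) \<otimes>\<^bsub>T3 K R\<^esub> S3 \<sigma>' (\<mu> r) = \<mu> (\<sigma>' r) \<otimes>\<^bsub>T3 K R\<^esub> adG (inv\<^bsub>R\<^esub> g)"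
    using a m by (simp add: T3.m_assoc[symmetric] del: pure3_mult pure3_closed)
qed

lemma cj_auto:
  assumes tw: "twist g \<sigma>" and g: "g \<in> Units R" and s: "\<sigma> \<in> alg_auto K R"
  shows "cj g \<sigma> \<in> alg_auto K HG"
proof -
  have sh: "\<sigma> \<in> alg_hom K R R" and sb: "bij_betw \<sigma> (carrier R) (carrier R)" using s by (auto simp: alg_iso_def)
  note sl = alg_hom_linmap[OF sh]
  let ?s = "inv_into (carrier R) \<sigma>"
  have i: "\<sigma> (?s x) = x" "?s (\<sigma> x) = x" "?s x \<in> carrier R" if "x \<in> carrier R" for x
    using that sb by (auto simp: bij_betw_def f_inv_into_f inv_into_into)
  have s'l: "linmap K R R ?s"
  proof (rule linmapI)
    fix x y assume "x \<in> carrier R" "y \<in> carrier R"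
    then show "?s (x \<oplus>\<^bsub>R\<^esub> y) = ?s x \<oplus>\<^bsub>R\<^esub> ?s y"
      using i(2)[of "?s x \<oplus>\<^bsub>R\<^esub> ?s y"] i by (simp add: alg_homD[OF sh])
  next
    fix a x assume "a \<in> carrier K" "x \<in> carrier R"
    then show "?s (a \<odot>\<^bsub>R\<^esub> x) = a \<odot>\<^bsub>R\<^esub> ?s x"
      using i(2)[of "a \<odot>\<^bsub>R\<^esub> ?s x"] i by (simp add: alg_homD[OF sh])
  qed (rule i)
  have g': "inv\<^bsub>R\<^esub> g \<in> Units R" using g by simp
  have tw': "twist (inv\<^bsub>R\<^esub> g) ?s" by (rule twist_inv[OF tw g sl s'l]) (auto simp: i)
  have c1: "cj (inv\<^bsub>R\<^esub> g) ?s (cj g \<sigma> u) = u" if "u \<in> carrier (T2 K R)" for u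
    by (rule T2_eqI[OF linmap_comp[OF linmap_cj[OF g' s'l] linmap_cj[OF g sl]] linmap_id T2_module _ that])
      (use g Units_inv_inv[OF g] Units_simps[OF g] linmapD(1)[OF sl] in \<open>simp_all add: cj_pure[OF g sl] cj_pure[OF g' s'l] i m_assoc Units_cancel[OF g]\<close>)
  have c2: "cj g \<sigma> (cj (inv\<^bsub>R\<^esub> g) ?s u) = u" if "u \<in> carrier (T2 K R)" for u
    by (rule T2_eqI[OF linmap_comp[OF linmap_cj[OF g sl] linmap_cj[OF g' s'l]] linmap_id T2_module _ that])
      (use g Units_inv_inv[OF g] Units_simps[OF g] linmapD(1)[OF sl] in \<open>simp_all add: cj_pure[OF g sl] cj_pure[OF g' s'l] i m_assoc Units_cancel[OF g]\<close>)
  have "bij_betw (cj g \<sigma>) (carrier HG) (carrier HG)"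
    by (rule bij_betw_byWitness[where f' = "cj (inv\<^bsub>R\<^esub> g) ?s"])
      (auto simp: c1 c2 HG_sub cj_HG[OF tw g sl] cj_HG[OF tw' g' s'l])
  moreover have "cj g \<sigma> \<in> alg_hom K HG HG"
    by (rule alg_homI[OF linmapI]) (auto simp: HG_sub cj_HG[OF tw g sl] alg_homD[OF cj_hom[OF g sh]])
  ultimately show ?thesis by (simp add: alg_iso_def)
qed

end

section \<open>Hopf-Galois structures on ambiskew polynomial algebras\<close>

context gasl
begin

text \<open>The properties delivered by \<open>ex_coefficients\<close> in one predicate, so that a
  single family can be fixed by choice. It refers to the monomials Y^i X^j.\<close>

definition "is_coef p \<longleftrightarrow> (\<forall>i j. linmap K A R (\<lambda>a. p a i j)) \<and>
    (\<forall>r a i j. r \<in> carrier R \<longrightarrow> a \<in> carrier A \<longrightarrow> p (\<iota> r \<otimes>\<^bsub>A\<^esub> a) i j = r \<otimes>\<^bsub>R\<^esub> p a i j) \<and>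
    (\<forall>a i j. a \<in> carrier A \<longrightarrow> p (Y \<otimes>\<^bsub>A\<^esub> a) i j = (case i of 0 \<Rightarrow> \<zero>\<^bsub>R\<^esub> | Suc i' \<Rightarrow> \<omega> (p a i' j))) \<and>
    (\<forall>a i j. a \<in> carrier A \<longrightarrow> p (X \<otimes>\<^bsub>A\<^esub> a) i j =
       (case j of 0 \<Rightarrow> \<zero>\<^bsub>R\<^esub> | Suc j' \<Rightarrow> (\<xi> [^]\<^bsub>K\<^esub> i) \<odot>\<^bsub>R\<^esub> \<tau> (p a i j')) \<oplus>\<^bsub>R\<^esub> \<tau> (p a (Suc i) j) \<otimes>\<^bsub>R\<^esub> qc (Suc i)) \<and>
    (\<forall>i j. p \<one>\<^bsub>A\<^esub> i j = (if i = (0::nat) \<and> j = (0::nat) then \<one>\<^bsub>R\<^esub> else \<zero>\<^bsub>R\<^esub>))"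

definition "pc = (SOME p. is_coef p)"
definition "p0 a = pc a 0 0"
definition "pX a = pc a 0 (Suc 0)"
definition "pY a = pc a (Suc 0) 0"

lemma is_coef_pc: "is_coef pc"
  unfolding pc_def
proof (rule someI_ex[of is_coef])
  show "\<exists>p. is_coef p"
    by (rule ex_coefficients, rule_tac x = p in exI) (simp add: is_coef_def del: qcoef.simps)
qed

lemmas pc_facts = is_coef_pc[unfolded is_coef_def]

lemma pc_lin: "linmap K A R (\<lambda>a. pc a i j)"
  by (rule pc_facts[THEN conjunct1, rule_format])

lemma pc_iota: "\<lbrakk>r \<in> carrier R; a \<in> carrier A\<rbrakk> \<Longrightarrow> pc (\<iota> r \<otimes>\<^bsub>A\<^esub> a) i j = r \<otimes>\<^bsub>R\<^esub> pc a i j"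
  by (rule pc_facts[THEN conjunct2, THEN conjunct1, rule_format])

lemma pc_Y: "a \<in> carrier A \<Longrightarrow> pc (Y \<otimes>\<^bsub>A\<^esub> a) i j = (case i of 0 \<Rightarrow> \<zero>\<^bsub>R\<^esub> | Suc i' \<Rightarrow> \<omega> (pc a i' j))"
  by (rule pc_facts[THEN conjunct2, THEN conjunct2, THEN conjunct1, rule_format])

lemma pc_X: "a \<in> carrier A \<Longrightarrow> pc (X \<otimes>\<^bsub>A\<^esub> a) i j =
    (case j of 0 \<Rightarrow> \<zero>\<^bsub>R\<^esub> | Suc j' \<Rightarrow> (\<xi> [^]\<^bsub>K\<^esub> i) \<odot>\<^bsub>R\<^esub> \<tau> (pc a i j')) \<oplus>\<^bsub>R\<^esub> \<tau> (pc a (Suc i) j) \<otimes>\<^bsub>R\<^esub> qc (Suc i)"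
  by (rule pc_facts[THEN conjunct2, THEN conjunct2, THEN conjunct2, THEN conjunct1, rule_format])

lemma pc_one: "pc \<one>\<^bsub>A\<^esub> i j = (if i = 0 \<and> j = 0 then \<one>\<^bsub>R\<^esub> else \<zero>\<^bsub>R\<^esub>)"
  by (rule pc_facts[THEN conjunct2, THEN conjunct2, THEN conjunct2, THEN conjunct2, rule_format])

lemma pc_iota0: "r \<in> carrier R \<Longrightarrow> pc (\<iota> r) i j = (if i = 0 \<and> j = 0 then r else \<zero>\<^bsub>R\<^esub>)"
  using pc_iota[of r "\<one>\<^bsub>A\<^esub>" i j] by (simp add: pc_one)

lemma pc_X0: "pc X i j = (if i = 0 \<and> j = Suc 0 then \<one>\<^bsub>R\<^esub> else \<zero>\<^bsub>R\<^esub>)"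
  using pc_X[of "\<one>\<^bsub>A\<^esub>" i j] by (auto simp: pc_one tau_simps split: nat.splits simp del: qcoef.simps)

lemma pc_Y0: "pc Y i j = (if i = Suc 0 \<and> j = 0 then \<one>\<^bsub>R\<^esub> else \<zero>\<^bsub>R\<^esub>)"
  using pc_Y[of "\<one>\<^bsub>A\<^esub>" i j] by (auto simp: pc_one omega_simps split: nat.splits)

lemma p_lin: "linmap K A R p0" "linmap K A R pX" "linmap K A R pY"
  unfolding p0_def pX_def pY_def by (rule pc_lin)+

lemma p_simps [simp]:
  "r \<in> carrier R \<Longrightarrow> p0 (\<iota> r) = r" "r \<in> carrier R \<Longrightarrow> pX (\<iota> r) = \<zero>\<^bsub>R\<^esub>" "r \<in> carrier R \<Longrightarrow> pY (\<iota> r) = \<zero>\<^bsub>R\<^esub>"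
  "r \<in> carrier R \<Longrightarrow> p0 (\<iota> r \<otimes>\<^bsub>A\<^esub> X) = \<zero>\<^bsub>R\<^esub>" "r \<in> carrier R \<Longrightarrow> p0 (\<iota> r \<otimes>\<^bsub>A\<^esub> Y) = \<zero>\<^bsub>R\<^esub>"
  "r \<in> carrier R \<Longrightarrow> pX (\<iota> r \<otimes>\<^bsub>A\<^esub> X) = r" "r \<in> carrier R \<Longrightarrow> pX (\<iota> r \<otimes>\<^bsub>A\<^esub> Y) = \<zero>\<^bsub>R\<^esub>"
  "r \<in> carrier R \<Longrightarrow> pY (\<iota> r \<otimes>\<^bsub>A\<^esub> X) = \<zero>\<^bsub>R\<^esub>" "r \<in> carrier R \<Longrightarrow> pY (\<iota> r \<otimes>\<^bsub>A\<^esub> Y) = r"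
  "p0 \<one>\<^bsub>A\<^esub> = \<one>\<^bsub>R\<^esub>" "pX \<one>\<^bsub>A\<^esub> = \<zero>\<^bsub>R\<^esub>" "pY \<one>\<^bsub>A\<^esub> = \<zero>\<^bsub>R\<^esub>" "p0 X = \<zero>\<^bsub>R\<^esub>" "p0 Y = \<zero>\<^bsub>R\<^esub>"
  "pX X = \<one>\<^bsub>R\<^esub>" "pX Y = \<zero>\<^bsub>R\<^esub>" "pY X = \<zero>\<^bsub>R\<^esub>" "pY Y = \<one>\<^bsub>R\<^esub>"
  "pX (X \<otimes>\<^bsub>A\<^esub> Y) = \<zero>\<^bsub>R\<^esub>" "pX (Y \<otimes>\<^bsub>A\<^esub> X) = \<zero>\<^bsub>R\<^esub>" "pY (X \<otimes>\<^bsub>A\<^esub> Y) = \<zero>\<^bsub>R\<^esub>" "pY (Y \<otimes>\<^bsub>A\<^esub> X) = \<zero>\<^bsub>R\<^esub>"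
  by (simp_all add: p0_def pX_def pY_def pc_iota pc_iota0 pc_X0 pc_Y0 pc_one pc_X pc_Y del: qcoef.simps)

lemma p0_Y [simp]: "a \<in> carrier A \<Longrightarrow> p0 (Y \<otimes>\<^bsub>A\<^esub> a) = \<zero>\<^bsub>R\<^esub>"
  by (simp add: p0_def pc_Y)

text \<open>The claim is proved for all exponents i of Y at once, since left multiplication by X
  feeds the coefficient at \<open>Suc i\<close> into the one at i.\<close>

lemma p0_X [simp]:
  assumes a: "a \<in> carrier A" shows "p0 (a \<otimes>\<^bsub>A\<^esub> X) = \<zero>\<^bsub>R\<^esub>"
proof -
  let ?S = "{a \<in> carrier A. \<forall>i. pc (a \<otimes>\<^bsub>A\<^esub> X) i 0 = \<zero>\<^bsub>R\<^esub>}"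
  have L: "linmap K A R (\<lambda>a. pc (a \<otimes>\<^bsub>A\<^esub> X) i 0)" for i
    by (rule linmap_comp[OF pc_lin linmap_mult_r[OF algA linmap_id X_closed]])
  have S: "submodule ?S K A"
    by (rule A.Mod.submoduleI)
      (auto simp: linmapD[OF L] linmap_zero[OF L A.moduleR R.moduleR, simplified] linmap_uminus[OF L A.moduleR R.moduleR])
  have "a \<in> ?S"
    by (rule gas_induct[OF S _ _ _ _ a])
      (auto simp: pc_X0 A.m_assoc pc_iota pc_X pc_Y split: nat.splits simp del: qcoef.simps)
  then show ?thesis by (simp add: p0_def)
qed

lemma iota_Units: "g \<in> Units R \<Longrightarrow> \<iota> g \<in> Units A" "g \<in> Units R \<Longrightarrow> inv\<^bsub>A\<^esub> (\<iota> g) = \<iota> (inv\<^bsub>R\<^esub> g)"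
proof -
  assume g: "g \<in> Units R"
  have c: "g \<in> carrier R" "inv\<^bsub>R\<^esub> g \<in> carrier R" using g by auto
  have i: "\<iota> (inv\<^bsub>R\<^esub> g) \<otimes>\<^bsub>A\<^esub> \<iota> g = \<one>\<^bsub>A\<^esub>" "\<iota> g \<otimes>\<^bsub>A\<^esub> \<iota> (inv\<^bsub>R\<^esub> g) = \<one>\<^bsub>A\<^esub>"
    using g c by (simp_all add: iota_simps(2,3)[symmetric])
  then show "\<iota> g \<in> Units A" using c by (auto simp: Units_def)
  then show "inv\<^bsub>A\<^esub> (\<iota> g) = \<iota> (inv\<^bsub>R\<^esub> g)" using i c by (intro A.inv_unique'[symmetric]) auto
qed

section \<open>Tensor powers of the map from R to A\<close>

abbreviation "pA2 \<equiv> pure2 K A"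
abbreviation "pA3 \<equiv> pure3 K A"
abbreviation "pR2 \<equiv> pure2 K R"
abbreviation "pR3 \<equiv> pure3 K R"
abbreviation "TA2 \<equiv> T2 K A"
abbreviation "TA3 \<equiv> T3 K A"
abbreviation "TR2 \<equiv> T2 K R"
abbreviation "TR3 \<equiv> T3 K R"

lemmas iota_lin = alg_hom_linmap[OF iota_hom]

definition "J2 = lift2 K TA2 (\<lambda>a b. pA2 [\<iota> a, \<iota> b])"
definition "J3 = lift3 K TA3 (\<lambda>a b d. pA3 [\<iota> a, \<iota> b, \<iota> d])"

lemma bi_J2: "bilin K R R TA2 (\<lambda>a b. pA2 [\<iota> a, \<iota> b])"
  by (rule bilinI) (auto intro!: A.linmap_pure2_1 A.linmap_pure2_2 iota_lin)

lemma tri_J3: "trilin K R R R TA3 (\<lambda>a b d. pA3 [\<iota> a, \<iota> b, \<iota> d])"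
  by (rule trilinI) (auto intro!: A.linmap_pure3_1 A.linmap_pure3_2 A.linmap_pure3_3 iota_lin)

lemma J2_lin: "linmap K TR2 TA2 J2" and J3_lin: "linmap K TR3 TA3 J3"
  unfolding J2_def J3_def by (rule R.linmap_lift2[OF bi_J2 A.T2_module] R.linmap_lift3[OF tri_J3 A.T3_module])+

lemma J2_pure [simp]: "\<lbrakk>a \<in> carrier R; b \<in> carrier R\<rbrakk> \<Longrightarrow> J2 (pR2 [a, b]) = pA2 [\<iota> a, \<iota> b]"
  and J3_pure [simp]: "\<lbrakk>a \<in> carrier R; b \<in> carrier R; d \<in> carrier R\<rbrakk> \<Longrightarrow> J3 (pR3 [a, b, d]) = pA3 [\<iota> a, \<iota> b, \<iota> d]"
  unfolding J2_def J3_def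
  by (simp_all add: R.lift2_pure[OF bi_J2 A.T2_module] R.lift3_pure[OF tri_J3 A.T3_module])

lemma J2_hom: "J2 \<in> alg_hom K TR2 TA2"
proof (rule alg_homI[OF J2_lin])
  show "J2 \<one>\<^bsub>TR2\<^esub> = \<one>\<^bsub>TA2\<^esub>" by (simp add: R.T2_one A.T2_one iota_simps)
  show "J2 (u \<otimes>\<^bsub>TR2\<^esub> v) = J2 u \<otimes>\<^bsub>TA2\<^esub> J2 v" if "u \<in> carrier TR2" "v \<in> carrier TR2" for u v
    by (rule R.T2_mult_eqI[OF _ J2_lin A.T2_alg that]) (simp add: iota_simps)
qed

lemma J3_hom: "J3 \<in> alg_hom K TR3 TA3"
proof (rule alg_homI[OF J3_lin])
  show "J3 \<one>\<^bsub>TR3\<^esub> = \<one>\<^bsub>TA3\<^esub>" by (simp add: R.T3_one A.T3_one iota_simps)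
  show "J3 (u \<otimes>\<^bsub>TR3\<^esub> v) = J3 u \<otimes>\<^bsub>TA3\<^esub> J3 v" if "u \<in> carrier TR3" "v \<in> carrier TR3" for u v
    by (rule R.T3_mult_eqI[OF _ J3_lin A.T3_alg that]) (simp add: iota_simps)
qed

lemmas J2D = alg_homD[OF J2_hom]
lemmas J3D = alg_homD[OF J3_hom]

end

locale hgext = gasl K R \<tau> \<omega> c \<xi> + HR: hg K R \<mu> + HA: hg K "gas K R \<tau> \<omega> c \<xi>" \<mu>'
  for K :: "'k ring" and R :: "('k, 'r) module" and \<tau> \<omega> c \<xi> \<mu> \<mu>' +
  assumes mu_iota0: "r \<in> carrier R \<Longrightarrow> \<mu>' (gas_gen K R \<tau> \<omega> c \<xi> (Coeff r)) =
        tlift K (T3 K (gas K R \<tau> \<omega> c \<xi>)) (\<lambda>x. pure3 K (gas K R \<tau> \<omega> c \<xi>) (map (\<lambda>s. gas_gen K R \<tau> \<omega> c \<xi> (Coeff s)) x)) (\<mu> r)"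
begin

lemma mu_iota: "r \<in> carrier R \<Longrightarrow> \<mu>' (\<iota> r) = J3 (\<mu> r)"
proof -
  assume r: "r \<in> carrier R"
  have t: "trilin K R (opp R) R TA3 (\<lambda>a b d. pA3 [\<iota> a, \<iota> b, \<iota> d])" using tri_J3 by (simp add: trilin_def)
  show ?thesis unfolding mu_iota0[OF r] J3_def
    by (rule lift3_cong[OF algR R.alg_opp algR t A.T3_module HR.muD(1)[OF r]]) simp
qed

lemma HG_incl_eq: "u \<in> carrier TR2 \<Longrightarrow>
    tlift K TA2 (\<lambda>x. pA2 (map (\<lambda>s. \<iota> s) x)) u = J2 u"
proof -
  assume u: "u \<in> carrier TR2"
  have t: "bilin K (opp R) R TA2 (\<lambda>a b. pA2 [\<iota> a, \<iota> b])" using bi_J2 by (simp add: bilin_def)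
  show ?thesis unfolding J2_def by (rule lift2_cong[OF R.alg_opp algR t A.T2_module u]) simp
qed

definition "proj3 f1 f2 f3 = lift3 K TR3 (\<lambda>a b d. pR3 [f1 a, f2 b, f3 d])"
definition "proj2 f1 f2 = lift2 K TR2 (\<lambda>a b. pR2 [f1 a, f2 b])"

lemma tri_proj3:
  assumes "linmap K A R f1" "linmap K A R f2" "linmap K A R f3"
  shows "trilin K A A A TR3 (\<lambda>a b d. pR3 [f1 a, f2 b, f3 d])"
  by (rule trilinI) (use assms linmapD(1)[OF assms(1)] linmapD(1)[OF assms(2)] linmapD(1)[OF assms(3)]
      in \<open>auto intro!: R.linmap_pure3_1 R.linmap_pure3_2 R.linmap_pure3_3\<close>)

lemma bi_proj2:
  assumes "linmap K A R f1" "linmap K A R f2"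
  shows "bilin K A A TR2 (\<lambda>a b. pR2 [f1 a, f2 b])"
  by (rule bilinI) (use assms linmapD(1)[OF assms(1)] linmapD(1)[OF assms(2)] in \<open>auto intro!: R.linmap_pure2_1 R.linmap_pure2_2\<close>)

lemma linmap_proj3: "\<lbrakk>linmap K A R f1; linmap K A R f2; linmap K A R f3\<rbrakk> \<Longrightarrow> linmap K TA3 TR3 (proj3 f1 f2 f3)"
  unfolding proj3_def by (rule A.linmap_lift3[OF tri_proj3 R.T3_module])

lemma linmap_proj2: "\<lbrakk>linmap K A R f1; linmap K A R f2\<rbrakk> \<Longrightarrow> linmap K TA2 TR2 (proj2 f1 f2)"
  unfolding proj2_def by (rule A.linmap_lift2[OF bi_proj2 R.T2_module])

lemma proj3_pure: "\<lbrakk>linmap K A R f1; linmap K A R f2; linmap K A R f3; a \<in> carrier A; b \<in> carrier A; d \<in> carrier A\<rbrakk> \<Longrightarrow>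
    proj3 f1 f2 f3 (pA3 [a, b, d]) = pR3 [f1 a, f2 b, f3 d]"
  unfolding proj3_def by (simp add: A.lift3_pure[OF tri_proj3 R.T3_module])

lemma proj2_pure: "\<lbrakk>linmap K A R f1; linmap K A R f2; a \<in> carrier A; b \<in> carrier A\<rbrakk> \<Longrightarrow>
    proj2 f1 f2 (pA2 [a, b]) = pR2 [f1 a, f2 b]"
  unfolding proj2_def by (simp add: A.lift2_pure[OF bi_proj2 R.T2_module])

text \<open>\<open>p0\<close> is a retraction of the inclusion of R, hence its tensor power is one
  of \<open>J3\<close>. Identities over R can therefore be verified over A.\<close>

lemma proj3_J3: "t \<in> carrier TR3 \<Longrightarrow> proj3 p0 p0 p0 (J3 t) = t"
  by (rule R.T3_eqI[OF linmap_comp[OF linmap_proj3 J3_lin] linmap_id R.T3_module]) (auto simp: proj3_pure p_lin)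

lemma proj2_J2: "t \<in> carrier TR2 \<Longrightarrow> proj2 p0 p0 (J2 t) = t"
  by (rule R.T2_eqI[OF linmap_comp[OF linmap_proj2 J2_lin] linmap_id R.T2_module]) (auto simp: proj2_pure p_lin)

lemma Phi_J2: "u \<in> carrier TR2 \<Longrightarrow> HA.Phi (J2 u) = J3 (HR.Phi u)"
  by (rule R.T2_eqI[OF linmap_comp[OF HA.linmap_Phi J2_lin] linmap_comp[OF J3_lin HR.linmap_Phi] A.T3_module])
    (use HR.muD(1) in \<open>auto simp: HA.Phi_pure HR.Phi_pure mu_iota J3D iota_simps\<close>)

lemma inj3_J2: "u \<in> carrier TR2 \<Longrightarrow> HA.inj3 (J2 u) = J3 (HR.inj3 u)"
  by (rule R.T2_eqI[OF linmap_comp[OF HA.linmap_inj3 J2_lin] linmap_comp[OF J3_lin HR.linmap_inj3] A.T3_module])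
    (auto simp: HA.inj3_pure HR.inj3_pure iota_simps)

text \<open>\<open>J2\<close> and \<open>J3\<close> carry the two sides of the defining equation
  over R to those over A, and \<open>J3\<close> is injective. The direction from A back to R is what
  later places \<open>c'\<close> in H(R).\<close>

lemma J2_HG: "u \<in> carrier TR2 \<Longrightarrow> J2 u \<in> carrier HA.HG \<longleftrightarrow> u \<in> carrier HR.HG"
proof -
  assume u: "u \<in> carrier TR2"
  have "J3 (HR.Phi u) = J3 (HR.inj3 u) \<longleftrightarrow> HR.Phi u = HR.inj3 u"
    using proj3_J3[OF linmapD(1)[OF HR.linmap_Phi u]] proj3_J3[OF linmapD(1)[OF HR.linmap_inj3 u]] by metis
  then show ?thesis using u J2D(1) by (simp add: HA.HG_carrier HR.HG_carrier Phi_J2 inj3_J2)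
qed

end

text \<open>\<open>Z\<close> stands for X with (\<tau>, g) or Y with (\<omega>, h), so that
  everything concerning one generator is proved once. The map \<open>pz\<close> reads off the
  coefficient of \<open>Z\<close>, and \<open>p0\<close> the constant one.\<close>

locale skew = hgext K R \<tau> \<omega> c \<xi> \<mu> \<mu>'
  for K :: "'k ring" and R :: "('k, 'r) module" and \<tau> \<omega> c \<xi> \<mu> \<mu>' +
  fixes Z \<sigma> \<gamma> pz
  assumes Z_closed [simp]: "Z \<in> carrier (gas K R \<tau> \<omega> c \<xi>)" and sigma_auto: "\<sigma> \<in> alg_auto K R"
    and Z_iota: "r \<in> carrier R \<Longrightarrow> Z \<otimes>\<^bsub>gas K R \<tau> \<omega> c \<xi>\<^esub> gas_gen K R \<tau> \<omega> c \<xi> (Coeff r) = gas_gen K R \<tau> \<omega> c \<xi> (Coeff (\<sigma> r)) \<otimes>\<^bsub>gas K R \<tau> \<omega> c \<xi>\<^esub> Z"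
    and gam: "\<gamma> \<in> G0 K R \<mu>"
    and pz_lin: "linmap K (gas K R \<tau> \<omega> c \<xi>) R pz"
    and pz_iota: "r \<in> carrier R \<Longrightarrow> pz (gas_gen K R \<tau> \<omega> c \<xi> (Coeff r)) = \<zero>\<^bsub>R\<^esub>"
    and pz_Z: "r \<in> carrier R \<Longrightarrow> pz (gas_gen K R \<tau> \<omega> c \<xi> (Coeff r) \<otimes>\<^bsub>gas K R \<tau> \<omega> c \<xi>\<^esub> Z) = r"
    and p0_Z: "r \<in> carrier R \<Longrightarrow> p0 (gas_gen K R \<tau> \<omega> c \<xi> (Coeff r) \<otimes>\<^bsub>gas K R \<tau> \<omega> c \<xi>\<^esub> Z) = \<zero>\<^bsub>R\<^esub>"
    and mu_Z0: "\<mu>' Z = skew_prim K (gas K R \<tau> \<omega> c \<xi>) (gas_gen K R \<tau> \<omega> c \<xi> (Coeff \<gamma>)) Z"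
begin

lemma gU: "\<gamma> \<in> Units R" and g_mu: "\<mu> \<gamma> = pR3 [\<gamma>, inv\<^bsub>R\<^esub> \<gamma>, \<gamma>]"
  using gam by (auto simp: G0_def)

abbreviation "\<gamma>' \<equiv> inv\<^bsub>R\<^esub> \<gamma>"

lemmas gs [simp] = HR.Units_simps[OF gU]
lemmas gc = HR.Units_cancel[OF gU]

lemma sig_hom: "\<sigma> \<in> alg_hom K R R"
  using sigma_auto by (simp add: alg_iso_def)

lemmas sig_lin = alg_hom_linmap[OF sig_hom]
lemmas sigD = alg_homD[OF sig_hom]

lemma sig_closed [simp]: "r \<in> carrier R \<Longrightarrow> \<sigma> r \<in> carrier R"
  by (rule sigD)

lemma mu_Z: "\<mu>' Z = (pA3 [Z, \<one>\<^bsub>A\<^esub>, \<one>\<^bsub>A\<^esub>] \<ominus>\<^bsub>TA3\<^esub> pA3 [\<iota> \<gamma>, \<iota> \<gamma>' \<otimes>\<^bsub>A\<^esub> Z, \<one>\<^bsub>A\<^esub>]) \<oplus>\<^bsub>TA3\<^esub> pA3 [\<iota> \<gamma>, \<iota> \<gamma>', Z]"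
  unfolding mu_Z0 skew_prim_def by (simp add: iota_Units[OF gU])

lemma iota_l: "\<lbrakk>r \<in> carrier R; s \<in> carrier R; a \<in> carrier A\<rbrakk> \<Longrightarrow> \<iota> r \<otimes>\<^bsub>A\<^esub> (\<iota> s \<otimes>\<^bsub>A\<^esub> a) = \<iota> (r \<otimes>\<^bsub>R\<^esub> s) \<otimes>\<^bsub>A\<^esub> a"
  by (simp add: iota_simps A.m_assoc)

lemma pR3_zero [simp]:
  "\<lbrakk>a \<in> carrier R; b \<in> carrier R\<rbrakk> \<Longrightarrow> pR3 [\<zero>\<^bsub>R\<^esub>, a, b] = \<zero>\<^bsub>TR3\<^esub>"
  "\<lbrakk>a \<in> carrier R; b \<in> carrier R\<rbrakk> \<Longrightarrow> pR3 [a, \<zero>\<^bsub>R\<^esub>, b] = \<zero>\<^bsub>TR3\<^esub>"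
  "\<lbrakk>a \<in> carrier R; b \<in> carrier R\<rbrakk> \<Longrightarrow> pR3 [a, b, \<zero>\<^bsub>R\<^esub>] = \<zero>\<^bsub>TR3\<^esub>"
  using linmap_zero[OF R.linmap_pure3_1[OF linmap_id] R.moduleR R.T3_module]
    linmap_zero[OF R.linmap_pure3_2[OF linmap_id] R.moduleR R.T3_module]
    linmap_zero[OF R.linmap_pure3_3[OF linmap_id] R.moduleR R.T3_module] by simp_all

lemma mu_Z_comm:
  assumes r: "r \<in> carrier R"
  shows "\<mu>' Z \<otimes>\<^bsub>TA3\<^esub> J3 (\<mu> r) = J3 (\<mu> (\<sigma> r)) \<otimes>\<^bsub>TA3\<^esub> \<mu>' Z"
  using r HA.muD(3)[of Z "\<iota> r"] HA.muD(3)[of "\<iota> (\<sigma> r)" Z] by (simp add: Z_iota mu_iota)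

lemma mu_Z_mult:
  assumes x: "x \<in> carrier R" "y \<in> carrier R" "z \<in> carrier R"
  shows "\<mu>' Z \<otimes>\<^bsub>TA3\<^esub> J3 (pR3 [x, y, z]) =
     (pA3 [\<iota> (\<sigma> x) \<otimes>\<^bsub>A\<^esub> Z, \<iota> y, \<iota> z] \<ominus>\<^bsub>TA3\<^esub> pA3 [\<iota> (\<gamma> \<otimes>\<^bsub>R\<^esub> x), \<iota> (y \<otimes>\<^bsub>R\<^esub> \<gamma>') \<otimes>\<^bsub>A\<^esub> Z, \<iota> z])
        \<oplus>\<^bsub>TA3\<^esub> pA3 [\<iota> (\<gamma> \<otimes>\<^bsub>R\<^esub> x), \<iota> (y \<otimes>\<^bsub>R\<^esub> \<gamma>'), \<iota> (\<sigma> z) \<otimes>\<^bsub>A\<^esub> Z]"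
    and "J3 (pR3 [x, y, z]) \<otimes>\<^bsub>TA3\<^esub> \<mu>' Z =
     (pA3 [\<iota> x \<otimes>\<^bsub>A\<^esub> Z, \<iota> y, \<iota> z] \<ominus>\<^bsub>TA3\<^esub> pA3 [\<iota> (x \<otimes>\<^bsub>R\<^esub> \<gamma>), \<iota> (\<gamma>' \<otimes>\<^bsub>R\<^esub> \<sigma> y) \<otimes>\<^bsub>A\<^esub> Z, \<iota> z])
        \<oplus>\<^bsub>TA3\<^esub> pA3 [\<iota> (x \<otimes>\<^bsub>R\<^esub> \<gamma>), \<iota> (\<gamma>' \<otimes>\<^bsub>R\<^esub> y), \<iota> z \<otimes>\<^bsub>A\<^esub> Z]"
  using x by (simp_all add: mu_Z a_minus_def HA.T3.l_distr HA.T3.r_distr HA.T3.l_minus HA.T3.r_minus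
      Z_iota iota_simps A.m_assoc)

text \<open>Take the coefficient of \<open>Z\<close> in the third slot, and constant coefficients in
  the other two, of \<mu>(Z)\<mu>(r) = \<mu>(\<sigma>(r))\<mu>(Z). Only the summand \<gamma>
  \<otimes> \<gamma>^-1 \<otimes> Z contributes.\<close>

lemma twist_sigma: "HR.twist \<gamma> \<sigma>"
  unfolding HR.twist_def
proof
  fix r assume r: "r \<in> carrier R"
  note pl = p_lin(1) pz_lin
  have P: "linmap K TA3 TR3 (proj3 p0 p0 pz)" by (intro linmap_proj3 pl)
  note PD = linmapD[OF P] linmap_uminus[OF P A.T3_module R.T3_module]
  have m: "\<mu> r \<in> carrier TR3" "\<mu> (\<sigma> r) \<in> carrier TR3" "\<mu>' Z \<in> carrier TA3" using r HR.muD(1) HA.muD(1) by auto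
  have e1: "proj3 p0 p0 pz (\<mu>' Z \<otimes>\<^bsub>TA3\<^esub> J3 t) = HR.adG \<gamma> \<otimes>\<^bsub>TR3\<^esub> HR.S3 \<sigma> t" if t: "t \<in> carrier TR3" for t
    by (rule R.T3_eqI[OF linmap_comp[OF P linmap_mult_l[OF A.T3_alg J3_lin m(3)]] linmap_mult_l[OF R.T3_alg HR.linmap_S3[OF sig_lin]] R.T3_module _ t])
      (simp_all del: J3_pure add: mu_Z_mult PD proj3_pure pl p0_Z pz_iota pz_Z HR.S3_pure[OF sig_lin] a_minus_def)
  have e2: "proj3 p0 p0 pz (J3 t \<otimes>\<^bsub>TA3\<^esub> \<mu>' Z) = t \<otimes>\<^bsub>TR3\<^esub> HR.adG \<gamma>" if t: "t \<in> carrier TR3" for t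
    by (rule R.T3_eqI[OF linmap_comp[OF P linmap_mult_r[OF A.T3_alg J3_lin m(3)]] linmap_mult_r[OF R.T3_alg linmap_id] R.T3_module _ t])
      (simp_all del: J3_pure add: mu_Z_mult PD proj3_pure pl p0_Z pz_iota pz_Z a_minus_def)
  show "HR.adG \<gamma> \<otimes>\<^bsub>TR3\<^esub> HR.S3 \<sigma> (\<mu> r) = \<mu> (\<sigma> r) \<otimes>\<^bsub>TR3\<^esub> HR.adG \<gamma>"
    using e1[OF m(1)] e2[OF m(2)] mu_Z_comm[OF r] by simp
qed

text \<open>Up to sign, and for \<open>V3\<close> up to a left factor \<gamma> in the first slot,
  \<open>V3\<close> and \<open>U3\<close> are the coefficients of \<open>Z\<close> in the middle
  slot of \<mu>(Z)t and t\<mu>(Z). \<open>W3\<close> is what \<open>U3\<close> becomes after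
  \<mu>(\<sigma>(r)) is expressed through \<mu>(r) by the twist.\<close>

definition "V3 = lift3 K TR3 (\<lambda>x y z. pR3 [x, y \<otimes>\<^bsub>R\<^esub> \<gamma>', z])"
definition "W3 = lift3 K TR3 (\<lambda>x y z. pR3 [x, \<gamma>' \<otimes>\<^bsub>R\<^esub> \<sigma> (\<gamma> \<otimes>\<^bsub>R\<^esub> y \<otimes>\<^bsub>R\<^esub> \<gamma>'), \<sigma> z])"
definition "U3 = lift3 K TR3 (\<lambda>x y z. pR3 [x \<otimes>\<^bsub>R\<^esub> \<gamma>, \<gamma>' \<otimes>\<^bsub>R\<^esub> \<sigma> y, z])"

lemma ad_lin: "linmap K R R (\<lambda>y. \<gamma>' \<otimes>\<^bsub>R\<^esub> \<sigma> (\<gamma> \<otimes>\<^bsub>R\<^esub> y \<otimes>\<^bsub>R\<^esub> \<gamma>'))"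
  by (intro linmap_mult_l linmap_comp[OF sig_lin] linmap_mult_r linmap_id algR) auto

lemma tri_VWU: "trilin K R R R TR3 (\<lambda>x y z. pR3 [x, y \<otimes>\<^bsub>R\<^esub> \<gamma>', z])"
  "trilin K R R R TR3 (\<lambda>x y z. pR3 [x, \<gamma>' \<otimes>\<^bsub>R\<^esub> \<sigma> (\<gamma> \<otimes>\<^bsub>R\<^esub> y \<otimes>\<^bsub>R\<^esub> \<gamma>'), \<sigma> z])"
  "trilin K R R R TR3 (\<lambda>x y z. pR3 [x \<otimes>\<^bsub>R\<^esub> \<gamma>, \<gamma>' \<otimes>\<^bsub>R\<^esub> \<sigma> y, z])"
  by (rule trilinI; (auto intro!: R.linmap_pure3_1 R.linmap_pure3_2 R.linmap_pure3_3 linmap_id ad_lin linmap_mult_l linmap_mult_r sig_lin algR)[])+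

lemma VWU_lin: "linmap K TR3 TR3 V3" "linmap K TR3 TR3 W3" "linmap K TR3 TR3 U3"
  unfolding V3_def W3_def U3_def by (intro R.linmap_lift3 tri_VWU R.T3_module)+

lemma VWU_pure: "\<lbrakk>x \<in> carrier R; y \<in> carrier R; z \<in> carrier R\<rbrakk> \<Longrightarrow> V3 (pR3 [x, y, z]) = pR3 [x, y \<otimes>\<^bsub>R\<^esub> \<gamma>', z]"
  "\<lbrakk>x \<in> carrier R; y \<in> carrier R; z \<in> carrier R\<rbrakk> \<Longrightarrow> W3 (pR3 [x, y, z]) = pR3 [x, \<gamma>' \<otimes>\<^bsub>R\<^esub> \<sigma> (\<gamma> \<otimes>\<^bsub>R\<^esub> y \<otimes>\<^bsub>R\<^esub> \<gamma>'), \<sigma> z]"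
  "\<lbrakk>x \<in> carrier R; y \<in> carrier R; z \<in> carrier R\<rbrakk> \<Longrightarrow> U3 (pR3 [x, y, z]) = pR3 [x \<otimes>\<^bsub>R\<^esub> \<gamma>, \<gamma>' \<otimes>\<^bsub>R\<^esub> \<sigma> y, z]"
  unfolding V3_def W3_def U3_def by (simp_all add: R.lift3_pure[OF tri_VWU(1) R.T3_module]
    R.lift3_pure[OF tri_VWU(2) R.T3_module] R.lift3_pure[OF tri_VWU(3) R.T3_module])

text \<open>Now the middle slot is compared, where only -\<gamma> \<otimes> \<gamma>^-1 Z \<otimes>
  1 contributes. After the twist both sides have \<gamma> as leftmost factor of the first slot, and
  cancelling it gives the identity.\<close>

lemma VW_mu:
  assumes r: "r \<in> carrier R"
  shows "V3 (\<mu> r) = W3 (\<mu> r)"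
proof -
  note pl = p_lin(1) pz_lin
  have P: "linmap K TA3 TR3 (proj3 p0 pz p0)" by (intro linmap_proj3 pl)
  note PD = linmapD[OF P] linmap_uminus[OF P A.T3_module R.T3_module]
  have m: "\<mu> r \<in> carrier TR3" "\<mu> (\<sigma> r) \<in> carrier TR3" "\<mu>' Z \<in> carrier TA3" using r HR.muD(1) HA.muD(1) by auto
  have e1: "proj3 p0 pz p0 (\<mu>' Z \<otimes>\<^bsub>TA3\<^esub> J3 t) = \<ominus>\<^bsub>TR3\<^esub> (pR3 [\<gamma>, \<one>\<^bsub>R\<^esub>, \<one>\<^bsub>R\<^esub>] \<otimes>\<^bsub>TR3\<^esub> V3 t)" if t: "t \<in> carrier TR3" for t
    by (rule R.T3_eqI[OF linmap_comp[OF P linmap_mult_l[OF A.T3_alg J3_lin m(3)]] linmap_neg[OF linmap_mult_l[OF R.T3_alg VWU_lin(1)] R.T3_module] R.T3_module _ t])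
      (simp_all del: J3_pure add: mu_Z_mult PD proj3_pure pl p0_Z pz_iota pz_Z VWU_pure a_minus_def)
  have e2: "proj3 p0 pz p0 (J3 t \<otimes>\<^bsub>TA3\<^esub> \<mu>' Z) = \<ominus>\<^bsub>TR3\<^esub> U3 t" if t: "t \<in> carrier TR3" for t
    by (rule R.T3_eqI[OF linmap_comp[OF P linmap_mult_r[OF A.T3_alg J3_lin m(3)]] linmap_neg[OF VWU_lin(3) R.T3_module] R.T3_module _ t])
      (simp_all del: J3_pure add: mu_Z_mult PD proj3_pure pl p0_Z pz_iota pz_Z VWU_pure a_minus_def)
  let ?g = "pR3 [\<gamma>, \<one>\<^bsub>R\<^esub>, \<one>\<^bsub>R\<^esub>]"
  note a = HR.adG_inv[OF gU]
  have e3: "U3 (HR.adG \<gamma> \<otimes>\<^bsub>TR3\<^esub> HR.S3 \<sigma> t \<otimes>\<^bsub>TR3\<^esub> HR.adG \<gamma>') = ?g \<otimes>\<^bsub>TR3\<^esub> W3 t" if t: "t \<in> carrier TR3" for t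
    by (rule R.T3_eqI[OF linmap_comp[OF VWU_lin(3) linmap_mult_r[OF R.T3_alg linmap_mult_l[OF R.T3_alg HR.linmap_S3[OF sig_lin]]]]
        linmap_mult_l[OF R.T3_alg VWU_lin(2)] R.T3_module _ t])
      (use R.Units_inv_inv[OF gU] in \<open>simp_all add: HR.S3_pure[OF sig_lin] VWU_pure gc R.m_assoc\<close>)
  have cl: "V3 (\<mu> r) \<in> carrier TR3" "W3 (\<mu> r) \<in> carrier TR3" "U3 (\<mu> (\<sigma> r)) \<in> carrier TR3"
    using m linmapD(1)[OF VWU_lin(1)] linmapD(1)[OF VWU_lin(2)] linmapD(1)[OF VWU_lin(3)] by auto
  have gcl: "?g \<in> carrier TR3" "pR3 [\<gamma>', \<one>\<^bsub>R\<^esub>, \<one>\<^bsub>R\<^esub>] \<in> carrier TR3" "pR3 [\<gamma>', \<one>\<^bsub>R\<^esub>, \<one>\<^bsub>R\<^esub>] \<otimes>\<^bsub>TR3\<^esub> ?g = \<one>\<^bsub>TR3\<^esub>"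
    by (simp_all add: R.T3_one)
  have "\<ominus>\<^bsub>TR3\<^esub> (?g \<otimes>\<^bsub>TR3\<^esub> V3 (\<mu> r)) = \<ominus>\<^bsub>TR3\<^esub> U3 (\<mu> (\<sigma> r))"
    using e1[OF m(1)] e2[OF m(2)] mu_Z_comm[OF r] by simp
  then have "?g \<otimes>\<^bsub>TR3\<^esub> V3 (\<mu> r) = U3 (\<mu> (\<sigma> r))"
    using cl gcl by (metis HR.T3.minus_minus HR.T3.m_closed)
  also have "\<dots> = ?g \<otimes>\<^bsub>TR3\<^esub> W3 (\<mu> r)"
    unfolding HR.twist_eq[OF twist_sigma gU sig_lin r] by (rule e3[OF m(1)])
  finally have "pR3 [\<gamma>', \<one>\<^bsub>R\<^esub>, \<one>\<^bsub>R\<^esub>] \<otimes>\<^bsub>TR3\<^esub> (?g \<otimes>\<^bsub>TR3\<^esub> V3 (\<mu> r)) = pR3 [\<gamma>', \<one>\<^bsub>R\<^esub>, \<one>\<^bsub>R\<^esub>] \<otimes>\<^bsub>TR3\<^esub> (?g \<otimes>\<^bsub>TR3\<^esub> W3 (\<mu> r))"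
    by simp
  then show ?thesis using gcl cl by (simp add: HR.T3.m_assoc[symmetric] del: R.pure3_mult R.pure3_closed)
qed

definition "V2 = lift2 K TR2 (\<lambda>x y. pR2 [x \<otimes>\<^bsub>R\<^esub> \<gamma>', y])"
definition "W2 = lift2 K TR2 (\<lambda>x y. pR2 [\<gamma>' \<otimes>\<^bsub>R\<^esub> \<sigma> (\<gamma> \<otimes>\<^bsub>R\<^esub> x \<otimes>\<^bsub>R\<^esub> \<gamma>'), \<sigma> y])"

lemma bi_VW: "bilin K R R TR2 (\<lambda>x y. pR2 [x \<otimes>\<^bsub>R\<^esub> \<gamma>', y])"
  "bilin K R R TR2 (\<lambda>x y. pR2 [\<gamma>' \<otimes>\<^bsub>R\<^esub> \<sigma> (\<gamma> \<otimes>\<^bsub>R\<^esub> x \<otimes>\<^bsub>R\<^esub> \<gamma>'), \<sigma> y])"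
  by (rule bilinI; (auto intro!: R.linmap_pure2_1 R.linmap_pure2_2 linmap_id ad_lin linmap_mult_l linmap_mult_r sig_lin algR)[])+

lemma VW2_lin: "linmap K TR2 TR2 V2" "linmap K TR2 TR2 W2"
  unfolding V2_def W2_def by (intro R.linmap_lift2 bi_VW R.T2_module)+

lemma VW2_pure: "\<lbrakk>x \<in> carrier R; y \<in> carrier R\<rbrakk> \<Longrightarrow> V2 (pR2 [x, y]) = pR2 [x \<otimes>\<^bsub>R\<^esub> \<gamma>', y]"
  "\<lbrakk>x \<in> carrier R; y \<in> carrier R\<rbrakk> \<Longrightarrow> W2 (pR2 [x, y]) = pR2 [\<gamma>' \<otimes>\<^bsub>R\<^esub> \<sigma> (\<gamma> \<otimes>\<^bsub>R\<^esub> x \<otimes>\<^bsub>R\<^esub> \<gamma>'), \<sigma> y]"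
  unfolding V2_def W2_def by (simp_all add: R.lift2_pure[OF bi_VW(1) R.T2_module] R.lift2_pure[OF bi_VW(2) R.T2_module])

text \<open>\<open>V3\<close> and \<open>W3\<close> leave the first slot alone, so they commute with
  left multiplication there and the previous identity passes from \<mu>(y) to xy_1 \<otimes> y_2
  \<otimes> y_3. On H(R) this is 1 \<otimes> x \<otimes> y, and a functional with value 1 at 1
  removes the first slot.\<close>

lemma VW_HG:
  assumes u: "u \<in> carrier HR.HG"
  shows "V2 u = W2 u"
proof -
  have u': "u \<in> carrier TR2" "HR.Phi u = HR.inj3 u" using u by (auto simp: HR.HG_carrier)
  have l: "F (pR3 [x, \<one>\<^bsub>R\<^esub>, \<one>\<^bsub>R\<^esub>] \<otimes>\<^bsub>TR3\<^esub> t) = pR3 [x, \<one>\<^bsub>R\<^esub>, \<one>\<^bsub>R\<^esub>] \<otimes>\<^bsub>TR3\<^esub> F t"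
    if F: "F = V3 \<or> F = W3" and x: "x \<in> carrier R" and t: "t \<in> carrier TR3" for F x t
  proof (rule R.T3_eqI[OF _ _ R.T3_module _ t])
    have Fl: "linmap K TR3 TR3 F" using F VWU_lin by auto
    show "linmap K TR3 TR3 (\<lambda>t. F (pR3 [x, \<one>\<^bsub>R\<^esub>, \<one>\<^bsub>R\<^esub>] \<otimes>\<^bsub>TR3\<^esub> t))"
      by (rule linmap_comp[OF Fl linmap_mult_l[OF R.T3_alg linmap_id]]) (simp add: x)
    show "linmap K TR3 TR3 (\<lambda>t. pR3 [x, \<one>\<^bsub>R\<^esub>, \<one>\<^bsub>R\<^esub>] \<otimes>\<^bsub>TR3\<^esub> F t)"
      by (rule linmap_mult_l[OF R.T3_alg Fl]) (simp add: x)
  qed (use F x in \<open>auto simp: VWU_pure\<close>)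
  have "V3 (HR.Phi u) = W3 (HR.Phi u)"
    by (rule R.T2_eqI[OF linmap_comp[OF VWU_lin(1) HR.linmap_Phi] linmap_comp[OF VWU_lin(2) HR.linmap_Phi] R.T3_module _ u'(1)])
      (use HR.muD(1) in \<open>simp add: HR.Phi_pure l VW_mu\<close>)
  then have e: "V3 (HR.inj3 u) = W3 (HR.inj3 u)" by (simp only: u')
  obtain \<phi> where \<phi>: "R.functional \<phi>" "\<phi> \<one>\<^bsub>R\<^esub> = \<one>\<^bsub>K\<^esub>" using R.ex_functional[OF HR.one_ne_zero] by blast
  have 1: "HR.contr \<phi> (V3 (HR.inj3 v)) = V2 v" "HR.contr \<phi> (W3 (HR.inj3 v)) = W2 v" if "v \<in> carrier TR2" for v
    by (rule R.T2_eqI[OF linmap_comp[OF HR.linmap_contr[OF \<phi>(1)] linmap_comp[OF VWU_lin(1) HR.linmap_inj3]] VW2_lin(1) R.T2_module _ that],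
        simp add: HR.inj3_pure VWU_pure VW2_pure HR.contr_pure[OF \<phi>(1)] \<phi>(2))
      (rule R.T2_eqI[OF linmap_comp[OF HR.linmap_contr[OF \<phi>(1)] linmap_comp[OF VWU_lin(2) HR.linmap_inj3]] VW2_lin(2) R.T2_module _ that],
        simp add: HR.inj3_pure VWU_pure VW2_pure HR.contr_pure[OF \<phi>(1)] \<phi>(2))
  show ?thesis using e 1[OF u'(1)] by simp
qed

section \<open>The element of H(A) attached to a skew primitive generator\<close>

abbreviation "\<sigma>' \<equiv> conj_tensor K R \<gamma> \<sigma>"

lemma sigma'_auto: "\<sigma>' \<in> alg_auto K HR.HG"
  by (rule HR.cj_auto[OF twist_sigma gU sigma_auto])

definition "E = pA2 [\<iota> \<gamma>', Z] \<ominus>\<^bsub>TA2\<^esub> pA2 [\<iota> \<gamma>' \<otimes>\<^bsub>A\<^esub> Z, \<one>\<^bsub>A\<^esub>]"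

lemma E_T2 [simp]: "E \<in> carrier TA2"
  by (simp add: E_def)

lemma inj3_E: "HA.inj3 E = pA3 [\<one>\<^bsub>A\<^esub>, \<iota> \<gamma>', Z] \<ominus>\<^bsub>TA3\<^esub> pA3 [\<one>\<^bsub>A\<^esub>, \<iota> \<gamma>' \<otimes>\<^bsub>A\<^esub> Z, \<one>\<^bsub>A\<^esub>]"
  by (simp add: E_def linmap_minus[OF HA.linmap_inj3 A.T2_module A.T3_module] HA.inj3_pure)

lemma mu_Z_E: "\<mu>' Z = pA3 [Z, \<one>\<^bsub>A\<^esub>, \<one>\<^bsub>A\<^esub>] \<oplus>\<^bsub>TA3\<^esub> pA3 [\<iota> \<gamma>, \<one>\<^bsub>A\<^esub>, \<one>\<^bsub>A\<^esub>] \<otimes>\<^bsub>TA3\<^esub> HA.inj3 E"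
  by (simp add: mu_Z inj3_E a_minus_def HA.T3.r_distr HA.T3.r_minus HA.T3.a_ac)

text \<open>\<open>Phi\<close> sends \<gamma>^-1 \<otimes> Z to \<gamma>^-1 Z \<otimes> 1 \<otimes>
  1 plus \<open>inj3 E\<close>, and it sends \<gamma>^-1 Z \<otimes> 1 to the first of these terms;
  the difference is \<open>inj3 E\<close>.\<close>

lemma E_HG: "E \<in> carrier HA.HG"
proof -
  have "HA.Phi E = pA3 [\<iota> \<gamma>', \<one>\<^bsub>A\<^esub>, \<one>\<^bsub>A\<^esub>] \<otimes>\<^bsub>TA3\<^esub> \<mu>' Z \<ominus>\<^bsub>TA3\<^esub> pA3 [\<iota> \<gamma>' \<otimes>\<^bsub>A\<^esub> Z, \<one>\<^bsub>A\<^esub>, \<one>\<^bsub>A\<^esub>]"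
    by (simp add: E_def linmap_minus[OF HA.linmap_Phi A.T2_module A.T3_module] HA.Phi_pure HA.muD A.T3_one)
  also have "pA3 [\<iota> \<gamma>', \<one>\<^bsub>A\<^esub>, \<one>\<^bsub>A\<^esub>] \<otimes>\<^bsub>TA3\<^esub> \<mu>' Z = pA3 [\<iota> \<gamma>' \<otimes>\<^bsub>A\<^esub> Z, \<one>\<^bsub>A\<^esub>, \<one>\<^bsub>A\<^esub>] \<oplus>\<^bsub>TA3\<^esub> HA.inj3 E"
  proof -
    have i: "\<iota> \<gamma>' \<otimes>\<^bsub>A\<^esub> \<iota> \<gamma> = \<one>\<^bsub>A\<^esub>" by (simp add: iota_simps(2,3)[symmetric])
    have cl: "HA.inj3 E \<in> carrier TA3" using linmapD(1)[OF HA.linmap_inj3] by simp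
    have o: "pA3 [\<one>\<^bsub>A\<^esub>, \<one>\<^bsub>A\<^esub>, \<one>\<^bsub>A\<^esub>] = \<one>\<^bsub>TA3\<^esub>" by (simp add: A.T3_one)
    show ?thesis using cl by (simp add: mu_Z_E HA.T3.r_distr HA.T3.m_assoc[symmetric] i o)
  qed
  finally have "HA.Phi E = HA.inj3 E"
    using linmapD(1)[OF HA.linmap_inj3 E_T2] by (simp add: a_minus_def HA.T3.a_ac HA.T3.r_neg1 HA.T3.r_neg2 HA.T3.r_neg)
  then show ?thesis by (simp add: HA.HG_carrier)
qed

definition "B2 = lift2 K TA2 (\<lambda>x y. pA2 [\<iota> x \<otimes>\<^bsub>A\<^esub> Z, \<iota> y])"

lemma bi_B2: "bilin K R R TA2 (\<lambda>x y. pA2 [\<iota> x \<otimes>\<^bsub>A\<^esub> Z, \<iota> y])"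
  by (rule bilinI) (auto intro!: A.linmap_pure2_1 A.linmap_pure2_2 linmap_mult_r iota_lin algA)

lemma B2_lin: "linmap K TR2 TA2 B2"
  unfolding B2_def by (rule R.linmap_lift2[OF bi_B2 A.T2_module])

lemma B2_pure: "\<lbrakk>x \<in> carrier R; y \<in> carrier R\<rbrakk> \<Longrightarrow> B2 (pR2 [x, y]) = pA2 [\<iota> x \<otimes>\<^bsub>A\<^esub> Z, \<iota> y]"
  unfolding B2_def by (simp add: R.lift2_pure[OF bi_B2 A.T2_module])

definition "B1 = lift2 K TA2 (\<lambda>x y. pA2 [\<iota> (x \<otimes>\<^bsub>R\<^esub> \<gamma>'), \<iota> (\<sigma> y) \<otimes>\<^bsub>A\<^esub> Z])"

lemma bi_B1: "bilin K R R TA2 (\<lambda>x y. pA2 [\<iota> (x \<otimes>\<^bsub>R\<^esub> \<gamma>'), \<iota> (\<sigma> y) \<otimes>\<^bsub>A\<^esub> Z])"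
  by (rule bilinI) (auto intro!: A.linmap_pure2_1 A.linmap_pure2_2 linmap_mult_r linmap_comp[OF iota_lin] linmap_id sig_lin algA algR)

lemma B1_lin: "linmap K TR2 TA2 B1"
  unfolding B1_def by (rule R.linmap_lift2[OF bi_B1 A.T2_module])

lemma B1_pure: "\<lbrakk>x \<in> carrier R; y \<in> carrier R\<rbrakk> \<Longrightarrow> B1 (pR2 [x, y]) = pA2 [\<iota> (x \<otimes>\<^bsub>R\<^esub> \<gamma>'), \<iota> (\<sigma> y) \<otimes>\<^bsub>A\<^esub> Z]"
  unfolding B1_def by (simp add: R.lift2_pure[OF bi_B1 A.T2_module])

text \<open>The summand \<gamma>^-1 \<otimes> Z yields \<open>B1 u\<close> on both sides. The
  summand \<gamma>^-1 Z \<otimes> 1 yields xZ-type tensors, \<open>B2 (V2 u)\<close> on the left and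
  \<open>B2 (W2 u)\<close> on the right, which \<open>VW_HG\<close> identifies.\<close>

lemma E_comm:
  assumes u: "u \<in> carrier HR.HG"
  shows "E \<otimes>\<^bsub>TA2\<^esub> J2 u = J2 (\<sigma>' u) \<otimes>\<^bsub>TA2\<^esub> E"
proof -
  have u': "u \<in> carrier TR2" using HR.HG_sub[OF u] .
  have "E \<otimes>\<^bsub>TA2\<^esub> J2 u = B1 u \<ominus>\<^bsub>TA2\<^esub> B2 (V2 u)"
    by (rule R.T2_eqI[OF linmap_mult_l[OF A.T2_alg J2_lin E_T2] linmap_diff[OF B1_lin linmap_comp[OF B2_lin VW2_lin(1)] A.T2_module] A.T2_module _ u'])
      (simp add: E_def B1_pure B2_pure VW2_pure a_minus_def HA.T2.l_distr HA.T2.l_minus Z_iota iota_simps A.m_assoc)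
  also have "V2 u = W2 u" by (rule VW_HG[OF u])
  also have "B1 u \<ominus>\<^bsub>TA2\<^esub> B2 (W2 u) = J2 (\<sigma>' u) \<otimes>\<^bsub>TA2\<^esub> E"
    by (rule R.T2_eqI[OF linmap_diff[OF B1_lin linmap_comp[OF B2_lin VW2_lin(2)] A.T2_module]
         linmap_mult_r[OF A.T2_alg linmap_comp[OF J2_lin HR.linmap_cj[OF gU sig_lin]] E_T2] A.T2_module _ u'])
      (simp add: E_def B1_pure B2_pure VW2_pure HR.cj_pure[OF gU sig_lin] a_minus_def HA.T2.r_distr HA.T2.r_minus
        iota_simps(2)[symmetric] Z_iota A.m_assoc gc R.m_assoc iota_l)
  finally show ?thesis .
qed

end

text \<open>Bookkeeping for the relation between E and F: the two products share four terms and
  differ in \<open>b\<close> and \<open>d\<close>.\<close>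

lemma (in abelian_group) add_cancel_pair:
  assumes "a1 \<in> carrier G" "a2 \<in> carrier G" "a3 \<in> carrier G" "a4 \<in> carrier G" "b \<in> carrier G" "d \<in> carrier G"
  shows "((a1 \<oplus> b) \<ominus> a2) \<oplus> (a4 \<ominus> a3) = ((a1 \<ominus> a2) \<oplus> ((a4 \<oplus> d) \<ominus> a3)) \<oplus> (b \<ominus> d)"
proof -
  have "((a1 \<ominus> a2) \<oplus> ((a4 \<oplus> d) \<ominus> a3)) \<oplus> (b \<ominus> d) = (((a1 \<oplus> b) \<ominus> a2) \<oplus> (a4 \<ominus> a3)) \<oplus> (d \<oplus> \<ominus> d)"
    using assms by (simp add: a_minus_def a_ac)
  then show ?thesis using assms by (simp add: r_neg)
qed

lemma (in tens) submodule_T_eq: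
  assumes S: "submodule S K T" and p: "\<And>xs. xs \<in> carrier TM \<Longrightarrow> pure K Rs xs \<in> S" and u: "u \<in> carrier T"
  shows "u \<in> S"
proof -
  obtain x where x: "u = Nul +>\<^bsub>MA.F\<^esub> x" "x \<in> carrier MA.F"
    using u unfolding tensor_def by (elim TQ.Q_cases)
  have pr: "linmap K MA.F T (\<lambda>x. Nul +>\<^bsub>MA.F\<^esub> x)"
    unfolding tensor_def by (rule alg_hom_linmap[OF TQ.proj_hom])
  show ?thesis unfolding x(1)
    using MA.submodule_F_eq[OF linmap_vimage[OF pr MA.module_F module_T S] _ x(2)] p by (auto simp: pure_def)
qed

lemma (in kalg) T2_induct:
  assumes S: "submodule S K (T2 K R)" and p: "\<And>a b. \<lbrakk>a \<in> carrier R; b \<in> carrier R\<rbrakk> \<Longrightarrow> pure2 K R [a, b] \<in> S"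
    and u: "u \<in> carrier (T2 K R)"
  shows "u \<in> S"
  by (rule tens.submodule_T_eq[OF tens2[OF alg_opp alg] S _ u]) (auto elim!: tuple2_cases simp: p)

lemma (in kalg) alg_auto_inv:
  assumes s: "\<sigma> \<in> alg_auto K R"
  shows "inv_auto R \<sigma> \<in> alg_auto K R"
    and "\<And>x. x \<in> carrier R \<Longrightarrow> \<sigma> (inv_auto R \<sigma> x) = x" and "\<And>x. x \<in> carrier R \<Longrightarrow> inv_auto R \<sigma> (\<sigma> x) = x"
proof -
  have sh: "\<sigma> \<in> alg_hom K R R" and sb: "bij_betw \<sigma> (carrier R) (carrier R)" using s by (auto simp: alg_iso_def)
  let ?s = "inv_into (carrier R) \<sigma>"
  have i: "\<sigma> (?s x) = x" "?s (\<sigma> x) = x" "?s x \<in> carrier R" if "x \<in> carrier R" for x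
    using that sb by (auto simp: bij_betw_def f_inv_into_f inv_into_into)
  show "\<And>x. x \<in> carrier R \<Longrightarrow> \<sigma> (?s x) = x" "\<And>x. x \<in> carrier R \<Longrightarrow> ?s (\<sigma> x) = x" by (rule i; assumption)+
  have "?s \<in> alg_hom K R R"
  proof (rule alg_homI[OF linmapI])
    fix x y assume xy: "x \<in> carrier R" "y \<in> carrier R"
    show "?s (x \<oplus>\<^bsub>R\<^esub> y) = ?s x \<oplus>\<^bsub>R\<^esub> ?s y"
      using i(2)[of "?s x \<oplus>\<^bsub>R\<^esub> ?s y"] i xy by (simp add: alg_homD[OF sh])
    show "?s (x \<otimes>\<^bsub>R\<^esub> y) = ?s x \<otimes>\<^bsub>R\<^esub> ?s y"
      using i(2)[of "?s x \<otimes>\<^bsub>R\<^esub> ?s y"] i xy by (simp add: alg_homD[OF sh])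
  next
    fix a x assume "a \<in> carrier K" "x \<in> carrier R"
    then show "?s (a \<odot>\<^bsub>R\<^esub> x) = a \<odot>\<^bsub>R\<^esub> ?s x"
      using i(2)[of "a \<odot>\<^bsub>R\<^esub> ?s x"] i by (simp add: alg_homD[OF sh])
  next
    show "?s \<one>\<^bsub>R\<^esub> = \<one>\<^bsub>R\<^esub>" using i(2)[of "\<one>\<^bsub>R\<^esub>"] by (simp add: alg_homD[OF sh])
  qed (rule i)
  moreover have "bij_betw ?s (carrier R) (carrier R)" by (rule bij_betw_inv_into[OF sb])
  ultimately show "?s \<in> alg_auto K R" by (simp add: alg_iso_def)
qed

lemma (in hg) contr_left:
  assumes \<phi>: "functional \<phi>" and x: "x \<in> carrier R" and t: "t \<in> carrier (T3 K R)"
  shows "contr \<phi> (pure3 K R [x, \<one>\<^bsub>R\<^esub>, \<one>\<^bsub>R\<^esub>] \<otimes>\<^bsub>T3 K R\<^esub> t) = contr (\<lambda>y. \<phi> (x \<otimes>\<^bsub>R\<^esub> y)) t"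
proof -
  have f: "functional (\<lambda>y. \<phi> (x \<otimes>\<^bsub>R\<^esub> y))" by (rule functional_linmap[OF \<phi> linmap_mult_l[OF alg linmap_id x]])
  have xc: "pure3 K R [x, \<one>\<^bsub>R\<^esub>, \<one>\<^bsub>R\<^esub>] \<in> carrier (T3 K R)" using x by simp
  show ?thesis
    by (rule T3_eqI[OF linmap_comp[OF linmap_contr[OF \<phi>] linmap_mult_l[OF T3_alg linmap_id xc]] linmap_contr[OF f] T2_module _ t])
      (use x in \<open>simp add: contr_pure \<phi> f\<close>)
qed

lemma (in hg) contr_inj3_mult:
  assumes \<phi>: "functional \<phi>" and v: "v \<in> carrier (T2 K R)" and t: "t \<in> carrier (T3 K R)"
  shows "contr \<phi> (inj3 v \<otimes>\<^bsub>T3 K R\<^esub> t) = v \<otimes>\<^bsub>T2 K R\<^esub> contr \<phi> t"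
proof -
  have 1: "contr \<phi> (inj3 (pure2 K R [a, b]) \<otimes>\<^bsub>T3 K R\<^esub> t) = pure2 K R [a, b] \<otimes>\<^bsub>T2 K R\<^esub> contr \<phi> t"
    if ab: "a \<in> carrier R" "b \<in> carrier R" for a b
    by (rule T3_eqI[OF linmap_comp[OF linmap_contr[OF \<phi>] linmap_mult_l[OF T3_alg linmap_id]] linmap_mult_l[OF T2_alg linmap_contr[OF \<phi>]] T2_module _ t])
      (use ab \<phi> functionalD(1)[OF \<phi>] in \<open>simp_all add: inj3_pure contr_pure T2.smult_mult_r\<close>)
  show ?thesis
    by (rule T2_eqI[OF linmap_comp[OF linmap_contr[OF \<phi>] linmap_mult_r[OF T3_alg linmap_inj3 t]]
        linmap_mult_r[OF T2_alg linmap_id] T2_module 1 v]) (use linmapD(1)[OF linmap_contr[OF \<phi>] t] in auto)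
qed

text \<open>By \<mu>(Z) = Z \<otimes> 1 \<otimes> 1 + \<gamma> \<otimes> E, a factor in the first
  slot is absorbed by the functional while E comes out in front. Left multiplication by
  \<open>Z\<close> thus changes the functional.\<close>

lemma (in skew) contr_Z:
  assumes \<phi>: "A.functional \<phi>" and b: "b \<in> carrier A"
  shows "HA.contr \<phi> (\<mu>' (Z \<otimes>\<^bsub>A\<^esub> b)) = HA.contr (\<lambda>y. \<phi> (Z \<otimes>\<^bsub>A\<^esub> y)) (\<mu>' b) \<oplus>\<^bsub>TA2\<^esub> E \<otimes>\<^bsub>TA2\<^esub> HA.contr (\<lambda>y. \<phi> (\<iota> \<gamma> \<otimes>\<^bsub>A\<^esub> y)) (\<mu>' b)"
proof -
  have m: "\<mu>' b \<in> carrier TA3" using HA.muD(1)[OF b] .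
  have i: "HA.inj3 E \<in> carrier TA3" using linmapD(1)[OF HA.linmap_inj3] by simp
  have f: "A.functional (\<lambda>y. \<phi> (\<iota> \<gamma> \<otimes>\<^bsub>A\<^esub> y))" by (rule A.functional_linmap[OF \<phi> linmap_mult_l[OF algA linmap_id]]) simp
  have "\<mu>' (Z \<otimes>\<^bsub>A\<^esub> b) = pA3 [Z, \<one>\<^bsub>A\<^esub>, \<one>\<^bsub>A\<^esub>] \<otimes>\<^bsub>TA3\<^esub> \<mu>' b \<oplus>\<^bsub>TA3\<^esub> pA3 [\<iota> \<gamma>, \<one>\<^bsub>A\<^esub>, \<one>\<^bsub>A\<^esub>] \<otimes>\<^bsub>TA3\<^esub> (HA.inj3 E \<otimes>\<^bsub>TA3\<^esub> \<mu>' b)"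
    using b m i by (simp add: HA.muD mu_Z_E HA.T3.l_distr HA.T3.m_assoc)
  then show ?thesis using m i \<phi> f
    by (simp add: linmapD[OF HA.linmap_contr[OF \<phi>]] HA.contr_left HA.contr_inj3_mult)
qed

section \<open>The Hopf algebra of an ambiskew polynomial algebra\<close>

locale amb =
  fixes K :: "'k ring" and R :: "('k, 'r) module" and \<mu> \<tau> c \<xi> g h \<mu>'
  assumes H: "ambiskew_hopf_galois K R \<mu> \<tau> c \<xi> g h \<mu>'"
begin

abbreviation "\<omega> \<equiv> inv_auto R \<tau>"

lemmas H' = H[unfolded ambiskew_hopf_galois_def Let_def]

lemma amb_facts: "hopf_galois K R \<mu>" "\<tau> \<in> alg_auto K R" "c \<in> carrier R" "\<And>r. r \<in> carrier R \<Longrightarrow> c \<otimes>\<^bsub>R\<^esub> r = r \<otimes>\<^bsub>R\<^esub> c"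
  "\<xi> \<in> carrier K - {\<zero>\<^bsub>K\<^esub>}" "g \<in> G0 K R \<mu>" "h \<in> G0 K R \<mu>" "hopf_galois K (gas K R \<tau> \<omega> c \<xi>) \<mu>'"
  using H' by auto

lemma algR0: "k_algebra K R" using amb_facts(1) by (simp add: hopf_galois_def)

lemma hgR: "hg K R \<mu>" by (rule hg.intro[OF kalgI[OF algR0]]) (rule hg_axioms.intro[OF amb_facts(1)])

lemma gas_data0: "gas_data K R \<tau> \<omega> c \<xi>"
proof -
  interpret R: kalg K R by (rule kalgI[OF algR0])
  note i = R.alg_auto_inv[OF amb_facts(2)]
  show ?thesis unfolding gas_data_def using amb_facts i algR0 by simp
qed

lemma gasl0: "gasl K R \<tau> \<omega> c \<xi>" by (rule gasl.intro[OF gas_data0])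

lemma hgA: "hg K (gas K R \<tau> \<omega> c \<xi>) \<mu>'"
  by (rule hg.intro[OF kalgI[OF gasl.algA[OF gasl0]]]) (rule hg_axioms.intro[OF amb_facts(8)])

sublocale hgext K R \<tau> \<omega> c \<xi> \<mu> \<mu>'
  by (rule hgext.intro[OF gasl0 hgR hgA]) (rule hgext_axioms.intro, use H' in blast)

lemma tau_auto: "\<tau> \<in> alg_auto K R" and omega_auto: "\<omega> \<in> alg_auto K R"
  using data by (auto simp: gas_data_def)

sublocale SX: skew K R \<tau> \<omega> c \<xi> \<mu> \<mu>' "gas_gen K R \<tau> \<omega> c \<xi> GenX" \<tau> g pX
  by (rule skew.intro[OF hgext_axioms], rule skew_axioms.intro)
    (use H' amb_facts in \<open>simp_all add: tau_auto X_iota p_lin\<close>)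

sublocale SY: skew K R \<tau> \<omega> c \<xi> \<mu> \<mu>' "gas_gen K R \<tau> \<omega> c \<xi> GenY" \<omega> h pY
  by (rule skew.intro[OF hgext_axioms], rule skew_axioms.intro)
    (use H' amb_facts in \<open>simp_all add: omega_auto Y_iota p_lin\<close>)

abbreviation "g' \<equiv> inv\<^bsub>R\<^esub> g"
abbreviation "h' \<equiv> inv\<^bsub>R\<^esub> h"
abbreviation "E \<equiv> SX.E"
abbreviation "F \<equiv> SY.E"

lemma tau_omega_id [simp]: "r \<in> carrier R \<Longrightarrow> \<tau> (\<omega> r) = r" "r \<in> carrier R \<Longrightarrow> \<omega> (\<tau> r) = r"
  using R.alg_auto_inv[OF tau_auto] by auto

section \<open>Relations between the two group-like elements\<close>

definition "tmul f1 f2 f3 = lift3 K R (\<lambda>x y z. f1 x \<otimes>\<^bsub>R\<^esub> (f2 y \<otimes>\<^bsub>R\<^esub> f3 z))"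

lemma tri_tmul:
  assumes "linmap K A R f1" "linmap K A R f2" "linmap K A R f3"
  shows "trilin K A A A R (\<lambda>x y z. f1 x \<otimes>\<^bsub>R\<^esub> (f2 y \<otimes>\<^bsub>R\<^esub> f3 z))"
  by (rule trilinI) (use assms linmapD(1)[OF assms(1)] linmapD(1)[OF assms(2)] linmapD(1)[OF assms(3)]
      in \<open>auto intro!: linmap_mult_l linmap_mult_r algR\<close>)

lemma linmap_tmul: "\<lbrakk>linmap K A R f1; linmap K A R f2; linmap K A R f3\<rbrakk> \<Longrightarrow> linmap K TA3 R (tmul f1 f2 f3)"
  unfolding tmul_def by (rule A.linmap_lift3[OF tri_tmul R.moduleR])

lemma tmul_pure: "\<lbrakk>linmap K A R f1; linmap K A R f2; linmap K A R f3; a \<in> carrier A; b \<in> carrier A; d \<in> carrier A\<rbrakk> \<Longrightarrow>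
    tmul f1 f2 f3 (pA3 [a, b, d]) = f1 a \<otimes>\<^bsub>R\<^esub> (f2 b \<otimes>\<^bsub>R\<^esub> f3 d)"
  unfolding tmul_def by (simp add: A.lift3_pure[OF tri_tmul R.moduleR])

lemma mu_XY: "\<mu>' X \<otimes>\<^bsub>TA3\<^esub> \<mu>' Y = \<xi> \<odot>\<^bsub>TA3\<^esub> (\<mu>' Y \<otimes>\<^bsub>TA3\<^esub> \<mu>' X) \<oplus>\<^bsub>TA3\<^esub> J3 (\<mu> c)"
  using HA.muD(3)[OF X_closed Y_closed] by (simp add: XY_eq HA.muD mu_iota)

lemma p_closed [simp]: "a \<in> carrier A \<Longrightarrow> p0 a \<in> carrier R" "a \<in> carrier A \<Longrightarrow> pX a \<in> carrier R" "a \<in> carrier A \<Longrightarrow> pY a \<in> carrier R"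
  by (rule linmapD(1)[OF p_lin(1)] linmapD(1)[OF p_lin(2)] linmapD(1)[OF p_lin(3)], assumption)+

text \<open>Coefficients of \<open>X \<otimes> 1 \<otimes> Y\<close> and \<open>Y \<otimes> 1 \<otimes> X\<close> in \<open>\<mu>(XY - \<xi>YX) = \<mu>(c)\<close>, multiplied together in \<open>R\<close>.\<close>

lemma tau_h: "\<tau> h = \<xi> \<odot>\<^bsub>R\<^esub> h" and xi_omega_g: "\<xi> \<odot>\<^bsub>R\<^esub> \<omega> g = g"
proof -
  { fix f1 f3 assume f: "f1 = pX \<and> f3 = pY \<or> f1 = pY \<and> f3 = pX"
    have fl: "linmap K A R f1" "linmap K A R f3" using f p_lin by auto
    have T: "linmap K TA3 R (tmul f1 p0 f3)" by (rule linmap_tmul[OF fl(1) p_lin(1) fl(2)])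
    \<comment> \<open>\<mu>(c) has all its slots in R, where the coefficients of X and Y
      vanish.\<close>
    have 0: "tmul f1 p0 f3 (J3 (\<mu> c)) = \<zero>\<^bsub>R\<^esub>"
      by (rule R.T3_eqI[OF linmap_comp[OF T J3_lin] linmap_const0[OF R.moduleR] R.moduleR])
        (use f HR.muD(1) in \<open>auto simp: tmul_pure p_lin\<close>)
    have "tmul f1 p0 f3 (\<mu>' X \<otimes>\<^bsub>TA3\<^esub> \<mu>' Y) = \<xi> \<odot>\<^bsub>R\<^esub> tmul f1 p0 f3 (\<mu>' Y \<otimes>\<^bsub>TA3\<^esub> \<mu>' X)"
      unfolding mu_XY using HR.muD(1) HA.muD(1) 0 linmapD[OF T] linmapD(1)[OF J3_lin] by simp }
  note M = this
  note PD = linmapD linmap_uminus[OF _ A.T3_module R.moduleR]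
  have T1: "linmap K TA3 R (tmul pX p0 pY)" and T2: "linmap K TA3 R (tmul pY p0 pX)"
    by (rule linmap_tmul; rule p_lin)+
  \<comment> \<open>X must come from the first slot and Y from the third, which leaves the product
    of X \<otimes> 1 \<otimes> 1 with h \<otimes> h^-1 \<otimes> Y; passing X over h produces
    \<tau>(h). The other three cases select their single term in the same way.\<close>
  have c1: "tmul pX p0 pY (\<mu>' X \<otimes>\<^bsub>TA3\<^esub> \<mu>' Y) = \<tau> h \<otimes>\<^bsub>R\<^esub> h'"
    by (simp add: SX.mu_Z SY.mu_Z a_minus_def HA.T3.l_distr HA.T3.r_distr HA.T3.l_minus HA.T3.r_minus PD[OF T1]
        linmapD[OF T1] tmul_pure p_lin X_iota Y_iota iota_simps(2)[symmetric] A.m_assoc SX.iota_l)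
  have c2: "tmul pX p0 pY (\<mu>' Y \<otimes>\<^bsub>TA3\<^esub> \<mu>' X) = \<one>\<^bsub>R\<^esub>"
    by (simp add: SX.mu_Z SY.mu_Z a_minus_def HA.T3.l_distr HA.T3.r_distr HA.T3.l_minus HA.T3.r_minus PD[OF T1]
        linmapD[OF T1] tmul_pure p_lin X_iota Y_iota iota_simps(2)[symmetric] A.m_assoc SX.iota_l)
  have c3: "tmul pY p0 pX (\<mu>' X \<otimes>\<^bsub>TA3\<^esub> \<mu>' Y) = \<one>\<^bsub>R\<^esub>"
    by (simp add: SX.mu_Z SY.mu_Z a_minus_def HA.T3.l_distr HA.T3.r_distr HA.T3.l_minus HA.T3.r_minus PD[OF T2]
        linmapD[OF T2] tmul_pure p_lin X_iota Y_iota iota_simps(2)[symmetric] A.m_assoc SX.iota_l)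
  have c4: "tmul pY p0 pX (\<mu>' Y \<otimes>\<^bsub>TA3\<^esub> \<mu>' X) = \<omega> g \<otimes>\<^bsub>R\<^esub> g'"
    by (simp add: SX.mu_Z SY.mu_Z a_minus_def HA.T3.l_distr HA.T3.r_distr HA.T3.l_minus HA.T3.r_minus PD[OF T2]
        linmapD[OF T2] tmul_pure p_lin X_iota Y_iota iota_simps(2)[symmetric] A.m_assoc SX.iota_l)
  have "\<tau> h \<otimes>\<^bsub>R\<^esub> h' \<otimes>\<^bsub>R\<^esub> h = (\<xi> \<odot>\<^bsub>R\<^esub> \<one>\<^bsub>R\<^esub>) \<otimes>\<^bsub>R\<^esub> h" using M[of pX pY] c1 c2 by simp
  then show "\<tau> h = \<xi> \<odot>\<^bsub>R\<^esub> h" by (simp add: SY.gc R.smult_mult_l)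
  have "\<one>\<^bsub>R\<^esub> \<otimes>\<^bsub>R\<^esub> g = (\<xi> \<odot>\<^bsub>R\<^esub> (\<omega> g \<otimes>\<^bsub>R\<^esub> g')) \<otimes>\<^bsub>R\<^esub> g" using M[of pY pX] c3 c4 by simp
  then show "\<xi> \<odot>\<^bsub>R\<^esub> \<omega> g = g" by (simp add: SX.gc R.smult_mult_l)
qed

lemma smult_move: "\<lbrakk>a \<in> carrier K; x \<in> carrier R; y \<in> carrier R; a \<noteq> \<zero>\<^bsub>K\<^esub>; a \<odot>\<^bsub>R\<^esub> x = a \<odot>\<^bsub>R\<^esub> y\<rbrakk> \<Longrightarrow> x = y"
proof -
  assume a: "a \<in> carrier K" "x \<in> carrier R" "y \<in> carrier R" "a \<noteq> \<zero>\<^bsub>K\<^esub>" "a \<odot>\<^bsub>R\<^esub> x = a \<odot>\<^bsub>R\<^esub> y"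
  then have u: "inv\<^bsub>K\<^esub> a \<in> carrier K" "inv\<^bsub>K\<^esub> a \<otimes>\<^bsub>K\<^esub> a = \<one>\<^bsub>K\<^esub>"
    using R.K.field_Units by (auto intro: R.K.Units_l_inv R.K.Units_inv_closed)
  have i: "inv\<^bsub>K\<^esub> a \<odot>\<^bsub>R\<^esub> (a \<odot>\<^bsub>R\<^esub> z) = z" if "z \<in> carrier R" for z
    using u a(1) that by (simp add: R.Mod.smult_assoc1[symmetric])
  show ?thesis by (rule trans[OF i[OF a(2), symmetric, unfolded a(5)] i[OF a(3)]])
qed

text \<open>Inverting \<omega>(g) = \<xi>^-1 g. This and \<open>xi_tau_h'\<close> are the rules by
  which Y passes g^-1 and X passes h^-1 in the products of E and F.\<close>

lemma omega_g': "\<omega> g' = \<xi> \<odot>\<^bsub>R\<^esub> g'"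
proof -
  have "\<omega> g' = \<omega> g' \<otimes>\<^bsub>R\<^esub> (g \<otimes>\<^bsub>R\<^esub> g')" by simp
  also have "\<dots> = \<omega> g' \<otimes>\<^bsub>R\<^esub> ((\<xi> \<odot>\<^bsub>R\<^esub> \<omega> g) \<otimes>\<^bsub>R\<^esub> g')" by (simp only: xi_omega_g)
  also have "\<dots> = \<xi> \<odot>\<^bsub>R\<^esub> ((\<omega> g' \<otimes>\<^bsub>R\<^esub> \<omega> g) \<otimes>\<^bsub>R\<^esub> g')" by (simp add: R.smult_mult_l R.smult_mult_r R.m_assoc)
  also have "\<omega> g' \<otimes>\<^bsub>R\<^esub> \<omega> g = \<one>\<^bsub>R\<^esub>" by (simp add: omega_simps(2)[symmetric] omega_simps(3))
  finally show ?thesis by simp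
qed

lemma xi_tau_h': "\<xi> \<odot>\<^bsub>R\<^esub> \<tau> h' = h'"
proof -
  have "h' = (\<tau> h' \<otimes>\<^bsub>R\<^esub> \<tau> h) \<otimes>\<^bsub>R\<^esub> h'" by (simp add: tau_simps(2)[symmetric] tau_simps(3))
  also have "\<dots> = \<xi> \<odot>\<^bsub>R\<^esub> \<tau> h'" by (simp add: tau_h R.smult_mult_l R.smult_mult_r R.m_assoc)
  finally show ?thesis by simp
qed

text \<open>Since \<open>\<tau>(h) = \<xi>h\<close>, the element \<open>\<mu>(\<tau>(h))\<close> is both \<open>\<xi>\<mu>(h)\<close> and
  \<open>ghg\<^sup>-\<^sup>1 \<otimes> gh\<^sup>-\<^sup>1g\<^sup>-\<^sup>1 \<otimes> \<tau>(h)\<close>, which forces \<open>h\<close> and \<open>ghg\<^sup>-\<^sup>1\<close> to be proportional.\<close>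

lemma ex_lambda: "\<exists>l\<in>carrier K. l \<noteq> \<zero>\<^bsub>K\<^esub> \<and> h = l \<odot>\<^bsub>R\<^esub> (g \<otimes>\<^bsub>R\<^esub> h \<otimes>\<^bsub>R\<^esub> g')"
proof -
  obtain \<phi> where \<phi>: "R.functional \<phi>" "\<phi> \<one>\<^bsub>R\<^esub> = \<one>\<^bsub>K\<^esub>" using R.ex_functional[OF HR.one_ne_zero] by blast
  let ?w = "g \<otimes>\<^bsub>R\<^esub> h \<otimes>\<^bsub>R\<^esub> g'" and ?v = "g \<otimes>\<^bsub>R\<^esub> h' \<otimes>\<^bsub>R\<^esub> g'"
  have e: "\<mu> (\<tau> h) = HR.adG g \<otimes>\<^bsub>TR3\<^esub> HR.S3 \<tau> (\<mu> h) \<otimes>\<^bsub>TR3\<^esub> HR.adG g'"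
    by (rule HR.twist_eq[OF SX.twist_sigma SX.gU SX.sig_lin]) simp
  have e': "\<mu> (\<tau> h) = pR3 [?w, ?v, \<tau> h]"
    unfolding e by (simp add: SY.g_mu HR.S3_pure[OF SX.sig_lin] R.Units_inv_inv[OF SX.gU] R.m_assoc)
  \<comment> \<open>Designed so that h \<otimes> h^-1 \<otimes> h goes to h: the functional sees
    h^-1 h = 1, the third factor is cancelled by h^-1, and the first remains. On the conjugated form
    of \<mu>(\<tau>(h)) it leaves a multiple of ghg^-1.\<close>
  let ?G = "\<lambda>x y z. \<phi> (y \<otimes>\<^bsub>R\<^esub> h) \<odot>\<^bsub>R\<^esub> (x \<otimes>\<^bsub>R\<^esub> (z \<otimes>\<^bsub>R\<^esub> h'))"
  have G: "trilin K R R R R ?G"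
    by (rule trilinI)
      (auto intro!: linmap_smult R.linmap_functional_smult[OF \<phi>(1)] linmap_mult_l linmap_mult_r linmap_id R.moduleR algR R.functionalD(1)[OF \<phi>(1)])
  note L = R.linmap_lift3[OF G R.moduleR]
  note LP = R.lift3_pure[OF G R.moduleR]
  have f: "\<phi> (?v \<otimes>\<^bsub>R\<^esub> h) \<in> carrier K" by (rule R.functionalD(1)[OF \<phi>(1)]) simp
  have "lift3 K R ?G (\<mu> (\<tau> h)) = \<xi> \<odot>\<^bsub>R\<^esub> h"
    by (simp add: tau_h HR.muD SY.g_mu linmapD[OF L] LP \<phi>(2))
  moreover have "lift3 K R ?G (\<mu> (\<tau> h)) = \<xi> \<odot>\<^bsub>R\<^esub> (\<phi> (?v \<otimes>\<^bsub>R\<^esub> h) \<odot>\<^bsub>R\<^esub> ?w)"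
    unfolding e' using f by (simp add: tau_h LP R.smult_mult_l R.smult_mult_r R.Mod.smult_assoc1[symmetric] R.K.m_comm)
  ultimately have e2: "\<xi> \<odot>\<^bsub>R\<^esub> h = \<xi> \<odot>\<^bsub>R\<^esub> (\<phi> (?v \<otimes>\<^bsub>R\<^esub> h) \<odot>\<^bsub>R\<^esub> ?w)" by simp
  have hw: "h = \<phi> (?v \<otimes>\<^bsub>R\<^esub> h) \<odot>\<^bsub>R\<^esub> ?w"
    by (rule smult_move[OF xi_closed _ _ xi_nz e2]) (simp_all add: f)
  have "\<phi> (?v \<otimes>\<^bsub>R\<^esub> h) \<noteq> \<zero>\<^bsub>K\<^esub>"
  proof
    assume "\<phi> (?v \<otimes>\<^bsub>R\<^esub> h) = \<zero>\<^bsub>K\<^esub>"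
    then have "h = \<zero>\<^bsub>R\<^esub>" using hw by simp
    then have "\<one>\<^bsub>R\<^esub> = \<zero>\<^bsub>R\<^esub>" using SY.gs(3) SY.gs(2) R.l_null by metis
    then show False using HR.one_ne_zero by simp
  qed
  then show ?thesis using hw f by blast
qed

definition "lam = (SOME l. l \<in> carrier K \<and> l \<noteq> \<zero>\<^bsub>K\<^esub> \<and> h = l \<odot>\<^bsub>R\<^esub> (g \<otimes>\<^bsub>R\<^esub> h \<otimes>\<^bsub>R\<^esub> g'))"

lemma lam: "lam \<in> carrier K" "lam \<noteq> \<zero>\<^bsub>K\<^esub>" "h = lam \<odot>\<^bsub>R\<^esub> (g \<otimes>\<^bsub>R\<^esub> h \<otimes>\<^bsub>R\<^esub> g')"
proof -
  have "lam \<in> carrier K \<and> lam \<noteq> \<zero>\<^bsub>K\<^esub> \<and> h = lam \<odot>\<^bsub>R\<^esub> (g \<otimes>\<^bsub>R\<^esub> h \<otimes>\<^bsub>R\<^esub> g')"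
    unfolding lam_def by (rule someI_ex) (use ex_lambda in blast)
  then show "lam \<in> carrier K" "lam \<noteq> \<zero>\<^bsub>K\<^esub>" "h = lam \<odot>\<^bsub>R\<^esub> (g \<otimes>\<^bsub>R\<^esub> h \<otimes>\<^bsub>R\<^esub> g')" by blast+
qed

lemma hg_comm: "h \<otimes>\<^bsub>R\<^esub> g = lam \<odot>\<^bsub>R\<^esub> (g \<otimes>\<^bsub>R\<^esub> h)"
proof -
  have "h \<otimes>\<^bsub>R\<^esub> g = (lam \<odot>\<^bsub>R\<^esub> (g \<otimes>\<^bsub>R\<^esub> h \<otimes>\<^bsub>R\<^esub> g')) \<otimes>\<^bsub>R\<^esub> g" by (simp only: lam(3)[symmetric])
  then show ?thesis using lam(1) by (simp add: R.smult_mult_l SX.gc)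
qed

abbreviation "q \<equiv> h' \<otimes>\<^bsub>R\<^esub> g'"

lemma q_eq: "lam \<odot>\<^bsub>R\<^esub> (g' \<otimes>\<^bsub>R\<^esub> h') = q"
proof -
  have "h' \<otimes>\<^bsub>R\<^esub> g' \<otimes>\<^bsub>R\<^esub> (h \<otimes>\<^bsub>R\<^esub> g) \<otimes>\<^bsub>R\<^esub> (g' \<otimes>\<^bsub>R\<^esub> h') = q" by (simp add: R.m_assoc SX.gc SY.gc)
  moreover have "h' \<otimes>\<^bsub>R\<^esub> g' \<otimes>\<^bsub>R\<^esub> (h \<otimes>\<^bsub>R\<^esub> g) \<otimes>\<^bsub>R\<^esub> (g' \<otimes>\<^bsub>R\<^esub> h') = lam \<odot>\<^bsub>R\<^esub> (g' \<otimes>\<^bsub>R\<^esub> h')"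
    unfolding hg_comm using lam(1) by (simp add: R.smult_mult_l R.smult_mult_r R.m_assoc SX.gc SY.gc)
  ultimately show ?thesis by simp
qed

section \<open>The commutation relation between E and F\<close>

definition "xi' = \<xi> \<otimes>\<^bsub>K\<^esub> lam"
definition "c' = pR2 [q, c] \<ominus>\<^bsub>TR2\<^esub> pR2 [q \<otimes>\<^bsub>R\<^esub> c, \<one>\<^bsub>R\<^esub>]"

lemma xi': "xi' \<in> carrier K" "xi' \<noteq> \<zero>\<^bsub>K\<^esub>"
  using lam(1,2) xi_nz by (auto simp: xi'_def R.K.integral_iff)

lemma c'_T2: "c' \<in> carrier TR2" by (simp add: c'_def)

lemma J2_c': "J2 c' = pA2 [\<iota> q, \<iota> c] \<ominus>\<^bsub>TA2\<^esub> pA2 [\<iota> q \<otimes>\<^bsub>A\<^esub> \<iota> c, \<one>\<^bsub>A\<^esub>]"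
  by (simp add: c'_def linmap_minus[OF J2_lin R.T2_module A.T2_module] iota_simps)

lemma pA2_lin: "\<lbrakk>a \<in> carrier A; b \<in> carrier A; d \<in> carrier A\<rbrakk> \<Longrightarrow> pA2 [a \<oplus>\<^bsub>A\<^esub> b, d] = pA2 [a, d] \<oplus>\<^bsub>TA2\<^esub> pA2 [b, d]"
  "\<lbrakk>a \<in> carrier A; b \<in> carrier A; d \<in> carrier A\<rbrakk> \<Longrightarrow> pA2 [d, a \<oplus>\<^bsub>A\<^esub> b] = pA2 [d, a] \<oplus>\<^bsub>TA2\<^esub> pA2 [d, b]"
  "\<lbrakk>k \<in> carrier K; b \<in> carrier A; d \<in> carrier A\<rbrakk> \<Longrightarrow> pA2 [k \<odot>\<^bsub>A\<^esub> b, d] = k \<odot>\<^bsub>TA2\<^esub> pA2 [b, d]"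
  "\<lbrakk>k \<in> carrier K; b \<in> carrier A; d \<in> carrier A\<rbrakk> \<Longrightarrow> pA2 [d, k \<odot>\<^bsub>A\<^esub> b] = k \<odot>\<^bsub>TA2\<^esub> pA2 [d, b]"
  using linmapD[OF A.linmap_pure2_1[OF linmap_id]] linmapD[OF A.linmap_pure2_2[OF linmap_id]] by simp_all

lemma EF_eq: "E \<otimes>\<^bsub>TA2\<^esub> F = xi' \<odot>\<^bsub>TA2\<^esub> (F \<otimes>\<^bsub>TA2\<^esub> E) \<oplus>\<^bsub>TA2\<^esub> J2 c'"
proof -
  \<comment> \<open>Both EF and \<xi>'FE reduce to the terms \<open>?a1\<close> to
    \<open>?a4\<close>. The extra \<open>?b\<close> comes from XY in the second slot of EF, the
    extra \<open>?d\<close> from XY in the first slot of FE, where the product is reversed. Their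
    difference is \<open>J2 c'\<close>.\<close>
  let ?a1 = "\<xi> \<odot>\<^bsub>TA2\<^esub> pA2 [\<iota> q, Y \<otimes>\<^bsub>A\<^esub> X]" and ?a2 = "\<xi> \<odot>\<^bsub>TA2\<^esub> pA2 [\<iota> q \<otimes>\<^bsub>A\<^esub> Y, X]"
    and ?a3 = "pA2 [\<iota> q \<otimes>\<^bsub>A\<^esub> X, Y]" and ?a4 = "\<xi> \<odot>\<^bsub>TA2\<^esub> pA2 [\<iota> q \<otimes>\<^bsub>A\<^esub> (Y \<otimes>\<^bsub>A\<^esub> X), \<one>\<^bsub>A\<^esub>]"
    and ?b = "pA2 [\<iota> q, \<iota> c]" and ?d = "pA2 [\<iota> q \<otimes>\<^bsub>A\<^esub> \<iota> c, \<one>\<^bsub>A\<^esub>]"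
  have hYg: "\<iota> h' \<otimes>\<^bsub>A\<^esub> (Y \<otimes>\<^bsub>A\<^esub> (\<iota> g' \<otimes>\<^bsub>A\<^esub> a)) = \<xi> \<odot>\<^bsub>A\<^esub> (\<iota> q \<otimes>\<^bsub>A\<^esub> (Y \<otimes>\<^bsub>A\<^esub> a))" if a: "a \<in> carrier A" for a
  proof -
    have "Y \<otimes>\<^bsub>A\<^esub> (\<iota> g' \<otimes>\<^bsub>A\<^esub> a) = \<iota> (\<xi> \<odot>\<^bsub>R\<^esub> g') \<otimes>\<^bsub>A\<^esub> (Y \<otimes>\<^bsub>A\<^esub> a)"
      using a by (simp add: A.m_assoc[symmetric] Y_iota omega_g')
    then show ?thesis using a by (simp add: iota_simps A.smult_mult_l A.smult_mult_r A.m_assoc)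
  qed
  have hYg1: "\<iota> h' \<otimes>\<^bsub>A\<^esub> (Y \<otimes>\<^bsub>A\<^esub> \<iota> g') = \<xi> \<odot>\<^bsub>A\<^esub> (\<iota> q \<otimes>\<^bsub>A\<^esub> Y)" using hYg[of "\<one>\<^bsub>A\<^esub>"] by simp
  have L: "E \<otimes>\<^bsub>TA2\<^esub> F = ((?a1 \<oplus>\<^bsub>TA2\<^esub> ?b) \<ominus>\<^bsub>TA2\<^esub> ?a2) \<oplus>\<^bsub>TA2\<^esub> (?a4 \<ominus>\<^bsub>TA2\<^esub> ?a3)"
    by (simp add: SX.E_def SY.E_def a_minus_def HA.T2.l_distr HA.T2.r_distr HA.T2.l_minus HA.T2.r_minus
       A.m_assoc hYg hYg1 XY_eq pA2_lin HA.T2.minus_add HA.T2.a_ac iota_simps(2) )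
  \<comment> \<open>Passing X over h^-1 costs \<xi>^-1, which the factor \<xi> of \<open>xi'\<close>
    repairs; the factor \<open>lam\<close> reorders g^-1 h^-1 into \<open>q\<close>.\<close>
  have gXh: "xi' \<odot>\<^bsub>A\<^esub> (\<iota> g' \<otimes>\<^bsub>A\<^esub> (X \<otimes>\<^bsub>A\<^esub> (\<iota> h' \<otimes>\<^bsub>A\<^esub> a))) = \<iota> q \<otimes>\<^bsub>A\<^esub> (X \<otimes>\<^bsub>A\<^esub> a)" if a: "a \<in> carrier A" for a
  proof -
    have "X \<otimes>\<^bsub>A\<^esub> (\<iota> h' \<otimes>\<^bsub>A\<^esub> a) = \<iota> (\<tau> h') \<otimes>\<^bsub>A\<^esub> (X \<otimes>\<^bsub>A\<^esub> a)"
      using a by (simp add: A.m_assoc[symmetric] X_iota)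
    moreover have "xi' \<odot>\<^bsub>A\<^esub> (\<iota> g' \<otimes>\<^bsub>A\<^esub> (\<iota> (\<tau> h') \<otimes>\<^bsub>A\<^esub> (X \<otimes>\<^bsub>A\<^esub> a))) = \<iota> (lam \<odot>\<^bsub>R\<^esub> (g' \<otimes>\<^bsub>R\<^esub> (\<xi> \<odot>\<^bsub>R\<^esub> \<tau> h'))) \<otimes>\<^bsub>A\<^esub> (X \<otimes>\<^bsub>A\<^esub> a)"
    proof -
      have x: "xi' = lam \<otimes>\<^bsub>K\<^esub> \<xi>" using lam(1) by (simp add: xi'_def R.K.m_comm)
      have "lam \<odot>\<^bsub>R\<^esub> (g' \<otimes>\<^bsub>R\<^esub> (\<xi> \<odot>\<^bsub>R\<^esub> \<tau> h')) = xi' \<odot>\<^bsub>R\<^esub> (g' \<otimes>\<^bsub>R\<^esub> \<tau> h')"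
        unfolding x using lam(1) by (simp add: R.smult_mult_r R.Mod.smult_assoc1)
      then show ?thesis using a xi'(1) by (simp add: iota_simps A.smult_mult_l A.m_assoc)
    qed
    ultimately show ?thesis by (simp add: xi_tau_h' q_eq)
  qed
  have gXh1: "xi' \<odot>\<^bsub>A\<^esub> (\<iota> g' \<otimes>\<^bsub>A\<^esub> (X \<otimes>\<^bsub>A\<^esub> \<iota> h')) = \<iota> q \<otimes>\<^bsub>A\<^esub> X" using gXh[of "\<one>\<^bsub>A\<^esub>"] by simp
  \<comment> \<open>No X is passed over h^-1 here, so only \<open>lam\<close> is absorbed and \<xi>
    remains, in agreement with the coefficients of \<open>?a1\<close> and
    \<open>?a2\<close>.\<close>
  have gh: "xi' \<odot>\<^bsub>A\<^esub> (\<iota> g' \<otimes>\<^bsub>A\<^esub> (\<iota> h' \<otimes>\<^bsub>A\<^esub> a)) = \<xi> \<odot>\<^bsub>A\<^esub> (\<iota> q \<otimes>\<^bsub>A\<^esub> a)" if a: "a \<in> carrier A" for a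
  proof -
    have "\<xi> \<odot>\<^bsub>A\<^esub> (\<iota> (lam \<odot>\<^bsub>R\<^esub> (g' \<otimes>\<^bsub>R\<^esub> h')) \<otimes>\<^bsub>A\<^esub> a) = xi' \<odot>\<^bsub>A\<^esub> (\<iota> g' \<otimes>\<^bsub>A\<^esub> (\<iota> h' \<otimes>\<^bsub>A\<^esub> a))"
      using a lam(1) by (simp add: xi'_def iota_simps A.smult_mult_l A.smult_mult_r A.m_assoc A.Mod.smult_assoc1)
    then show ?thesis by (simp add: q_eq)
  qed
  have gh1: "xi' \<odot>\<^bsub>A\<^esub> (\<iota> g' \<otimes>\<^bsub>A\<^esub> \<iota> h') = \<xi> \<odot>\<^bsub>A\<^esub> \<iota> q" using gh[of "\<one>\<^bsub>A\<^esub>"] by simp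
  have XYq: "\<iota> q \<otimes>\<^bsub>A\<^esub> (X \<otimes>\<^bsub>A\<^esub> Y) = \<xi> \<odot>\<^bsub>A\<^esub> (\<iota> q \<otimes>\<^bsub>A\<^esub> (Y \<otimes>\<^bsub>A\<^esub> X)) \<oplus>\<^bsub>A\<^esub> \<iota> q \<otimes>\<^bsub>A\<^esub> \<iota> c"
    by (simp add: XY_eq A.r_distr A.smult_mult_r)
  have FE: "F \<otimes>\<^bsub>TA2\<^esub> E = (pA2 [\<iota> g' \<otimes>\<^bsub>A\<^esub> \<iota> h', Y \<otimes>\<^bsub>A\<^esub> X] \<ominus>\<^bsub>TA2\<^esub> pA2 [\<iota> g' \<otimes>\<^bsub>A\<^esub> (\<iota> h' \<otimes>\<^bsub>A\<^esub> Y), X]) \<oplus>\<^bsub>TA2\<^esub>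
     (pA2 [\<iota> g' \<otimes>\<^bsub>A\<^esub> (X \<otimes>\<^bsub>A\<^esub> (\<iota> h' \<otimes>\<^bsub>A\<^esub> Y)), \<one>\<^bsub>A\<^esub>] \<ominus>\<^bsub>TA2\<^esub> pA2 [\<iota> g' \<otimes>\<^bsub>A\<^esub> (X \<otimes>\<^bsub>A\<^esub> \<iota> h'), Y])"
    by (simp add: SX.E_def SY.E_def a_minus_def HA.T2.l_distr HA.T2.r_distr HA.T2.l_minus HA.T2.r_minus
       A.m_assoc HA.T2.minus_add HA.T2.a_ac)
  have Rr: "xi' \<odot>\<^bsub>TA2\<^esub> (F \<otimes>\<^bsub>TA2\<^esub> E) = (?a1 \<ominus>\<^bsub>TA2\<^esub> ?a2) \<oplus>\<^bsub>TA2\<^esub> ((?a4 \<oplus>\<^bsub>TA2\<^esub> ?d) \<ominus>\<^bsub>TA2\<^esub> ?a3)"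
    unfolding FE using xi'(1)
    by (simp add: a_minus_def HA.T2.Mod.smult_r_distr HA.T2.Mod.smult_r_minus pA2_lin(3)[symmetric] gXh gXh1 gh gh1 XYq)
      (simp add: pA2_lin)
  show ?thesis unfolding L Rr J2_c'
    by (rule HA.T2.add_cancel_pair) simp_all
qed

text \<open>\<open>J2 c'\<close> is EF - \<xi>'FE, hence lies in H(A), and \<open>J2\<close>
  reflects membership. No computation of \<mu>(c) is involved.\<close>

lemma c'_HG: "c' \<in> carrier HR.HG"
proof -
  note s = HA.T2.Mod.submoduleE[OF HA.HG_submodule]
  have EF: "E \<otimes>\<^bsub>TA2\<^esub> F \<in> carrier HA.HG" "F \<otimes>\<^bsub>TA2\<^esub> E \<in> carrier HA.HG"
    by (intro HA.HG_mult_closed SX.E_HG SY.E_HG)+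
  have cl: "J2 c' \<in> carrier TA2" "xi' \<odot>\<^bsub>TA2\<^esub> (F \<otimes>\<^bsub>TA2\<^esub> E) \<in> carrier TA2" using J2D(1)[OF c'_T2] xi'(1) by simp_all
  have "J2 c' = E \<otimes>\<^bsub>TA2\<^esub> F \<oplus>\<^bsub>TA2\<^esub> \<ominus>\<^bsub>TA2\<^esub> (xi' \<odot>\<^bsub>TA2\<^esub> (F \<otimes>\<^bsub>TA2\<^esub> E))"
    unfolding EF_eq using cl by (simp add: HA.T2.a_ac HA.T2.r_neg1 HA.T2.r_neg2 HA.T2.r_neg)
  then have "J2 c' \<in> carrier HA.HG" using s(3,4,5) EF xi'(1) by simp
  then show ?thesis using J2_HG[OF c'_T2] by simp
qed

abbreviation "tau' \<equiv> SX.\<sigma>'"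
abbreviation "omega' \<equiv> SY.\<sigma>'"

lemma tau'_HG: "u \<in> carrier HR.HG \<Longrightarrow> tau' u \<in> carrier HR.HG" and omega'_HG: "u \<in> carrier HR.HG \<Longrightarrow> omega' u \<in> carrier HR.HG"
  using SX.sigma'_auto SY.sigma'_auto by (auto simp: alg_iso_def bij_betw_def)

text \<open>On the first slot the two composites are conjugation by gh and by hg, which agree
  because these elements are proportional; on the second slot \<tau> and its inverse
  commute.\<close>

lemma tau'_omega': "u \<in> carrier TR2 \<Longrightarrow> tau' (omega' u) = omega' (tau' u)"
proof -
  assume u: "u \<in> carrier TR2"
  note tl = HR.linmap_cj[OF SX.gU SX.sig_lin] and wl = HR.linmap_cj[OF SY.gU SY.sig_lin]
  have c: "g \<otimes>\<^bsub>R\<^esub> (h \<otimes>\<^bsub>R\<^esub> (a \<otimes>\<^bsub>R\<^esub> (h' \<otimes>\<^bsub>R\<^esub> g'))) = h \<otimes>\<^bsub>R\<^esub> (g \<otimes>\<^bsub>R\<^esub> (a \<otimes>\<^bsub>R\<^esub> (g' \<otimes>\<^bsub>R\<^esub> h')))" if a: "a \<in> carrier R" for a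
  proof -
    have "h \<otimes>\<^bsub>R\<^esub> (g \<otimes>\<^bsub>R\<^esub> (a \<otimes>\<^bsub>R\<^esub> (g' \<otimes>\<^bsub>R\<^esub> h'))) = (h \<otimes>\<^bsub>R\<^esub> g) \<otimes>\<^bsub>R\<^esub> (a \<otimes>\<^bsub>R\<^esub> (g' \<otimes>\<^bsub>R\<^esub> h'))" using a by (simp add: R.m_assoc)
    also have "\<dots> = (g \<otimes>\<^bsub>R\<^esub> h) \<otimes>\<^bsub>R\<^esub> (a \<otimes>\<^bsub>R\<^esub> (lam \<odot>\<^bsub>R\<^esub> (g' \<otimes>\<^bsub>R\<^esub> h')))"
      unfolding hg_comm using a lam(1) by (simp add: R.smult_mult_l R.smult_mult_r)
    finally show ?thesis using a by (simp add: q_eq R.m_assoc)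
  qed
  show ?thesis
    by (rule R.T2_eqI[OF linmap_comp[OF tl wl] linmap_comp[OF wl tl] R.T2_module _ u])
      (simp add: HR.cj_pure[OF SX.gU SX.sig_lin] HR.cj_pure[OF SY.gU SY.sig_lin] R.m_assoc c)
qed

lemma J2_inj: "\<lbrakk>u \<in> carrier TR2; v \<in> carrier TR2; J2 u = J2 v\<rbrakk> \<Longrightarrow> u = v"
  by (metis proj2_J2)

text \<open>Checked in H(A): EF and FE both carry u to \<tau>'\<omega>'(u), since the automorphisms
  commute, and so does their combination \<open>J2 c'\<close>. Injectivity of \<open>J2\<close>
  brings the identity back.\<close>

lemma c'_comm:
  assumes u: "u \<in> carrier HR.HG"
  shows "c' \<otimes>\<^bsub>TR2\<^esub> u = tau' (omega' u) \<otimes>\<^bsub>TR2\<^esub> c'"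
proof (rule J2_inj)
  have u': "u \<in> carrier TR2" by (rule HR.HG_sub[OF u])
  have w: "omega' u \<in> carrier HR.HG" "tau' u \<in> carrier HR.HG" "tau' (omega' u) \<in> carrier HR.HG"
    using omega'_HG tau'_HG u by auto
  note w' = w[THEN HR.HG_sub]
  show "c' \<otimes>\<^bsub>TR2\<^esub> u \<in> carrier TR2" "tau' (omega' u) \<otimes>\<^bsub>TR2\<^esub> c' \<in> carrier TR2" using c'_T2 u' w' by auto
  have cl: "J2 c' \<in> carrier TA2" "xi' \<odot>\<^bsub>TA2\<^esub> (F \<otimes>\<^bsub>TA2\<^esub> E) \<in> carrier TA2" using J2D(1)[OF c'_T2] xi'(1) by simp_all
  have Jc: "J2 c' = E \<otimes>\<^bsub>TA2\<^esub> F \<ominus>\<^bsub>TA2\<^esub> (xi' \<odot>\<^bsub>TA2\<^esub> (F \<otimes>\<^bsub>TA2\<^esub> E))"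
    unfolding EF_eq using cl by (simp add: a_minus_def HA.T2.a_ac HA.T2.r_neg1 HA.T2.r_neg2 HA.T2.r_neg)
  have J: "J2 u \<in> carrier TA2" "J2 (omega' u) \<in> carrier TA2" "J2 (tau' u) \<in> carrier TA2" "J2 (tau' (omega' u)) \<in> carrier TA2"
    using J2D(1) u' w' by auto
  have 1: "E \<otimes>\<^bsub>TA2\<^esub> F \<otimes>\<^bsub>TA2\<^esub> J2 u = J2 (tau' (omega' u)) \<otimes>\<^bsub>TA2\<^esub> (E \<otimes>\<^bsub>TA2\<^esub> F)"
  proof -
    have "E \<otimes>\<^bsub>TA2\<^esub> F \<otimes>\<^bsub>TA2\<^esub> J2 u = (E \<otimes>\<^bsub>TA2\<^esub> J2 (omega' u)) \<otimes>\<^bsub>TA2\<^esub> F"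
      using J by (simp add: HA.T2.m_assoc SY.E_comm[OF u])
    then show ?thesis using J by (simp add: SX.E_comm[OF w(1)] HA.T2.m_assoc)
  qed
  have 2: "F \<otimes>\<^bsub>TA2\<^esub> E \<otimes>\<^bsub>TA2\<^esub> J2 u = J2 (tau' (omega' u)) \<otimes>\<^bsub>TA2\<^esub> (F \<otimes>\<^bsub>TA2\<^esub> E)"
  proof -
    have "F \<otimes>\<^bsub>TA2\<^esub> E \<otimes>\<^bsub>TA2\<^esub> J2 u = (F \<otimes>\<^bsub>TA2\<^esub> J2 (tau' u)) \<otimes>\<^bsub>TA2\<^esub> E"
      using J by (simp add: HA.T2.m_assoc SX.E_comm[OF u])
    then show ?thesis using J J2D(1) w' by (simp add: SY.E_comm[OF w(2)] tau'_omega'[OF u', symmetric] HA.T2.m_assoc)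
  qed
  have "J2 c' \<otimes>\<^bsub>TA2\<^esub> J2 u = J2 (tau' (omega' u)) \<otimes>\<^bsub>TA2\<^esub> J2 c'"
    unfolding Jc a_minus_def using J xi'(1)
    by (simp add: HA.T2.l_distr HA.T2.r_distr HA.T2.l_minus HA.T2.r_minus HA.T2.smult_mult_l HA.T2.smult_mult_r 1 2)
  then show "J2 (c' \<otimes>\<^bsub>TR2\<^esub> u) = J2 (tau' (omega' u) \<otimes>\<^bsub>TR2\<^esub> c')"
    using u' w' c'_T2 by (simp add: J2D)
qed

lemma data': "gas_data K HR.HG tau' omega' c' xi'"
  unfolding gas_data_def
  using HR.HG_algebra SX.sigma'_auto SY.sigma'_auto c'_HG xi' c'_comm tau'_omega' HR.HG_sub by simp

section \<open>The comparison map from the generalized ambiskew algebra to H(A)\<close>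

sublocale GH: gasl K "HG_alg K R \<mu>" "conj_tensor K R g \<tau>" "conj_tensor K R h \<omega>" c' xi'
  by (rule gasl.intro[OF data'])

lemma J2_HG_hom: "J2 \<in> alg_hom K HR.HG HA.HG"
  by (rule alg_homI[OF linmapI]) (auto simp: HR.HG_sub J2D J2_HG)

definition "psi = (SOME \<psi>. \<psi> \<in> alg_hom K GH.A HA.HG \<and> (\<forall>u\<in>carrier HR.HG. \<psi> (GH.\<iota> u) = J2 u) \<and> \<psi> GH.X = E \<and> \<psi> GH.Y = F)"

lemma psi: "psi \<in> alg_hom K GH.A HA.HG" "u \<in> carrier HR.HG \<Longrightarrow> psi (GH.\<iota> u) = J2 u" "psi GH.X = E" "psi GH.Y = F"
proof -
  have "\<exists>\<psi>. \<psi> \<in> alg_hom K GH.A HA.HG \<and> (\<forall>u\<in>carrier HR.HG. \<psi> (GH.\<iota> u) = J2 u) \<and> \<psi> GH.X = E \<and> \<psi> GH.Y = F"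
  proof (rule GH.gas_univ[OF HA.HG_algebra J2_HG_hom SX.E_HG SY.E_HG])
    show "E \<otimes>\<^bsub>HA.HG\<^esub> F = xi' \<odot>\<^bsub>HA.HG\<^esub> (F \<otimes>\<^bsub>HA.HG\<^esub> E) \<oplus>\<^bsub>HA.HG\<^esub> J2 c'" using EF_eq by simp
  qed (auto simp: SX.E_comm SY.E_comm)
  from someI_ex[OF this] show "psi \<in> alg_hom K GH.A HA.HG" "u \<in> carrier HR.HG \<Longrightarrow> psi (GH.\<iota> u) = J2 u" "psi GH.X = E" "psi GH.Y = F"
    unfolding psi_def[symmetric] by blast+
qed

lemmas psiD = alg_homD[OF psi(1), simplified HA.HG_ops]

lemma psi_T2: "a \<in> carrier GH.A \<Longrightarrow> psi a \<in> carrier TA2"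
  using psiD(1) HA.HG_sub by blast

lemma psi_pow: "a \<in> carrier GH.A \<Longrightarrow> psi (a [^]\<^bsub>GH.A\<^esub> (n::nat)) = psi a [^]\<^bsub>TA2\<^esub> n"
  by (induction n) (simp_all add: psiD)

lemma psi_mnm: "u \<in> carrier HR.HG \<Longrightarrow> psi (GH.mnm i j u) = (E [^]\<^bsub>TA2\<^esub> j) \<otimes>\<^bsub>TA2\<^esub> (J2 u \<otimes>\<^bsub>TA2\<^esub> (F [^]\<^bsub>TA2\<^esub> i))"
  by (simp add: GH.mnm_def psiD psi_pow psi)

section \<open>Injectivity\<close>

text \<open>Such an \<open>f\<close> kills the second summand of \<open>E = g\<^sup>-\<^sup>1 \<otimes> X - g\<^sup>-\<^sup>1X \<otimes> 1\<close> acting from the left, and of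
  \<open>F\<close> acting from the right, on the first tensor factor. So \<open>f \<otimes> q\<close> reads off coefficients of \<open>E\<^sup>juF\<^sup>i\<close> as if
  \<open>E\<close> and \<open>F\<close> were \<open>g\<^sup>-\<^sup>1 \<otimes> X\<close> and \<open>h\<^sup>-\<^sup>1 \<otimes> Y\<close>.\<close>

definition "good f \<longleftrightarrow> linmap K A R f \<and> (\<forall>a\<in>carrier A. f (a \<otimes>\<^bsub>A\<^esub> X) = \<zero>\<^bsub>R\<^esub> \<and> f (Y \<otimes>\<^bsub>A\<^esub> a) = \<zero>\<^bsub>R\<^esub>)"

lemma goodD: "good f \<Longrightarrow> linmap K A R f" "good f \<Longrightarrow> a \<in> carrier A \<Longrightarrow> f (a \<otimes>\<^bsub>A\<^esub> X) = \<zero>\<^bsub>R\<^esub>"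
  "good f \<Longrightarrow> a \<in> carrier A \<Longrightarrow> f (Y \<otimes>\<^bsub>A\<^esub> a) = \<zero>\<^bsub>R\<^esub>"
  by (auto simp: good_def)

lemma good_p0: "good p0"
  by (simp add: good_def p_lin)

lemma X_iota_g': "X \<otimes>\<^bsub>A\<^esub> \<iota> g' = \<iota> (\<tau> g') \<otimes>\<^bsub>A\<^esub> X" and iota_h'_Y: "\<iota> h' \<otimes>\<^bsub>A\<^esub> Y = Y \<otimes>\<^bsub>A\<^esub> \<iota> (\<tau> h')"
  by (simp_all add: X_iota Y_iota)

text \<open>Stability holds because g^-1 can be moved across X at the price of \<tau>, so X still
  ends up on the far right.\<close>

lemma good_r: "good f \<Longrightarrow> good (\<lambda>a. f (a \<otimes>\<^bsub>A\<^esub> \<iota> g'))"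
  unfolding good_def
  by (auto intro!: linmap_comp[of K A R f] linmap_mult_r algA linmap_id)
    (simp_all add: A.m_assoc X_iota_g' goodD, simp_all add: A.m_assoc[symmetric])

lemma good_l: "good f \<Longrightarrow> good (\<lambda>a. f (\<iota> h' \<otimes>\<^bsub>A\<^esub> a))"
  unfolding good_def
  by (auto intro!: linmap_comp[of K A R f] linmap_mult_l algA linmap_id)
    (simp_all add: A.m_assoc[symmetric] iota_h'_Y, simp_all add: A.m_assoc)

lemma pR2_zero: "b \<in> carrier R \<Longrightarrow> pR2 [\<zero>\<^bsub>R\<^esub>, b] = \<zero>\<^bsub>TR2\<^esub>" "b \<in> carrier R \<Longrightarrow> pR2 [b, \<zero>\<^bsub>R\<^esub>] = \<zero>\<^bsub>TR2\<^esub>"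
  using linmap_zero[OF R.linmap_pure2_1[OF linmap_id] R.moduleR R.T2_module]
    linmap_zero[OF R.linmap_pure2_2[OF linmap_id] R.moduleR R.T2_module] by simp_all

lemma proj2_E:
  assumes f: "good f" and qf: "linmap K A R qf" and v: "v \<in> carrier TA2"
  shows "proj2 f qf (E \<otimes>\<^bsub>TA2\<^esub> v) = proj2 (\<lambda>a. f (a \<otimes>\<^bsub>A\<^esub> \<iota> g')) (\<lambda>b. qf (X \<otimes>\<^bsub>A\<^esub> b)) v"
proof -
  have fl: "linmap K A R f" "linmap K A R (\<lambda>a. f (a \<otimes>\<^bsub>A\<^esub> \<iota> g'))" by (rule goodD[OF f], rule goodD(1)[OF good_r[OF f]])
  have qf': "linmap K A R (\<lambda>b. qf (X \<otimes>\<^bsub>A\<^esub> b))" by (rule linmap_comp[OF qf linmap_mult_l[OF algA linmap_id X_closed]])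
  note P = linmap_proj2[OF fl(1) qf]
  show ?thesis
  proof (rule A.T2_eqI[OF linmap_comp[OF P linmap_mult_l[OF A.T2_alg linmap_id SX.E_T2]] linmap_proj2[OF fl(2) qf'] R.T2_module _ v])
    fix a b assume ab: "a \<in> carrier A" "b \<in> carrier A"
    have "f (a \<otimes>\<^bsub>A\<^esub> (\<iota> g' \<otimes>\<^bsub>A\<^esub> X)) = \<zero>\<^bsub>R\<^esub>" using goodD(2)[OF f, of "a \<otimes>\<^bsub>A\<^esub> \<iota> g'"] ab by (simp add: A.m_assoc)
    then show "proj2 f qf (E \<otimes>\<^bsub>TA2\<^esub> pA2 [a, b]) = proj2 (\<lambda>a. f (a \<otimes>\<^bsub>A\<^esub> \<iota> g')) (\<lambda>b. qf (X \<otimes>\<^bsub>A\<^esub> b)) (pA2 [a, b])"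
      using ab linmapD(1)[OF qf] linmapD(1)[OF fl(1)]
      by (simp add: SX.E_def a_minus_def HA.T2.l_distr HA.T2.l_minus linmapD[OF P] linmap_uminus[OF P A.T2_module R.T2_module]
          proj2_pure[OF fl(1) qf] proj2_pure[OF fl(2) qf'] pR2_zero)
  qed
qed

lemma proj2_F:
  assumes f: "good f" and qf: "linmap K A R qf" and v: "v \<in> carrier TA2"
  shows "proj2 f qf (v \<otimes>\<^bsub>TA2\<^esub> F) = proj2 (\<lambda>a. f (\<iota> h' \<otimes>\<^bsub>A\<^esub> a)) (\<lambda>b. qf (b \<otimes>\<^bsub>A\<^esub> Y)) v"
proof -
  have fl: "linmap K A R f" "linmap K A R (\<lambda>a. f (\<iota> h' \<otimes>\<^bsub>A\<^esub> a))" by (rule goodD[OF f], rule goodD(1)[OF good_l[OF f]])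
  have qf': "linmap K A R (\<lambda>b. qf (b \<otimes>\<^bsub>A\<^esub> Y))" by (rule linmap_comp[OF qf linmap_mult_r[OF algA linmap_id Y_closed]])
  note P = linmap_proj2[OF fl(1) qf]
  show ?thesis
  proof (rule A.T2_eqI[OF linmap_comp[OF P linmap_mult_r[OF A.T2_alg linmap_id SY.E_T2]] linmap_proj2[OF fl(2) qf'] R.T2_module _ v])
    fix a b assume ab: "a \<in> carrier A" "b \<in> carrier A"
    have "f (\<iota> h' \<otimes>\<^bsub>A\<^esub> Y \<otimes>\<^bsub>A\<^esub> a) = \<zero>\<^bsub>R\<^esub>"
      using goodD(3)[OF f, of "\<iota> (\<tau> h') \<otimes>\<^bsub>A\<^esub> a"] ab by (simp add: iota_h'_Y A.m_assoc)
    then show "proj2 f qf (pA2 [a, b] \<otimes>\<^bsub>TA2\<^esub> F) = proj2 (\<lambda>a. f (\<iota> h' \<otimes>\<^bsub>A\<^esub> a)) (\<lambda>b. qf (b \<otimes>\<^bsub>A\<^esub> Y)) (pA2 [a, b])"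
      using ab linmapD(1)[OF qf] linmapD(1)[OF fl(1)]
      by (simp add: SY.E_def a_minus_def HA.T2.r_distr HA.T2.r_minus linmapD[OF P] linmap_uminus[OF P A.T2_module R.T2_module]
          proj2_pure[OF fl(1) qf] proj2_pure[OF fl(2) qf'] pR2_zero)
  qed
qed

lemma proj2_cong:
  assumes "linmap K A R f" "linmap K A R qf" "linmap K A R f'" "linmap K A R qf'" and v: "v \<in> carrier TA2"
    and "\<And>a. a \<in> carrier A \<Longrightarrow> f a = f' a" "\<And>a. a \<in> carrier A \<Longrightarrow> qf a = qf' a"
  shows "proj2 f qf v = proj2 f' qf' v"
  by (rule A.T2_eqI[OF linmap_proj2[OF assms(1,2)] linmap_proj2[OF assms(3,4)] R.T2_module _ v])
    (simp add: assms proj2_pure)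

abbreviation "gp j \<equiv> g' [^]\<^bsub>R\<^esub> (j::nat)"
abbreviation "hp i \<equiv> h' [^]\<^bsub>R\<^esub> (i::nat)"

text \<open>Each factor E passes g^-1 to \<open>f\<close> and X to \<open>qf\<close>, so both are
  generalized in the induction. That the modified \<open>f\<close> is again \<open>good\<close> is
  part of the claim because the powers of F are treated next.\<close>

lemma proj2_Epow:
  assumes f: "good f" and qf: "linmap K A R qf" and v: "v \<in> carrier TA2"
  shows "good (\<lambda>a. f (a \<otimes>\<^bsub>A\<^esub> \<iota> (gp j))) \<and> proj2 f qf ((E [^]\<^bsub>TA2\<^esub> j) \<otimes>\<^bsub>TA2\<^esub> v) =
    proj2 (\<lambda>a. f (a \<otimes>\<^bsub>A\<^esub> \<iota> (gp j))) (\<lambda>b. qf ((X [^]\<^bsub>A\<^esub> j) \<otimes>\<^bsub>A\<^esub> b)) v"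
  using f qf
proof (induction j arbitrary: f qf)
  case 0
  have f1: "linmap K A R (\<lambda>a. f (a \<otimes>\<^bsub>A\<^esub> \<iota> \<one>\<^bsub>R\<^esub>))" "linmap K A R (\<lambda>b. qf (\<one>\<^bsub>A\<^esub> \<otimes>\<^bsub>A\<^esub> b))"
    by (auto intro!: linmap_comp[OF goodD(1)[OF 0(1)]] linmap_comp[OF 0(2)] linmap_mult_l linmap_mult_r algA linmap_id)
  have "good (\<lambda>a. f (a \<otimes>\<^bsub>A\<^esub> \<iota> \<one>\<^bsub>R\<^esub>))"
    using 0(1) f1 by (simp add: good_def iota_simps)
  moreover have "proj2 f qf v = proj2 (\<lambda>a. f (a \<otimes>\<^bsub>A\<^esub> \<iota> \<one>\<^bsub>R\<^esub>)) (\<lambda>b. qf (\<one>\<^bsub>A\<^esub> \<otimes>\<^bsub>A\<^esub> b)) v"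
    by (rule proj2_cong[OF goodD(1)[OF 0(1)] 0(2) f1 v]) (simp_all add: iota_simps)
  ultimately show ?case using v by simp
next
  case (Suc j)
  let ?f = "\<lambda>a. f (a \<otimes>\<^bsub>A\<^esub> \<iota> g')" and ?qf = "\<lambda>b. qf (X \<otimes>\<^bsub>A\<^esub> b)"
  have qf': "linmap K A R ?qf" by (rule linmap_comp[OF Suc.prems(2) linmap_mult_l[OF algA linmap_id X_closed]])
  note IH = Suc.IH[OF good_r[OF Suc.prems(1)] qf']
  have Ev: "(E [^]\<^bsub>TA2\<^esub> j) \<otimes>\<^bsub>TA2\<^esub> v \<in> carrier TA2" using v by simp
  have f1: "linmap K A R (\<lambda>a. f (a \<otimes>\<^bsub>A\<^esub> \<iota> (gp (Suc j))))" "linmap K A R (\<lambda>b. qf ((X [^]\<^bsub>A\<^esub> Suc j) \<otimes>\<^bsub>A\<^esub> b))"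
    by (auto intro!: linmap_comp[OF goodD(1)[OF Suc.prems(1)]] linmap_comp[OF Suc.prems(2)] linmap_mult_l linmap_mult_r algA linmap_id)
  have q2: "linmap K A R (\<lambda>b. ?qf ((X [^]\<^bsub>A\<^esub> j) \<otimes>\<^bsub>A\<^esub> b))"
    by (rule linmap_comp[OF qf' linmap_mult_l[OF algA linmap_id]]) simp
  have ef: "?f (a \<otimes>\<^bsub>A\<^esub> \<iota> (gp j)) = f (a \<otimes>\<^bsub>A\<^esub> \<iota> (gp (Suc j)))" if "a \<in> carrier A" for a
    using that by (simp add: iota_simps A.m_assoc)
  have "proj2 f qf ((E [^]\<^bsub>TA2\<^esub> Suc j) \<otimes>\<^bsub>TA2\<^esub> v) = proj2 f qf (E \<otimes>\<^bsub>TA2\<^esub> ((E [^]\<^bsub>TA2\<^esub> j) \<otimes>\<^bsub>TA2\<^esub> v))"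
    unfolding HA.T2.nat_pow_Suc2[OF SX.E_T2] using v by (simp add: HA.T2.m_assoc)
  also have "\<dots> = proj2 (\<lambda>a. ?f (a \<otimes>\<^bsub>A\<^esub> \<iota> (gp j))) (\<lambda>b. ?qf ((X [^]\<^bsub>A\<^esub> j) \<otimes>\<^bsub>A\<^esub> b)) v"
    unfolding proj2_E[OF Suc.prems Ev] using IH by blast
  also have "\<dots> = proj2 (\<lambda>a. f (a \<otimes>\<^bsub>A\<^esub> \<iota> (gp (Suc j)))) (\<lambda>b. qf ((X [^]\<^bsub>A\<^esub> Suc j) \<otimes>\<^bsub>A\<^esub> b)) v"
  proof (rule proj2_cong[OF goodD(1)[OF conjunct1[OF IH]] q2 f1 v ef])
    fix b assume b: "b \<in> carrier A"
    show "?qf ((X [^]\<^bsub>A\<^esub> j) \<otimes>\<^bsub>A\<^esub> b) = qf ((X [^]\<^bsub>A\<^esub> Suc j) \<otimes>\<^bsub>A\<^esub> b)"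
      unfolding A.nat_pow_Suc2[OF X_closed] using b by (simp add: A.m_assoc)
  qed
  finally have "proj2 f qf ((E [^]\<^bsub>TA2\<^esub> Suc j) \<otimes>\<^bsub>TA2\<^esub> v) = proj2 (\<lambda>a. f (a \<otimes>\<^bsub>A\<^esub> \<iota> (gp (Suc j)))) (\<lambda>b. qf ((X [^]\<^bsub>A\<^esub> Suc j) \<otimes>\<^bsub>A\<^esub> b)) v" .
  moreover have "good (\<lambda>a. f (a \<otimes>\<^bsub>A\<^esub> \<iota> (gp (Suc j))))"
  proof -
    have "f (a \<otimes>\<^bsub>A\<^esub> X \<otimes>\<^bsub>A\<^esub> \<iota> (gp (Suc j))) = \<zero>\<^bsub>R\<^esub> \<and> f (Y \<otimes>\<^bsub>A\<^esub> a \<otimes>\<^bsub>A\<^esub> \<iota> (gp (Suc j))) = \<zero>\<^bsub>R\<^esub>" if a: "a \<in> carrier A" for a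
      using goodD(2,3)[OF conjunct1[OF IH] a] ef[of "a \<otimes>\<^bsub>A\<^esub> X"] ef[of "Y \<otimes>\<^bsub>A\<^esub> a"] a by simp
    then show ?thesis unfolding good_def using f1(1) by blast
  qed
  ultimately show ?case by blast
qed

lemma proj2_Fpow:
  assumes f: "good f" and qf: "linmap K A R qf" and v: "v \<in> carrier TA2"
  shows "proj2 f qf (v \<otimes>\<^bsub>TA2\<^esub> (F [^]\<^bsub>TA2\<^esub> i)) =
    proj2 (\<lambda>a. f (\<iota> (hp i) \<otimes>\<^bsub>A\<^esub> a)) (\<lambda>b. qf (b \<otimes>\<^bsub>A\<^esub> (Y [^]\<^bsub>A\<^esub> i))) v"
  using f qf
proof (induction i arbitrary: f qf)
  case 0
  have f1: "linmap K A R (\<lambda>a. f (\<iota> \<one>\<^bsub>R\<^esub> \<otimes>\<^bsub>A\<^esub> a))" "linmap K A R (\<lambda>b. qf (b \<otimes>\<^bsub>A\<^esub> \<one>\<^bsub>A\<^esub>))"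
    by (auto intro!: linmap_comp[OF goodD(1)[OF 0(1)]] linmap_comp[OF 0(2)] linmap_mult_l linmap_mult_r algA linmap_id)
  have "proj2 f qf v = proj2 (\<lambda>a. f (\<iota> \<one>\<^bsub>R\<^esub> \<otimes>\<^bsub>A\<^esub> a)) (\<lambda>b. qf (b \<otimes>\<^bsub>A\<^esub> \<one>\<^bsub>A\<^esub>)) v"
    by (rule proj2_cong[OF goodD(1)[OF 0(1)] 0(2) f1 v]) (simp_all add: iota_simps)
  then show ?case using v by simp
next
  case (Suc i)
  let ?f = "\<lambda>a. f (\<iota> h' \<otimes>\<^bsub>A\<^esub> a)" and ?qf = "\<lambda>b. qf (b \<otimes>\<^bsub>A\<^esub> Y)"
  have qf': "linmap K A R ?qf" by (rule linmap_comp[OF Suc.prems(2) linmap_mult_r[OF algA linmap_id Y_closed]])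
  note gf = good_l[OF Suc.prems(1)]
  note IH = Suc.IH[OF gf qf']
  have Fv: "v \<otimes>\<^bsub>TA2\<^esub> (F [^]\<^bsub>TA2\<^esub> i) \<in> carrier TA2" using v by simp
  have f1: "linmap K A R (\<lambda>a. f (\<iota> (hp (Suc i)) \<otimes>\<^bsub>A\<^esub> a))" "linmap K A R (\<lambda>b. qf (b \<otimes>\<^bsub>A\<^esub> (Y [^]\<^bsub>A\<^esub> Suc i)))"
    by (auto intro!: linmap_comp[OF goodD(1)[OF Suc.prems(1)]] linmap_comp[OF Suc.prems(2)] linmap_mult_l linmap_mult_r algA linmap_id)
  have f2: "linmap K A R (\<lambda>a. ?f (\<iota> (hp i) \<otimes>\<^bsub>A\<^esub> a))" "linmap K A R (\<lambda>b. ?qf (b \<otimes>\<^bsub>A\<^esub> (Y [^]\<^bsub>A\<^esub> i)))"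
    by (auto intro!: linmap_comp[OF goodD(1)[OF gf]] linmap_comp[OF qf'] linmap_mult_l linmap_mult_r algA linmap_id)
  have "proj2 f qf (v \<otimes>\<^bsub>TA2\<^esub> (F [^]\<^bsub>TA2\<^esub> Suc i)) = proj2 f qf ((v \<otimes>\<^bsub>TA2\<^esub> (F [^]\<^bsub>TA2\<^esub> i)) \<otimes>\<^bsub>TA2\<^esub> F)"
    using v by (simp add: HA.T2.m_assoc)
  also have "\<dots> = proj2 (\<lambda>a. ?f (\<iota> (hp i) \<otimes>\<^bsub>A\<^esub> a)) (\<lambda>b. ?qf (b \<otimes>\<^bsub>A\<^esub> (Y [^]\<^bsub>A\<^esub> i))) v"
    unfolding proj2_F[OF Suc.prems Fv] by (rule IH)
  also have "\<dots> = proj2 (\<lambda>a. f (\<iota> (hp (Suc i)) \<otimes>\<^bsub>A\<^esub> a)) (\<lambda>b. qf (b \<otimes>\<^bsub>A\<^esub> (Y [^]\<^bsub>A\<^esub> Suc i))) v"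
  proof (rule proj2_cong[OF f2 f1 v])
    fix a assume a: "a \<in> carrier A"
    show "?f (\<iota> (hp i) \<otimes>\<^bsub>A\<^esub> a) = f (\<iota> (hp (Suc i)) \<otimes>\<^bsub>A\<^esub> a)"
      unfolding R.nat_pow_Suc2[OF SY.gs(2)] using a by (simp add: iota_simps A.m_assoc)
    show "?qf (a \<otimes>\<^bsub>A\<^esub> (Y [^]\<^bsub>A\<^esub> i)) = qf (a \<otimes>\<^bsub>A\<^esub> (Y [^]\<^bsub>A\<^esub> Suc i))"
      using a by (simp add: A.m_assoc)
  qed
  finally show ?case .
qed

text \<open>What remains of the coefficient u of E^j u F^i after projection: units multiplied onto
  the first slot and a power of \<tau> on the second. Both can be undone, as \<open>Th_inj\<close>
  shows.\<close>

definition "Th i j = lift2 K TR2 (\<lambda>a b. pR2 [hp i \<otimes>\<^bsub>R\<^esub> a \<otimes>\<^bsub>R\<^esub> gp j, (\<tau> ^^ j) b])"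

lemma linmap_pow: "linmap K R R f \<Longrightarrow> linmap K R R (f ^^ n)"
  by (induction n) (auto simp: linmap_def)

lemma bi_Th: "\<lbrakk>x \<in> carrier R; y \<in> carrier R; linmap K R R f\<rbrakk> \<Longrightarrow> bilin K R R TR2 (\<lambda>a b. pR2 [x \<otimes>\<^bsub>R\<^esub> a \<otimes>\<^bsub>R\<^esub> y, f b])"
  by (rule bilinI) (auto intro!: R.linmap_pure2_1 R.linmap_pure2_2 linmap_mult_l linmap_mult_r linmap_id algR linmapD(1)[of K R R f])

lemma Th_pure: "\<lbrakk>a \<in> carrier R; b \<in> carrier R\<rbrakk> \<Longrightarrow> Th i j (pR2 [a, b]) = pR2 [hp i \<otimes>\<^bsub>R\<^esub> a \<otimes>\<^bsub>R\<^esub> gp j, (\<tau> ^^ j) b]"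
  and Th_lin: "linmap K TR2 TR2 (Th i j)"
proof -
  have b: "bilin K R R TR2 (\<lambda>a b. pR2 [hp i \<otimes>\<^bsub>R\<^esub> a \<otimes>\<^bsub>R\<^esub> gp j, (\<tau> ^^ j) b])"
    by (rule bi_Th[OF _ _ linmap_pow[OF SX.sig_lin]]) simp_all
  show "\<lbrakk>a \<in> carrier R; b \<in> carrier R\<rbrakk> \<Longrightarrow> Th i j (pR2 [a, b]) = pR2 [hp i \<otimes>\<^bsub>R\<^esub> a \<otimes>\<^bsub>R\<^esub> gp j, (\<tau> ^^ j) b]"
    unfolding Th_def by (simp add: R.lift2_pure[OF b R.T2_module])
  show "linmap K TR2 TR2 (Th i j)" unfolding Th_def by (rule R.linmap_lift2[OF b R.T2_module])
qed

lemma pow_inv: "\<lbrakk>x \<in> carrier R; y \<in> carrier R; x \<otimes>\<^bsub>R\<^esub> y = \<one>\<^bsub>R\<^esub>\<rbrakk> \<Longrightarrow> (x [^]\<^bsub>R\<^esub> (n::nat)) \<otimes>\<^bsub>R\<^esub> (y [^]\<^bsub>R\<^esub> n) = \<one>\<^bsub>R\<^esub>"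
proof (induction n)
  case (Suc n)
  have "(x [^]\<^bsub>R\<^esub> Suc n) \<otimes>\<^bsub>R\<^esub> (y [^]\<^bsub>R\<^esub> Suc n) = (x [^]\<^bsub>R\<^esub> n) \<otimes>\<^bsub>R\<^esub> (x \<otimes>\<^bsub>R\<^esub> y) \<otimes>\<^bsub>R\<^esub> (y [^]\<^bsub>R\<^esub> n)"
    unfolding R.nat_pow_Suc2[OF Suc.prems(2)] using Suc.prems(1,2) by (simp add: R.m_assoc)
  then show ?case using Suc by simp
qed simp

lemma omega_tau_pow: "b \<in> carrier R \<Longrightarrow> (\<omega> ^^ j) ((\<tau> ^^ j) b) = b"
proof (induction j arbitrary: b)
  case (Suc j)
  have "(\<tau> ^^ j) b \<in> carrier R" using linmapD(1)[OF linmap_pow[OF SX.sig_lin] Suc.prems] .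
  then show ?case unfolding funpow_Suc_right[of j \<omega>] funpow.simps(2)[of j \<tau>] using Suc by simp
qed simp

lemma Th_inj:
  assumes u: "u \<in> carrier TR2" and z: "Th i j u = \<zero>\<^bsub>TR2\<^esub>"
  shows "u = \<zero>\<^bsub>TR2\<^esub>"
proof -
  let ?x = "h [^]\<^bsub>R\<^esub> i" and ?y = "g [^]\<^bsub>R\<^esub> j"
  note wl = linmap_pow[OF SY.sig_lin, of j] and tl = linmap_pow[OF SX.sig_lin, of j]
  have b: "bilin K R R TR2 (\<lambda>a b. pR2 [?x \<otimes>\<^bsub>R\<^esub> a \<otimes>\<^bsub>R\<^esub> ?y, (\<omega> ^^ j) b])"
    by (rule bi_Th[OF _ _ wl]) simp_all
  let ?I = "lift2 K TR2 (\<lambda>a b. pR2 [?x \<otimes>\<^bsub>R\<^esub> a \<otimes>\<^bsub>R\<^esub> ?y, (\<omega> ^^ j) b])"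
  note Il = R.linmap_lift2[OF b R.T2_module]
  have x: "?x \<otimes>\<^bsub>R\<^esub> hp i = \<one>\<^bsub>R\<^esub>" "gp j \<otimes>\<^bsub>R\<^esub> ?y = \<one>\<^bsub>R\<^esub>" by (rule pow_inv; simp)+
  have "?I (Th i j u) = u"
  proof (rule R.T2_eqI[OF linmap_comp[OF Il Th_lin] linmap_id R.T2_module _ u])
    fix a d assume c: "a \<in> carrier R" "d \<in> carrier R"
    have "?x \<otimes>\<^bsub>R\<^esub> (hp i \<otimes>\<^bsub>R\<^esub> a \<otimes>\<^bsub>R\<^esub> gp j) \<otimes>\<^bsub>R\<^esub> ?y = (?x \<otimes>\<^bsub>R\<^esub> hp i) \<otimes>\<^bsub>R\<^esub> a \<otimes>\<^bsub>R\<^esub> (gp j \<otimes>\<^bsub>R\<^esub> ?y)"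
      using c by (simp add: R.m_assoc)
    also have "\<dots> = a" unfolding x using c by simp
    finally show "?I (Th i j (pR2 [a, d])) = pR2 [a, d]"
      using c linmapD(1)[OF tl] by (simp add: Th_pure R.lift2_pure[OF b R.T2_module] omega_tau_pow)
  qed
  then show ?thesis unfolding z using linmap_zero[OF Il R.T2_module R.T2_module] by simp
qed

text \<open>Expand the element in monomials with coefficients in H(R). Constant coefficients in the
  first slot and coefficients with respect to X^j Y^i in the second isolate one monomial of the
  image at a time, which forces each coefficient to vanish.\<close>

lemma psi_inj:
  assumes a: "a \<in> carrier GH.A" and z: "psi a = \<zero>\<^bsub>TA2\<^esub>"
  shows "a = \<zero>\<^bsub>GH.A\<^esub>"
proof -
  obtain S u where S: "finite S" and u: "\<And>p. u p \<in> carrier HR.HG" and au: "a = finsum GH.A (\<lambda>p. GH.mnm (fst p) (snd p) (u p)) S"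
    using GH.normal_form[OF a] by blast
  obtain qf where ql: "\<And>i j. linmap K A R (\<lambda>a. qf a i j)" and
    qm: "\<And>r i j k l. r \<in> carrier R \<Longrightarrow> qf ((X [^]\<^bsub>A\<^esub> (l::nat)) \<otimes>\<^bsub>A\<^esub> (\<iota> r \<otimes>\<^bsub>A\<^esub> (Y [^]\<^bsub>A\<^esub> (k::nat)))) i j =
       (if i = k \<and> j = l then (\<tau> ^^ l) r else \<zero>\<^bsub>R\<^esub>)"
    by (rule ex_coefficients') blast
  have ut: "u p \<in> carrier TR2" for p using HR.HG_sub[OF u] .
  \<comment> \<open>The powers of E and F are absorbed into the two coefficient maps until only
    \<open>J2 (u p)\<close> is left, where the second map is nonzero for matching exponents
    only.\<close>
  have D: "proj2 p0 (\<lambda>a. qf a i j) (psi (GH.mnm k l (u p))) = (if i = k \<and> j = l then Th k l (u p) else \<zero>\<^bsub>TR2\<^esub>)" for i j k l p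
  proof -
    let ?f = "\<lambda>a. p0 (a \<otimes>\<^bsub>A\<^esub> \<iota> (gp l))" and ?qf = "\<lambda>b. qf ((X [^]\<^bsub>A\<^esub> l) \<otimes>\<^bsub>A\<^esub> b) i j"
    let ?f2 = "\<lambda>a. ?f (\<iota> (hp k) \<otimes>\<^bsub>A\<^esub> a)" and ?q2 = "\<lambda>b. ?qf (b \<otimes>\<^bsub>A\<^esub> (Y [^]\<^bsub>A\<^esub> k))"
    have v: "J2 (u p) \<in> carrier TA2" using ut by (rule J2D)
    then have v2: "J2 (u p) \<otimes>\<^bsub>TA2\<^esub> (F [^]\<^bsub>TA2\<^esub> k) \<in> carrier TA2" by simp
    note e1 = proj2_Epow[OF good_p0 ql[of i j] v2, of l]
    have ql2: "linmap K A R ?qf" by (rule linmap_comp[OF ql linmap_mult_l[OF algA linmap_id]]) simp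
    have f2: "linmap K A R ?f2"
      by (rule linmap_comp[OF goodD(1)[OF conjunct1[OF e1]] linmap_mult_l[OF algA linmap_id]]) simp
    have q2: "linmap K A R ?q2"
      by (rule linmap_comp[OF ql2 linmap_mult_r[OF algA linmap_id]]) simp
    have "proj2 p0 (\<lambda>a. qf a i j) (psi (GH.mnm k l (u p))) = proj2 ?f2 ?q2 (J2 (u p))"
      unfolding psi_mnm[OF u] conjunct2[OF e1] by (rule proj2_Fpow[OF conjunct1[OF e1] ql2 v])
    also have "\<dots> = (if i = k \<and> j = l then Th k l (u p) else \<zero>\<^bsub>TR2\<^esub>)"
    proof (rule R.T2_eqI[OF linmap_comp[OF linmap_proj2[OF f2 q2] J2_lin] _ R.T2_module _ ut])
      show "linmap K TR2 TR2 (\<lambda>v. if i = k \<and> j = l then Th k l v else \<zero>\<^bsub>TR2\<^esub>)"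
        by (cases "i = k \<and> j = l") (auto simp: Th_lin linmap_const0[OF R.T2_module])
      fix r s assume rs: "r \<in> carrier R" "s \<in> carrier R"
      have p: "?f2 (\<iota> r) = hp k \<otimes>\<^bsub>R\<^esub> r \<otimes>\<^bsub>R\<^esub> gp l" using rs by (simp add: iota_simps(2)[symmetric])
      have qq: "?q2 (\<iota> s) = (if i = k \<and> j = l then (\<tau> ^^ l) s else \<zero>\<^bsub>R\<^esub>)" using rs by (simp add: qm)
      have "proj2 ?f2 ?q2 (J2 (pR2 [r, s])) = pR2 [?f2 (\<iota> r), ?q2 (\<iota> s)]"
        using rs by (simp add: proj2_pure[OF f2 q2])
      then show "proj2 ?f2 ?q2 (J2 (pR2 [r, s])) = (if i = k \<and> j = l then Th k l (pR2 [r, s]) else \<zero>\<^bsub>TR2\<^esub>)"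
        unfolding p qq using rs by (simp add: Th_pure pR2_zero)
    qed
    finally show ?thesis .
  qed
  have up: "u p = \<zero>\<^bsub>TR2\<^esub>" if p: "p \<in> S" for p
  proof -
    let ?D = "proj2 p0 (\<lambda>a. qf a (fst p) (snd p))"
    have Dl: "linmap K TA2 TR2 ?D" by (rule linmap_proj2[OF p_lin(1) ql])
    have psl: "linmap K GH.A TA2 psi" by (rule linmapI) (simp_all add: psi_T2 psiD)
    have "?D (psi a) = finsum TR2 (\<lambda>s. ?D (psi (GH.mnm (fst s) (snd s) (u s)))) S"
      unfolding au by (rule linmap_finsum[OF linmap_comp[OF Dl psl] GH.A.moduleR R.T2_module S]) (simp add: u)
    also have "\<dots> = finsum TR2 (\<lambda>s. if p = s then Th (fst s) (snd s) (u s) else \<zero>\<^bsub>TR2\<^esub>) S"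
      by (rule HR.T2.finsum_cong') (auto simp: D prod_eq_iff linmapD(1)[OF Th_lin] ut)
    also have "\<dots> = Th (fst p) (snd p) (u p)"
      by (rule HR.T2.finsum_singleton[OF p S]) (simp add: linmapD(1)[OF Th_lin] ut)
    finally have "Th (fst p) (snd p) (u p) = \<zero>\<^bsub>TR2\<^esub>"
      unfolding z using linmap_zero[OF Dl A.T2_module R.T2_module] by simp
    then show ?thesis by (rule Th_inj[OF ut])
  qed
  have m0: "GH.mnm i j \<zero>\<^bsub>TR2\<^esub> = \<zero>\<^bsub>GH.A\<^esub>" for i j
    using linmap_zero[OF alg_hom_linmap[OF GH.iota_hom] HR.HG.moduleR GH.A.moduleR] by (simp add: GH.mnm_def)
  show ?thesis unfolding au
    by (rule GH.A.add.finprod_one_eqI) (simp add: up m0)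
qed

section \<open>Surjectivity\<close>

abbreviation "Bs \<equiv> psi ` carrier GH.A"

lemma Bs_submodule: "submodule Bs K TA2"
proof (rule HA.T2.Mod.submoduleI)
  have psl: "linmap K GH.A TA2 psi" by (rule linmapI) (simp_all add: psi_T2 psiD)
  show "\<zero>\<^bsub>TA2\<^esub> \<in> Bs" using linmap_zero[OF psl GH.A.moduleR A.T2_module] by (metis GH.A.zero_closed image_eqI)
  show "\<ominus>\<^bsub>TA2\<^esub> b \<in> Bs" if "b \<in> Bs" for b
    using that linmap_uminus[OF psl GH.A.moduleR A.T2_module, symmetric] by auto
  show "b \<oplus>\<^bsub>TA2\<^esub> d \<in> Bs" if "b \<in> Bs" "d \<in> Bs" for b d
    using that by (auto simp: psiD(2)[symmetric])
  show "k \<odot>\<^bsub>TA2\<^esub> b \<in> Bs" if "k \<in> carrier K" "b \<in> Bs" for k b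
    using that by (auto simp: psiD(5)[symmetric])
qed (auto simp: psi_T2)

lemma Bs_mult: "\<lbrakk>b \<in> Bs; d \<in> Bs\<rbrakk> \<Longrightarrow> b \<otimes>\<^bsub>TA2\<^esub> d \<in> Bs"
  by (auto simp: psiD(3)[symmetric])

lemma Bs_gens: "E \<in> Bs" "F \<in> Bs" "u \<in> carrier HR.HG \<Longrightarrow> J2 u \<in> Bs"
  using psi(2,3,4) by (metis GH.X_closed image_eqI, metis GH.Y_closed image_eqI, metis GH.iota_closed image_eqI)

lemmas BsE = HA.T2.Mod.submoduleE[OF Bs_submodule]

lemma functional_mult: "\<lbrakk>A.functional \<phi>; x \<in> carrier A\<rbrakk> \<Longrightarrow> A.functional (\<lambda>y. \<phi> (x \<otimes>\<^bsub>A\<^esub> y))"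
  by (rule A.functional_linmap[OF _ linmap_mult_l[OF algA linmap_id]])

text \<open>The elements \<open>b\<close> with this property form a subspace that contains \<open>R\<close> by coassociativity, and it is
  stable under left multiplication by \<open>X\<close> and \<open>Y\<close> because \<open>\<mu>(X) = X \<otimes> 1 \<otimes> 1 + g \<otimes> E\<close>, and similarly for \<open>Y\<close>.\<close>

lemma contr_mu_Bs:
  assumes b: "b \<in> carrier A" and \<phi>: "A.functional \<phi>"
  shows "HA.contr \<phi> (\<mu>' b) \<in> Bs"
proof -
  \<comment> \<open>All functionals are quantified over because multiplying b by X replaces \<phi>
    by \<phi>(X -) and \<phi>(g -), and similarly for Y.\<close>
  let ?W = "{b \<in> carrier A. \<forall>\<phi>. A.functional \<phi> \<longrightarrow> HA.contr \<phi> (\<mu>' b) \<in> Bs}"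
  have L: "linmap K A TA2 (\<lambda>b. HA.contr \<phi> (\<mu>' b))" if "A.functional \<phi>" for \<phi>
    by (rule linmap_comp[OF HA.linmap_contr[OF that] HA.mu_lin])
  have V: "submodule {b \<in> carrier A. HA.contr \<phi> (\<mu>' b) \<in> Bs} K A" if "A.functional \<phi>" for \<phi>
    by (rule linmap_vimage[OF L[OF that] A.moduleR A.T2_module Bs_submodule])
  note VE = A.Mod.submoduleE[OF V]
  have W: "submodule ?W K A"
  proof (rule A.Mod.submoduleI)
    show "\<zero>\<^bsub>A\<^esub> \<in> ?W" using submodule_zero[OF V] by auto
    show "\<ominus>\<^bsub>A\<^esub> a \<in> ?W" if "a \<in> ?W" for a using VE(3)[of _ a] that by auto
    show "a \<oplus>\<^bsub>A\<^esub> d \<in> ?W" if "a \<in> ?W" "d \<in> ?W" for a d using VE(5)[of _ a d] that by auto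
    show "k \<odot>\<^bsub>A\<^esub> a \<in> ?W" if "k \<in> carrier K" "a \<in> ?W" for k a using VE(4)[of _ k a] that by auto
  qed auto
  have X: "X \<otimes>\<^bsub>A\<^esub> a \<in> ?W" if "a \<in> ?W" for a
    using that by (auto simp: SX.contr_Z functional_mult intro!: BsE(5) Bs_mult Bs_gens)
  have Y: "Y \<otimes>\<^bsub>A\<^esub> a \<in> ?W" if "a \<in> ?W" for a
    using that by (auto simp: SY.contr_Z functional_mult intro!: BsE(5) Bs_mult Bs_gens)
  have r: "\<iota> r \<in> ?W" if r: "r \<in> carrier R" for r
  proof (rule CollectI, intro conjI allI impI)
    show "\<iota> r \<in> carrier A" using r by simp
    fix \<phi> assume \<phi>: "A.functional \<phi>"
    have f: "R.functional (\<lambda>r. \<phi> (\<iota> r))"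
      using \<phi> by (simp add: A.functional_def R.functional_def iota_simps)
    have m: "\<mu> r \<in> carrier TR3" using HR.muD(1)[OF r] .
    have "HA.contr \<phi> (J3 (\<mu> r)) = J2 (HR.contr (\<lambda>r. \<phi> (\<iota> r)) (\<mu> r))"
      by (rule R.T3_eqI[OF linmap_comp[OF HA.linmap_contr[OF \<phi>] J3_lin] linmap_comp[OF J2_lin HR.linmap_contr[OF f]] A.T2_module _ m])
        (simp add: HA.contr_pure[OF \<phi>] HR.contr_pure[OF f] J2D A.functionalD(1)[OF \<phi>])
    then show "HA.contr \<phi> (\<mu>' (\<iota> r)) \<in> Bs"
      using Bs_gens(3)[OF HR.contr_mu_HG[OF f r]] r by (simp add: mu_iota)
  qed
  have Yp: "(Y [^]\<^bsub>A\<^esub> (n::nat)) \<otimes>\<^bsub>A\<^esub> a \<in> ?W" if a: "a \<in> ?W" for n a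
  proof (induction n)
    case 0 then show ?case using a by simp
  next
    case (Suc n)
    have "(Y [^]\<^bsub>A\<^esub> Suc n) \<otimes>\<^bsub>A\<^esub> a = Y \<otimes>\<^bsub>A\<^esub> ((Y [^]\<^bsub>A\<^esub> n) \<otimes>\<^bsub>A\<^esub> a)"
      unfolding A.nat_pow_Suc2[OF Y_closed] using a by (simp add: A.m_assoc)
    then show ?case using Y[OF Suc.IH] by (simp only:)
  qed
  have Xp: "(X [^]\<^bsub>A\<^esub> (n::nat)) \<otimes>\<^bsub>A\<^esub> a \<in> ?W" if a: "a \<in> ?W" for n a
  proof (induction n)
    case 0 then show ?case using a by simp
  next
    case (Suc n)
    have "(X [^]\<^bsub>A\<^esub> Suc n) \<otimes>\<^bsub>A\<^esub> a = X \<otimes>\<^bsub>A\<^esub> ((X [^]\<^bsub>A\<^esub> n) \<otimes>\<^bsub>A\<^esub> a)"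
      unfolding A.nat_pow_Suc2[OF X_closed] using a by (simp add: A.m_assoc)
    then show ?case using X[OF Suc.IH] by (simp only:)
  qed
  have "b \<in> ?W"
  proof (rule mnm_span[OF W _ b])
    \<comment> \<open>The coefficient is moved to the far right: stability is known for left
      multiplication by X and Y, and the elements of R already belong to \<open>?W\<close>.\<close>
    fix i j r assume r': "r \<in> carrier R"
    obtain s where s: "s \<in> carrier R" "\<iota> r \<otimes>\<^bsub>A\<^esub> (Y [^]\<^bsub>A\<^esub> (i::nat)) = (Y [^]\<^bsub>A\<^esub> i) \<otimes>\<^bsub>A\<^esub> \<iota> s"
      by (rule bexE[OF Ypow_iota[OF r', of i]])
    show "mnm i j r \<in> ?W" unfolding mnm_def s(2) by (rule Xp[OF Yp[OF r[OF s(1)]]])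
  qed
  then show ?thesis using \<phi> by blast
qed

lemma psi_surj:
  assumes u: "u \<in> carrier HA.HG"
  shows "u \<in> Bs"
proof -
  obtain \<phi> where \<phi>: "A.functional \<phi>" "\<phi> \<one>\<^bsub>A\<^esub> = \<one>\<^bsub>K\<^esub>" using A.ex_functional[OF HA.one_ne_zero] by blast
  have u': "u \<in> carrier TA2" "HA.Phi u = HA.inj3 u" using u by (auto simp: HA.HG_carrier)
  \<comment> \<open>The contraction of \<open>Phi\<close> lands in the image on all of the tensor
    product, since for a \<otimes> b the factor a is absorbed by the functional. For u in H(A) the
    contraction of \<open>Phi u\<close> is that of \<open>inj3 u\<close>, which is u itself.\<close>
  have "u \<in> {u \<in> carrier TA2. HA.contr \<phi> (HA.Phi u) \<in> Bs}"
  proof (rule A.T2_induct[OF linmap_vimage[OF linmap_comp[OF HA.linmap_contr[OF \<phi>(1)] HA.linmap_Phi] A.T2_module A.T2_module Bs_submodule] _ u'(1)])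
    fix a b assume ab: "a \<in> carrier A" "b \<in> carrier A"
    then show "pA2 [a, b] \<in> {u \<in> carrier TA2. HA.contr \<phi> (HA.Phi u) \<in> Bs}"
      using contr_mu_Bs[OF ab(2) functional_mult[OF \<phi>(1) ab(1)]] HA.muD(1)
      by (simp add: HA.Phi_pure HA.contr_left[OF \<phi>(1)])
  qed
  then show ?thesis using HA.contr_inj3[OF \<phi> u'(1)] by (simp add: u'(2))
qed

lemma psi_iso: "psi \<in> alg_iso K GH.A HA.HG"
proof -
  have psl: "linmap K GH.A TA2 psi" by (rule linmapI) (simp_all add: psi_T2 psiD)
  have "inj_on psi (carrier GH.A)"
  proof (rule inj_onI)
    fix a b assume ab: "a \<in> carrier GH.A" "b \<in> carrier GH.A" "psi a = psi b"
    have "psi (a \<ominus>\<^bsub>GH.A\<^esub> b) = \<zero>\<^bsub>TA2\<^esub>"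
      using linmap_minus[OF psl GH.A.moduleR A.T2_module ab(1,2)] ab psi_T2 by (simp add: HA.T2.diff_eq_zero_iff)
    then have "a \<ominus>\<^bsub>GH.A\<^esub> b = \<zero>\<^bsub>GH.A\<^esub>" using ab by (intro psi_inj) simp_all
    then show "a = b" using ab by (simp add: GH.A.diff_eq_zero_iff)
  qed
  moreover have "Bs = carrier HA.HG" using psi_surj psiD(1) by blast
  ultimately show ?thesis using psi(1) by (simp add: alg_iso_def bij_betw_def)
qed

lemma HG_ambiskew:
  "\<exists>d \<zeta>. gas_data K (HG_alg K R \<mu>) (conj_tensor K R g \<tau>) (conj_tensor K R h \<omega>) d \<zeta> \<and>
     (\<exists>\<phi> \<in> alg_iso K (gas K (HG_alg K R \<mu>) (conj_tensor K R g \<tau>) (conj_tensor K R h \<omega>) d \<zeta>) (HG_alg K (ambiskew K R \<tau> c \<xi>) \<mu>').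
        \<forall>u\<in>carrier (HG_alg K R \<mu>). \<phi> (gas_gen K (HG_alg K R \<mu>) (conj_tensor K R g \<tau>) (conj_tensor K R h \<omega>) d \<zeta> (Coeff u)) = HG_incl K R \<tau> c \<xi> u)"
proof (intro exI conjI bexI ballI)
  show "gas_data K (HG_alg K R \<mu>) (conj_tensor K R g \<tau>) (conj_tensor K R h \<omega>) c' xi'" by (rule data')
  show "psi \<in> alg_iso K GH.A HA.HG" by (rule psi_iso)
  fix u assume u: "u \<in> carrier HR.HG"
  show "psi (GH.\<iota> u) = HG_incl K R \<tau> c \<xi> u"
    unfolding HG_incl_def Let_def HG_incl_eq[OF HR.HG_sub[OF u]] by (rule psi(2)[OF u])
qed

end

section \<open>Hopf-Galois algebras generated by group-likes and skew primitives\<close>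

context kalg
begin

text \<open>Tensors occupying disjoint slots commute, so each side of coassociativity is an algebra
  map. Hence coassociativity need only be checked on generators.\<close>

lemma L_hom:
  assumes m: "\<mu> \<in> alg_hom K R (T3 K R)"
  shows "L1 \<mu> \<in> alg_hom K (T3 K R) T5" "L2 \<mu> \<in> alg_hom K (T3 K R) T5"
proof -
  note ml = alg_hom_linmap[OF m] and mD = alg_homD[OF m]
  note i1 = alg_homD[OF I123_hom] and i3 = alg_homD[OF I345_hom]
  interpret T5: kalg K T5 by (rule kalgI, rule T5_alg)
  have k1: "pure5 [\<one>\<^bsub>R\<^esub>, \<one>\<^bsub>R\<^esub>, \<one>\<^bsub>R\<^esub>, b, x] \<otimes>\<^bsub>T5\<^esub> I123 t = I123 t \<otimes>\<^bsub>T5\<^esub> pure5 [\<one>\<^bsub>R\<^esub>, \<one>\<^bsub>R\<^esub>, \<one>\<^bsub>R\<^esub>, b, x]"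
    if "b \<in> carrier R" "x \<in> carrier R" "t \<in> carrier (T3 K R)" for b x t
    by (rule T3_eqI[OF linmap_mult_l[OF T5_alg linmap_I123] linmap_mult_r[OF T5_alg linmap_I123] T5_module _ that(3)])
      (use that in \<open>simp_all add: pure5_closed I123_pure pure5_mult\<close>)
  have k3: "pure5 [b, x, \<one>\<^bsub>R\<^esub>, \<one>\<^bsub>R\<^esub>, \<one>\<^bsub>R\<^esub>] \<otimes>\<^bsub>T5\<^esub> I345 t = I345 t \<otimes>\<^bsub>T5\<^esub> pure5 [b, x, \<one>\<^bsub>R\<^esub>, \<one>\<^bsub>R\<^esub>, \<one>\<^bsub>R\<^esub>]"
    if "b \<in> carrier R" "x \<in> carrier R" "t \<in> carrier (T3 K R)" for b x t
    by (rule T3_eqI[OF linmap_mult_l[OF T5_alg linmap_I345] linmap_mult_r[OF T5_alg linmap_I345] T5_module _ that(3)])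
      (use that in \<open>simp_all add: pure5_closed I345_pure pure5_mult\<close>)
  show "L1 \<mu> \<in> alg_hom K (T3 K R) T5"
  proof (rule alg_homI[OF linmap_L1[OF ml]])
    show "L1 \<mu> \<one>\<^bsub>T3 K R\<^esub> = \<one>\<^bsub>T5\<^esub>"
      by (simp add: T3_one L1_pure[OF ml] mD(4)) (simp add: T3_one I123_pure T5_one pure5_mult)
    fix u v assume uv: "u \<in> carrier (T3 K R)" "v \<in> carrier (T3 K R)"
    show "L1 \<mu> (u \<otimes>\<^bsub>T3 K R\<^esub> v) = L1 \<mu> u \<otimes>\<^bsub>T5\<^esub> L1 \<mu> v"
    proof (rule T3_mult_eqI[OF _ linmap_L1[OF ml] T5_alg uv])
      fix a b x a' b' x' assume c: "a \<in> carrier R" "b \<in> carrier R" "x \<in> carrier R" "a' \<in> carrier R" "b' \<in> carrier R" "x' \<in> carrier R"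
      let ?P = "pure5 [\<one>\<^bsub>R\<^esub>, \<one>\<^bsub>R\<^esub>, \<one>\<^bsub>R\<^esub>, b, x]" and ?Q = "pure5 [\<one>\<^bsub>R\<^esub>, \<one>\<^bsub>R\<^esub>, \<one>\<^bsub>R\<^esub>, b', x']"
      have PQ: "?P \<in> carrier T5" "?Q \<in> carrier T5" "?P \<otimes>\<^bsub>T5\<^esub> ?Q = pure5 [\<one>\<^bsub>R\<^esub>, \<one>\<^bsub>R\<^esub>, \<one>\<^bsub>R\<^esub>, b' \<otimes>\<^bsub>R\<^esub> b, x \<otimes>\<^bsub>R\<^esub> x']"
        using c by (simp_all add: pure5_closed pure5_mult)
      have I: "I123 (\<mu> a) \<in> carrier T5" "I123 (\<mu> a') \<in> carrier T5" using c mD(1) i1(1) by auto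
      have "L1 \<mu> (pure3 K R [a, b, x] \<otimes>\<^bsub>T3 K R\<^esub> pure3 K R [a', b', x']) = (I123 (\<mu> a) \<otimes>\<^bsub>T5\<^esub> I123 (\<mu> a')) \<otimes>\<^bsub>T5\<^esub> (?P \<otimes>\<^bsub>T5\<^esub> ?Q)"
        using c mD(1) by (simp add: L1_pure[OF ml] mD(3) i1(3) PQ(3))
      also have "\<dots> = I123 (\<mu> a) \<otimes>\<^bsub>T5\<^esub> (I123 (\<mu> a') \<otimes>\<^bsub>T5\<^esub> ?P) \<otimes>\<^bsub>T5\<^esub> ?Q"
        using I PQ(1,2) by (simp add: T5.m_assoc)
      also have "\<dots> = (I123 (\<mu> a) \<otimes>\<^bsub>T5\<^esub> ?P) \<otimes>\<^bsub>T5\<^esub> (I123 (\<mu> a') \<otimes>\<^bsub>T5\<^esub> ?Q)"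
        unfolding k1[OF c(2,3) mD(1)[OF c(4)], symmetric] using I PQ(1,2) by (simp add: T5.m_assoc)
      finally show "L1 \<mu> (pure3 K R [a, b, x] \<otimes>\<^bsub>T3 K R\<^esub> pure3 K R [a', b', x']) = L1 \<mu> (pure3 K R [a, b, x]) \<otimes>\<^bsub>T5\<^esub> L1 \<mu> (pure3 K R [a', b', x'])"
        using c by (simp add: L1_pure[OF ml])
    qed
  qed
  show "L2 \<mu> \<in> alg_hom K (T3 K R) T5"
  proof (rule alg_homI[OF linmap_L2[OF ml]])
    show "L2 \<mu> \<one>\<^bsub>T3 K R\<^esub> = \<one>\<^bsub>T5\<^esub>"
      by (simp add: T3_one L2_pure[OF ml] mD(4)) (simp add: T3_one I345_pure T5_one pure5_mult)
    fix u v assume uv: "u \<in> carrier (T3 K R)" "v \<in> carrier (T3 K R)"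
    show "L2 \<mu> (u \<otimes>\<^bsub>T3 K R\<^esub> v) = L2 \<mu> u \<otimes>\<^bsub>T5\<^esub> L2 \<mu> v"
    proof (rule T3_mult_eqI[OF _ linmap_L2[OF ml] T5_alg uv])
      fix a b x a' b' x' assume c: "a \<in> carrier R" "b \<in> carrier R" "x \<in> carrier R" "a' \<in> carrier R" "b' \<in> carrier R" "x' \<in> carrier R"
      let ?P = "pure5 [a, b, \<one>\<^bsub>R\<^esub>, \<one>\<^bsub>R\<^esub>, \<one>\<^bsub>R\<^esub>]" and ?Q = "pure5 [a', b', \<one>\<^bsub>R\<^esub>, \<one>\<^bsub>R\<^esub>, \<one>\<^bsub>R\<^esub>]"
      have PQ: "?P \<in> carrier T5" "?Q \<in> carrier T5" "?P \<otimes>\<^bsub>T5\<^esub> ?Q = pure5 [a \<otimes>\<^bsub>R\<^esub> a', b' \<otimes>\<^bsub>R\<^esub> b, \<one>\<^bsub>R\<^esub>, \<one>\<^bsub>R\<^esub>, \<one>\<^bsub>R\<^esub>]"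
        using c by (simp_all add: pure5_closed pure5_mult)
      have I: "I345 (\<mu> x) \<in> carrier T5" "I345 (\<mu> x') \<in> carrier T5" using c mD(1) i3(1) by auto
      have "L2 \<mu> (pure3 K R [a, b, x] \<otimes>\<^bsub>T3 K R\<^esub> pure3 K R [a', b', x']) = (?P \<otimes>\<^bsub>T5\<^esub> ?Q) \<otimes>\<^bsub>T5\<^esub> (I345 (\<mu> x) \<otimes>\<^bsub>T5\<^esub> I345 (\<mu> x'))"
        using c mD(1) by (simp add: L2_pure[OF ml] mD(3) i3(3) PQ(3))
      also have "\<dots> = ?P \<otimes>\<^bsub>T5\<^esub> (?Q \<otimes>\<^bsub>T5\<^esub> I345 (\<mu> x)) \<otimes>\<^bsub>T5\<^esub> I345 (\<mu> x')"
        using I PQ(1,2) by (simp add: T5.m_assoc)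
      also have "\<dots> = (?P \<otimes>\<^bsub>T5\<^esub> I345 (\<mu> x)) \<otimes>\<^bsub>T5\<^esub> (?Q \<otimes>\<^bsub>T5\<^esub> I345 (\<mu> x'))"
        unfolding k3[OF c(4,5) mD(1)[OF c(3)]] using I PQ(1,2) by (simp add: T5.m_assoc)
      finally show "L2 \<mu> (pure3 K R [a, b, x] \<otimes>\<^bsub>T3 K R\<^esub> pure3 K R [a', b', x']) = L2 \<mu> (pure3 K R [a, b, x]) \<otimes>\<^bsub>T5\<^esub> L2 \<mu> (pure3 K R [a', b', x'])"
        using c by (simp add: L2_pure[OF ml])
    qed
  qed
qed

lemma grouplike_axioms:
  assumes ml: "linmap K R (T3 K R) \<mu>" and u: "u \<in> carrier R" "v \<in> carrier R" "u \<otimes>\<^bsub>R\<^esub> v = \<one>\<^bsub>R\<^esub>" "v \<otimes>\<^bsub>R\<^esub> u = \<one>\<^bsub>R\<^esub>"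
    and m: "\<mu> u = pure3 K R [u, v, u]"
  shows "L1 \<mu> (\<mu> u) = L2 \<mu> (\<mu> u)" "N1 (\<mu> u) = pure K [R, R] [\<one>\<^bsub>R\<^esub>, u]" "N2 (\<mu> u) = pure K [R, R] [u, \<one>\<^bsub>R\<^esub>]"
  using u by (simp_all add: m L1_pure[OF ml] L2_pure[OF ml] I123_pure I345_pure pure5_mult N1_pure N2_pure)

lemma skew_prim_linmap:
  assumes f: "linmap K (T3 K R) N f" "module K N" and u: "u \<in> Units R" and x: "x \<in> carrier R"
  shows "f (skew_prim K R u x) = (f (pure3 K R [x, \<one>\<^bsub>R\<^esub>, \<one>\<^bsub>R\<^esub>]) \<ominus>\<^bsub>N\<^esub> f (pure3 K R [u, inv\<^bsub>R\<^esub> u \<otimes>\<^bsub>R\<^esub> x, \<one>\<^bsub>R\<^esub>])) \<oplus>\<^bsub>N\<^esub> f (pure3 K R [u, inv\<^bsub>R\<^esub> u, x])"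
proof -
  interpret T3: kalg K "T3 K R" by (rule kalgI, rule T3_alg)
  have us: "u \<in> carrier R" "inv\<^bsub>R\<^esub> u \<in> carrier R" using u by auto
  show ?thesis unfolding skew_prim_def using us x by (simp add: linmapD[OF f(1)] linmap_minus[OF f(1) T3_module f(2)])
qed

text \<open>Iterating \<mu> in the first or the last slot produces the same five terms with
  different bracketing. In each counit axiom two of the three terms of \<mu>(x) cancel after
  multiplication.\<close>

lemma skew_primitive_axioms:
  assumes mh: "\<mu> \<in> alg_hom K R (T3 K R)" and u: "u \<in> Units R"
    and m: "\<mu> u = pure3 K R [u, inv\<^bsub>R\<^esub> u, u]" and x: "x \<in> carrier R" and mx: "\<mu> x = skew_prim K R u x"
  shows "L1 \<mu> (\<mu> x) = L2 \<mu> (\<mu> x)" "N1 (\<mu> x) = pure K [R, R] [\<one>\<^bsub>R\<^esub>, x]" "N2 (\<mu> x) = pure K [R, R] [x, \<one>\<^bsub>R\<^esub>]"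
proof -
  interpret T5: kalg K T5 by (rule kalgI, rule T5_alg)
  interpret T3: kalg K "T3 K R" by (rule kalgI, rule T3_alg)
  interpret TT: kalg K TT by (rule kalgI, rule TT_alg)
  note ml = alg_hom_linmap[OF mh]
  let ?v = "inv\<^bsub>R\<^esub> u"
  have us: "u \<in> carrier R" "?v \<in> carrier R" "u \<otimes>\<^bsub>R\<^esub> ?v = \<one>\<^bsub>R\<^esub>" "?v \<otimes>\<^bsub>R\<^esub> u = \<one>\<^bsub>R\<^esub>" using u by auto
  have uvx: "u \<otimes>\<^bsub>R\<^esub> (?v \<otimes>\<^bsub>R\<^esub> x) = x" using us x by (simp add: m_assoc[symmetric])
  have m1: "\<mu> \<one>\<^bsub>R\<^esub> = pure3 K R [\<one>\<^bsub>R\<^esub>, \<one>\<^bsub>R\<^esub>, \<one>\<^bsub>R\<^esub>]" using alg_homD(4)[OF mh] by (simp add: T3_one)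
  note lin = skew_prim_linmap[OF _ _ u x, folded mx]
  have "L1 \<mu> (\<mu> x) = (((pure5 [x, \<one>\<^bsub>R\<^esub>, \<one>\<^bsub>R\<^esub>, \<one>\<^bsub>R\<^esub>, \<one>\<^bsub>R\<^esub>] \<ominus>\<^bsub>T5\<^esub> pure5 [u, ?v \<otimes>\<^bsub>R\<^esub> x, \<one>\<^bsub>R\<^esub>, \<one>\<^bsub>R\<^esub>, \<one>\<^bsub>R\<^esub>]) \<oplus>\<^bsub>T5\<^esub> pure5 [u, ?v, x, \<one>\<^bsub>R\<^esub>, \<one>\<^bsub>R\<^esub>])
       \<ominus>\<^bsub>T5\<^esub> pure5 [u, ?v, u, ?v \<otimes>\<^bsub>R\<^esub> x, \<one>\<^bsub>R\<^esub>]) \<oplus>\<^bsub>T5\<^esub> pure5 [u, ?v, u, ?v, x]"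
    unfolding lin[OF linmap_L1[OF ml] T5_module]
    using us x by (simp add: L1_pure[OF ml] lin[OF linmap_I123 T5_module] I123_pure m m1 pure5_mult pure5_closed
       T5.l_distr T5.l_minus a_minus_def)
  moreover have "L2 \<mu> (\<mu> x) = (pure5 [x, \<one>\<^bsub>R\<^esub>, \<one>\<^bsub>R\<^esub>, \<one>\<^bsub>R\<^esub>, \<one>\<^bsub>R\<^esub>] \<ominus>\<^bsub>T5\<^esub> pure5 [u, ?v \<otimes>\<^bsub>R\<^esub> x, \<one>\<^bsub>R\<^esub>, \<one>\<^bsub>R\<^esub>, \<one>\<^bsub>R\<^esub>]) \<oplus>\<^bsub>T5\<^esub>
      ((pure5 [u, ?v, x, \<one>\<^bsub>R\<^esub>, \<one>\<^bsub>R\<^esub>] \<ominus>\<^bsub>T5\<^esub> pure5 [u, ?v, u, ?v \<otimes>\<^bsub>R\<^esub> x, \<one>\<^bsub>R\<^esub>]) \<oplus>\<^bsub>T5\<^esub> pure5 [u, ?v, u, ?v, x])"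
    unfolding lin[OF linmap_L2[OF ml] T5_module]
    using us x by (simp add: L2_pure[OF ml] lin[OF linmap_I345 T5_module] I345_pure m m1 pure5_mult pure5_closed
       T5.r_distr T5.r_minus a_minus_def)
  ultimately show "L1 \<mu> (\<mu> x) = L2 \<mu> (\<mu> x)"
    using us x by (simp add: a_minus_def T5.a_assoc pure5_closed)
  have pc: "\<lbrakk>a \<in> carrier R; b \<in> carrier R\<rbrakk> \<Longrightarrow> pure K [R, R] [a, b] \<in> carrier TT" for a b
    by (rule pair_closed[OF alg alg])
  show "N1 (\<mu> x) = pure K [R, R] [\<one>\<^bsub>R\<^esub>, x]"
    unfolding lin[OF linmap_N1 TT_module] using us x pc
    by (simp add: N1_pure uvx a_minus_def TT.r_neg)
  show "N2 (\<mu> x) = pure K [R, R] [x, \<one>\<^bsub>R\<^esub>]"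
    unfolding lin[OF linmap_N2 TT_module] using us x pc
    by (simp add: N2_pure a_minus_def TT.a_assoc TT.l_neg)
qed

text \<open>Multiplying adjacent slots is not compatible with the reversed middle factor, so
  \<open>N1\<close> and \<open>N2\<close> cannot be treated as algebra maps. Instead the products
  nest: a_1 b_1 b_2 a_2 \<otimes> a_3 b_3 collapses from the inside, first b_1 b_2 and then a_1 a_2;
  for \<open>N2\<close> the nested product is b_2 a_2 a_3 b_3.\<close>

lemma counit_mult:
  assumes m: "\<mu> \<in> alg_hom K R (T3 K R)" and ab: "a \<in> carrier R" "b \<in> carrier R"
  shows "\<lbrakk>N1 (\<mu> a) = pure K [R, R] [\<one>\<^bsub>R\<^esub>, a]; N1 (\<mu> b) = pure K [R, R] [\<one>\<^bsub>R\<^esub>, b]\<rbrakk> \<Longrightarrow> N1 (\<mu> (a \<otimes>\<^bsub>R\<^esub> b)) = pure K [R, R] [\<one>\<^bsub>R\<^esub>, a \<otimes>\<^bsub>R\<^esub> b]"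
    and "\<lbrakk>N2 (\<mu> a) = pure K [R, R] [a, \<one>\<^bsub>R\<^esub>]; N2 (\<mu> b) = pure K [R, R] [b, \<one>\<^bsub>R\<^esub>]\<rbrakk> \<Longrightarrow> N2 (\<mu> (a \<otimes>\<^bsub>R\<^esub> b)) = pure K [R, R] [a \<otimes>\<^bsub>R\<^esub> b, \<one>\<^bsub>R\<^esub>]"
proof -
  note mD = alg_homD[OF m]
  note pc = pair_closed[OF alg alg] and pm = pair_mult[OF alg alg]
  note l1 = pair_lin1[OF alg alg] and l2 = pair_lin2[OF alg alg]
  { fix x y z assume c: "x \<in> carrier R" "y \<in> carrier R" "z \<in> carrier R"
    have b1: "bilin K R R TT (\<lambda>p q. pure K [R, R] [x \<otimes>\<^bsub>R\<^esub> p \<otimes>\<^bsub>R\<^esub> y, z \<otimes>\<^bsub>R\<^esub> q])"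
      by (rule bilinI) (use c in \<open>auto intro!: linmap_comp[OF l1] linmap_comp[OF l2] linmap_mult_l linmap_mult_r linmap_id alg\<close>)
    have b2: "bilin K R R TT (\<lambda>p q. pure K [R, R] [p \<otimes>\<^bsub>R\<^esub> x, y \<otimes>\<^bsub>R\<^esub> q \<otimes>\<^bsub>R\<^esub> z])"
      by (rule bilinI) (use c in \<open>auto intro!: linmap_comp[OF l1] linmap_comp[OF l2] linmap_mult_l linmap_mult_r linmap_id alg\<close>)
    note P1 = pair_lift[OF alg alg b1 TT_module] pair_lift_pure[OF alg alg b1 TT_module]
    note P2 = pair_lift[OF alg alg b2 TT_module] pair_lift_pure[OF alg alg b2 TT_module]
    have "N1 (pure3 K R [x, y, z] \<otimes>\<^bsub>T3 K R\<^esub> s) = lift2 K TT (\<lambda>p q. pure K [R, R] [x \<otimes>\<^bsub>R\<^esub> p \<otimes>\<^bsub>R\<^esub> y, z \<otimes>\<^bsub>R\<^esub> q]) (N1 s)"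
      if s: "s \<in> carrier (T3 K R)" for s
      by (rule T3_eqI[OF linmap_comp[OF linmap_N1 linmap_mult_l[OF T3_alg linmap_id]] linmap_comp[OF P1(1) linmap_N1] TT_module _ s])
        (use c in \<open>simp_all add: N1_pure P1(2) m_assoc\<close>)
    then have 1: "N1 (pure3 K R [x, y, z] \<otimes>\<^bsub>T3 K R\<^esub> s) = N1 (pure3 K R [x, y, z]) \<otimes>\<^bsub>TT\<^esub> pure K [R, R] [\<one>\<^bsub>R\<^esub>, d]"
      if "s \<in> carrier (T3 K R)" "d \<in> carrier R" "N1 s = pure K [R, R] [\<one>\<^bsub>R\<^esub>, d]" for s d
      using that c by (simp add: P1(2) N1_pure pm)
    have "N2 (s \<otimes>\<^bsub>T3 K R\<^esub> pure3 K R [x, y, z]) = lift2 K TT (\<lambda>p q. pure K [R, R] [p \<otimes>\<^bsub>R\<^esub> x, y \<otimes>\<^bsub>R\<^esub> q \<otimes>\<^bsub>R\<^esub> z]) (N2 s)"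
      if s: "s \<in> carrier (T3 K R)" for s
      by (rule T3_eqI[OF linmap_comp[OF linmap_N2 linmap_mult_r[OF T3_alg linmap_id]] linmap_comp[OF P2(1) linmap_N2] TT_module _ s])
        (use c in \<open>simp_all add: N2_pure P2(2) m_assoc\<close>)
    then have 2: "N2 (s \<otimes>\<^bsub>T3 K R\<^esub> pure3 K R [x, y, z]) = pure K [R, R] [d, \<one>\<^bsub>R\<^esub>] \<otimes>\<^bsub>TT\<^esub> N2 (pure3 K R [x, y, z])"
      if "s \<in> carrier (T3 K R)" "d \<in> carrier R" "N2 s = pure K [R, R] [d, \<one>\<^bsub>R\<^esub>]" for s d
      using that c by (simp add: P2(2) N2_pure pm)
    note 1 2 }
  note S = this
  have mc: "\<mu> a \<in> carrier (T3 K R)" "\<mu> b \<in> carrier (T3 K R)" using mD(1) ab by auto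
  show "N1 (\<mu> (a \<otimes>\<^bsub>R\<^esub> b)) = pure K [R, R] [\<one>\<^bsub>R\<^esub>, a \<otimes>\<^bsub>R\<^esub> b]"
    if n: "N1 (\<mu> a) = pure K [R, R] [\<one>\<^bsub>R\<^esub>, a]" "N1 (\<mu> b) = pure K [R, R] [\<one>\<^bsub>R\<^esub>, b]"
  proof -
    have "N1 (\<mu> a \<otimes>\<^bsub>T3 K R\<^esub> \<mu> b) = N1 (\<mu> a) \<otimes>\<^bsub>TT\<^esub> pure K [R, R] [\<one>\<^bsub>R\<^esub>, b]"
      by (rule T3_eqI[OF linmap_comp[OF linmap_N1 linmap_mult_r[OF T3_alg linmap_id mc(2)]] linmap_mult_r[OF TT_alg linmap_N1 pc] TT_module _ mc(1)])
        (use ab mc n(2) in \<open>simp_all add: S\<close>)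
    then show ?thesis using ab n by (simp add: mD(3) pm)
  qed
  show "N2 (\<mu> (a \<otimes>\<^bsub>R\<^esub> b)) = pure K [R, R] [a \<otimes>\<^bsub>R\<^esub> b, \<one>\<^bsub>R\<^esub>]"
    if n: "N2 (\<mu> a) = pure K [R, R] [a, \<one>\<^bsub>R\<^esub>]" "N2 (\<mu> b) = pure K [R, R] [b, \<one>\<^bsub>R\<^esub>]"
  proof -
    have "N2 (\<mu> a \<otimes>\<^bsub>T3 K R\<^esub> \<mu> b) = pure K [R, R] [a, \<one>\<^bsub>R\<^esub>] \<otimes>\<^bsub>TT\<^esub> N2 (\<mu> b)"
      by (rule T3_eqI[OF linmap_comp[OF linmap_N2 linmap_mult_l[OF T3_alg linmap_id mc(1)]] linmap_mult_l[OF TT_alg linmap_N2 pc] TT_module _ mc(2)])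
        (use ab mc n(1) in \<open>simp_all add: S\<close>)
    then show ?thesis using ab n by (simp add: mD(3) pm)
  qed
qed

end

text \<open>With \<open>\<tau> = id\<close>, \<open>c = 0\<close> and \<open>\<xi> = 1\<close> the algebra is the polynomial algebra \<open>R[X, Y]\<close>.\<close>

locale polyext = gasl K R \<tau> \<omega> c \<xi> + HR: hg K R \<mu> for K :: "'k ring" and R :: "('k, 'r) module" and \<tau> \<omega> c \<xi> \<mu> +
  fixes g
  assumes tau_id: "r \<in> carrier R \<Longrightarrow> \<tau> r = r" and omega_id: "r \<in> carrier R \<Longrightarrow> \<omega> r = r"
    and c0: "c = \<zero>\<^bsub>R\<^esub>" and xi1: "\<xi> = \<one>\<^bsub>K\<^esub>"
    and gG: "g \<in> G0 K R \<mu>"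
    and ad_g: "r \<in> carrier R \<Longrightarrow> HR.adG g \<otimes>\<^bsub>T3 K R\<^esub> \<mu> r = \<mu> r \<otimes>\<^bsub>T3 K R\<^esub> HR.adG g"
    and G0_span: "\<lbrakk>submodule S K R; \<And>u. u \<in> G0 K R \<mu> \<Longrightarrow> u \<in> S; r \<in> carrier R\<rbrakk> \<Longrightarrow> r \<in> S"
begin

sublocale TA3: kalg K TA3 by (rule kalgI, rule A.T3_alg)

lemma XY_central:
  assumes Z: "Z = X \<or> Z = Y" and a: "a \<in> carrier A"
  shows "Z \<otimes>\<^bsub>A\<^esub> a = a \<otimes>\<^bsub>A\<^esub> Z"
proof -
  have Zc: "Z \<in> carrier A" using Z by auto
  have i0: "\<iota> \<zero>\<^bsub>R\<^esub> = \<zero>\<^bsub>A\<^esub>" by (rule linmap_zero[OF iota_lin R.moduleR A.moduleR])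
  have ic: "\<iota> c = \<zero>\<^bsub>A\<^esub>" using arg_cong[where f = "\<lambda>r. \<iota> r", OF c0] i0 by (rule trans)
  have xa: "\<xi> \<odot>\<^bsub>A\<^esub> d = d" if "d \<in> carrier A" for d
    by (rule trans[OF arg_cong[where f = "\<lambda>k. k \<odot>\<^bsub>A\<^esub> d", OF xi1]]) (simp add: that)
  have xy: "X \<otimes>\<^bsub>A\<^esub> Y = Y \<otimes>\<^bsub>A\<^esub> X" by (simp add: XY_eq xa ic)
  have "a \<in> {a \<in> carrier A. Z \<otimes>\<^bsub>A\<^esub> a = a \<otimes>\<^bsub>A\<^esub> Z}"
  proof (rule gas_induct[OF linmap_equalizer[OF linmap_mult_l[OF algA linmap_id Zc] linmap_mult_r[OF algA linmap_id Zc] A.moduleR A.moduleR] _ _ _ _ a])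
    show "\<one>\<^bsub>A\<^esub> \<in> {a \<in> carrier A. Z \<otimes>\<^bsub>A\<^esub> a = a \<otimes>\<^bsub>A\<^esub> Z}" using Zc by simp
    have step: "b \<otimes>\<^bsub>A\<^esub> d \<in> {a \<in> carrier A. Z \<otimes>\<^bsub>A\<^esub> a = a \<otimes>\<^bsub>A\<^esub> Z}"
      if "b \<in> carrier A" "Z \<otimes>\<^bsub>A\<^esub> b = b \<otimes>\<^bsub>A\<^esub> Z" "d \<in> {a \<in> carrier A. Z \<otimes>\<^bsub>A\<^esub> a = a \<otimes>\<^bsub>A\<^esub> Z}" for b d
    proof -
      have d: "d \<in> carrier A" "Z \<otimes>\<^bsub>A\<^esub> d = d \<otimes>\<^bsub>A\<^esub> Z" using that by auto
      have "Z \<otimes>\<^bsub>A\<^esub> (b \<otimes>\<^bsub>A\<^esub> d) = (b \<otimes>\<^bsub>A\<^esub> Z) \<otimes>\<^bsub>A\<^esub> d" using that(1) d(1) Zc by (simp add: A.m_assoc[symmetric] that(2))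
      also have "\<dots> = b \<otimes>\<^bsub>A\<^esub> d \<otimes>\<^bsub>A\<^esub> Z" using that(1) d Zc by (simp add: A.m_assoc)
      finally show ?thesis using that(1) d(1) by simp
    qed
    show "\<iota> r \<otimes>\<^bsub>A\<^esub> d \<in> {a \<in> carrier A. Z \<otimes>\<^bsub>A\<^esub> a = a \<otimes>\<^bsub>A\<^esub> Z}" if "r \<in> carrier R" "d \<in> {a \<in> carrier A. Z \<otimes>\<^bsub>A\<^esub> a = a \<otimes>\<^bsub>A\<^esub> Z}" for r d
      using that Z by (intro step) (auto simp: X_iota Y_iota tau_id omega_id)
    show "X \<otimes>\<^bsub>A\<^esub> d \<in> {a \<in> carrier A. Z \<otimes>\<^bsub>A\<^esub> a = a \<otimes>\<^bsub>A\<^esub> Z}" if "d \<in> {a \<in> carrier A. Z \<otimes>\<^bsub>A\<^esub> a = a \<otimes>\<^bsub>A\<^esub> Z}" for d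
      using that Z xy by (intro step) auto
    show "Y \<otimes>\<^bsub>A\<^esub> d \<in> {a \<in> carrier A. Z \<otimes>\<^bsub>A\<^esub> a = a \<otimes>\<^bsub>A\<^esub> Z}" if "d \<in> {a \<in> carrier A. Z \<otimes>\<^bsub>A\<^esub> a = a \<otimes>\<^bsub>A\<^esub> Z}" for d
      using that Z xy by (intro step) auto
  qed
  then show ?thesis by simp
qed

lemma TA3_central:
  assumes Z: "Z = X \<or> Z = Y" and w: "w = pA3 [Z, \<one>\<^bsub>A\<^esub>, \<one>\<^bsub>A\<^esub>] \<or> w = pA3 [\<one>\<^bsub>A\<^esub>, Z, \<one>\<^bsub>A\<^esub>] \<or> w = pA3 [\<one>\<^bsub>A\<^esub>, \<one>\<^bsub>A\<^esub>, Z]"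
    and t: "t \<in> carrier TA3"
  shows "w \<otimes>\<^bsub>TA3\<^esub> t = t \<otimes>\<^bsub>TA3\<^esub> w"
proof -
  have Zc: "Z \<in> carrier A" using Z by auto
  then have wc: "w \<in> carrier TA3" using w by auto
  show ?thesis
    by (rule A.T3_eqI[OF linmap_mult_l[OF A.T3_alg linmap_id wc] linmap_mult_r[OF A.T3_alg linmap_id wc] A.T3_module _ t])
      (use w Zc in \<open>auto simp: XY_central[OF Z]\<close>)
qed

text \<open>As \<open>Z\<close> is central, it can be split off. Commutation with the skew primitive
  element then reduces to commutation with \<open>adG u\<close>.\<close>

lemma skew_eq:
  assumes u: "u \<in> Units R" and Z: "Z = X \<or> Z = Y"
  shows "skew_prim K A (\<iota> u) Z = (pA3 [Z, \<one>\<^bsub>A\<^esub>, \<one>\<^bsub>A\<^esub>] \<ominus>\<^bsub>TA3\<^esub> J3 (HR.adG u) \<otimes>\<^bsub>TA3\<^esub> pA3 [\<one>\<^bsub>A\<^esub>, Z, \<one>\<^bsub>A\<^esub>])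
       \<oplus>\<^bsub>TA3\<^esub> J3 (HR.adG u) \<otimes>\<^bsub>TA3\<^esub> pA3 [\<one>\<^bsub>A\<^esub>, \<one>\<^bsub>A\<^esub>, Z]"
proof -
  have Zc: "Z \<in> carrier A" using Z by auto
  show ?thesis using HR.Units_simps[OF u] Zc
    by (simp add: skew_prim_def iota_Units[OF u] iota_simps XY_central[OF Z])
qed

lemma skew_comm:
  assumes u: "u \<in> Units R" and Z: "Z = X \<or> Z = Y" and t: "t \<in> carrier TA3" and ut: "J3 (HR.adG u) \<otimes>\<^bsub>TA3\<^esub> t = t \<otimes>\<^bsub>TA3\<^esub> J3 (HR.adG u)"
  shows "skew_prim K A (\<iota> u) Z \<otimes>\<^bsub>TA3\<^esub> t = t \<otimes>\<^bsub>TA3\<^esub> skew_prim K A (\<iota> u) Z"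
proof -
  have Zc: "Z \<in> carrier A" using Z by auto
  have G: "J3 (HR.adG u) \<in> carrier TA3" using J3D(1) HR.adG_inv[OF u] by blast
  have step: "J3 (HR.adG u) \<otimes>\<^bsub>TA3\<^esub> w \<otimes>\<^bsub>TA3\<^esub> t = t \<otimes>\<^bsub>TA3\<^esub> (J3 (HR.adG u) \<otimes>\<^bsub>TA3\<^esub> w)"
    if w: "w = pA3 [Z, \<one>\<^bsub>A\<^esub>, \<one>\<^bsub>A\<^esub>] \<or> w = pA3 [\<one>\<^bsub>A\<^esub>, Z, \<one>\<^bsub>A\<^esub>] \<or> w = pA3 [\<one>\<^bsub>A\<^esub>, \<one>\<^bsub>A\<^esub>, Z]" for w
  proof -
    have wc: "w \<in> carrier TA3" using w Zc by auto
    have "J3 (HR.adG u) \<otimes>\<^bsub>TA3\<^esub> w \<otimes>\<^bsub>TA3\<^esub> t = (J3 (HR.adG u) \<otimes>\<^bsub>TA3\<^esub> t) \<otimes>\<^bsub>TA3\<^esub> w"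
      using G wc t TA3_central[OF Z w t] by (simp add: TA3.m_assoc)
    then show ?thesis unfolding ut using G wc t by (simp add: TA3.m_assoc)
  qed
  show ?thesis unfolding skew_eq[OF u Z] a_minus_def using Zc G t
    by (simp add: TA3.l_distr TA3.r_distr TA3.l_minus TA3.r_minus step TA3_central[OF Z _ t] del: A.pure3_mult J3_pure)
qed

lemma one_G0: "\<one>\<^bsub>R\<^esub> \<in> G0 K R \<mu>"
  by (simp add: G0_def HR.muD R.T3_one)

lemma gU: "g \<in> Units R"
  using gG by (simp add: G0_def)

definition "mu' = (SOME m. m \<in> alg_hom K A TA3 \<and> (\<forall>r\<in>carrier R. m (\<iota> r) = J3 (\<mu> r)) \<and>
   m X = skew_prim K A (\<iota> g) X \<and> m Y = skew_prim K A (\<iota> \<one>\<^bsub>R\<^esub>) Y)"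

lemma skew_closed: "\<lbrakk>u \<in> Units R; Z = X \<or> Z = Y\<rbrakk> \<Longrightarrow> skew_prim K A (\<iota> u) Z \<in> carrier TA3"
  using J3D(1) HR.adG_inv(3) by (auto simp: skew_eq simp del: J3_pure intro!: TA3.minus_closed)

lemma mu': "mu' \<in> alg_hom K A TA3" "r \<in> carrier R \<Longrightarrow> mu' (\<iota> r) = J3 (\<mu> r)"
   "mu' X = skew_prim K A (\<iota> g) X" "mu' Y = skew_prim K A (\<iota> \<one>\<^bsub>R\<^esub>) Y"
proof -
  have f: "(\<lambda>r. J3 (\<mu> r)) \<in> alg_hom K R TA3" by (rule alg_hom_comp[OF J3_hom HR.mu_hom])
  have J1: "J3 (HR.adG \<one>\<^bsub>R\<^esub>) = \<one>\<^bsub>TA3\<^esub>" using J3D(4) by (simp add: R.T3_one)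
  \<comment> \<open>For the group-like 1 the element \<open>adG\<close> is the identity, so the
    value assigned to Y is central. This settles both the relations for Y and the relation between X
    and Y.\<close>
  have yc: "skew_prim K A (\<iota> \<one>\<^bsub>R\<^esub>) Y \<otimes>\<^bsub>TA3\<^esub> t = t \<otimes>\<^bsub>TA3\<^esub> skew_prim K A (\<iota> \<one>\<^bsub>R\<^esub>) Y" if "t \<in> carrier TA3" for t
    by (rule skew_comm[OF R.Units_one_closed _ that], simp, unfold J1) (simp add: that)
  have "\<exists>m. m \<in> alg_hom K A TA3 \<and> (\<forall>r\<in>carrier R. m (\<iota> r) = J3 (\<mu> r)) \<and> m X = skew_prim K A (\<iota> g) X \<and> m Y = skew_prim K A (\<iota> \<one>\<^bsub>R\<^esub>) Y"
  proof (rule gas_univ[OF A.T3_alg f skew_closed[OF gU] skew_closed[OF R.Units_one_closed]])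
    fix r assume r: "r \<in> carrier R"
    have m: "\<mu> r \<in> carrier TR3" using HR.muD(1)[OF r] .
    have "J3 (HR.adG g) \<otimes>\<^bsub>TA3\<^esub> J3 (\<mu> r) = J3 (\<mu> r) \<otimes>\<^bsub>TA3\<^esub> J3 (HR.adG g)"
      using ad_g[OF r] HR.adG_inv(3)[OF gU] m by (simp add: J3D(3)[symmetric] del: J3_pure)
    then show "skew_prim K A (\<iota> g) X \<otimes>\<^bsub>TA3\<^esub> J3 (\<mu> r) = J3 (\<mu> (\<tau> r)) \<otimes>\<^bsub>TA3\<^esub> skew_prim K A (\<iota> g) X"
      unfolding tau_id[OF r] by (intro skew_comm[OF gU] J3D(1) m) auto
    show "skew_prim K A (\<iota> \<one>\<^bsub>R\<^esub>) Y \<otimes>\<^bsub>TA3\<^esub> J3 (\<mu> r) = J3 (\<mu> (\<omega> r)) \<otimes>\<^bsub>TA3\<^esub> skew_prim K A (\<iota> \<one>\<^bsub>R\<^esub>) Y"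
      unfolding omega_id[OF r] by (rule yc[OF J3D(1)[OF m]])
  next
    have z: "J3 (\<mu> c) = \<zero>\<^bsub>TA3\<^esub>"
      using arg_cong[where f = "\<lambda>r. J3 (\<mu> r)", OF c0] linmap_zero[OF alg_hom_linmap[OF f] R.moduleR A.T3_module] by (rule trans)
    have xa: "\<xi> \<odot>\<^bsub>TA3\<^esub> d = d" if "d \<in> carrier TA3" for d
      by (rule trans[OF arg_cong[where f = "\<lambda>k. k \<odot>\<^bsub>TA3\<^esub> d", OF xi1]]) (simp add: that)
    show "skew_prim K A (\<iota> g) X \<otimes>\<^bsub>TA3\<^esub> skew_prim K A (\<iota> \<one>\<^bsub>R\<^esub>) Y = \<xi> \<odot>\<^bsub>TA3\<^esub> (skew_prim K A (\<iota> \<one>\<^bsub>R\<^esub>) Y \<otimes>\<^bsub>TA3\<^esub> skew_prim K A (\<iota> g) X) \<oplus>\<^bsub>TA3\<^esub> J3 (\<mu> c)"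
      using skew_closed[OF gU, of X] skew_closed[OF R.Units_one_closed, of Y]
      by (simp add: z xa yc[symmetric])
  qed auto
  from someI_ex[OF this] show "mu' \<in> alg_hom K A TA3" "r \<in> carrier R \<Longrightarrow> mu' (\<iota> r) = J3 (\<mu> r)"
   "mu' X = skew_prim K A (\<iota> g) X" "mu' Y = skew_prim K A (\<iota> \<one>\<^bsub>R\<^esub>) Y"
    unfolding mu'_def[symmetric] by blast+
qed

lemmas mu'_lin = alg_hom_linmap[OF mu'(1)]

lemma mu'_G0: "u \<in> G0 K R \<mu> \<Longrightarrow> mu' (\<iota> u) = pA3 [\<iota> u, \<iota> (inv\<^bsub>R\<^esub> u), \<iota> u]"
  using HR.Units_simps[of u] by (simp add: G0_def mu')

lemma axioms_G0:
  assumes u: "u \<in> G0 K R \<mu>"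
  shows "A.L1 mu' (mu' (\<iota> u)) = A.L2 mu' (mu' (\<iota> u))" "A.N1 (mu' (\<iota> u)) = pure K [A, A] [\<one>\<^bsub>A\<^esub>, \<iota> u]"
    "A.N2 (mu' (\<iota> u)) = pure K [A, A] [\<iota> u, \<one>\<^bsub>A\<^esub>]"
proof -
  have U: "u \<in> Units R" using u by (simp add: G0_def)
  note us = HR.Units_simps[OF U]
  have i: "\<iota> u \<otimes>\<^bsub>A\<^esub> \<iota> (inv\<^bsub>R\<^esub> u) = \<one>\<^bsub>A\<^esub>" "\<iota> (inv\<^bsub>R\<^esub> u) \<otimes>\<^bsub>A\<^esub> \<iota> u = \<one>\<^bsub>A\<^esub>"
    using us by (simp_all add: iota_simps(2,3)[symmetric])
  note G = A.grouplike_axioms[OF mu'_lin iota_closed[OF us(1)] iota_closed[OF us(2)] i mu'_G0[OF u]]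
  show "A.L1 mu' (mu' (\<iota> u)) = A.L2 mu' (mu' (\<iota> u))" "A.N1 (mu' (\<iota> u)) = pure K [A, A] [\<one>\<^bsub>A\<^esub>, \<iota> u]"
    "A.N2 (mu' (\<iota> u)) = pure K [A, A] [\<iota> u, \<one>\<^bsub>A\<^esub>]" by (rule G)+
qed

text \<open>All three axioms are linear in \<open>r\<close>, and R is spanned by
  group-likes.\<close>

lemma axioms_iota:
  assumes r: "r \<in> carrier R"
  shows "A.L1 mu' (mu' (\<iota> r)) = A.L2 mu' (mu' (\<iota> r))" "A.N1 (mu' (\<iota> r)) = pure K [A, A] [\<one>\<^bsub>A\<^esub>, \<iota> r]"
    "A.N2 (mu' (\<iota> r)) = pure K [A, A] [\<iota> r, \<one>\<^bsub>A\<^esub>]"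
proof -
  have Gc: "u \<in> G0 K R \<mu> \<Longrightarrow> u \<in> carrier R" for u by (auto simp: G0_def)
  note ml = linmap_comp[OF mu'_lin iota_lin]
  have "r \<in> {r \<in> carrier R. A.L1 mu' (mu' (\<iota> r)) = A.L2 mu' (mu' (\<iota> r))}"
    by (rule G0_span[OF linmap_equalizer[OF linmap_comp[OF A.linmap_L1[OF mu'_lin] ml] linmap_comp[OF A.linmap_L2[OF mu'_lin] ml] R.moduleR A.T5_module] _ r])
      (use axioms_G0 Gc in auto)
  then show "A.L1 mu' (mu' (\<iota> r)) = A.L2 mu' (mu' (\<iota> r))" by simp
  have "r \<in> {r \<in> carrier R. A.N1 (mu' (\<iota> r)) = pure K [A, A] [\<one>\<^bsub>A\<^esub>, \<iota> r]}"
    by (rule G0_span[OF linmap_equalizer[OF linmap_comp[OF A.linmap_N1 ml] linmap_comp[OF pair_lin2[OF algA algA A.one_closed] iota_lin] R.moduleR A.TT_module] _ r])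
      (use axioms_G0 Gc in auto)
  then show "A.N1 (mu' (\<iota> r)) = pure K [A, A] [\<one>\<^bsub>A\<^esub>, \<iota> r]" by simp
  have "r \<in> {r \<in> carrier R. A.N2 (mu' (\<iota> r)) = pure K [A, A] [\<iota> r, \<one>\<^bsub>A\<^esub>]}"
    by (rule G0_span[OF linmap_equalizer[OF linmap_comp[OF A.linmap_N2 ml] linmap_comp[OF pair_lin1[OF algA algA A.one_closed] iota_lin] R.moduleR A.TT_module] _ r])
      (use axioms_G0 Gc in auto)
  then show "A.N2 (mu' (\<iota> r)) = pure K [A, A] [\<iota> r, \<one>\<^bsub>A\<^esub>]" by simp
qed

lemma axioms_XY:
  assumes Z: "Z = X \<or> Z = Y"
  shows "A.L1 mu' (mu' Z) = A.L2 mu' (mu' Z)" "A.N1 (mu' Z) = pure K [A, A] [\<one>\<^bsub>A\<^esub>, Z]" "A.N2 (mu' Z) = pure K [A, A] [Z, \<one>\<^bsub>A\<^esub>]"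
proof -
  obtain u where u: "u \<in> G0 K R \<mu>" and m: "mu' Z = skew_prim K A (\<iota> u) Z" using Z mu'(3,4) gG one_G0 by blast
  have U: "u \<in> Units R" using u by (simp add: G0_def)
  have Zc: "Z \<in> carrier A" using Z by auto
  have mu: "mu' (\<iota> u) = pA3 [\<iota> u, inv\<^bsub>A\<^esub> (\<iota> u), \<iota> u]" using mu'_G0[OF u] iota_Units[OF U] by simp
  note S = A.skew_primitive_axioms[OF mu'(1) iota_Units(1)[OF U] mu Zc m]
  show "A.L1 mu' (mu' Z) = A.L2 mu' (mu' Z)" "A.N1 (mu' Z) = pure K [A, A] [\<one>\<^bsub>A\<^esub>, Z]" "A.N2 (mu' Z) = pure K [A, A] [Z, \<one>\<^bsub>A\<^esub>]"
    by (rule S)+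
qed

lemma hopf_A: "hopf_galois K A mu'"
  unfolding A.hopf_galois_iff
proof (intro conjI ballI)
  show "\<one>\<^bsub>A\<^esub> \<noteq> \<zero>\<^bsub>A\<^esub>"
    using linmap_zero[OF p_lin(1) A.moduleR R.moduleR] p_simps(10) HR.one_ne_zero by metis
  show "mu' \<in> alg_hom K A TA3" by (rule mu')
  fix a assume a: "a \<in> carrier A"
  note h1 = alg_hom_comp[OF A.L_hom(1)[OF mu'(1)] mu'(1)] and h2 = alg_hom_comp[OF A.L_hom(2)[OF mu'(1)] mu'(1)]
  show "A.L1 mu' (mu' a) = A.L2 mu' (mu' a)"
    by (rule gas_hom_eqI[OF h1 h2 A.T5_alg axioms_iota(1) axioms_XY(1) axioms_XY(1) a]) auto
  note n1 = linmap_comp[OF A.linmap_N1 mu'_lin] and n2 = linmap_comp[OF A.linmap_N2 mu'_lin]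
  note q1 = pair_lin2[OF algA algA A.one_closed] and q2 = pair_lin1[OF algA algA A.one_closed]
  have o: "A.N1 (mu' \<one>\<^bsub>A\<^esub>) = pure K [A, A] [\<one>\<^bsub>A\<^esub>, \<one>\<^bsub>A\<^esub>]" "A.N2 (mu' \<one>\<^bsub>A\<^esub>) = pure K [A, A] [\<one>\<^bsub>A\<^esub>, \<one>\<^bsub>A\<^esub>]"
    using axioms_iota(2,3)[OF R.one_closed] by (simp_all add: iota_simps(3))
  \<comment> \<open>Unlike coassociativity, the counit axioms do not compare algebra maps, so they
    are propagated from generators by left multiplication with \<open>counit_mult\<close>.\<close>
  have "a \<in> {a \<in> carrier A. A.N1 (mu' a) = pure K [A, A] [\<one>\<^bsub>A\<^esub>, a]}"
    by (rule gas_induct[OF linmap_equalizer[OF n1 q1 A.moduleR A.TT_module] _ _ _ _ a])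
      (simp_all add: o axioms_iota axioms_XY A.counit_mult(1)[OF mu'(1)])
  then show "A.N1 (mu' a) = pure K [A, A] [\<one>\<^bsub>A\<^esub>, a]" by simp
  have "a \<in> {a \<in> carrier A. A.N2 (mu' a) = pure K [A, A] [a, \<one>\<^bsub>A\<^esub>]}"
    by (rule gas_induct[OF linmap_equalizer[OF n2 q2 A.moduleR A.TT_module] _ _ _ _ a])
      (simp_all add: o axioms_iota axioms_XY A.counit_mult(2)[OF mu'(1)])
  then show "A.N2 (mu' a) = pure K [A, A] [a, \<one>\<^bsub>A\<^esub>]" by simp
qed

lemma mu'_iota: "r \<in> carrier R \<Longrightarrow> mu' (\<iota> r) = tlift K TA3 (\<lambda>x. pA3 (map (\<lambda>s. \<iota> s) x)) (\<mu> r)"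
proof -
  assume r: "r \<in> carrier R"
  have t: "trilin K R (opp R) R TA3 (\<lambda>a b d. pA3 [\<iota> a, \<iota> b, \<iota> d])" using tri_J3 by (simp add: trilin_def)
  show ?thesis unfolding mu'(2)[OF r] J3_def
    by (rule lift3_cong[OF algR R.alg_opp algR t A.T3_module HR.muD(1)[OF r], symmetric]) simp
qed

end

section \<open>An example in which the two automorphisms are not mutually inverse\<close>

definition Cx :: "complex ring" where
  "Cx = \<lparr>carrier = UNIV, mult = (*), one = 1, zero = 0, add = (+)\<rparr>"

lemma Cx_simps [simp]: "carrier Cx = UNIV" "x \<otimes>\<^bsub>Cx\<^esub> y = x * y" "\<one>\<^bsub>Cx\<^esub> = 1" "\<zero>\<^bsub>Cx\<^esub> = 0" "x \<oplus>\<^bsub>Cx\<^esub> y = x + y"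
  by (simp_all add: Cx_def)

lemma field_Cx: "field Cx"
proof -
  have ag: "abelian_group Cx"
    by (rule abelian_groupI) (auto simp: algebra_simps intro: exI[of _ "- _"] add.left_inverse)
  have "cring Cx"
    by (rule cringI[OF ag]) (auto intro!: comm_monoidI simp: algebra_simps)
  moreover have "Units Cx = carrier Cx - {\<zero>\<^bsub>Cx\<^esub>}"
    by (auto simp: Units_def) (metis left_inverse right_inverse)
  ultimately show ?thesis by (rule cring.cring_fieldI)
qed

text \<open>The twisted group algebra of \<open>\<int>/2 \<times> \<int>/2\<close> (isomorphic to the \<open>2 \<times> 2\<close> matrices), with basis
  \<open>1, e\<^sub>1, e\<^sub>2, e\<^sub>3 = e\<^sub>1e\<^sub>2 = -e\<^sub>2e\<^sub>1\<close> and \<open>e\<^sub>1\<^sup>2 = e\<^sub>2\<^sup>2 = 1\<close>.\<close>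

definition vec4 :: "complex \<Rightarrow> complex \<Rightarrow> complex \<Rightarrow> complex \<Rightarrow> nat \<Rightarrow> complex" where
  "vec4 a b c d = (\<lambda>n. if n = 0 then a else if n = 1 then b else if n = 2 then c else if n = 3 then d else 0)"

definition Q4 :: "(complex, nat \<Rightarrow> complex) module" where
  "Q4 = \<lparr>carrier = {vec4 a b c d | a b c d. True},
     mult = (\<lambda>f g. vec4 (f 0 * g 0 + f 1 * g 1 + f 2 * g 2 - f 3 * g 3)
       (f 0 * g 1 + f 1 * g 0 - f 2 * g 3 + f 3 * g 2)
       (f 0 * g 2 + f 2 * g 0 + f 1 * g 3 - f 3 * g 1)
       (f 0 * g 3 + f 3 * g 0 + f 1 * g 2 - f 2 * g 1)),
     one = vec4 1 0 0 0, zero = vec4 0 0 0 0,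
     add = (\<lambda>f g. vec4 (f 0 + g 0) (f 1 + g 1) (f 2 + g 2) (f 3 + g 3)),
     smult = (\<lambda>k f. vec4 (k * f 0) (k * f 1) (k * f 2) (k * f 3))\<rparr>"

lemma vec4_nth: "vec4 a b c d 0 = a" "vec4 a b c d (Suc 0) = b" "vec4 a b c d 2 = c" "vec4 a b c d 3 = d"
  by (simp_all add: vec4_def)

lemma vec4_eq [simp]: "vec4 a b c d = vec4 a' b' c' d' \<longleftrightarrow> a = a' \<and> b = b' \<and> c = c' \<and> d = d'"
  by (metis vec4_nth)

lemma Q4_simps [simp]: "vec4 a b c d \<in> carrier Q4"
  "vec4 a b c d \<otimes>\<^bsub>Q4\<^esub> vec4 a' b' c' d' = vec4 (a * a' + b * b' + c * c' - d * d') (a * b' + b * a' - c * d' + d * c')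
       (a * c' + c * a' + b * d' - d * b') (a * d' + d * a' + b * c' - c * b')"
  "vec4 a b c d \<oplus>\<^bsub>Q4\<^esub> vec4 a' b' c' d' = vec4 (a + a') (b + b') (c + c') (d + d')"
  "k \<odot>\<^bsub>Q4\<^esub> vec4 a b c d = vec4 (k * a) (k * b) (k * c) (k * d)"
  "\<one>\<^bsub>Q4\<^esub> = vec4 1 0 0 0" "\<zero>\<^bsub>Q4\<^esub> = vec4 0 0 0 0"
  by (auto simp: Q4_def vec4_nth)

lemma Q4_cases: "x \<in> carrier Q4 \<Longrightarrow> \<exists>a b c d. x = vec4 a b c d"
  by (auto simp: Q4_def)

lemma alg_Q4: "k_algebra Cx Q4"
proof -
  interpret K: field Cx by (rule field_Cx)
  have ag: "abelian_group Q4"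
  proof (rule abelian_groupI)
    fix x assume "x \<in> carrier Q4"
    then obtain a b c d where "x = vec4 a b c d" using Q4_cases by blast
    then show "\<exists>y\<in>carrier Q4. y \<oplus>\<^bsub>Q4\<^esub> x = \<zero>\<^bsub>Q4\<^esub>" by (intro bexI[of _ "vec4 (- a) (- b) (- c) (- d)"]) simp_all
  qed (auto dest!: Q4_cases)
  have mo: "monoid Q4" by (rule monoidI) (auto dest!: Q4_cases simp: algebra_simps)
  have "ring Q4" by (rule ringI[OF ag mo]) (auto dest!: Q4_cases simp: algebra_simps)
  moreover have "module Cx Q4" by (rule moduleI[OF K.is_cring ag]) (auto dest!: Q4_cases simp: algebra_simps)
  ultimately show ?thesis unfolding k_algebra_def using field_Cx by (auto dest!: Q4_cases simp: algebra_simps)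
qed

interpretation Q: kalg Cx Q4 by (rule kalgI, rule alg_Q4)

abbreviation "b0 \<equiv> vec4 1 0 0 0"
abbreviation "b1 \<equiv> vec4 0 1 0 0"
abbreviation "b2 \<equiv> vec4 0 0 1 0"
abbreviation "b3 \<equiv> vec4 0 0 0 1"

abbreviation "QT \<equiv> T3 Cx Q4"
abbreviation "p3 \<equiv> pure3 Cx Q4"

interpretation QT: kalg Cx QT by (rule kalgI, rule Q.T3_alg)

definition "P0 = p3 [b0, b0, b0]"
definition "P1 = p3 [b1, b1, b1]"
definition "P2 = p3 [b2, b2, b2]"
definition "P3 = p3 [b3, b3, b3]"

lemma P_closed [simp]: "P0 \<in> carrier QT" "P1 \<in> carrier QT" "P2 \<in> carrier QT" "P3 \<in> carrier QT"
  by (simp_all add: P0_def P1_def P2_def P3_def)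

lemma p3_smult:
  assumes "x \<in> carrier Q4" "y \<in> carrier Q4" "z \<in> carrier Q4"
  shows "p3 [k \<odot>\<^bsub>Q4\<^esub> x, l \<odot>\<^bsub>Q4\<^esub> y, m \<odot>\<^bsub>Q4\<^esub> z] = (k * l * m) \<odot>\<^bsub>QT\<^esub> p3 [x, y, z]"
proof -
  have 1: "p3 [k \<odot>\<^bsub>Q4\<^esub> x, l \<odot>\<^bsub>Q4\<^esub> y, m \<odot>\<^bsub>Q4\<^esub> z] = k \<odot>\<^bsub>QT\<^esub> p3 [x, l \<odot>\<^bsub>Q4\<^esub> y, m \<odot>\<^bsub>Q4\<^esub> z]"
    using linmapD(3)[OF Q.linmap_pure3_1[OF linmap_id]] assms by simp
  have 2: "p3 [x, l \<odot>\<^bsub>Q4\<^esub> y, m \<odot>\<^bsub>Q4\<^esub> z] = l \<odot>\<^bsub>QT\<^esub> p3 [x, y, m \<odot>\<^bsub>Q4\<^esub> z]"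
    using linmapD(3)[OF Q.linmap_pure3_2[OF linmap_id]] assms by simp
  have 3: "p3 [x, y, m \<odot>\<^bsub>Q4\<^esub> z] = m \<odot>\<^bsub>QT\<^esub> p3 [x, y, z]"
    using linmapD(3)[OF Q.linmap_pure3_3[OF linmap_id]] assms by simp
  show ?thesis unfolding 1 2 3 using assms QT.Mod.smult_assoc1[of k "l * m" "p3 [x, y, z]"] QT.Mod.smult_assoc1[of l m "p3 [x, y, z]"]
    by (simp add: mult.assoc)
qed

lemma p3_vec:
  "p3 [vec4 k 0 0 0, vec4 l 0 0 0, vec4 m 0 0 0] = (k * l * m) \<odot>\<^bsub>QT\<^esub> P0"
  "p3 [vec4 0 k 0 0, vec4 0 l 0 0, vec4 0 m 0 0] = (k * l * m) \<odot>\<^bsub>QT\<^esub> P1"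
  "p3 [vec4 0 0 k 0, vec4 0 0 l 0, vec4 0 0 m 0] = (k * l * m) \<odot>\<^bsub>QT\<^esub> P2"
  "p3 [vec4 0 0 0 k, vec4 0 0 0 l, vec4 0 0 0 m] = (k * l * m) \<odot>\<^bsub>QT\<^esub> P3"
  using p3_smult[of b0 b0 b0 k l m] p3_smult[of b1 b1 b1 k l m] p3_smult[of b2 b2 b2 k l m] p3_smult[of b3 b3 b3 k l m]
  by (simp_all add: P0_def P1_def P2_def P3_def)

text \<open>Determined by making the basis elements group-like. The sign of the last term reflects
  that the inverse of e_3 is -e_3, so that e_3 \<otimes> e_3^-1 \<otimes> e_3 is the negative of
  \<open>P3\<close>.\<close>

definition mu4 :: "(nat \<Rightarrow> complex) \<Rightarrow> ((nat \<Rightarrow> complex) list \<Rightarrow> complex) set" where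
  "mu4 f = (f 0 \<odot>\<^bsub>QT\<^esub> P0 \<oplus>\<^bsub>QT\<^esub> f 1 \<odot>\<^bsub>QT\<^esub> P1) \<oplus>\<^bsub>QT\<^esub> (f 2 \<odot>\<^bsub>QT\<^esub> P2 \<oplus>\<^bsub>QT\<^esub> (- f 3) \<odot>\<^bsub>QT\<^esub> P3)"

lemma QT_smult [simp]: "x \<in> carrier QT \<Longrightarrow> 0 \<odot>\<^bsub>QT\<^esub> x = \<zero>\<^bsub>QT\<^esub>" "x \<in> carrier QT \<Longrightarrow> 1 \<odot>\<^bsub>QT\<^esub> x = x"
  "x \<in> carrier QT \<Longrightarrow> k \<odot>\<^bsub>QT\<^esub> (l \<odot>\<^bsub>QT\<^esub> x) = (k * l) \<odot>\<^bsub>QT\<^esub> x" "x \<in> carrier QT \<Longrightarrow> k \<odot>\<^bsub>QT\<^esub> x \<in> carrier QT"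
  "\<lbrakk>x \<in> carrier QT; y \<in> carrier QT\<rbrakk> \<Longrightarrow> (k \<odot>\<^bsub>QT\<^esub> x) \<otimes>\<^bsub>QT\<^esub> y = k \<odot>\<^bsub>QT\<^esub> (x \<otimes>\<^bsub>QT\<^esub> y)"
  "\<lbrakk>x \<in> carrier QT; y \<in> carrier QT\<rbrakk> \<Longrightarrow> x \<otimes>\<^bsub>QT\<^esub> (k \<odot>\<^bsub>QT\<^esub> y) = k \<odot>\<^bsub>QT\<^esub> (x \<otimes>\<^bsub>QT\<^esub> y)"
  using QT.Mod.smult_l_null[of x] QT.Mod.smult_one[of x] QT.Mod.smult_assoc1[of k l x] QT.Mod.smult_closed[of k x]
   QT.smult_mult_l[of k x y] QT.smult_mult_r[of k x y] by simp_all

lemma mu4_vec: "mu4 (vec4 a b c d) = (a \<odot>\<^bsub>QT\<^esub> P0 \<oplus>\<^bsub>QT\<^esub> b \<odot>\<^bsub>QT\<^esub> P1) \<oplus>\<^bsub>QT\<^esub> (c \<odot>\<^bsub>QT\<^esub> P2 \<oplus>\<^bsub>QT\<^esub> (- d) \<odot>\<^bsub>QT\<^esub> P3)"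
  by (simp add: mu4_def vec4_nth)

lemma mu4_lin: "linmap Cx Q4 QT mu4"
proof (rule linmapI)
  have dl: "(k + l) \<odot>\<^bsub>QT\<^esub> x = k \<odot>\<^bsub>QT\<^esub> x \<oplus>\<^bsub>QT\<^esub> l \<odot>\<^bsub>QT\<^esub> x" if "x \<in> carrier QT" for k l x
    using QT.Mod.smult_l_distr[of k l x] that by simp
  have dr: "k \<odot>\<^bsub>QT\<^esub> (x \<oplus>\<^bsub>QT\<^esub> y) = k \<odot>\<^bsub>QT\<^esub> x \<oplus>\<^bsub>QT\<^esub> k \<odot>\<^bsub>QT\<^esub> y" if "x \<in> carrier QT" "y \<in> carrier QT" for k x y
    using QT.Mod.smult_r_distr[of k x y] that by simp
  fix x assume "x \<in> carrier Q4"
  then obtain a b c d where x: "x = vec4 a b c d" using Q4_cases by blast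
  show "mu4 x \<in> carrier QT" by (simp add: x mu4_vec)
  show "mu4 (k \<odot>\<^bsub>Q4\<^esub> x) = k \<odot>\<^bsub>QT\<^esub> mu4 x" for k by (simp add: x mu4_vec dr)
  fix y assume "y \<in> carrier Q4"
  then obtain a' b' c' d' where y: "y = vec4 a' b' c' d'" using Q4_cases by blast
  have "- (d + d') = - d + - d'" by simp
  then show "mu4 (x \<oplus>\<^bsub>Q4\<^esub> y) = mu4 x \<oplus>\<^bsub>QT\<^esub> mu4 y"
    by (simp only: x y mu4_vec Q4_simps(3) dl P_closed) (simp add: QT.a_ac)
qed

lemma Q4_span:
  assumes S: "submodule S Cx Q4" and b: "b0 \<in> S" "b1 \<in> S" "b2 \<in> S" "b3 \<in> S" and x: "x \<in> carrier Q4"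
  shows "x \<in> S"
proof -
  note E = Q.Mod.submoduleE[OF S]
  obtain a b c d where x: "x = vec4 a b c d" using Q4_cases[OF x] by blast
  have "(a \<odot>\<^bsub>Q4\<^esub> b0 \<oplus>\<^bsub>Q4\<^esub> b \<odot>\<^bsub>Q4\<^esub> b1) \<oplus>\<^bsub>Q4\<^esub> (c \<odot>\<^bsub>Q4\<^esub> b2 \<oplus>\<^bsub>Q4\<^esub> d \<odot>\<^bsub>Q4\<^esub> b3) \<in> S"
    by (intro E(5) E(4) b) simp_all
  then show ?thesis by (simp add: x)
qed

text \<open>Checked on the sixteen products of basis elements and extended linearly in each
  argument. The sign in ee' = -e'e enters through the middle slot, which carries the reversed
  product.\<close>

lemma mu4_hom: "mu4 \<in> alg_hom Cx Q4 QT"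
proof (rule alg_homI[OF mu4_lin])
  show "mu4 \<one>\<^bsub>Q4\<^esub> = \<one>\<^bsub>QT\<^esub>" by (simp add: mu4_vec Q.T3_one) (simp add: P0_def)
  have M: "mu4 x \<in> carrier QT" if "x \<in> carrier Q4" for x using linmapD(1)[OF mu4_lin that] .
  have bb: "mu4 (x \<otimes>\<^bsub>Q4\<^esub> y) = mu4 x \<otimes>\<^bsub>QT\<^esub> mu4 y" if "x \<in> {b0, b1, b2, b3}" "y \<in> {b0, b1, b2, b3}" for x y
  proof -
    have PP: "p3 [x, x, x] \<otimes>\<^bsub>QT\<^esub> p3 [y, y, y] = p3 [x \<otimes>\<^bsub>Q4\<^esub> y, y \<otimes>\<^bsub>Q4\<^esub> x, x \<otimes>\<^bsub>Q4\<^esub> y]"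
      if "x \<in> carrier Q4" "y \<in> carrier Q4" for x y using that by simp
    show ?thesis using that
      by (elim insertE emptyE; simp add: mu4_vec; simp add: P0_def[symmetric] P1_def[symmetric] P2_def[symmetric] P3_def[symmetric];
          simp add: PP[of b0, folded P0_def] P0_def P1_def P2_def P3_def PP; simp add: p3_vec; simp add: P0_def P1_def P2_def P3_def)
  qed
  have b: "mu4 (x \<otimes>\<^bsub>Q4\<^esub> y) = mu4 x \<otimes>\<^bsub>QT\<^esub> mu4 y" if x: "x \<in> {b0, b1, b2, b3}" and y: "y \<in> carrier Q4" for x y
  proof -
    have xc: "x \<in> carrier Q4" using x by auto
    have "y \<in> {y \<in> carrier Q4. mu4 (x \<otimes>\<^bsub>Q4\<^esub> y) = mu4 x \<otimes>\<^bsub>QT\<^esub> mu4 y}"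
      by (rule Q4_span[OF linmap_equalizer[OF linmap_comp[OF mu4_lin linmap_mult_l[OF alg_Q4 linmap_id xc]] linmap_mult_l[OF Q.T3_alg mu4_lin M[OF xc]] Q.moduleR Q.T3_module] _ _ _ _ y])
        (use bb[OF x] in auto)
    then show ?thesis by blast
  qed
  fix x y assume x: "x \<in> carrier Q4" and y: "y \<in> carrier Q4"
  have "x \<in> {x \<in> carrier Q4. mu4 (x \<otimes>\<^bsub>Q4\<^esub> y) = mu4 x \<otimes>\<^bsub>QT\<^esub> mu4 y}"
    by (rule Q4_span[OF linmap_equalizer[OF linmap_comp[OF mu4_lin linmap_mult_r[OF alg_Q4 linmap_id y]] linmap_mult_r[OF Q.T3_alg mu4_lin M[OF y]] Q.moduleR Q.T3_module] _ _ _ _ x])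
      (use b[OF _ y] in auto)
  then show "mu4 (x \<otimes>\<^bsub>Q4\<^esub> y) = mu4 x \<otimes>\<^bsub>QT\<^esub> mu4 y" by blast
qed

lemma mu4_grouplike:
  "mu4 b0 = p3 [b0, b0, b0]" "mu4 b1 = p3 [b1, b1, b1]" "mu4 b2 = p3 [b2, b2, b2]" "mu4 b3 = p3 [b3, vec4 0 0 0 (- 1), b3]"
  by (simp_all add: mu4_vec p3_vec)

lemma Q4_axioms:
  assumes "x \<in> {b0, b1, b2, b3}"
  shows "Q.L1 mu4 (mu4 x) = Q.L2 mu4 (mu4 x)" "Q.N1 (mu4 x) = pure Cx [Q4, Q4] [\<one>\<^bsub>Q4\<^esub>, x]" "Q.N2 (mu4 x) = pure Cx [Q4, Q4] [x, \<one>\<^bsub>Q4\<^esub>]"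
proof -
  obtain v where "v \<in> carrier Q4" "x \<in> carrier Q4" "x \<otimes>\<^bsub>Q4\<^esub> v = \<one>\<^bsub>Q4\<^esub>" "v \<otimes>\<^bsub>Q4\<^esub> x = \<one>\<^bsub>Q4\<^esub>" "mu4 x = p3 [x, v, x]"
  proof -
    consider "x = b0" | "x = b1" | "x = b2" | "x = b3" using assms by auto
    then show ?thesis
    proof cases
      case 1 then show ?thesis by (intro that[of b0]) (simp_all add: mu4_grouplike)
    next
      case 2 then show ?thesis by (intro that[of b1]) (simp_all add: mu4_grouplike)
    next
      case 3 then show ?thesis by (intro that[of b2]) (simp_all add: mu4_grouplike)
    next
      case 4 then show ?thesis by (intro that[of "vec4 0 0 0 (- 1)"]) (simp_all add: mu4_grouplike)
    qed
  qed
  note G = Q.grouplike_axioms[OF mu4_lin this(2,1,3,4,5)]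
  show "Q.L1 mu4 (mu4 x) = Q.L2 mu4 (mu4 x)" "Q.N1 (mu4 x) = pure Cx [Q4, Q4] [\<one>\<^bsub>Q4\<^esub>, x]" "Q.N2 (mu4 x) = pure Cx [Q4, Q4] [x, \<one>\<^bsub>Q4\<^esub>]"
    by (rule G)+
qed

lemma hopf_Q4: "hopf_galois Cx Q4 mu4"
  unfolding Q.hopf_galois_iff
proof (intro conjI ballI)
  show "\<one>\<^bsub>Q4\<^esub> \<noteq> \<zero>\<^bsub>Q4\<^esub>" by simp
  show "mu4 \<in> alg_hom Cx Q4 QT" by (rule mu4_hom)
  fix x assume x: "x \<in> carrier Q4"
  have o: "\<one>\<^bsub>Q4\<^esub> \<in> carrier Q4" by simp
  have "x \<in> {x \<in> carrier Q4. Q.L1 mu4 (mu4 x) = Q.L2 mu4 (mu4 x)}"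
    by (rule Q4_span[OF linmap_equalizer[OF linmap_comp[OF Q.linmap_L1[OF mu4_lin] mu4_lin] linmap_comp[OF Q.linmap_L2[OF mu4_lin] mu4_lin] Q.moduleR Q.T5_module] _ _ _ _ x];
        rule CollectI, rule conjI, simp, rule Q4_axioms, simp)
  then show "Q.L1 mu4 (mu4 x) = Q.L2 mu4 (mu4 x)" by blast
  have "x \<in> {x \<in> carrier Q4. Q.N1 (mu4 x) = pure Cx [Q4, Q4] [\<one>\<^bsub>Q4\<^esub>, x]}"
    by (rule Q4_span[OF linmap_equalizer[OF linmap_comp[OF Q.linmap_N1 mu4_lin] pair_lin2[OF alg_Q4 alg_Q4 o] Q.moduleR Q.TT_module] _ _ _ _ x];
        rule CollectI, rule conjI, simp, rule Q4_axioms, simp)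
  then show "Q.N1 (mu4 x) = pure Cx [Q4, Q4] [\<one>\<^bsub>Q4\<^esub>, x]" by blast
  have "x \<in> {x \<in> carrier Q4. Q.N2 (mu4 x) = pure Cx [Q4, Q4] [x, \<one>\<^bsub>Q4\<^esub>]}"
    by (rule Q4_span[OF linmap_equalizer[OF linmap_comp[OF Q.linmap_N2 mu4_lin] pair_lin1[OF alg_Q4 alg_Q4 o] Q.moduleR Q.TT_module] _ _ _ _ x];
        rule CollectI, rule conjI, simp, rule Q4_axioms, simp)
  then show "Q.N2 (mu4 x) = pure Cx [Q4, Q4] [x, \<one>\<^bsub>Q4\<^esub>]" by blast
qed

lemma hg_Q4: "hg Cx Q4 mu4"
  by (rule hg.intro[OF kalgI[OF alg_Q4]]) (rule hg_axioms.intro[OF hopf_Q4])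

lemma Q4_units: "b0 \<in> Units Q4" "b1 \<in> Units Q4" "b2 \<in> Units Q4" "b3 \<in> Units Q4"
  "inv\<^bsub>Q4\<^esub> b0 = b0" "inv\<^bsub>Q4\<^esub> b1 = b1" "inv\<^bsub>Q4\<^esub> b2 = b2" "inv\<^bsub>Q4\<^esub> b3 = vec4 0 0 0 (- 1)"
proof -
  have u: "x \<in> Units Q4 \<and> inv\<^bsub>Q4\<^esub> x = y" if "x \<in> carrier Q4" "y \<in> carrier Q4" "x \<otimes>\<^bsub>Q4\<^esub> y = \<one>\<^bsub>Q4\<^esub>" "y \<otimes>\<^bsub>Q4\<^esub> x = \<one>\<^bsub>Q4\<^esub>" for x y
    using that Q.inv_unique'[of x y] by (auto simp: Units_def simp del: Q4_simps(5))
  show "b0 \<in> Units Q4" "b1 \<in> Units Q4" "b2 \<in> Units Q4" "b3 \<in> Units Q4"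
    "inv\<^bsub>Q4\<^esub> b0 = b0" "inv\<^bsub>Q4\<^esub> b1 = b1" "inv\<^bsub>Q4\<^esub> b2 = b2" "inv\<^bsub>Q4\<^esub> b3 = vec4 0 0 0 (- 1)"
    using u[of b0 b0] u[of b1 b1] u[of b2 b2] u[of b3 "vec4 0 0 0 (- 1)"] by simp_all
qed

lemma Q4_G0: "b0 \<in> G0 Cx Q4 mu4" "b1 \<in> G0 Cx Q4 mu4" "b2 \<in> G0 Cx Q4 mu4" "b3 \<in> G0 Cx Q4 mu4"
  by (simp_all add: G0_def Q4_units mu4_grouplike)

section \<open>The polynomial algebra in two variables over the example\<close>

lemma id4_auto: "(\<lambda>x. x) \<in> alg_auto Cx Q4"
proof -
  have "(\<lambda>x. x) \<in> alg_hom Cx Q4 Q4" by (rule alg_homI[OF linmap_id]) (rule refl)+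
  then show ?thesis by (simp add: alg_iso_def bij_betw_def)
qed

lemma id4_inv: "x \<in> carrier Q4 \<Longrightarrow> inv_auto Q4 (\<lambda>x. x) x = x"
  using Q.alg_auto_inv(2)[OF id4_auto] .

lemma gas_data_Q4: "gas_data Cx Q4 (\<lambda>x. x) (inv_auto Q4 (\<lambda>x. x)) \<zero>\<^bsub>Q4\<^esub> 1"
  unfolding gas_data_def
  using alg_Q4 id4_auto Q.alg_auto_inv(1)[OF id4_auto] Q.zero_closed
  by (auto simp: id4_inv Q.l_null Q.r_null simp del: Q4_simps(6))

lemma polyext_Q4: "polyext Cx Q4 (\<lambda>x. x) (inv_auto Q4 (\<lambda>x. x)) \<zero>\<^bsub>Q4\<^esub> 1 mu4 b1"
proof (rule polyext.intro[OF gasl.intro[OF gas_data_Q4] hg_Q4], rule polyext_axioms.intro)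
  interpret HQ: hg Cx Q4 mu4 by (rule hg_Q4)
  show "inv_auto Q4 (\<lambda>x. x) r = r" if "r \<in> carrier Q4" for r by (rule id4_inv[OF that])
  show "b1 \<in> G0 Cx Q4 mu4" by (rule Q4_G0)
  show "r \<in> S" if "submodule S Cx Q4" "\<And>u. u \<in> G0 Cx Q4 mu4 \<Longrightarrow> u \<in> S" "r \<in> carrier Q4" for S r
    by (rule Q4_span[OF that(1) that(2)[OF Q4_G0(1)] that(2)[OF Q4_G0(2)] that(2)[OF Q4_G0(3)] that(2)[OF Q4_G0(4)] that(3)])
  fix r assume r: "r \<in> carrier Q4"
  have a: "HQ.adG b1 \<in> carrier QT" by (simp add: Q4_units)
  have "r \<in> {r \<in> carrier Q4. HQ.adG b1 \<otimes>\<^bsub>QT\<^esub> mu4 r = mu4 r \<otimes>\<^bsub>QT\<^esub> HQ.adG b1}"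
  proof (rule Q4_span[OF linmap_equalizer[OF linmap_mult_l[OF Q.T3_alg mu4_lin a] linmap_mult_r[OF Q.T3_alg mu4_lin a] Q.moduleR Q.T3_module] _ _ _ _ r])
    \<comment> \<open>\<open>b1\<close> anticommutes with \<open>b2\<close> and \<open>b3\<close>.
      Comparing the two sides, the sign change occurs in the first and in the second slot, and the
      two signs cancel.\<close>
    have s: "p3 [(- 1) \<odot>\<^bsub>Q4\<^esub> x, (- 1) \<odot>\<^bsub>Q4\<^esub> y, 1 \<odot>\<^bsub>Q4\<^esub> z] = p3 [x, y, z]" if "x \<in> carrier Q4" "y \<in> carrier Q4" "z \<in> carrier Q4" for x y z
      using p3_smult[OF that, of "- 1" "- 1" 1] that by simp
    show "b0 \<in> {r \<in> carrier Q4. HQ.adG b1 \<otimes>\<^bsub>QT\<^esub> mu4 r = mu4 r \<otimes>\<^bsub>QT\<^esub> HQ.adG b1}" by (simp add: Q4_units mu4_grouplike)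
    show "b1 \<in> {r \<in> carrier Q4. HQ.adG b1 \<otimes>\<^bsub>QT\<^esub> mu4 r = mu4 r \<otimes>\<^bsub>QT\<^esub> HQ.adG b1}" by (simp add: Q4_units mu4_grouplike)
    show "b2 \<in> {r \<in> carrier Q4. HQ.adG b1 \<otimes>\<^bsub>QT\<^esub> mu4 r = mu4 r \<otimes>\<^bsub>QT\<^esub> HQ.adG b1}"
      using s[of "vec4 0 0 0 1" "vec4 0 0 0 (- 1)" b2] by (simp add: Q4_units mu4_grouplike)
    show "b3 \<in> {r \<in> carrier Q4. HQ.adG b1 \<otimes>\<^bsub>QT\<^esub> mu4 r = mu4 r \<otimes>\<^bsub>QT\<^esub> HQ.adG b1}"
      using s[of "vec4 0 0 1 0" "vec4 0 0 1 0" b3] by (simp add: Q4_units mu4_grouplike)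
  qed
  then show "HQ.adG b1 \<otimes>\<^bsub>QT\<^esub> mu4 r = mu4 r \<otimes>\<^bsub>QT\<^esub> HQ.adG b1" by blast
qed (simp_all)

lemma Q4_ambiskew: "\<exists>m. ambiskew_hopf_galois Cx Q4 mu4 (\<lambda>x. x) \<zero>\<^bsub>Q4\<^esub> 1 b1 b0 m"
proof -
  interpret PE: polyext Cx Q4 "\<lambda>x. x" "inv_auto Q4 (\<lambda>x. x)" "\<zero>\<^bsub>Q4\<^esub>" 1 mu4 b1 by (rule polyext_Q4)
  have "ambiskew_hopf_galois Cx Q4 mu4 (\<lambda>x. x) \<zero>\<^bsub>Q4\<^esub> 1 b1 b0 PE.mu'"
  unfolding ambiskew_hopf_galois_def Let_def
proof (intro conjI ballI)
  show "hopf_galois Cx Q4 mu4" by (rule hopf_Q4)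
  show "(\<lambda>x. x) \<in> alg_auto Cx Q4" by (rule id4_auto)
  show "\<zero>\<^bsub>Q4\<^esub> \<in> carrier Q4" by (rule Q.zero_closed)
  show "\<zero>\<^bsub>Q4\<^esub> \<otimes>\<^bsub>Q4\<^esub> r = r \<otimes>\<^bsub>Q4\<^esub> \<zero>\<^bsub>Q4\<^esub>" if "r \<in> carrier Q4" for r using that by (simp only: Q.l_null Q.r_null)
  show "1 \<in> carrier Cx - {\<zero>\<^bsub>Cx\<^esub>}" by simp
  show "b1 \<in> G0 Cx Q4 mu4" "b0 \<in> G0 Cx Q4 mu4" by (rule Q4_G0)+
  show "hopf_galois Cx (ambiskew Cx Q4 (\<lambda>x. x) \<zero>\<^bsub>Q4\<^esub> 1) PE.mu'" by (rule PE.hopf_A)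
qed (rule PE.mu'_iota, assumption, rule PE.mu', rule PE.mu'(4)[unfolded Q4_simps(5)])
  then show ?thesis by blast
qed

lemma Q4_not_inverse:
  assumes m: "ambiskew_hopf_galois Cx Q4 mu4 (\<lambda>x. x) \<zero>\<^bsub>Q4\<^esub> 1 b1 b0 m"
  shows "conj_tensor Cx Q4 b1 (\<lambda>x. x) \<in> alg_auto Cx (HG_alg Cx Q4 mu4) \<and> conj_tensor Cx Q4 b0 (inv_auto Q4 (\<lambda>x. x)) \<in> alg_auto Cx (HG_alg Cx Q4 mu4) \<and>
   (\<exists>u\<in>carrier (HG_alg Cx Q4 mu4). conj_tensor Cx Q4 b1 (\<lambda>x. x) (conj_tensor Cx Q4 b0 (inv_auto Q4 (\<lambda>x. x)) u) \<noteq> u)"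
proof -
  interpret HQ: hg Cx Q4 mu4 by (rule hg_Q4)
  interpret a: amb Cx Q4 mu4 "\<lambda>x. x" "\<zero>\<^bsub>Q4\<^esub>" 1 b1 b0 m by (rule amb.intro, rule m)
  let ?u = "pure2 Cx Q4 [b2, b2]"
  have c: "?u \<in> carrier (T2 Cx Q4)" by simp
  \<comment> \<open>Since \<open>b2\<close> is group-like and its own inverse, multiplying \<mu>(b2)
    by \<open>b2\<close> in the first slot gives 1 \<otimes> b2 \<otimes> b2.\<close>
  have u: "?u \<in> carrier HQ.HG" unfolding HQ.HG_carrier using c by (simp add: HQ.Phi_pure HQ.inj3_pure mu4_grouplike)
  have il: "linmap Cx Q4 Q4 (inv_auto Q4 (\<lambda>x. x))" by (rule a.SY.sig_lin)
  have w: "conj_tensor Cx Q4 b0 (inv_auto Q4 (\<lambda>x. x)) ?u = ?u"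
    using HQ.cj_pure[OF Q4_units(1) il, of b2 b2] by (simp add: Q4_units id4_inv)
  have t: "conj_tensor Cx Q4 b1 (\<lambda>x. x) ?u = pure2 Cx Q4 [vec4 0 0 (- 1) 0, b2]"
    using HQ.cj_pure[OF Q4_units(2) linmap_id, of b2 b2] by (simp add: Q4_units)
  have b: "bilin Cx Q4 Q4 Q4 (\<lambda>x y. x \<otimes>\<^bsub>Q4\<^esub> y)"
    by (rule bilinI) (auto intro!: linmap_mult_l linmap_mult_r linmap_id alg_Q4)
  \<comment> \<open>The multiplication map x \<otimes> y \<mapsto> xy, the counit on H, separates
    the two tensors: its values are -1 and 1.\<close>
  have "lift2 Cx Q4 (\<lambda>x y. x \<otimes>\<^bsub>Q4\<^esub> y) (pure2 Cx Q4 [vec4 0 0 (- 1) 0, b2]) \<noteq> lift2 Cx Q4 (\<lambda>x y. x \<otimes>\<^bsub>Q4\<^esub> y) ?u"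
    by (simp add: Q.lift2_pure[OF b Q.moduleR])
  then have "pure2 Cx Q4 [vec4 0 0 (- 1) 0, b2] \<noteq> ?u" by metis
  then have "conj_tensor Cx Q4 b1 (\<lambda>x. x) (conj_tensor Cx Q4 b0 (inv_auto Q4 (\<lambda>x. x)) ?u) \<noteq> ?u" unfolding w t .
  then show ?thesis using a.SX.sigma'_auto a.SY.sigma'_auto u by blast
qed

theorem corollary5p5:
  shows
    "(\<forall>(K :: 'k ring) (R :: ('k, 'r) module) \<mu> \<tau> c \<xi> g h \<mu>'.
        ambiskew_hopf_galois K R \<mu> \<tau> c \<xi> g h \<mu>' \<longrightarrow>
        (let H = HG_alg K R \<mu>;
             \<tau>' = conj_tensor K R g \<tau>;
             \<omega>' = conj_tensor K R h (inv_auto R \<tau>)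
         in \<exists>c' \<xi>'. gas_data K H \<tau>' \<omega>' c' \<xi>' \<and>
              (\<exists>\<phi> \<in> alg_iso K (gas K H \<tau>' \<omega>' c' \<xi>') (HG_alg K (ambiskew K R \<tau> c \<xi>) \<mu>').
                 \<forall>u\<in>carrier H. \<phi> (gas_gen K H \<tau>' \<omega>' c' \<xi>' (Coeff u)) = HG_incl K R \<tau> c \<xi> u)))
     \<and>
     (\<exists>(K :: complex ring) (R :: (complex, nat \<Rightarrow> complex) module) \<mu> \<tau> c \<xi> g h \<mu>'.
        ambiskew_hopf_galois K R \<mu> \<tau> c \<xi> g h \<mu>' \<and>
        (let H = HG_alg K R \<mu>;
             \<tau>' = conj_tensor K R g \<tau>;
             \<omega>' = conj_tensor K R h (inv_auto R \<tau>)
         in \<tau>' \<in> alg_auto K H \<and> \<omega>' \<in> alg_auto K H \<and>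
            (\<exists>u\<in>carrier H. \<tau>' (\<omega>' u) \<noteq> u)))"
  unfolding Let_def
proof (intro conjI allI impI)
  fix K :: "'k ring" and R :: "('k, 'r) module" and \<mu> \<tau> c \<xi> g h \<mu>'
  assume "ambiskew_hopf_galois K R \<mu> \<tau> c \<xi> g h \<mu>'"
  then interpret amb K R \<mu> \<tau> c \<xi> g h \<mu>' by (rule amb.intro)
  show "\<exists>c' \<xi>'. gas_data K (HG_alg K R \<mu>) (conj_tensor K R g \<tau>) (conj_tensor K R h (inv_auto R \<tau>)) c' \<xi>' \<and>
     (\<exists>\<phi> \<in> alg_iso K (gas K (HG_alg K R \<mu>) (conj_tensor K R g \<tau>) (conj_tensor K R h (inv_auto R \<tau>)) c' \<xi>') (HG_alg K (ambiskew K R \<tau> c \<xi>) \<mu>').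
        \<forall>u\<in>carrier (HG_alg K R \<mu>). \<phi> (gas_gen K (HG_alg K R \<mu>) (conj_tensor K R g \<tau>) (conj_tensor K R h (inv_auto R \<tau>)) c' \<xi>' (Coeff u)) = HG_incl K R \<tau> c \<xi> u)"
    by (rule HG_ambiskew)
next
  obtain m where m: "ambiskew_hopf_galois Cx Q4 mu4 (\<lambda>x. x) \<zero>\<^bsub>Q4\<^esub> 1 b1 b0 m" using Q4_ambiskew by blast
  show "\<exists>(K :: complex ring) (R :: (complex, nat \<Rightarrow> complex) module) \<mu> \<tau> c \<xi> g h \<mu>'.
        ambiskew_hopf_galois K R \<mu> \<tau> c \<xi> g h \<mu>' \<and>
        (conj_tensor K R g \<tau> \<in> alg_auto K (HG_alg K R \<mu>) \<and> conj_tensor K R h (inv_auto R \<tau>) \<in> alg_auto K (HG_alg K R \<mu>) \<and>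
            (\<exists>u\<in>carrier (HG_alg K R \<mu>). conj_tensor K R g \<tau> (conj_tensor K R h (inv_auto R \<tau>) u) \<noteq> u))"
    by (intro exI) (rule conjI[OF m Q4_not_inverse[OF m]])
qed

end
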